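(* Let $(b,B,m,\mu)$ be an admissible parameter set on $\mathcal H^+$ (see context). Then there exists an affine process $(X_t)_{t\ge 0}$ in $\mathcal H^+$, i.e. a time-homogeneous $\mathcal H^+$-valued Markov process such that $$\mathbb E\big[e^{-\langle X_t,u\rangle}\,\big|\,X_0=x\big]=e^{-\phi(t,u)-\langle x,\psi(t,u)\rangle},\qquad t\ge 0,\ u,x\in\mathcal H^+,$$ where, for every $u\in\mathcal H^+$, the pair $(\phi(\cdot,u),\psi(\cdot,u))\colon[0,\infty)\to[0,\infty)\times\mathcal H^+$ is the unique continuously differentiable solution, with values in $[0,\infty)\times\mathcal H^+$, of the generalized Riccati equations $$\frac{\partial}{\partial t}\phi(t,u)=\langle b,\psi(t,u)\rangle-\int_{\mathcal H^+\setminus\{0\}}\big(e^{-\langle\xi,\psi(t,u)\rangle}-1+\langle\chi(\xi),\psi(t,u)\rangle\big)\,m(\mathrm d\xi),$$ $$\frac{\partial}{\partial t}\psi(t,u)=B^*(\psi(t,u))-\int_{\mathcal H^+\setminus\{0\}}\big(e^{-\langle\xi,\psi(t,u)\rangle}-1+\langle\chi(\xi),\psi(t,u)\rangle\big)\,\frac{\mu(\mathrm d\xi)}{\|\xi\|^2},$$ with initial values $\phi(0,u)=0$ and $\psi(0,u)=u$.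
   Context: Setting: $(H,\langle\cdot,\cdot\rangle_H)$ is a separable infinite-dimensional real Hilbert space. $\mathcal H$ is the Hilbert space of self-adjoint Hilbert-Schmidt operators on $H$ with the Hilbert-Schmidt inner product $\langle\cdot,\cdot\rangle$ and norm $\|\cdot\|$. $\mathcal H^+=\{A\in\mathcal H:\langle Ah,h\rangle_H\ge 0\ \forall h\in H\}$. Truncation function: $\chi(\xi)=\xi\mathbf 1_{\{\|\xi\|\le 1\}}$. Vector measures: an $\mathcal H^+$-valued measure $\mu$ on the Borel $\sigma$-algebra $\mathcal B(\mathcal H^+\setminus\{0\})$ is a weakly countably additive map $\mu\colon\mathcal B(\mathcal H^+\setminus\{0\})\to\mathcal H^+$; for $h\in\mathcal H$, $\langle\mu,h\rangle(A):=\langle\mu(A),h\rangle$ is a signed measure. A measurable real function $f$ is integrated against $\mu$ weakly: if $\int|f|\,\mathrm d|\langle\mu,h\rangle|<\infty$ for all $h\in\mathcal H$, then $\int_A f\,\mathrm d\mu\in\mathcal H$ is the unique element with $\langle\int_A f\,\mathrm d\mu,h\rangle=\int_A f\,\mathrm d\langle\mu,h\rangle$ for all $h\in\mathcal H$. An admissible parameter set $(b,B,m,\mu)$ consists of: (i) a measure $m\colon\mathcal B(\mathcal H^+\setminus\{0\})\to[0,\infty]$ with $\int\|\xi\|^2\,m(\mathrm d\xi)<\infty$ and $\int|\langle\chi(\xi),h\rangle|\,m(\mathrm d\xi)<\infty$ for all $h\in\mathcal H$, and such that there is $I_m\in\mathcal H$ with $\langle I_m,h\rangle=\int\langle\chi(\xi),h\rangle\,m(\mathrm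 d\xi)$ for all $h\in\mathcal H$; (ii) a vector $b\in\mathcal H$ with $\langle b,v\rangle-\int\langle\chi(\xi),v\rangle\,m(\mathrm d\xi)\ge 0$ for all $v\in\mathcal H^+$; (iii) an $\mathcal H^+$-valued measure $\mu$ on $\mathcal B(\mathcal H^+\setminus\{0\})$ with $\int\langle\chi(\xi),u\rangle\frac{\langle\mu(\mathrm d\xi),x\rangle}{\|\xi\|^2}<\infty$ for all $u,x\in\mathcal H^+$ with $\langle u,x\rangle=0$; (iv) an operator $B\in\mathcal L(\mathcal H)$ (bounded linear, adjoint $B^*$) with $\langle B^*(u),x\rangle-\int\langle\chi(\xi),u\rangle\frac{\langle\mu(\mathrm d\xi),x\rangle}{\|\xi\|^2}\ge 0$ for all $x,u\in\mathcal H^+$ with $\langle u,x\rangle=0$. (All integrals are over $\mathcal H^+\setminus\{0\}$.) *)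

theory Defs
  imports "HOL-Probability.Probability"
begin

section \<open>Orthonormal bases of a real Hilbert space\<close>

definition orthonormal :: "'h::real_inner set \<Rightarrow> bool" where
  "orthonormal E \<longleftrightarrow> pairwise orthogonal E \<and> (\<forall>e\<in>E. norm e = 1)"

definition orthonormal_basis :: "'h::real_inner set \<Rightarrow> bool" where
  "orthonormal_basis E \<longleftrightarrow> orthonormal E \<and> closure (span E) = UNIV"

lemma orthonormal_inner:
  assumes "orthonormal E" "e \<in> E" "f \<in> E"
  shows "e \<bullet> f = (if e = f then 1 else 0)"
  using assms by (auto simp: orthonormal_def pairwise_def orthogonal_def dot_square_norm)

lemma orthonormal_norm_diff_sq:
  fixes x :: "'h::real_inner"
  assumes E: "orthonormal E" and t: "finite t" "t \<subseteq> E"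
  shows "(norm (x - (\<Sum>e\<in>t. c e *\<^sub>R e)))\<^sup>2
    = (norm x)\<^sup>2 - (\<Sum>e\<in>t. (x \<bullet> e)\<^sup>2) + (\<Sum>e\<in>t. (c e - x \<bullet> e)\<^sup>2)"
proof -
  have "(\<Sum>e\<in>t. c e *\<^sub>R e) \<bullet> (\<Sum>e\<in>t. c e *\<^sub>R e) = (\<Sum>e\<in>t. \<Sum>f\<in>t. c e * c f * (e \<bullet> f))"
    by (simp add: inner_sum_left inner_sum_right sum_distrib_left mult_ac inner_commute)
  also have "\<dots> = (\<Sum>e\<in>t. \<Sum>f\<in>t. if f = e then c e * c e else 0)"
    using t by (intro sum.cong refl) (auto simp: orthonormal_inner[OF E] subset_iff)
  also have "\<dots> = (\<Sum>e\<in>t. (c e)\<^sup>2)"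
    using t by (simp add: power2_eq_square)
  finally have 1: "(\<Sum>e\<in>t. c e *\<^sub>R e) \<bullet> (\<Sum>e\<in>t. c e *\<^sub>R e) = (\<Sum>e\<in>t. (c e)\<^sup>2)" .
  have "(norm (x - (\<Sum>e\<in>t. c e *\<^sub>R e)))\<^sup>2
      = (norm x)\<^sup>2 - 2 * (\<Sum>e\<in>t. c e * (x \<bullet> e)) + (\<Sum>e\<in>t. (c e)\<^sup>2)"
    unfolding power2_norm_eq_inner inner_diff_left inner_diff_right 1
    by (simp add: inner_sum_right inner_commute sum_distrib_left sum_negf 1)
  also have "\<dots> = (norm x)\<^sup>2 - (\<Sum>e\<in>t. (x \<bullet> e)\<^sup>2) + (\<Sum>e\<in>t. (c e - x \<bullet> e)\<^sup>2)"
    by (simp add: power2_diff sum.distrib sum_subtractf sum_distrib_left mult_ac)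
  finally show ?thesis .
qed

lemma span_obtain_finite:
  fixes y :: "'h::real_vector"
  assumes "y \<in> span E"
  obtains t c where "finite t" "t \<subseteq> E" "y = (\<Sum>e\<in>t. c e *\<^sub>R e)"
  using assms unfolding span_explicit by auto

lemma orthonormal_basis_parseval:
  fixes x :: "'h::real_inner"
  assumes "orthonormal_basis E"
  shows "((\<lambda>e. (x \<bullet> e)\<^sup>2) has_sum (norm x)\<^sup>2) E"
proof -
  have E: "orthonormal E" and dense: "closure (span E) = UNIV"
    using assms by (auto simp: orthonormal_basis_def)
  have bessel: "(\<Sum>e\<in>t. (x \<bullet> e)\<^sup>2) \<le> (norm x)\<^sup>2" if "finite t" "t \<subseteq> E" for t
  proof -
    have "(norm x)\<^sup>2 - (\<Sum>e\<in>t. (x \<bullet> e)\<^sup>2) = (norm (x - (\<Sum>e\<in>t. (x \<bullet> e) *\<^sub>R e)))\<^sup>2"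
      using orthonormal_norm_diff_sq[OF E that, of x "\<lambda>e. x \<bullet> e"] by simp
    also have "\<dots> \<ge> 0" by (rule zero_le_power2)
    finally show ?thesis by simp
  qed
  have summ: "(\<lambda>e. (x \<bullet> e)\<^sup>2) summable_on E"
    by (rule nonneg_bounded_partial_sums_imp_summable_on[where C = "(norm x)\<^sup>2"])
       (auto intro!: eventually_finite_subsets_at_top_weakI bessel)
  have le: "infsum (\<lambda>e. (x \<bullet> e)\<^sup>2) E \<le> (norm x)\<^sup>2"
    by (rule infsum_le_finite_sums[OF summ bessel])
  have ge: "(norm x)\<^sup>2 \<le> infsum (\<lambda>e. (x \<bullet> e)\<^sup>2) E"
  proof (rule field_le_epsilon)
    fix \<epsilon> :: real assume "\<epsilon> > 0"
    have "x \<in> closure (span E)" using dense by simp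
    then obtain y where y: "y \<in> span E" "dist y x < sqrt \<epsilon>"
      using \<open>\<epsilon> > 0\<close> unfolding closure_approachable by (metis real_sqrt_gt_zero)
    obtain t c where t: "finite t" "t \<subseteq> E" "y = (\<Sum>e\<in>t. c e *\<^sub>R e)"
      using span_obtain_finite[OF y(1)] .
    have "(norm (x - y))\<^sup>2 < (sqrt \<epsilon>)\<^sup>2"
      using y(2) by (intro power_strict_mono) (auto simp: dist_norm norm_minus_commute)
    then have "(norm x)\<^sup>2 - (\<Sum>e\<in>t. (x \<bullet> e)\<^sup>2) + (\<Sum>e\<in>t. (c e - x \<bullet> e)\<^sup>2) < \<epsilon>"
      using orthonormal_norm_diff_sq[OF E t(1,2), of x c] t(3) \<open>\<epsilon> > 0\<close> by simp
    moreover have "(\<Sum>e\<in>t. (c e - x \<bullet> e)\<^sup>2) \<ge> 0"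
      by (intro sum_nonneg) auto
    moreover have "(\<Sum>e\<in>t. (x \<bullet> e)\<^sup>2) \<le> infsum (\<lambda>e. (x \<bullet> e)\<^sup>2) E"
      by (rule finite_sum_le_infsum[OF summ t(1,2)]) auto
    ultimately show "(norm x)\<^sup>2 \<le> infsum (\<lambda>e. (x \<bullet> e)\<^sup>2) E + \<epsilon>" by linarith
  qed
  show ?thesis using has_sum_infsum[OF summ] antisym[OF le ge] by simp
qed

lemma closed_subspace_orthogonal_vector:
  fixes S :: "'h::{real_inner,banach} set"
  assumes S: "subspace S" "closed S" "S \<noteq> UNIV"
  shows "\<exists>z. z \<noteq> 0 \<and> (\<forall>w\<in>S. z \<bullet> w = 0)"
proof -
  obtain x where x: "x \<notin> S" using S(3) by auto
  define d where "d = infdist x S"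
  have ne: "S \<noteq> {}" using S(1) subspace_0 by blast
  have d0: "d \<ge> 0" by (simp add: d_def infdist_nonneg)
  have dle: "d \<le> norm (x - w)" if "w \<in> S" for w
    using infdist_le[OF that, of x] by (simp add: d_def dist_norm)
  have "\<exists>y\<in>S. norm (x - y) < d + 1 / real (Suc n)" for n
  proof -
    have "infdist x S < d + 1 / real (Suc n)" by (simp add: d_def)
    then show ?thesis unfolding infdist_notempty[OF ne] using ne
      by (subst (asm) cINF_less_iff) (auto simp: dist_norm intro!: bdd_belowI2[where m=0])
  qed
  then obtain y where y: "\<And>n. y n \<in> S" "\<And>n. norm (x - y n) < d + 1 / real (Suc n)"
    by metis
  have par: "(norm (y m - y n))\<^sup>2 \<le> 2 * (norm (x - y m))\<^sup>2 + 2 * (norm (x - y n))\<^sup>2 - 4 * d\<^sup>2" for m n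
  proof -
    define c where "c = (1/2) *\<^sub>R (y m + y n)"
    have "c \<in> S" unfolding c_def using S(1) y(1) by (intro subspace_scale subspace_add)
    then have "d\<^sup>2 \<le> (norm (x - c))\<^sup>2" using dle d0 by (intro power_mono)
    moreover have "(norm (y m - y n))\<^sup>2 =
        2 * (norm (x - y m))\<^sup>2 + 2 * (norm (x - y n))\<^sup>2 - 4 * (norm (x - c))\<^sup>2"
      unfolding c_def power2_norm_eq_inner
      by (simp add: inner_diff_left inner_diff_right inner_add_left inner_add_right
          inner_commute algebra_simps)
    ultimately show ?thesis by linarith
  qed
  have "Cauchy y"
  proof (rule metric_CauchyI)
    fix e :: real assume e: "e > 0"
    have "(\<lambda>n. 4 * (d + 1 / real (Suc n))\<^sup>2 - 4 * d\<^sup>2) \<longlonglongrightarrow> 4 * (d + 0)\<^sup>2 - 4 * d\<^sup>2"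
      using LIMSEQ_inverse_real_of_nat
      by (intro tendsto_intros) (simp add: inverse_eq_divide)
    then have "eventually (\<lambda>n. 4 * (d + 1 / real (Suc n))\<^sup>2 - 4 * d\<^sup>2 < e\<^sup>2) sequentially"
      using e by (intro order_tendstoD(2)[where y="4 * (d + 0)\<^sup>2 - 4 * d\<^sup>2"]) auto
    then obtain N where N: "\<And>n. n \<ge> N \<Longrightarrow> 4 * (d + 1 / real (Suc n))\<^sup>2 - 4 * d\<^sup>2 < e\<^sup>2"
      by (auto simp: eventually_sequentially)
    have "dist (y m) (y n) < e" if "m \<ge> N" "n \<ge> N" for m n
    proof -
      have sq: "(norm (x - y k))\<^sup>2 \<le> (d + 1 / real (Suc k))\<^sup>2" for k
        using y(2)[of k] by (intro power_mono) auto
      have "(norm (y m - y n))\<^sup>2 < e\<^sup>2"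
        using par[of m n] sq[of m] sq[of n] N[OF that(1)] N[OF that(2)] by linarith
      then show ?thesis using e by (simp add: dist_norm power_less_imp_less_base)
    qed
    then show "\<exists>M. \<forall>m\<ge>M. \<forall>n\<ge>M. dist (y m) (y n) < e" by blast
  qed
  then obtain l where l: "y \<longlonglongrightarrow> l" using Cauchy_convergent_iff convergent_def by blast
  have lS: "l \<in> S" using closed_sequentially[OF S(2) _ l] y(1) by blast
  have "norm (x - l) \<le> d"
  proof (rule LIMSEQ_le)
    show "(\<lambda>n. norm (x - y n)) \<longlonglongrightarrow> norm (x - l)" by (intro tendsto_intros l)
    show "(\<lambda>n. d + 1 / real (Suc n)) \<longlonglongrightarrow> d"
      using LIMSEQ_inverse_real_of_nat_add[of d] by (simp add: inverse_eq_divide)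
    show "\<exists>N. \<forall>n\<ge>N. norm (x - y n) \<le> d + 1 / real (Suc n)" using y(2) less_imp_le by blast
  qed
  then have min: "norm (x - l) \<le> norm (x - w)" if "w \<in> S" for w
    using dle[OF that] by linarith
  define z where "z = x - l"
  have "z \<bullet> w = 0" if w: "w \<in> S" for w
  proof (cases "w = 0")
    case False
    define r where "r = (z \<bullet> w) / (w \<bullet> w)"
    have "l + r *\<^sub>R w \<in> S" using S(1) lS w by (intro subspace_add subspace_scale)
    then have "(norm z)\<^sup>2 \<le> (norm (z - r *\<^sub>R w))\<^sup>2"
      using min[of "l + r *\<^sub>R w"] by (intro power_mono) (auto simp: z_def algebra_simps)
    then have "0 \<le> r * r * (w \<bullet> w) - 2 * r * (z \<bullet> w)"
      unfolding power2_norm_eq_inner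
      by (simp add: inner_diff_left inner_diff_right inner_commute algebra_simps)
    moreover have "r * (w \<bullet> w) = z \<bullet> w" using False by (simp add: r_def)
    ultimately have "r * (z \<bullet> w) \<le> 0" by (simp add: mult.assoc)
    moreover have "w \<bullet> w > 0" using False by simp
    ultimately show ?thesis
      by (simp add: r_def divide_le_0_iff power2_eq_square[symmetric])
  qed simp
  moreover have "z \<noteq> 0" using lS x by (auto simp: z_def)
  ultimately show ?thesis by blast
qed

lemma subspace_closure:
  fixes S :: "'h::real_normed_vector set"
  assumes "subspace S"
  shows "subspace (closure S)"
  unfolding subspace_def
proof (intro conjI ballI allI)
  show "0 \<in> closure S" using assms subspace_0 closure_subset by blast
next
  fix x y assume "x \<in> closure S" "y \<in> closure S"
  then obtain a b where "\<And>n. a n \<in> S" "\<And>n. b n \<in> S" "a \<longlonglongrightarrow> x" "b \<longlonglongrightarrow> y"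
    unfolding closure_sequential by blast
  then have "\<forall>n. a n + b n \<in> S" "(\<lambda>n. a n + b n) \<longlonglongrightarrow> x + y"
    using assms by (auto intro: subspace_add tendsto_add)
  then show "x + y \<in> closure S"
    unfolding closure_sequential by (intro exI[of _ "\<lambda>n. a n + b n"] conjI)
next
  fix c x assume "x \<in> closure S"
  then obtain a where "\<And>n. a n \<in> S" "a \<longlonglongrightarrow> x"
    unfolding closure_sequential by blast
  then have "\<forall>n. c *\<^sub>R a n \<in> S" "(\<lambda>n. c *\<^sub>R a n) \<longlonglongrightarrow> c *\<^sub>R x"
    using assms by (auto intro: subspace_scale tendsto_scaleR)
  then show "c *\<^sub>R x \<in> closure S"
    unfolding closure_sequential by (intro exI[of _ "\<lambda>n. c *\<^sub>R a n"] conjI)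
qed

lemma orthonormal_basis_exists: "\<exists>E::'h::{real_inner,banach} set. orthonormal_basis E"
proof -
  have "\<exists>M\<in>{E::'h set. orthonormal E}. \<forall>X\<in>{E. orthonormal E}. M \<subseteq> X \<longrightarrow> X = M"
  proof (rule subset_Zorn')
    fix C :: "'h set set" assume "subset.chain {E. orthonormal E} C"
    then have C: "\<And>E. E \<in> C \<Longrightarrow> orthonormal E" "\<And>E F. E \<in> C \<Longrightarrow> F \<in> C \<Longrightarrow> E \<subseteq> F \<or> F \<subseteq> E"
      by (auto simp: subset_chain_def)
    show "\<Union>C \<in> {E. orthonormal E}"
      unfolding mem_Collect_eq orthonormal_def pairwise_def
    proof (intro conjI ballI impI)
      fix a b assume "a \<in> \<Union>C" "b \<in> \<Union>C" "a \<noteq> b"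
      then obtain E where "E \<in> C" "a \<in> E" "b \<in> E" using C(2) by blast
      then show "orthogonal a b"
        using C(1) \<open>a \<noteq> b\<close> by (auto simp: orthonormal_def pairwise_def)
    next
      fix a assume "a \<in> \<Union>C" then show "norm a = 1" using C(1) by (auto simp: orthonormal_def)
    qed
  qed
  then obtain M :: "'h set" where M: "orthonormal M"
    and max: "\<And>X. orthonormal X \<Longrightarrow> M \<subseteq> X \<Longrightarrow> X = M" by blast
  have "closure (span M) = UNIV"
  proof (rule ccontr)
    assume "closure (span M) \<noteq> UNIV"
    then obtain z where z: "z \<noteq> 0" "\<And>w. w \<in> closure (span M) \<Longrightarrow> z \<bullet> w = 0"
      using closed_subspace_orthogonal_vector[of "closure (span M)"]
      by (auto simp: closed_subspace subspace_span subspace_closure)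
    define u where "u = (1 / norm z) *\<^sub>R z"
    have orth: "u \<bullet> w = 0" if "w \<in> M" for w
    proof -
      have "w \<in> closure (span M)" using that by (meson closure_subset span_base subsetD)
      then show ?thesis using z(2) by (simp add: u_def)
    qed
    have "norm u = 1" using z(1) by (simp add: u_def)
    then have "orthonormal (insert u M)" using M orth
      by (auto simp: orthonormal_def pairwise_insert orthogonal_def inner_commute)
    then have "u \<in> M" using max[of "insert u M"] by blast
    then show False using orth[of u] \<open>norm u = 1\<close> by auto
  qed
  then show ?thesis using M unfolding orthonormal_basis_def by blast
qed

definition some_onb :: "'h::{real_inner,banach} set" where
  "some_onb = (SOME E. orthonormal_basis E)"

lemma orthonormal_basis_some_onb: "orthonormal_basis some_onb"
  unfolding some_onb_def by (rule someI_ex) (rule orthonormal_basis_exists)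


section \<open>Hilbert-Schmidt operators\<close>

text \<open>
  Neither the Hilbert-Schmidt property nor the Hilbert-Schmidt inner product of self-adjoint
  operators depends on the orthonormal basis, see \<open>hilbert_schmidt_basis_independent\<close> and
  \<open>sahs_inner_basis_independent\<close> below.
\<close>

definition hilbert_schmidt :: "('h::{real_inner,banach} \<Rightarrow>\<^sub>L 'h) \<Rightarrow> bool" where
  "hilbert_schmidt A \<longleftrightarrow> (\<lambda>e. (norm (blinfun_apply A e))\<^sup>2) summable_on some_onb"

definition self_adjoint :: "('h::{real_inner,banach} \<Rightarrow>\<^sub>L 'h) \<Rightarrow> bool" where
  "self_adjoint A \<longleftrightarrow> (\<forall>x y. blinfun_apply A x \<bullet> y = x \<bullet> blinfun_apply A y)"

lemma self_adjoint_has_sum_swap: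
  assumes A: "self_adjoint A" and E: "orthonormal_basis E" and F: "orthonormal_basis F"
    and s: "((\<lambda>e. (norm (blinfun_apply A e))\<^sup>2) has_sum s) E"
  shows "((\<lambda>e. (norm (blinfun_apply A e))\<^sup>2) has_sum s) F"
proof -
  let ?f = "\<lambda>(e, f). (blinfun_apply A e \<bullet> f)\<^sup>2"
  have 1: "((\<lambda>f. ?f (e, f)) has_sum (norm (blinfun_apply A e))\<^sup>2) F" for e
    using orthonormal_basis_parseval[OF F, of "blinfun_apply A e"] by simp
  have "?f summable_on E \<times> F"
    by (rule summable_on_SigmaI[OF 1]) (use s in \<open>auto simp: summable_on_def\<close>)
  then have "(?f has_sum s) (E \<times> F)" by (intro has_sum_SigmaI[OF 1 s])
  then have 2: "((\<lambda>(f, e). ?f (e, f)) has_sum s) (F \<times> E)" by (subst (asm) has_sum_swap)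
  have "((\<lambda>e. (blinfun_apply A e \<bullet> f)\<^sup>2) has_sum (norm (blinfun_apply A f))\<^sup>2) E" for f
  proof -
    have "blinfun_apply A e \<bullet> f = blinfun_apply A f \<bullet> e" for e
      using A by (simp add: self_adjoint_def inner_commute)
    then show ?thesis
      using orthonormal_basis_parseval[OF E, of "blinfun_apply A f"] by simp
  qed
  then show ?thesis by (intro has_sum_SigmaD[OF 2]) simp
qed

lemma hilbert_schmidt_basis_independent:
  assumes "self_adjoint A" and "orthonormal_basis E"
  shows "hilbert_schmidt A \<longleftrightarrow> (\<lambda>e. (norm (blinfun_apply A e))\<^sup>2) summable_on E"
  unfolding hilbert_schmidt_def summable_on_def
  using self_adjoint_has_sum_swap[OF assms(1) orthonormal_basis_some_onb assms(2)]
    self_adjoint_has_sum_swap[OF assms(1) assms(2) orthonormal_basis_some_onb]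
  by (intro iffI; elim exE; intro exI)

lemma hilbert_schmidt_0: "hilbert_schmidt 0"
  by (simp add: hilbert_schmidt_def)

lemma hilbert_schmidt_scaleR: "hilbert_schmidt A \<Longrightarrow> hilbert_schmidt (r *\<^sub>R A)"
  unfolding hilbert_schmidt_def by (auto simp: blinfun.scaleR_left power_mult_distrib
      intro: summable_on_cmult_right)

lemma hilbert_schmidt_add:
  assumes "hilbert_schmidt A" "hilbert_schmidt B"
  shows "hilbert_schmidt (A + B)"
proof -
  have "(\<lambda>e. 2 * (norm (blinfun_apply A e))\<^sup>2 + 2 * (norm (blinfun_apply B e))\<^sup>2) summable_on some_onb"
    using assms unfolding hilbert_schmidt_def
    by (intro summable_on_add summable_on_cmult_right)
  moreover have "(norm (blinfun_apply (A + B) e))\<^sup>2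
      \<le> 2 * (norm (blinfun_apply A e))\<^sup>2 + 2 * (norm (blinfun_apply B e))\<^sup>2" for e
  proof -
    have "(norm (blinfun_apply (A + B) e))\<^sup>2 \<le> (norm (blinfun_apply A e) + norm (blinfun_apply B e))\<^sup>2"
      by (intro power_mono) (auto simp: blinfun.add_left norm_triangle_ineq)
    also have "\<dots> \<le> 2 * (norm (blinfun_apply A e))\<^sup>2 + 2 * (norm (blinfun_apply B e))\<^sup>2"
      using sum_squares_bound[of "norm (blinfun_apply A e)" "norm (blinfun_apply B e)"]
      by (simp add: power2_sum)
    finally show ?thesis .
  qed
  ultimately show ?thesis unfolding hilbert_schmidt_def
    by (rule summable_on_comparison_test) auto
qed

lemma hilbert_schmidt_inner_summable:
  assumes "hilbert_schmidt A" "hilbert_schmidt B"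
  shows "(\<lambda>e. blinfun_apply A e \<bullet> blinfun_apply B e) summable_on some_onb"
proof -
  have pol: "blinfun_apply A e \<bullet> blinfun_apply B e =
     (1/2) * ((norm (blinfun_apply (A + B) e))\<^sup>2 + (- 1 * (norm (blinfun_apply A e))\<^sup>2
       + - 1 * (norm (blinfun_apply B e))\<^sup>2))" for e
    by (simp add: blinfun.add_left power2_norm_eq_inner inner_add_left inner_add_right inner_commute)
  show ?thesis unfolding pol
    using assms hilbert_schmidt_add[OF assms] unfolding hilbert_schmidt_def
    by (intro summable_on_cmult_right summable_on_add)
qed

typedef (overloaded) 'h sahs =
  "{A :: 'h::{real_inner,banach} \<Rightarrow>\<^sub>L 'h. self_adjoint A \<and> hilbert_schmidt A}"
  morphisms op_of Abs_sahs
  by (rule exI[of _ 0]) (simp add: self_adjoint_def hilbert_schmidt_0)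

setup_lifting type_definition_sahs

abbreviation sahs_apply :: "'h::{real_inner,banach} sahs \<Rightarrow> 'h \<Rightarrow> 'h" where
  "sahs_apply A \<equiv> blinfun_apply (op_of A)"

lemma sahs_self_adjoint: "self_adjoint (op_of A)" and sahs_hs: "hilbert_schmidt (op_of A)"
  using op_of[of A] by auto

instantiation sahs :: ("{real_inner,banach}") real_vector
begin

lift_definition zero_sahs :: "'a sahs" is 0
  by (simp add: self_adjoint_def hilbert_schmidt_0)

lift_definition plus_sahs :: "'a sahs \<Rightarrow> 'a sahs \<Rightarrow> 'a sahs" is "(+)"
  by (auto simp: self_adjoint_def hilbert_schmidt_add blinfun.add_left inner_add_left inner_add_right)

lift_definition scaleR_sahs :: "real \<Rightarrow> 'a sahs \<Rightarrow> 'a sahs" is "(*\<^sub>R)"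
  by (auto simp: self_adjoint_def hilbert_schmidt_scaleR blinfun.scaleR_left)

lift_definition uminus_sahs :: "'a sahs \<Rightarrow> 'a sahs" is uminus
  by (simp add: self_adjoint_def hilbert_schmidt_def blinfun.minus_left)

definition minus_sahs :: "'a sahs \<Rightarrow> 'a sahs \<Rightarrow> 'a sahs" where
  "minus_sahs A B = A + - B"

instance
  by standard (simp_all add: op_of_inject[symmetric] plus_sahs.rep_eq zero_sahs.rep_eq
      uminus_sahs.rep_eq scaleR_sahs.rep_eq minus_sahs_def scaleR_add_right scaleR_add_left)

end

lemma op_of_minus: "op_of (A - B) = op_of A - op_of B"
  unfolding minus_sahs_def plus_sahs.rep_eq uminus_sahs.rep_eq by simp

instantiation sahs :: ("{real_inner,banach}") real_inner
begin

definition inner_sahs :: "'a sahs \<Rightarrow> 'a sahs \<Rightarrow> real" where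
  "inner_sahs A B = (\<Sum>\<^sub>\<infinity>e\<in>some_onb. sahs_apply A e \<bullet> sahs_apply B e)"

definition norm_sahs :: "'a sahs \<Rightarrow> real" where
  "norm_sahs A = sqrt (A \<bullet> A)"

definition sgn_sahs :: "'a sahs \<Rightarrow> 'a sahs" where
  "sgn_sahs A = A /\<^sub>R norm A"

definition dist_sahs :: "'a sahs \<Rightarrow> 'a sahs \<Rightarrow> real" where
  "dist_sahs A B = norm (A - B)"

definition uniformity_sahs :: "('a sahs \<times> 'a sahs) filter" where
  [code del]: "uniformity_sahs = (INF e\<in>{0 <..}. principal {(x, y). dist x y < e})"

definition open_sahs :: "'a sahs set \<Rightarrow> bool" where
  [code del]: "open_sahs U = (\<forall>x\<in>U. \<forall>\<^sub>F (x', y) in uniformity. x' = x \<longrightarrow> y \<in> U)"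

instance
proof
  fix A B C :: "'a sahs" and r :: real
  note summ = hilbert_schmidt_inner_summable[OF sahs_hs sahs_hs]
  show "A \<bullet> B = B \<bullet> A" by (simp add: inner_sahs_def inner_commute)
  show "(A + B) \<bullet> C = A \<bullet> C + B \<bullet> C"
    unfolding inner_sahs_def plus_sahs.rep_eq blinfun.add_left inner_add_left
    by (rule infsum_add[OF summ summ])
  show "(r *\<^sub>R A) \<bullet> B = r * (A \<bullet> B)"
    unfolding inner_sahs_def scaleR_sahs.rep_eq blinfun.scaleR_left inner_scaleR_left
    by (rule infsum_cmult_right) (rule summ)
  show "0 \<le> A \<bullet> A" unfolding inner_sahs_def by (rule infsum_nonneg) simp
  show "(A \<bullet> A = 0) = (A = 0)"
  proof
    assume "A \<bullet> A = 0"
    then have z: "sahs_apply A e = 0" if "e \<in> some_onb" for e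
      using nonneg_infsum_le_0D[of "\<lambda>e. sahs_apply A e \<bullet> sahs_apply A e" some_onb e] summ that
      unfolding inner_sahs_def by auto
    have "span some_onb \<subseteq> {x. sahs_apply A x = 0}"
      by (rule span_minimal)
        (auto simp: z subspace_def blinfun.add_right blinfun.scaleR_right)
    moreover have "closed {x. sahs_apply A x = 0}"
      by (intro closed_Collect_eq continuous_intros)
    ultimately have "closure (span some_onb) \<subseteq> {x. sahs_apply A x = 0}"
      by (rule closure_minimal)
    then have "sahs_apply A x = 0" for x
      by (metis (mono_tags) UNIV_I mem_Collect_eq orthonormal_basis_def orthonormal_basis_some_onb
          subset_iff)
    then have "op_of A = 0" by (intro blinfun_eqI) simp
    then show "A = 0" by (simp add: zero_sahs.rep_eq flip: op_of_inject)
  qed (simp add: inner_sahs_def zero_sahs.rep_eq)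
  show "norm A = sqrt (A \<bullet> A)" by (rule norm_sahs_def)
  show "sgn A = A /\<^sub>R norm A" by (rule sgn_sahs_def)
  show "dist A B = norm (A - B)" by (rule dist_sahs_def)
  show "(uniformity :: ('a sahs \<times> 'a sahs) filter) = (INF e\<in>{0 <..}. principal {(x, y). dist x y < e})"
    by (rule uniformity_sahs_def)
  show "open U = (\<forall>x\<in>U. \<forall>\<^sub>F (x', y) in uniformity. x' = x \<longrightarrow> y \<in> U)" for U :: "'a sahs set"
    by (rule open_sahs_def)
qed

end

lemma sahs_has_sum_norm:
  "((\<lambda>e. (norm (sahs_apply A e))\<^sup>2) has_sum (norm A)\<^sup>2) some_onb"
  unfolding power2_norm_eq_inner inner_sahs_def
  by (rule has_sum_infsum[OF hilbert_schmidt_inner_summable[OF sahs_hs sahs_hs]])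

lemma sahs_inner_basis_independent:
  assumes E: "orthonormal_basis E"
  shows "((\<lambda>e. sahs_apply A e \<bullet> sahs_apply B e) has_sum (A \<bullet> B)) E"
proof -
  have n: "((\<lambda>e. (norm (sahs_apply C e))\<^sup>2) has_sum (norm C)\<^sup>2) E" for C
    by (rule self_adjoint_has_sum_swap[OF sahs_self_adjoint orthonormal_basis_some_onb E sahs_has_sum_norm])
  have pol: "x \<bullet> y = (1/2) * ((norm (x + y))\<^sup>2 + (- ((norm x)\<^sup>2) + - ((norm y)\<^sup>2)))"
    for x y :: "'c::real_inner"
    by (simp add: power2_norm_eq_inner inner_add_left inner_add_right inner_commute)
  have "((\<lambda>e. (1/2) * ((norm (sahs_apply (A + B) e))\<^sup>2
        + (- ((norm (sahs_apply A e))\<^sup>2) + - ((norm (sahs_apply B e))\<^sup>2))))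
      has_sum (1/2) * ((norm (A + B))\<^sup>2 + (- ((norm A)\<^sup>2) + - ((norm B)\<^sup>2)))) E"
    by (intro has_sum_cmult_right has_sum_add has_sum_uminusI n)
  then show ?thesis by (simp only: pol plus_sahs.rep_eq blinfun.add_left)
qed

lemma norm_sahs_apply_le:
  fixes A :: "'h::{real_inner,banach} sahs"
  shows "norm (sahs_apply A x) \<le> norm A * norm x"
proof -
  have E: "orthonormal (some_onb :: 'h set)" "closure (span some_onb) = (UNIV :: 'h set)"
    using orthonormal_basis_some_onb[where 'a='h] by (auto simp: orthonormal_basis_def)
  have "closed {x. norm (sahs_apply A x) \<le> norm A * norm x}"
    by (intro closed_Collect_le continuous_intros)
  moreover have "span some_onb \<subseteq> {x. norm (sahs_apply A x) \<le> norm A * norm x}"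
  proof safe
    fix x :: 'h assume "x \<in> span some_onb"
    then obtain t c where t: "finite t" "t \<subseteq> some_onb" "x = (\<Sum>e\<in>t. c e *\<^sub>R e)"
      using span_obtain_finite by blast
    have "(norm (0 - x))\<^sup>2 = (\<Sum>e\<in>t. (c e)\<^sup>2)"
      using orthonormal_norm_diff_sq[OF E(1) t(1,2), of 0 c] t(3) by simp
    then have x: "norm x = L2_set c t"
      by (simp add: L2_set_def real_sqrt_unique)
    have "(\<Sum>e\<in>t. (norm (sahs_apply A e))\<^sup>2) \<le> (norm A)\<^sup>2"
      by (rule finite_sum_le_has_sum[OF sahs_has_sum_norm t(1,2)]) auto
    then have A: "L2_set (\<lambda>e. norm (sahs_apply A e)) t \<le> norm A"
      by (simp add: L2_set_def real_le_lsqrt sum_nonneg)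
    have "norm (sahs_apply A x) \<le> (\<Sum>e\<in>t. \<bar>c e\<bar> * \<bar>norm (sahs_apply A e)\<bar>)"
      unfolding t(3) by (simp add: blinfun.sum_right blinfun.scaleR_right sum_norm_le)
    also have "\<dots> \<le> L2_set c t * L2_set (\<lambda>e. norm (sahs_apply A e)) t"
      by (rule L2_set_mult_ineq)
    also have "\<dots> \<le> norm x * norm A"
      unfolding x by (intro mult_left_mono A L2_set_nonneg)
    finally show "norm (sahs_apply A x) \<le> norm A * norm x" by (simp add: mult.commute)
  qed
  ultimately have "closure (span some_onb) \<subseteq> {x. norm (sahs_apply A x) \<le> norm A * norm x}"
    by (rule closure_minimal[rotated])
  then show ?thesis using E(2) by auto
qed

instance sahs :: ("{real_inner,banach}") banach
proof
  fix X :: "nat \<Rightarrow> 'a sahs" assume X: "Cauchy X"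
  have opn: "norm (op_of C) \<le> norm C" for C :: "'a sahs"
    by (intro norm_blinfun_bound norm_sahs_apply_le) simp
  have "Cauchy (\<lambda>n. op_of (X n))"
  proof (rule metric_CauchyI)
    fix e :: real assume "e > 0"
    then obtain M where M: "\<And>m n. m \<ge> M \<Longrightarrow> n \<ge> M \<Longrightarrow> dist (X m) (X n) < e"
      using metric_CauchyD[OF X] by blast
    have "dist (op_of (X m)) (op_of (X n)) \<le> dist (X m) (X n)" for m n
      using opn[of "X m - X n"] by (simp add: dist_norm op_of_minus)
    then show "\<exists>M. \<forall>m\<ge>M. \<forall>n\<ge>M. dist (op_of (X m)) (op_of (X n)) < e"
      using M by (meson le_less_trans)
  qed
  then obtain T where T: "(\<lambda>n. op_of (X n)) \<longlonglongrightarrow> T"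
    using Cauchy_convergent_iff convergent_def by blast
  have Tx: "(\<lambda>n. sahs_apply (X n) x) \<longlonglongrightarrow> blinfun_apply T x" for x
    by (intro tendsto_intros T)
  have sa: "self_adjoint T"
    unfolding self_adjoint_def
  proof (intro allI)
    fix x y
    have "(\<lambda>n. sahs_apply (X n) x \<bullet> y) \<longlonglongrightarrow> blinfun_apply T x \<bullet> y"
      by (intro tendsto_intros Tx)
    moreover have "(\<lambda>n. sahs_apply (X n) x \<bullet> y) \<longlonglongrightarrow> x \<bullet> blinfun_apply T y"
    proof -
      have "(\<lambda>n. x \<bullet> sahs_apply (X n) y) \<longlonglongrightarrow> x \<bullet> blinfun_apply T y"
        by (intro tendsto_intros Tx)
      moreover have "x \<bullet> sahs_apply (X n) y = sahs_apply (X n) x \<bullet> y" for n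
        using sahs_self_adjoint[of "X n"] unfolding self_adjoint_def by metis
      ultimately show ?thesis by simp
    qed
    ultimately show "blinfun_apply T x \<bullet> y = x \<bullet> blinfun_apply T y"
      by (rule LIMSEQ_unique)
  qed
  have fin: "(\<Sum>e\<in>F. (norm (blinfun_apply (op_of (X n) - T) e))\<^sup>2) \<le> \<epsilon>\<^sup>2"
    if \<epsilon>: "\<And>m. m \<ge> n \<Longrightarrow> norm (X n - X m) \<le> \<epsilon>" and F: "finite F" "F \<subseteq> some_onb" for n \<epsilon> F
  proof (rule LIMSEQ_le_const2)
    show "(\<lambda>m. \<Sum>e\<in>F. (norm (blinfun_apply (op_of (X n) - op_of (X m)) e))\<^sup>2)
       \<longlonglongrightarrow> (\<Sum>e\<in>F. (norm (blinfun_apply (op_of (X n) - T) e))\<^sup>2)"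
      unfolding blinfun.diff_left by (intro tendsto_intros Tx)
    have "(\<Sum>e\<in>F. (norm (blinfun_apply (op_of (X n) - op_of (X m)) e))\<^sup>2) \<le> \<epsilon>\<^sup>2" if "m \<ge> n" for m
    proof -
      have "(\<Sum>e\<in>F. (norm (sahs_apply (X n - X m) e))\<^sup>2) \<le> (norm (X n - X m))\<^sup>2"
        by (rule finite_sum_le_has_sum[OF sahs_has_sum_norm F]) auto
      also have "\<dots> \<le> \<epsilon>\<^sup>2" using \<epsilon>[OF that] by (intro power_mono) auto
      finally show ?thesis by (simp add: op_of_minus)
    qed
    then show "\<exists>N. \<forall>m\<ge>N. (\<Sum>e\<in>F. (norm (blinfun_apply (op_of (X n) - op_of (X m)) e))\<^sup>2) \<le> \<epsilon>\<^sup>2"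
      by blast
  qed
  have small: "\<exists>N. \<forall>n\<ge>N. \<forall>m\<ge>n. norm (X n - X m) \<le> \<epsilon>" if "\<epsilon> > 0" for \<epsilon>
    using metric_CauchyD[OF X that] by (force simp: dist_norm intro: less_imp_le)
  have hs: "hilbert_schmidt T"
  proof -
    obtain N where "\<And>m. m \<ge> N \<Longrightarrow> norm (X N - X m) \<le> 1" using small[of 1] by force
    then have "hilbert_schmidt (op_of (X N) - T)"
      unfolding hilbert_schmidt_def
      by (intro nonneg_bounded_partial_sums_imp_summable_on[where C="1\<^sup>2"]
          eventually_finite_subsets_at_top_weakI fin) auto
    then have "hilbert_schmidt (op_of (X N) + (-1) *\<^sub>R (op_of (X N) - T))"
      by (intro hilbert_schmidt_add hilbert_schmidt_scaleR sahs_hs)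
    then show ?thesis by simp
  qed
  define L where "L = Abs_sahs T"
  have L: "op_of L = T" unfolding L_def using sa hs by (intro Abs_sahs_inverse) auto
  have "X \<longlonglongrightarrow> L"
  proof (rule metric_LIMSEQ_I)
    fix e :: real assume "e > 0"
    then obtain N where N: "\<And>n m. n \<ge> N \<Longrightarrow> m \<ge> n \<Longrightarrow> norm (X n - X m) \<le> e / 2"
      using small[of "e/2"] by force
    have "dist (X n) L < e" if "n \<ge> N" for n
    proof -
      have "(norm (X n - L))\<^sup>2 \<le> (e/2)\<^sup>2"
      proof (rule has_sum_le_finite_sums[OF sahs_has_sum_norm])
        fix F :: "'a set" assume "finite F" "F \<subseteq> some_onb"
        from fin[OF N[OF that] this]
        show "(\<Sum>e\<in>F. (norm (sahs_apply (X n - L) e))\<^sup>2) \<le> (e/2)\<^sup>2"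
          unfolding op_of_minus L .
      qed
      then have "norm (X n - L) \<le> e / 2" using \<open>e > 0\<close> power2_le_imp_le[of "norm (X n - L)" "e/2"] by linarith
      then show ?thesis using \<open>e > 0\<close> by (simp add: dist_norm)
    qed
    then show "\<exists>N. \<forall>n\<ge>N. dist (X n) L < e" by blast
  qed
  then show "convergent X" by (auto simp: convergent_def)
qed


section \<open>The cone of positive operators and the truncation function\<close>

definition pos_cone :: "'h::{real_inner,banach} sahs set" where
  "pos_cone = {A. \<forall>h. sahs_apply A h \<bullet> h \<ge> 0}"

definition trunc :: "'h::{real_inner,banach} sahs \<Rightarrow> 'h sahs" where
  "trunc \<xi> = indicator {\<xi>. norm \<xi> \<le> 1} \<xi> *\<^sub>R \<xi>"

abbreviation pos_cone_minus_0 :: "'h::{real_inner,banach} sahs measure" where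
  "pos_cone_minus_0 \<equiv> restrict_space borel (pos_cone - {0})"


section \<open>Integration against signed and vector measures\<close>

text \<open>
  A signed measure is a set function \<open>\<nu>\<close> on the sigma-algebra of \<open>M\<close>; the measure carried by
  \<open>M\<close> plays no role.  \<open>upper_variation\<close> is the positive part of the Jordan decomposition,
  \<open>\<nu>\<^sup>+(A) = sup {\<nu>(B) | B \<subseteq> A measurable}\<close>; \<open>ennreal\<close> sends negative values to 0, which does not
  affect the supremum because \<open>\<nu>({}) = 0\<close>.
\<close>

definition upper_variation :: "'s measure \<Rightarrow> ('s set \<Rightarrow> real) \<Rightarrow> 's measure" where
  "upper_variation M \<nu> = measure_of (space M) (sets M) (\<lambda>A. SUP B\<in>{B\<in>sets M. B \<subseteq> A}. ennreal (\<nu> B))"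

definition lower_variation :: "'s measure \<Rightarrow> ('s set \<Rightarrow> real) \<Rightarrow> 's measure" where
  "lower_variation M \<nu> = upper_variation M (\<lambda>A. - \<nu> A)"

definition total_variation :: "'s measure \<Rightarrow> ('s set \<Rightarrow> real) \<Rightarrow> 's measure" where
  "total_variation M \<nu> = measure_of (space M) (sets M)
     (\<lambda>A. emeasure (upper_variation M \<nu>) A + emeasure (lower_variation M \<nu>) A)"

definition signed_integrable :: "'s measure \<Rightarrow> ('s set \<Rightarrow> real) \<Rightarrow> ('s \<Rightarrow> real) \<Rightarrow> bool" where
  "signed_integrable M \<nu> f \<longleftrightarrow> integrable (total_variation M \<nu>) f"

definition signed_integral :: "'s measure \<Rightarrow> ('s set \<Rightarrow> real) \<Rightarrow> ('s \<Rightarrow> real) \<Rightarrow> real" where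
  "signed_integral M \<nu> f =
     (\<integral>\<xi>. f \<xi> \<partial>upper_variation M \<nu>) - (\<integral>\<xi>. f \<xi> \<partial>lower_variation M \<nu>)"

lemma upper_variation_measure:
  assumes "finite_measure N" "sets N = sets M"
  shows "upper_variation M (measure N) = N"
proof -
  interpret finite_measure N by fact
  have "(SUP B\<in>{B\<in>sets M. B \<subseteq> A}. ennreal (measure N B)) = emeasure N A" if "A \<in> sets M" for A
  proof (rule antisym)
    show "(SUP B\<in>{B\<in>sets M. B \<subseteq> A}. ennreal (measure N B)) \<le> emeasure N A"
      using that assms(2) by (intro SUP_least) (auto simp: emeasure_eq_measure[symmetric] intro: emeasure_mono)
    show "emeasure N A \<le> (SUP B\<in>{B\<in>sets M. B \<subseteq> A}. ennreal (measure N B))"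
      using that by (intro SUP_upper2[of A]) (auto simp: emeasure_eq_measure)
  qed
  then have "upper_variation M (measure N) = measure_of (space M) (sets M) (emeasure N)"
    unfolding upper_variation_def
    by (intro measure_of_eq sets.space_closed) (simp add: sets.sigma_sets_eq)
  also have "\<dots> = N"
    using measure_of_of_measure[of N] assms(2) sets_eq_imp_space_eq[OF assms(2)] by simp
  finally show ?thesis .
qed

definition pos_vector_measure ::
  "('h::{real_inner,banach} sahs set \<Rightarrow> 'h sahs) \<Rightarrow> bool" where
  "pos_vector_measure \<mu> \<longleftrightarrow>
     (\<forall>A\<in>sets pos_cone_minus_0. \<mu> A \<in> pos_cone) \<and>
     (\<forall>A::nat \<Rightarrow> 'h sahs set. range A \<subseteq> sets pos_cone_minus_0 \<longrightarrow> disjoint_family A \<longrightarrow>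
       (\<forall>h. (\<lambda>i. \<mu> (A i) \<bullet> h) sums (\<mu> (\<Union>i. A i) \<bullet> h)))"

definition weak_integral ::
  "'s measure \<Rightarrow> ('s set \<Rightarrow> 'v::real_inner) \<Rightarrow> ('s \<Rightarrow> real) \<Rightarrow> 'v" where
  "weak_integral M \<mu> f = (THE v. \<forall>h. v \<bullet> h = signed_integral M (\<lambda>A. \<mu> A \<bullet> h) f)"


section \<open>Admissible parameter sets and generalized Riccati equations\<close>

definition admissible ::
  "'h::{real_inner,banach} sahs \<Rightarrow> ('h sahs \<Rightarrow>\<^sub>L 'h sahs) \<Rightarrow> 'h sahs measure \<Rightarrow>
   ('h sahs set \<Rightarrow> 'h sahs) \<Rightarrow> bool" where
  "admissible b B m \<mu> \<longleftrightarrow>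
     sets m = sets pos_cone_minus_0 \<and>
     (\<integral>\<^sup>+\<xi>. ennreal ((norm \<xi>)\<^sup>2) \<partial>m) < \<infinity> \<and>
     (\<forall>h. (\<integral>\<^sup>+\<xi>. ennreal \<bar>trunc \<xi> \<bullet> h\<bar> \<partial>m) < \<infinity>) \<and>
     (\<exists>I. \<forall>h. I \<bullet> h = (\<integral>\<xi>. trunc \<xi> \<bullet> h \<partial>m)) \<and>
     (\<forall>v\<in>pos_cone. b \<bullet> v - (\<integral>\<xi>. trunc \<xi> \<bullet> v \<partial>m) \<ge> 0) \<and>
     pos_vector_measure \<mu> \<and>
     (\<forall>u\<in>pos_cone. \<forall>x\<in>pos_cone. u \<bullet> x = 0 \<longrightarrow>
        signed_integrable pos_cone_minus_0 (\<lambda>A. \<mu> A \<bullet> x) (\<lambda>\<xi>. (trunc \<xi> \<bullet> u) / (norm \<xi>)\<^sup>2)) \<and>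
     (\<forall>u\<in>pos_cone. \<forall>x\<in>pos_cone. u \<bullet> x = 0 \<longrightarrow>
        adjoint (blinfun_apply B) u \<bullet> x
          - signed_integral pos_cone_minus_0 (\<lambda>A. \<mu> A \<bullet> x) (\<lambda>\<xi>. (trunc \<xi> \<bullet> u) / (norm \<xi>)\<^sup>2) \<ge> 0)"

definition riccati_F ::
  "'h::{real_inner,banach} sahs \<Rightarrow> 'h sahs measure \<Rightarrow> 'h sahs \<Rightarrow> real" where
  "riccati_F b m v = b \<bullet> v - (\<integral>\<xi>. (exp (- (\<xi> \<bullet> v)) - 1 + trunc \<xi> \<bullet> v) \<partial>m)"

definition riccati_R ::
  "('h::{real_inner,banach} sahs \<Rightarrow>\<^sub>L 'h sahs) \<Rightarrow> ('h sahs set \<Rightarrow> 'h sahs) \<Rightarrow> 'h sahs \<Rightarrow> 'h sahs" where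
  "riccati_R B \<mu> v = adjoint (blinfun_apply B) v
     - weak_integral pos_cone_minus_0 \<mu> (\<lambda>\<xi>. (exp (- (\<xi> \<bullet> v)) - 1 + trunc \<xi> \<bullet> v) / (norm \<xi>)\<^sup>2)"

text \<open>Derivatives at 0 are one-sided.\<close>

definition riccati_solution ::
  "'h::{real_inner,banach} sahs \<Rightarrow> ('h sahs \<Rightarrow>\<^sub>L 'h sahs) \<Rightarrow> 'h sahs measure \<Rightarrow>
   ('h sahs set \<Rightarrow> 'h sahs) \<Rightarrow> 'h sahs \<Rightarrow> (real \<Rightarrow> real) \<Rightarrow> (real \<Rightarrow> 'h sahs) \<Rightarrow> bool" where
  "riccati_solution b B m \<mu> u \<phi> \<psi> \<longleftrightarrow>
     (\<forall>t\<ge>0. \<phi> t \<ge> 0 \<and> \<psi> t \<in> pos_cone) \<and>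
     \<phi> 0 = 0 \<and> \<psi> 0 = u \<and>
     (\<forall>t\<ge>0. (\<phi> has_real_derivative riccati_F b m (\<psi> t)) (at t within {0..})) \<and>
     (\<forall>t\<ge>0. (\<psi> has_vector_derivative riccati_R B \<mu> (\<psi> t)) (at t within {0..})) \<and>
     continuous_on {0..} (\<lambda>t. riccati_F b m (\<psi> t)) \<and>
     continuous_on {0..} (\<lambda>t. riccati_R B \<mu> (\<psi> t))"


section \<open>Time-homogeneous Markov processes\<close>

definition natural_filtration :: "'w measure \<Rightarrow> 's measure \<Rightarrow> (real \<Rightarrow> 'w \<Rightarrow> 's) \<Rightarrow> real \<Rightarrow> 'w measure" where
  "natural_filtration \<Omega> S X s =
     sigma (space \<Omega>) {X r -` A \<inter> space \<Omega> | r A. 0 \<le> r \<and> r \<le> s \<and> A \<in> sets S}"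

text \<open>
  The process is given as a family \<open>P\<close> of laws on one measurable space \<open>\<Omega>\<close>, indexed by the
  starting point in the state space \<open>S\<close>: expectations under \<open>P x\<close> are expectations conditional on
  \<open>X\<^sub>0 = x\<close>.  The transition kernels are \<open>p\<^sub>t(x, A) = P x (X\<^sub>t \<in> A)\<close>; their measurability
  in \<open>x\<close> follows from that of \<open>P\<close>.  Only the sigma-algebras of \<open>\<Omega>\<close> and \<open>S\<close> matter.
\<close>

definition markov_process ::
  "'s measure \<Rightarrow> 'w measure \<Rightarrow> ('s \<Rightarrow> 'w measure) \<Rightarrow> (real \<Rightarrow> 'w \<Rightarrow> 's) \<Rightarrow> bool" where
  "markov_process S \<Omega> P X \<longleftrightarrow>
     P \<in> measurable S (prob_algebra \<Omega>) \<and>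
     (\<forall>t\<ge>0. X t \<in> measurable \<Omega> S) \<and>
     (\<forall>x\<in>space S. AE \<omega> in P x. X 0 \<omega> = x) \<and>
     (\<forall>x\<in>space S. \<forall>s\<ge>0. \<forall>t\<ge>0. \<forall>A\<in>sets S. AE \<omega> in P x.
        real_cond_exp (P x) (natural_filtration \<Omega> S X s) (\<lambda>\<omega>. indicator A (X (s + t) \<omega>)) \<omega>
          = measure (P (X s \<omega>)) {\<omega>' \<in> space \<Omega>. X t \<omega>' \<in> A})"

end

theory Submission
  imports Defs
begin

text \<open>
  The cone is self-dual, so a vector field on it that is quasi-positive (it points inwards along the
  normal cone) leaves it invariant. Admissibility makes the Riccati field \<open>R\<close> quasi-positive and
  locally Lipschitz with at most linear growth in the radial direction; this gives the global flow
  \<open>\<psi>\<close>, and \<open>\<phi>\<close> is the integral of \<open>F\<close> along it.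

  The transition laws are limits of Markov chains: over a time step \<open>h\<close> one makes an implicit Euler
  step for the drift and at most one jump of size larger than \<open>\<delta>\<close>, with intensity affine in the
  current state. The implicit step stays in the cone because the dual drift is quasi-positive too.
  One step changes \<open>exp (- \<phi> - \<langle>x, \<psi>\<rangle>)\<close> as the Riccati equations prescribe, up to
  \<open>o(h) (1 + \<parallel>x\<parallel>\<^sup>2)\<close>, and second moments grow at most by the factor \<open>1 + O(h)\<close>, so the
  Laplace transforms converge. Bounded sets of the Hilbert space are weakly compact, hence the
  moment bound alone turns this into convergence of laws: the limits of the transforms are Laplace
  transforms. Chapman-Kolmogorov holds since \<open>\<psi>\<close> is a flow with cocycle \<open>\<phi>\<close> and Laplace
  transforms on the cone determine laws, and the process exists by Kolmogorov's extension theorem.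
\<close>

section \<open>Self-dual cones\<close>

text \<open>The difficulty is uniformity in the jump truncation. Removing jumps of size at most
  \<delta> makes the intensity finite, but the compensator left in the drift is only bounded by a
  multiple of 1 / \<delta>: for \<mu> a finite full compensator is assumed only for orthogonal
  pairs. The growth rate of second moments is nevertheless independent of \<delta>, because the
  compensator in the drift cancels the truncated mean of the jumps. Time steps are chosen after
  \<delta>, so small that the remaining dependence disappears.

  In infinite dimension the cone has no interior points and is not locally compact. The projection
  onto the cone takes their place: the squared distance to the cone is differentiable, every vector
  is a difference of two cone elements of no larger norm, and the norm is monotone for the order of
  the cone. Laplace functionals see only the weak topology, which is why bounded moments can replace
  tightness in norm.\<close>

lemma inner_eqI:
  fixes v w :: "'a::real_inner"
  assumes "\<And>h. v \<bullet> h = w \<bullet> h"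
  shows "v = w"
proof -
  have "(v - w) \<bullet> (v - w) = 0" using assms by (simp add: inner_diff_left)
  then show ?thesis by simp
qed

text \<open>By the parallelogram law a minimizing sequence is Cauchy, since convexity keeps the
  midpoints of its terms at distance at least \<open>d\<close> from \<open>x\<close>.\<close>

lemma closed_convex_nearest_point:
  fixes S :: "'a::{real_inner,banach} set"
  assumes S: "closed S" "convex S" "S \<noteq> {}"
  shows "\<exists>p\<in>S. \<forall>w\<in>S. norm (x - p) \<le> norm (x - w)"
proof -
  define d where "d = infdist x S"
  have d0: "d \<ge> 0" by (simp add: d_def infdist_nonneg)
  have dle: "d \<le> norm (x - w)" if "w \<in> S" for w
    using infdist_le[OF that, of x] by (simp add: d_def dist_norm)
  have "\<exists>y\<in>S. norm (x - y) < d + 1 / real (Suc n)" for n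
  proof -
    have "infdist x S < d + 1 / real (Suc n)" by (simp add: d_def)
    then show ?thesis unfolding infdist_notempty[OF S(3)] using S(3)
      by (subst (asm) cINF_less_iff) (auto simp: dist_norm intro!: bdd_belowI2[where m=0])
  qed
  then obtain y where y: "\<And>n. y n \<in> S" "\<And>n. norm (x - y n) < d + 1 / real (Suc n)"
    by metis
  have par: "(norm (y m - y n))\<^sup>2 \<le> 2 * (norm (x - y m))\<^sup>2 + 2 * (norm (x - y n))\<^sup>2 - 4 * d\<^sup>2" for m n
  proof -
    define c where "c = (1/2) *\<^sub>R y m + (1/2) *\<^sub>R y n"
    have "c \<in> S" unfolding c_def using S(2) y(1) by (intro convexD) auto
    then have "d\<^sup>2 \<le> (norm (x - c))\<^sup>2" using dle d0 by (intro power_mono)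
    moreover have "(norm (y m - y n))\<^sup>2 =
        2 * (norm (x - y m))\<^sup>2 + 2 * (norm (x - y n))\<^sup>2 - 4 * (norm (x - c))\<^sup>2"
      unfolding c_def power2_norm_eq_inner
      by (simp add: inner_diff_left inner_diff_right inner_add_left inner_add_right
          inner_commute algebra_simps)
    ultimately show ?thesis by linarith
  qed
  have lim: "(\<lambda>n. d + 1 / real (Suc n)) \<longlonglongrightarrow> d"
    using LIMSEQ_inverse_real_of_nat_add[of d] by (simp add: inverse_eq_divide)
  have "Cauchy y"
  proof (rule metric_CauchyI)
    fix e :: real assume e: "e > 0"
    have "(\<lambda>n. 4 * (d + 1 / real (Suc n))\<^sup>2 - 4 * d\<^sup>2) \<longlonglongrightarrow> 4 * d\<^sup>2 - 4 * d\<^sup>2"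
      by (intro tendsto_intros lim)
    then have "eventually (\<lambda>n. 4 * (d + 1 / real (Suc n))\<^sup>2 - 4 * d\<^sup>2 < e\<^sup>2) sequentially"
      using e by (intro order_tendstoD(2)[where y="4 * d\<^sup>2 - 4 * d\<^sup>2"]) auto
    then obtain N where N: "\<And>n. n \<ge> N \<Longrightarrow> 4 * (d + 1 / real (Suc n))\<^sup>2 - 4 * d\<^sup>2 < e\<^sup>2"
      by (auto simp: eventually_sequentially)
    have "dist (y m) (y n) < e" if "m \<ge> N" "n \<ge> N" for m n
    proof -
      have sq: "(norm (x - y k))\<^sup>2 \<le> (d + 1 / real (Suc k))\<^sup>2" for k
        using y(2)[of k] by (intro power_mono) auto
      have "(norm (y m - y n))\<^sup>2 < e\<^sup>2"
        using par[of m n] sq[of m] sq[of n] N[OF that(1)] N[OF that(2)] by linarith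
      then show ?thesis using e by (simp add: dist_norm power_less_imp_less_base)
    qed
    then show "\<exists>M. \<forall>m\<ge>M. \<forall>n\<ge>M. dist (y m) (y n) < e" by blast
  qed
  then obtain l where l: "y \<longlonglongrightarrow> l" using Cauchy_convergent_iff convergent_def by blast
  have lS: "l \<in> S" using closed_sequentially[OF S(1) _ l] y(1) by blast
  have "norm (x - l) \<le> d"
  proof (rule LIMSEQ_le)
    show "(\<lambda>n. norm (x - y n)) \<longlonglongrightarrow> norm (x - l)" by (intro tendsto_intros l)
    show "\<exists>N. \<forall>n\<ge>N. norm (x - y n) \<le> d + 1 / real (Suc n)" using y(2) less_imp_le by blast
  qed (rule lim)
  then show ?thesis using lS dle order_trans by blast
qed

section \<open>Riesz representation and adjoints of bounded operators\<close>

theorem riesz_representation: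
  fixes f :: "'a::{real_inner,banach} \<Rightarrow> real"
  assumes f: "bounded_linear f"
  shows "\<exists>v. \<forall>h. f h = v \<bullet> h"
proof (cases "\<forall>h. f h = 0")
  case True
  then show ?thesis by (intro exI[of _ 0]) simp
next
  case False
  then obtain a where a: "f a \<noteq> 0" by blast
  interpret f: bounded_linear f by fact
  have "closed {h. f h = 0}"
    by (intro closed_Collect_eq continuous_intros linear_continuous_on f)
  moreover have "subspace {h. f h = 0}"
    by (auto simp: subspace_def f.add f.scaleR f.zero)
  ultimately obtain z where z: "z \<noteq> 0" "\<And>w. f w = 0 \<Longrightarrow> z \<bullet> w = 0"
    using closed_subspace_orthogonal_vector[of "{h. f h = 0}"] a by auto
  have "f h = (f z / (z \<bullet> z)) *\<^sub>R z \<bullet> h" for h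
  proof -
    \<comment> \<open>The kernel of \<open>f\<close> has codimension one: this combination of
      \<open>h\<close> and \<open>z\<close> lies in it and is therefore orthogonal to
      \<open>z\<close>.\<close>
    have "f (f z *\<^sub>R h - f h *\<^sub>R z) = 0" by (simp add: f.diff f.scaleR)
    from z(2)[OF this] have "f z * (z \<bullet> h) = f h * (z \<bullet> z)"
      by (simp add: inner_diff_right)
    then show ?thesis using z(1) by (simp add: field_simps)
  qed
  then show ?thesis by blast
qed

text \<open>\<open>adjoint\<close> is a choice operator, so its identity is available only once some
  adjoint is known to exist; for bounded operators Riesz representation provides one.\<close>

lemma adjoint_bounded_linear_works:
  fixes f :: "'a::{real_inner,banach} \<Rightarrow> 'b::real_inner"
  assumes f: "bounded_linear f"
  shows "f x \<bullet> y = x \<bullet> adjoint f y"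
proof -
  interpret f: bounded_linear f by fact
  have "\<forall>y. \<exists>v. \<forall>h. f h \<bullet> y = v \<bullet> h"
    by (intro allI riesz_representation)
       (rule bounded_linear_compose[OF bounded_linear_inner_left f])
  from choice[OF this] obtain g where "\<And>y h. f h \<bullet> y = g y \<bullet> h" by blast
  then have "\<exists>g. \<forall>x y. f x \<bullet> y = x \<bullet> g y" by (intro exI[of _ g]) (simp add: inner_commute[of "g _"])
  from someI_ex[OF this] show ?thesis unfolding adjoint_def by blast
qed

lemma adjoint_bounded_linear:
  fixes f :: "'a::{real_inner,banach} \<Rightarrow> 'b::real_inner"
  assumes f: "bounded_linear f"
  shows "bounded_linear (adjoint f)" "norm (adjoint f y) \<le> onorm f * norm y"
proof -
  note adj = adjoint_bounded_linear_works[OF f, symmetric]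
  have bnd: "norm (adjoint f y) \<le> norm y * onorm f" for y
  proof -
    have "(norm (adjoint f y))\<^sup>2 = f (adjoint f y) \<bullet> y"
      by (simp add: power2_norm_eq_inner adj)
    also have "\<dots> \<le> norm (f (adjoint f y)) * norm y" by (rule norm_cauchy_schwarz)
    also have "\<dots> \<le> (onorm f * norm (adjoint f y)) * norm y"
      by (intro mult_right_mono onorm[OF f]) simp
    finally have "norm (adjoint f y) * norm (adjoint f y) \<le> norm (adjoint f y) * (norm y * onorm f)"
      by (simp add: power2_eq_square mult_ac)
    then show ?thesis
      using onorm_pos_le[OF f] by (cases "adjoint f y = 0") auto
  qed
  then show "norm (adjoint f y) \<le> onorm f * norm y" by (simp add: mult.commute)
  show "bounded_linear (adjoint f)"
  proof (rule bounded_linear_intro)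
    fix x y :: 'b and r :: real
    show "adjoint f (x + y) = adjoint f x + adjoint f y"
      by (rule inner_eqI) (simp add: inner_commute[of "adjoint f _"] adj inner_add_left inner_add_right)
    show "adjoint f (r *\<^sub>R x) = r *\<^sub>R adjoint f x"
      by (rule inner_eqI) (simp add: inner_commute[of "adjoint f _"] adj)
    show "norm (adjoint f x) \<le> norm x * onorm f" by (rule bnd)
  qed
qed

text \<open>Being its own dual is the only requirement. Closedness, convexity and the cone axioms
  follow, and every membership proof becomes a family of inequalities between inner
  products.\<close>

locale self_dual_cone =
  fixes K :: "'a::{real_inner,banach} set"
  assumes self_dual: "x \<in> K \<longleftrightarrow> (\<forall>y\<in>K. 0 \<le> x \<bullet> y)"
begin

lemma inner_nonneg: "x \<in> K \<Longrightarrow> y \<in> K \<Longrightarrow> 0 \<le> x \<bullet> y"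
  using self_dual[of x, THEN iffD1] by (rule bspec)

lemma cone_zero [simp]: "0 \<in> K"
  by (subst self_dual) simp

lemma cone_add: "x \<in> K \<Longrightarrow> y \<in> K \<Longrightarrow> x + y \<in> K"
  using self_dual[of x] self_dual[of y] self_dual[of "x + y"] by (simp add: inner_add_left)

lemma cone_scale: "x \<in> K \<Longrightarrow> 0 \<le> r \<Longrightarrow> r *\<^sub>R x \<in> K"
  using self_dual[of x] self_dual[of "r *\<^sub>R x"] by simp

lemma cone_closed: "closed K"
proof -
  have "K = (\<Inter>y\<in>K. {x. 0 \<le> x \<bullet> y})"
    by (rule set_eqI, subst self_dual) simp
  moreover have "closed (\<Inter>y\<in>K. {x. 0 \<le> x \<bullet> y})"
    by (intro closed_INT ballI closed_Collect_le continuous_intros)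
  ultimately show ?thesis by simp
qed

lemma cone_convex: "convex K"
  by (rule convexI) (intro cone_add cone_scale)

text \<open>Moreau's decomposition: \<open>x\<close> is the difference of the orthogonal cone
  elements \<open>p\<close> and \<open>p - x\<close>. For the nearest point \<open>p\<close>, moving
  towards cone elements gives the second membership through self-duality, and moving along the ray
  of \<open>p\<close> in both directions gives orthogonality.\<close>

lemma moreau_ex: "\<exists>p. p \<in> K \<and> p - x \<in> K \<and> (p - x) \<bullet> p = 0"
proof -
  obtain p where p: "p \<in> K" "\<And>w. w \<in> K \<Longrightarrow> norm (x - p) \<le> norm (x - w)"
    using closed_convex_nearest_point[OF cone_closed cone_convex] cone_zero by blast
  have var: "(x - p) \<bullet> d \<le> 0" if d: "\<And>t. 0 < t \<Longrightarrow> t \<le> 1 \<Longrightarrow> p + t *\<^sub>R d \<in> K" for d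
  proof (rule field_le_epsilon)
    fix e :: real assume e: "e > 0"
    \<comment> \<open>Small enough for the quadratic term of the expansion to stay below
      \<open>e\<close>; the 1 in the denominator covers \<open>d = 0\<close>.\<close>
    define t where "t = min 1 (e / (1 + d \<bullet> d))"
    have dd: "d \<bullet> d \<ge> 0" by simp
    have t: "0 < t" "t \<le> 1" using e dd by (auto simp: t_def intro!: divide_pos_pos add_pos_nonneg)
    have "t * (1 + d \<bullet> d) \<le> e"
    proof -
      have "t \<le> e / (1 + d \<bullet> d)" by (simp add: t_def)
      moreover have "1 + d \<bullet> d > 0" using dd by linarith
      ultimately show ?thesis by (simp add: pos_le_divide_eq)
    qed
    then have te: "t * (d \<bullet> d) \<le> e" using t by (simp add: distrib_left)
    have "(norm (x - p))\<^sup>2 \<le> (norm (x - (p + t *\<^sub>R d)))\<^sup>2"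
      by (intro power_mono p(2) d t) simp
    then have "2 * t * ((x - p) \<bullet> d) \<le> t * t * (d \<bullet> d)"
      unfolding power2_norm_eq_inner
      by (simp add: inner_diff_left inner_diff_right inner_add_left inner_add_right inner_commute algebra_simps)
    then have "t * (2 * ((x - p) \<bullet> d)) \<le> t * (t * (d \<bullet> d))" by (simp add: mult_ac)
    then have "2 * ((x - p) \<bullet> d) \<le> t * (d \<bullet> d)" using t by simp
    then show "(x - p) \<bullet> d \<le> 0 + e" using te e by linarith
  qed
  have "p - x \<in> K"
  proof (subst self_dual, rule ballI)
    fix y assume "y \<in> K"
    then have "(x - p) \<bullet> y \<le> 0" by (intro var cone_add cone_scale p(1)) auto
    then show "0 \<le> (p - x) \<bullet> y" by (simp add: inner_diff_left)
  qed
  moreover have "(x - p) \<bullet> (- p) \<le> 0"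
  proof (rule var)
    fix t :: real assume "0 < t" "t \<le> 1"
    then have "(1 - t) *\<^sub>R p \<in> K" by (intro cone_scale p(1)) auto
    then show "p + t *\<^sub>R - p \<in> K" by (simp add: scaleR_diff_left)
  qed
  moreover have "(x - p) \<bullet> p \<le> 0" by (intro var cone_add cone_scale p(1)) auto
  ultimately show ?thesis using p(1) by (intro exI[of _ p]) (auto simp: inner_diff_left)
qed

text \<open>The metric projection, specified by Moreau's conditions rather than by minimality,
  because these are what later estimates use. The negative part of \<open>x\<close> is
  \<open>pr x - x\<close>.\<close>

definition pr :: "'a \<Rightarrow> 'a" where
  "pr x = (SOME p. p \<in> K \<and> p - x \<in> K \<and> (p - x) \<bullet> p = 0)"

lemma pr_in [simp]: "pr x \<in> K" and pr_minus_in: "pr x - x \<in> K" and pr_orth: "(pr x - x) \<bullet> pr x = 0"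
  using someI_ex[OF moreau_ex[of x]] unfolding pr_def by auto

text \<open>Firm nonexpansiveness: the cross terms of \<open>pr x - x\<close> with
  \<open>pr y\<close> and of \<open>pr y - y\<close> with \<open>pr x\<close> pair cone elements,
  hence are nonnegative.\<close>

lemma pr_dist_sq: "(norm (pr x - pr y))\<^sup>2 \<le> (x - y) \<bullet> (pr x - pr y)"
proof -
  have "0 \<le> (pr x - x) \<bullet> pr y" "0 \<le> (pr y - y) \<bullet> pr x"
    by (auto intro: inner_nonneg pr_minus_in)
  then show ?thesis using pr_orth[of x] pr_orth[of y] unfolding power2_norm_eq_inner
    by (simp add: inner_diff_left inner_diff_right inner_commute)
qed

lemma pr_lipschitz: "norm (pr x - pr y) \<le> norm (x - y)"
proof -
  have "norm (pr x - pr y) * norm (pr x - pr y) \<le> norm (x - y) * norm (pr x - pr y)"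
    using pr_dist_sq[of x y] norm_cauchy_schwarz[of "x - y" "pr x - pr y"] by (simp add: power2_eq_square)
  then show ?thesis by (cases "pr x = pr y") auto
qed

lemma pr_ident: "x \<in> K \<Longrightarrow> pr x = x"
proof -
  assume "x \<in> K"
  then have "0 \<le> (pr x - x) \<bullet> x" by (intro inner_nonneg pr_minus_in)
  then have "(pr x - x) \<bullet> (pr x - x) \<le> 0" using pr_orth[of x] by (simp add: inner_diff_right)
  then show ?thesis using inner_ge_zero[of "pr x - x"] by (metis antisym eq_iff_diff_eq_0 inner_eq_zero_iff)
qed

lemma norm_pr_le: "norm (pr x) \<le> norm x"
  using pr_lipschitz[of x 0] pr_ident[of 0] by simp

lemma pr_idem [simp]: "pr (pr x) = pr x"
  by (rule pr_ident) simp

lemma continuous_pr: "continuous_on A pr"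
  by (rule continuous_on_subset[OF lipschitz_on_continuous_on[of 1 UNIV]])
     (auto simp: lipschitz_on_def dist_norm pr_lipschitz)

text \<open>Orthogonality of the two parts keeps their norms below that of \<open>x\<close>. The
  lemma transfers statements from the cone to the whole space.\<close>

lemma cone_decomp:
  obtains p n where "p \<in> K" "n \<in> K" "x = p - n" "norm p \<le> norm x" "norm n \<le> norm x"
proof
  show "pr x \<in> K" "pr x - x \<in> K" "x = pr x - (pr x - x)" "norm (pr x) \<le> norm x"
    by (auto intro: pr_minus_in norm_pr_le)
  have "(norm x)\<^sup>2 = (norm (pr x))\<^sup>2 + (norm (pr x - x))\<^sup>2"
    using pr_orth[of x] unfolding power2_norm_eq_inner
    by (simp add: inner_diff_left inner_diff_right inner_commute)
  then have "(norm (pr x - x))\<^sup>2 \<le> (norm x)\<^sup>2" by simp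
  then show "norm (pr x - x) \<le> norm x" by (rule power2_le_imp_le) simp
qed

text \<open>The pairing of \<open>b - a\<close> with \<open>b + a\<close> is the difference of the
  squared norms.\<close>

lemma norm_mono_symmetric:
  assumes "b - a \<in> K" "b + a \<in> K"
  shows "norm a \<le> norm b"
proof -
  have "0 \<le> (b - a) \<bullet> (b + a)" by (intro inner_nonneg assms)
  then have "(norm a)\<^sup>2 \<le> (norm b)\<^sup>2"
    unfolding power2_norm_eq_inner by (simp add: inner_diff_left inner_diff_right inner_add_left inner_add_right inner_commute)
  then show ?thesis by (rule power2_le_imp_le) simp
qed

text \<open>The squared distance to the cone has gradient \<open>2 *\<^sub>R (x - pr x)\<close> with
  a quadratic remainder. Each point is compared with the projection of the other; the lower bound
  also uses that \<open>pr\<close> is nonexpansive.\<close>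

lemma pr_gradient:
  "\<bar>(norm (y - pr y))\<^sup>2 - (norm (x - pr x))\<^sup>2 - 2 * ((x - pr x) \<bullet> (y - x))\<bar> \<le> 4 * (norm (y - x))\<^sup>2"
proof -
  have up: "(norm (y - pr y))\<^sup>2 \<le> (norm (y - pr x))\<^sup>2" for x y
  proof -
    have "0 \<le> (pr y - y) \<bullet> pr x" by (auto intro: inner_nonneg pr_minus_in)
    then have "0 \<le> (norm (pr y - pr x))\<^sup>2 + 2 * ((pr y - y) \<bullet> pr x)" by simp
    then show ?thesis using pr_orth[of y] unfolding power2_norm_eq_inner
      by (simp add: inner_diff_left inner_diff_right inner_commute)
  qed
  have e1: "(norm (y - pr x))\<^sup>2 = (norm (x - pr x))\<^sup>2 + 2 * ((x - pr x) \<bullet> (y - x)) + (norm (y - x))\<^sup>2"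
    unfolding power2_norm_eq_inner by (simp add: inner_diff_left inner_diff_right inner_commute)
  have e2: "(norm (x - pr y))\<^sup>2 = (norm (y - pr y))\<^sup>2 - 2 * ((y - pr y) \<bullet> (y - x)) + (norm (y - x))\<^sup>2"
    unfolding power2_norm_eq_inner by (simp add: inner_diff_left inner_diff_right inner_commute)
  have e3: "(y - pr y) \<bullet> (y - x) = (x - pr x) \<bullet> (y - x) + (norm (y - x))\<^sup>2 - (pr y - pr x) \<bullet> (y - x)"
    unfolding power2_norm_eq_inner by (simp add: inner_diff_left inner_diff_right inner_commute)
  have "(pr y - pr x) \<bullet> (y - x) \<le> norm (pr y - pr x) * norm (y - x)"
    by (rule norm_cauchy_schwarz)
  also have "\<dots> \<le> (norm (y - x))\<^sup>2"
    unfolding power2_eq_square by (intro mult_right_mono pr_lipschitz) simp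
  finally have e4: "(pr y - pr x) \<bullet> (y - x) \<le> (norm (y - x))\<^sup>2" .
  have e5: "(norm (y - x))\<^sup>2 \<ge> 0" by simp
  show ?thesis using up[of y x] up[of x y] e1 e2 e3 e4 e5 by linarith
qed

end

section \<open>Ordinary differential equations in a self-dual cone\<close>

text \<open>\<open>C\<close> may have any sign; \<open>C = 0\<close> gives monotonicity, which is
  how the distance to the cone is controlled.\<close>

lemma gronwall_differential:
  fixes f :: "real \<Rightarrow> real"
  assumes deriv: "\<And>t. t \<in> {0..T} \<Longrightarrow> (f has_real_derivative f' t) (at t within {0..T})"
    and le: "\<And>t. t \<in> {0..T} \<Longrightarrow> f' t \<le> C * f t" and t: "t \<in> {0..T}"
  shows "f t \<le> f 0 * exp (C * t)"
proof -
  define g where "g s = f s * exp (- (C * s))" for s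
  define g' where "g' s = (f' s - C * f s) * exp (- (C * s))" for s
  have "(g has_real_derivative g' s) (at s within {0..t})" if s: "s \<in> {0..t}" for s
  proof -
    have "s \<in> {0..T}" using s t by auto
    from DERIV_subset[OF deriv[OF this], of "{0..t}"] t
    have d: "(f has_real_derivative f' s) (at s within {0..t})" by auto
    show ?thesis unfolding g_def g'_def
      by (rule derivative_eq_intros d refl | simp add: algebra_simps)+
  qed
  then have "(g' has_integral (g t - g 0)) {0..t}"
    using t by (intro fundamental_theorem_of_calculus) (auto simp: has_real_derivative_iff_has_vector_derivative)
  then have "((\<lambda>s. - g' s) has_integral - (g t - g 0)) {0..t}" by (rule has_integral_neg)
  then have "0 \<le> - (g t - g 0)"
  proof (rule has_integral_nonneg)
    fix s assume "s \<in> {0..t}"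
    then have "f' s \<le> C * f s" using le t by auto
    then show "0 \<le> - g' s" by (simp add: g'_def mult_le_0_iff)
  qed
  then have "f t * exp (- (C * t)) \<le> f 0" by (simp add: g_def)
  then have "f t * exp (- (C * t)) * exp (C * t) \<le> f 0 * exp (C * t)" by (intro mult_right_mono) auto
  then show ?thesis by (simp add: mult.assoc flip: exp_add)
qed

lemma le_one_plus_square: "(r::real) \<le> 1 + r\<^sup>2"
proof -
  have "0 \<le> (r - 1)\<^sup>2" by simp
  then have "2 * r \<le> r\<^sup>2 + 1" by (simp add: power2_diff)
  moreover have "0 \<le> r\<^sup>2" by simp
  ultimately show ?thesis by linarith
qed

lemma norm_sq_has_derivative:
  fixes v :: "real \<Rightarrow> 'a::real_inner"
  assumes "(v has_vector_derivative v') (at t within S)"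
  shows "((\<lambda>t. (norm (v t))\<^sup>2) has_real_derivative 2 * (v t \<bullet> v')) (at t within S)"
proof -
  have v: "(v has_derivative (\<lambda>h. h *\<^sub>R v')) (at t within S)"
    using assms by (simp add: has_vector_derivative_def)
  have "((\<lambda>t. v t \<bullet> v t) has_derivative (\<lambda>h. v t \<bullet> (h *\<^sub>R v') + (h *\<^sub>R v') \<bullet> v t)) (at t within S)"
    by (rule has_derivative_inner[OF v v])
  then show ?thesis
    by (simp add: has_field_derivative_def power2_norm_eq_inner inner_commute mult_ac mult_commute_abs)
qed

lemma picard_lindelof_global:
  fixes F :: "'a::banach \<Rightarrow> 'a"
  assumes lip: "\<And>v w. norm (F v - F w) \<le> C * norm (v - w)" and C: "0 < C" and T: "0 \<le> T"
  shows "\<exists>v. v 0 = u \<and> (\<forall>t\<in>{0..T}. (v has_vector_derivative F (v t)) (at t within {0..T}))"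
proof -
  have contF: "continuous_on UNIV F"
    by (rule lipschitz_on_continuous_on[of C]) (use lip C in \<open>auto simp: lipschitz_on_def dist_norm\<close>)
  have contFw: "continuous_on S (\<lambda>s. F (w s))" if "continuous_on S w" for S and w :: "real \<Rightarrow> 'a"
    using continuous_on_compose2[OF contF that] by auto
  define v :: "nat \<Rightarrow> real \<Rightarrow> 'a" where "v = rec_nat (\<lambda>_. u) (\<lambda>_ w t. u + integral {0..t} (\<lambda>s. F (w s)))"
  have v0: "v 0 = (\<lambda>_. u)" and vS: "v (Suc n) = (\<lambda>t. u + integral {0..t} (\<lambda>s. F (v n s)))" for n
    by (simp_all add: v_def)
  have cont: "continuous_on {0..T} (v n)" for n
  proof (induction n)
    case (Suc n)
    have "(\<lambda>s. F (v n s)) integrable_on {0..T}"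
      by (rule integrable_continuous_real[OF contFw[OF Suc]])
    then show ?case unfolding vS by (intro continuous_intros indefinite_integral_continuous_1)
  qed (simp add: v0)
  define A where "A = T * norm (F u)"
  have A: "A \<ge> 0" using T by (simp add: A_def)
  \<comment> \<open>The weight \<open>exp (2 * C * t)\<close> makes the Picard map contract by 1/2
    on all of \<open>{0..T}\<close>, so the solution need not be continued from short
    intervals.\<close>
  have step: "norm (v (Suc n) t - v n t) \<le> A * (1/2) ^ n * exp (2 * C * t)" if "t \<in> {0..T}" for n t
    using that
  proof (induction n arbitrary: t)
    case 0
    have "norm (v (Suc 0) t - v 0 t) = t * norm (F u)"
      using 0 by (simp add: vS v0)
    also have "\<dots> \<le> A * 1" using 0 by (auto simp: A_def intro: mult_right_mono)
    also have "\<dots> \<le> A * exp (2 * C * t)" using 0 C A by (intro mult_left_mono) auto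
    finally show ?case by simp
  next
    case (Suc n)
    have sub: "{0..t} \<subseteq> {0..T}" using Suc.prems by auto
    have i: "(\<lambda>s. F (v k s)) integrable_on {0..t}" for k
      by (intro integrable_continuous_real contFw continuous_on_subset[OF cont sub])
    define a where "a = A * (1/2) ^ n"
    have e: "((\<lambda>s. C * a * exp (2 * C * s)) has_integral (a / 2 * exp (2 * C * t) - a / 2 * exp (2 * C * 0))) {0..t}"
      using Suc.prems C
      by (intro fundamental_theorem_of_calculus)
         (auto intro!: derivative_eq_intros simp flip: has_real_derivative_iff_has_vector_derivative)
    have "v (Suc (Suc n)) t - v (Suc n) t = integral {0..t} (\<lambda>s. F (v (Suc n) s) - F (v n s))"
      by (subst Henstock_Kurzweil_Integration.integral_diff[OF i i]) (simp add: vS)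
    also have "norm \<dots> \<le> integral {0..t} (\<lambda>s. C * a * exp (2 * C * s))"
    proof (rule integral_norm_bound_integral)
      show "(\<lambda>s. F (v (Suc n) s) - F (v n s)) integrable_on {0..t}"
        by (intro Henstock_Kurzweil_Integration.integrable_diff i)
      show "(\<lambda>s. C * a * exp (2 * C * s)) integrable_on {0..t}" using e by (rule has_integral_integrable)
      fix s assume "s \<in> {0..t}"
      then have "norm (v (Suc n) s - v n s) \<le> a * exp (2 * C * s)"
        using Suc.IH sub unfolding a_def by blast
      then have "C * norm (v (Suc n) s - v n s) \<le> C * (a * exp (2 * C * s))"
        using C by (intro mult_left_mono) auto
      then show "norm (F (v (Suc n) s) - F (v n s)) \<le> C * a * exp (2 * C * s)"
        using lip[of "v (Suc n) s" "v n s"] by (simp add: mult.assoc)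
    qed
    also have "\<dots> = a / 2 * exp (2 * C * t) - a / 2 * exp (2 * C * 0)"
      using e by (rule integral_unique)
    also have "\<dots> \<le> A * (1/2) ^ Suc n * exp (2 * C * t)" using A by (simp add: a_def)
    finally show ?case .
  qed
  define w where "w t = u + (\<Sum>n. v (Suc n) t - v n t)" for t
  have "uniform_limit {0..T} (\<lambda>n t. \<Sum>i<n. v (Suc i) t - v i t) (\<lambda>t. \<Sum>n. v (Suc n) t - v n t) sequentially"
  proof (rule Weierstrass_m_test)
    fix n t assume t: "t \<in> {0..T}"
    have "norm (v (Suc n) t - v n t) \<le> A * (1/2) ^ n * exp (2 * C * t)" by (rule step[OF t])
    also have "\<dots> \<le> A * (1/2) ^ n * exp (2 * C * T)" using t A C by (intro mult_left_mono) auto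
    finally show "norm (v (Suc n) t - v n t) \<le> A * exp (2 * C * T) * (1/2) ^ n" by (simp add: mult_ac)
  qed (intro summable_mult summable_geometric, simp)
  then have "uniform_limit {0..T} (\<lambda>n t. u + (\<Sum>i<n. v (Suc i) t - v i t)) w sequentially"
    unfolding w_def[abs_def] by (intro uniform_limit_intros)
  moreover have "u + (\<Sum>i<n. v (Suc i) t - v i t) = v n t" for n t
    by (subst sum_lessThan_telescope) (simp add: v0)
  ultimately have ul: "uniform_limit {0..T} v w sequentially" by simp
  have contw: "continuous_on {0..T} w"
    by (rule uniform_limit_theorem[OF always_eventually ul]) (auto intro: cont)
  have w: "w t = u + integral {0..t} (\<lambda>s. F (w s))" if t: "t \<in> {0..T}" for t
  proof -
    have sub: "{0..t} \<subseteq> {0..T}" using t by auto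
    have ul': "uniform_limit {0..t} (\<lambda>n s. F (v n s)) (\<lambda>s. F (w s)) sequentially"
    proof (rule uniform_limitI)
      fix e :: real assume e: "e > 0"
      have "\<forall>\<^sub>F n in sequentially. \<forall>s\<in>{0..t}. dist (v n s) (w s) < e / C"
        using uniform_limitD[OF uniform_limit_on_subset[OF ul sub], of "e / C"] e C by auto
      then show "\<forall>\<^sub>F n in sequentially. \<forall>s\<in>{0..t}. dist (F (v n s)) (F (w s)) < e"
      proof (rule eventually_mono)
        fix n assume *: "\<forall>s\<in>{0..t}. dist (v n s) (w s) < e / C"
        show "\<forall>s\<in>{0..t}. dist (F (v n s)) (F (w s)) < e"
        proof
          fix s assume "s \<in> {0..t}"
          then have "C * dist (v n s) (w s) < e" using * C by (auto simp: field_simps)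
          then show "dist (F (v n s)) (F (w s)) < e"
            using lip[of "v n s" "w s"] by (simp add: dist_norm)
        qed
      qed
    qed
    have cn: "continuous_on {0..t} (\<lambda>s. F (v n s))" for n
      by (intro contFw continuous_on_subset[OF cont]) (use sub in auto)
    obtain I J where IJ: "\<And>n. ((\<lambda>s. F (v n s)) has_integral I n) {0..t}"
        "((\<lambda>s. F (w s)) has_integral J) {0..t}" "I \<longlonglongrightarrow> J"
      by (rule uniform_limit_integral[OF ul' cn]) auto
    have "(\<lambda>n. v (Suc n) t) \<longlonglongrightarrow> u + J"
      unfolding vS using IJ(1)[THEN integral_unique] IJ(3) by (auto intro!: tendsto_intros)
    moreover have "(\<lambda>n. v (Suc n) t) \<longlonglongrightarrow> w t"
      using tendsto_uniform_limitI[OF ul t] by (rule LIMSEQ_Suc)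
    ultimately have "w t = u + J" using LIMSEQ_unique by blast
    then show ?thesis using integral_unique[OF IJ(2)] by simp
  qed
  have "(w has_vector_derivative F (w t)) (at t within {0..T})" if t: "t \<in> {0..T}" for t
  proof -
    have "((\<lambda>t. u + integral {0..t} (\<lambda>s. F (w s))) has_vector_derivative F (w t)) (at t within {0..T})"
      using integral_has_vector_derivative[OF contFw[OF contw] t]
      by (auto intro!: derivative_eq_intros)
    then show ?thesis
      by (rule has_vector_derivative_transform[OF t, rotated]) (rule w)
  qed
  moreover have "w 0 = u" using w[of 0] T by simp
  ultimately show ?thesis by blast
qed

text \<open>Radial truncation keeps points on their rays, hence in the cone, and makes a locally
  Lipschitz field globally Lipschitz.\<close>

lemma radial_retraction_lipschitz:
  fixes v w :: "'a::real_normed_vector"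
  assumes M: "0 < M"
  shows "norm ((M / max M (norm v)) *\<^sub>R v - (M / max M (norm w)) *\<^sub>R w) \<le> 2 * norm (v - w)"
proof -
  define a where "a = max M (norm v)"
  define b where "b = max M (norm w)"
  have ab: "0 < a" "0 < b" "M \<le> a" "norm w \<le> b" using M by (auto simp: a_def b_def)
  have d: "\<bar>b - a\<bar> \<le> norm (v - w)"
    using norm_triangle_ineq3[of w v] by (auto simp: a_def b_def max_def norm_minus_commute)
  have "(M / a) *\<^sub>R v - (M / b) *\<^sub>R w = (M / a) *\<^sub>R (v - w) + ((M / a) * ((b - a) / b)) *\<^sub>R w"
  proof -
    have e: "M / b = M / a - (M / a) * ((b - a) / b)" using ab by (simp add: field_simps)
    show ?thesis by (subst e) (simp add: scaleR_diff_left scaleR_diff_right)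
  qed
  also have "norm \<dots> \<le> (M / a) * norm (v - w) + (M / a) * (\<bar>b - a\<bar> / b) * norm w"
    using ab M by (intro norm_triangle_le add_mono) (auto simp: abs_mult)
  also have "(M / a) * (\<bar>b - a\<bar> / b) * norm w = (M / a) * (norm w / b) * \<bar>b - a\<bar>" by simp
  also have "\<dots> \<le> 1 * 1 * norm (v - w)"
    using ab M d by (intro mult_mono) auto
  also have "(M / a) * norm (v - w) \<le> 1 * norm (v - w)"
    using ab M by (intro mult_right_mono) auto
  finally show ?thesis by (simp add: a_def b_def)
qed

context self_dual_cone
begin

lemma dist_cone_sq_has_derivative:
  "((\<lambda>x. (norm (x - pr x))\<^sup>2) has_derivative (\<lambda>h. 2 * ((x - pr x) \<bullet> h))) (at x)"
proof (rule has_derivativeI_sandwich[of 1])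
  show "bounded_linear (\<lambda>h. 2 * ((x - pr x) \<bullet> h))"
    by (intro bounded_linear_const_mult bounded_linear_inner_right)
  fix y assume "y \<noteq> x"
  then have n: "norm (y - x) > 0" by simp
  have "norm ((norm (y - pr y))\<^sup>2 - (norm (x - pr x))\<^sup>2 - 2 * ((x - pr x) \<bullet> (y - x))) \<le> 4 * norm (y - x) * norm (y - x)"
    using pr_gradient[of y x] by (simp add: power2_eq_square)
  then show "norm ((norm (y - pr y))\<^sup>2 - (norm (x - pr x))\<^sup>2 - 2 * ((x - pr x) \<bullet> (y - x))) / norm (y - x) \<le> 4 * norm (y - x)"
    using n by (simp add: pos_divide_le_eq)
next
  have "((\<lambda>y. 4 * norm (y - x)) \<longlongrightarrow> 4 * norm (x - x)) (at x)" by (intro tendsto_intros)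
  then show "((\<lambda>y. 4 * norm (y - x)) \<longlongrightarrow> 0) (at x)" by simp
qed simp

end

text \<open>The Lipschitz constant grows with the norm because small jumps enter the Riccati field
  to second order. Explosion is excluded by bounding only the radial component
  \<open>v \<bullet> R v\<close>; the field itself may grow quadratically.\<close>

locale cone_ode = self_dual_cone K for K :: "'a::{real_inner,banach} set" +
  fixes R :: "'a \<Rightarrow> 'a" and L c :: real
  assumes lipschitz: "v \<in> K \<Longrightarrow> w \<in> K \<Longrightarrow> norm (R v - R w) \<le> L * (1 + norm v + norm w) * norm (v - w)"
    and quasi_positive: "v \<in> K \<Longrightarrow> x \<in> K \<Longrightarrow> v \<bullet> x = 0 \<Longrightarrow> 0 \<le> R v \<bullet> x"
    and growth: "v \<in> K \<Longrightarrow> v \<bullet> R v \<le> c * (norm v + (norm v)\<^sup>2)"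
    and const_nonneg: "0 \<le> L" "0 \<le> c"
begin

definition solves :: "real \<Rightarrow> 'a \<Rightarrow> (real \<Rightarrow> 'a) \<Rightarrow> bool" where
  "solves T u v \<longleftrightarrow> v 0 = u \<and> (\<forall>t\<in>{0..T}. v t \<in> K \<and> (v has_vector_derivative R (v t)) (at t within {0..T}))"

lemma solves_subset: "solves T u v \<Longrightarrow> S \<le> T \<Longrightarrow> solves S u v"
  unfolding solves_def
  by (intro conjI ballI) (auto intro: has_vector_derivative_within_subset[where S = "{0..T}"])

text \<open>Stated for an arbitrary derivative \<open>v'\<close>, since it serves both the original
  equation and its truncation in \<open>solves_exists\<close>.\<close>

lemma norm_bound:
  assumes v: "\<And>t. t \<in> {0..T} \<Longrightarrow> (v has_vector_derivative v' t) (at t within {0..T})"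
    and le: "\<And>t. t \<in> {0..T} \<Longrightarrow> v t \<bullet> v' t \<le> c * (norm (v t) + (norm (v t))\<^sup>2)" and t: "t \<in> {0..T}"
  shows "norm (v t) \<le> (1 + (norm (v 0))\<^sup>2) * exp (4 * c * T)"
proof -
  have "1 + (norm (v t))\<^sup>2 \<le> (1 + (norm (v 0))\<^sup>2) * exp (4 * c * t)"
  proof (rule gronwall_differential[where f = "\<lambda>t. 1 + (norm (v t))\<^sup>2" and T=T])
    fix s assume s: "s \<in> {0..T}"
    show "((\<lambda>t. 1 + (norm (v t))\<^sup>2) has_real_derivative 2 * (v s \<bullet> v' s)) (at s within {0..T})"
      using DERIV_add[OF DERIV_const[of 1] norm_sq_has_derivative[OF v[OF s]]] by simp
    have "norm (v s) + (norm (v s))\<^sup>2 \<le> 2 * (1 + (norm (v s))\<^sup>2)"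
      using le_one_plus_square[of "norm (v s)"] by simp
    then have "c * (norm (v s) + (norm (v s))\<^sup>2) \<le> c * (2 * (1 + (norm (v s))\<^sup>2))"
      using const_nonneg by (intro mult_left_mono)
    with le[OF s] show "2 * (v s \<bullet> v' s) \<le> 4 * c * (1 + (norm (v s))\<^sup>2)" by (simp add: algebra_simps)
  qed (rule t)
  also have "\<dots> \<le> (1 + (norm (v 0))\<^sup>2) * exp (4 * c * T)"
    using t const_nonneg by (intro mult_left_mono) (auto intro: mult_left_mono)
  finally show ?thesis using le_one_plus_square[of "norm (v t)"] by simp
qed

lemma solves_bound:
  assumes "solves T u v" "t \<in> {0..T}"
  shows "norm (v t) \<le> (1 + (norm u)\<^sup>2) * exp (4 * c * T)"
  using norm_bound[of T v "\<lambda>t. R (v t)" t] assms growth unfolding solves_def by auto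

lemma solves_unique:
  assumes v: "solves T u v" and w: "solves T u w" and t: "t \<in> {0..T}"
  shows "v t = w t"
proof -
  define M where "M = (1 + (norm u)\<^sup>2) * exp (4 * c * T)"
  have "(norm (v t - w t))\<^sup>2 \<le> (norm (v 0 - w 0))\<^sup>2 * exp (2 * (L * (1 + M + M)) * t)"
  proof (rule gronwall_differential[where f = "\<lambda>t. (norm (v t - w t))\<^sup>2" and T=T])
    fix s assume s: "s \<in> {0..T}"
    show "((\<lambda>t. (norm (v t - w t))\<^sup>2) has_real_derivative 2 * ((v s - w s) \<bullet> (R (v s) - R (w s)))) (at s within {0..T})"
      using v w s unfolding solves_def by (intro norm_sq_has_derivative has_vector_derivative_diff) auto
    have "(v s - w s) \<bullet> (R (v s) - R (w s)) \<le> norm (v s - w s) * norm (R (v s) - R (w s))"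
      by (rule norm_cauchy_schwarz)
    also have "\<dots> \<le> norm (v s - w s) * (L * (1 + norm (v s) + norm (w s)) * norm (v s - w s))"
      using v w s unfolding solves_def by (intro mult_left_mono lipschitz) auto
    also have "\<dots> \<le> norm (v s - w s) * (L * (1 + M + M) * norm (v s - w s))"
      using solves_bound[OF v s] solves_bound[OF w s] const_nonneg unfolding M_def
      by (intro mult_left_mono mult_right_mono add_mono) auto
    finally show "2 * ((v s - w s) \<bullet> (R (v s) - R (w s))) \<le> 2 * (L * (1 + M + M)) * (norm (v s - w s))\<^sup>2"
      by (simp add: power2_eq_square algebra_simps)
  qed (rule t)
  then show ?thesis using v w by (simp add: solves_def)
qed

lemma solves_exists:
  assumes u: "u \<in> K" and T: "0 \<le> T"
  shows "\<exists>v. solves T u v"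
proof -
  define M where "M = (1 + (norm u)\<^sup>2) * exp (4 * c * T)"
  have M: "M > 0" by (auto simp: M_def intro!: mult_pos_pos add_pos_nonneg)
  define r where "r v = (M / max M (norm v)) *\<^sub>R v" for v :: 'a
  have rK: "r v \<in> K" if "v \<in> K" for v
    unfolding r_def using that M by (intro cone_scale) auto
  have rM: "norm (r v) \<le> M" for v
  proof -
    have "norm (r v) = M * (norm v / max M (norm v))" using M by (simp add: r_def)
    also have "\<dots> \<le> M * 1" using M by (intro mult_left_mono) (auto simp: divide_le_eq)
    finally show ?thesis by simp
  qed
  \<comment> \<open>Globally Lipschitz; by the a priori bound \<open>M\<close> and invariance of \<open>K\<close> its solutions solve the original equation.\<close>
  define F where "F v = R (r (pr v))" for v
  have lipF: "norm (F v - F w) \<le> (2 * L * (1 + M + M) + 1) * norm (v - w)" for v w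
  proof -
    have "norm (F v - F w) \<le> L * (1 + norm (r (pr v)) + norm (r (pr w))) * norm (r (pr v) - r (pr w))"
      unfolding F_def by (intro lipschitz rK pr_in)
    also have "\<dots> \<le> L * (1 + M + M) * (2 * norm (pr v - pr w))"
      using const_nonneg rM radial_retraction_lipschitz[OF M, of "pr v" "pr w"] unfolding r_def[symmetric]
      by (intro mult_mono mult_left_mono add_mono) (use M in \<open>auto intro!: mult_nonneg_nonneg\<close>)
    also have "\<dots> \<le> L * (1 + M + M) * (2 * norm (v - w))"
      using const_nonneg M by (intro mult_left_mono pr_lipschitz) auto
    finally show ?thesis using norm_ge_zero[of "v - w"] by (simp add: algebra_simps del: norm_ge_zero)
  qed
  have "0 < 2 * L * (1 + M + M) + 1" using const_nonneg M by (simp add: add_nonneg_pos)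
  then obtain v where v0: "v 0 = u"
      and v: "\<And>t. t \<in> {0..T} \<Longrightarrow> (v has_vector_derivative F (v t)) (at t within {0..T})"
    using picard_lindelof_global[OF lipF _ T, of u] by blast
  have vK: "v t \<in> K" if t: "t \<in> {0..T}" for t
  proof -
    have "(norm (v t - pr (v t)))\<^sup>2 \<le> (norm (v 0 - pr (v 0)))\<^sup>2 * exp (0 * t)"
    proof (rule gronwall_differential[where T=T])
      fix s assume s: "s \<in> {0..T}"
      have vs: "(v has_derivative (\<lambda>h. h *\<^sub>R F (v s))) (at s within {0..T})"
        using v[OF s] by (simp add: has_vector_derivative_def)
      have "((\<lambda>s. (norm (v s - pr (v s)))\<^sup>2) has_derivative (\<lambda>h. 2 * ((v s - pr (v s)) \<bullet> (h *\<^sub>R F (v s))))) (at s within {0..T})"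
        by (rule has_derivative_compose[OF vs dist_cone_sq_has_derivative])
      then show "((\<lambda>s. (norm (v s - pr (v s)))\<^sup>2) has_real_derivative 2 * ((v s - pr (v s)) \<bullet> F (v s))) (at s within {0..T})"
        by (simp add: has_field_derivative_def mult_ac mult_commute_abs)
      \<comment> \<open>The gradient of the squared distance is a negative multiple of
        \<open>pr (v s) - v s\<close>, a cone element orthogonal to the truncated projection.
        Quasi-positivity at that point says that the distance does not increase.\<close>
      have "0 \<le> R (r (pr (v s))) \<bullet> (pr (v s) - v s)"
        using pr_orth[of "v s"] by (intro quasi_positive rK pr_in pr_minus_in) (simp add: r_def inner_commute)
      then show "2 * ((v s - pr (v s)) \<bullet> F (v s)) \<le> 0 * (norm (v s - pr (v s)))\<^sup>2"
        by (simp add: F_def inner_diff_left inner_diff_right inner_commute)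
    qed (rule t)
    then have "v t = pr (v t)" using u by (simp add: v0 pr_ident)
    then show ?thesis using pr_in by metis
  qed
  have "norm (v t) \<le> M" if t: "t \<in> {0..T}" for t
    unfolding M_def v0[symmetric]
  proof (rule norm_bound[OF v _ t])
    fix s assume s: "s \<in> {0..T}"
    \<comment> \<open>The factor with \<open>v s = a *\<^sub>R r (v s)\<close>. As \<open>a\<close>
      is at least 1, multiplying the growth bound at \<open>r (v s)\<close> by \<open>a\<close>
      still yields the bound at \<open>v s\<close>.\<close>
    define a where "a = max M (norm (v s)) / M"
    have a: "a \<ge> 1" using M by (simp add: a_def)
    have "max M (norm (v s)) > 0" using M by simp
    then have vr: "v s = a *\<^sub>R r (v s)" using M by (simp add: a_def r_def)
    then have nv: "norm (v s) = a * norm (r (v s))" using a by (metis abs_of_nonneg norm_scaleR order_trans zero_le_one)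
    have "v s \<bullet> F (v s) = a * (r (v s) \<bullet> R (r (v s)))"
      using vK[OF s] by (subst vr) (simp add: F_def pr_ident)
    also have "\<dots> \<le> a * (c * (norm (r (v s)) + (norm (r (v s)))\<^sup>2))"
      using a by (intro mult_left_mono growth rK vK s) auto
    also have "\<dots> = c * (norm (v s) + norm (v s) * norm (r (v s)))"
      by (simp add: nv algebra_simps power2_eq_square)
    also have "\<dots> \<le> c * (norm (v s) + norm (v s) * norm (v s))"
      using const_nonneg a by (intro mult_left_mono add_left_mono) (auto simp: nv mult_le_cancel_right1)
    finally show "v s \<bullet> F (v s) \<le> c * (norm (v s) + (norm (v s))\<^sup>2)" by (simp add: power2_eq_square)
  qed
  then have "F (v t) = R (v t)" if "t \<in> {0..T}" for t
    using that vK M by (simp add: F_def r_def pr_ident max_absorb1)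
  then show ?thesis using v0 v vK unfolding solves_def by (intro exI[of _ v]) auto
qed

text \<open>A solution is chosen separately for every \<open>t\<close>; uniqueness glues the choices
  together, see \<open>flow_eq\<close>.\<close>

definition flow :: "real \<Rightarrow> 'a \<Rightarrow> 'a" where
  "flow t u = (SOME v. solves (t + 1) u v) t"

lemma flow_eq:
  assumes u: "u \<in> K" and v: "solves T u v" and t: "t \<in> {0..T}"
  shows "flow t u = v t"
proof -
  have "solves (t + 1) u (SOME v. solves (t + 1) u v)"
    by (rule someI_ex[of "solves (t + 1) u"]) (rule solves_exists[OF u], use t in simp)
  then have "solves t u (SOME v. solves (t + 1) u v)" by (rule solves_subset) simp
  moreover have "solves t u v" by (rule solves_subset[OF v]) (use t in auto)
  ultimately show ?thesis unfolding flow_def by (rule solves_unique) (use t in auto)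
qed

lemma flow_solves:
  assumes u: "u \<in> K"
  shows "solves T u (\<lambda>t. flow t u)"
proof (cases "0 \<le> T")
  case True
  then obtain v where v: "solves T u v" using solves_exists[OF u] by blast
  have eq: "flow t u = v t" if "t \<in> {0..T}" for t by (rule flow_eq[OF u v that])
  show ?thesis unfolding solves_def
  proof (intro conjI ballI)
    fix t assume t: "t \<in> {0..T}"
    have "(v has_vector_derivative R (flow t u)) (at t within {0..T})"
      using v t by (simp add: solves_def eq[OF t])
    then show "((\<lambda>t. flow t u) has_vector_derivative R (flow t u)) (at t within {0..T})"
      by (rule has_vector_derivative_transform[OF t, rotated]) (simp add: eq)
  qed (use v eq True in \<open>auto simp: solves_def\<close>)
next
  case False
  obtain v where v: "solves 0 u v" using solves_exists[OF u] by blast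
  show ?thesis using flow_eq[OF u v, of 0] v False by (simp add: solves_def)
qed

lemma flow_in: "u \<in> K \<Longrightarrow> 0 \<le> t \<Longrightarrow> flow t u \<in> K"
  and flow_0: "u \<in> K \<Longrightarrow> flow 0 u = u"
  using flow_solves[of u t] flow_solves[of u 0] by (auto simp: solves_def)

lemma at_within_Icc_eq_Ici:
  assumes "0 \<le> t" "t < T"
  shows "at t within {0..T} = at t within {0::real..}"
  by (rule at_within_nhd[of _ "{..<T}"]) (use assms in auto)

lemma flow_deriv:
  assumes "u \<in> K" "0 \<le> t"
  shows "((\<lambda>t. flow t u) has_vector_derivative R (flow t u)) (at t within {0..})"
proof -
  have "((\<lambda>t. flow t u) has_vector_derivative R (flow t u)) (at t within {0..t + 1})"
    using flow_solves[OF assms(1), of "t + 1"] assms(2) by (simp add: solves_def)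
  then show ?thesis using at_within_Icc_eq_Ici[of t "t + 1"] assms(2) by simp
qed

lemma flow_unique:
  assumes u: "u \<in> K" and v: "v 0 = u" "\<And>t. 0 \<le> t \<Longrightarrow> v t \<in> K"
    "\<And>t. 0 \<le> t \<Longrightarrow> (v has_vector_derivative R (v t)) (at t within {0..})" and t: "0 \<le> t"
  shows "v t = flow t u"
proof -
  have "solves t u v" unfolding solves_def
    using v by (auto intro: has_vector_derivative_within_subset[where S = "{0..}"])
  from flow_eq[OF u this, of t] t show ?thesis by simp
qed

text \<open>The equation is autonomous, so the shifted flow solves it from
  \<open>flow s u\<close>.\<close>

lemma flow_add:
  assumes u: "u \<in> K" and s: "0 \<le> s" and t: "0 \<le> t"
  shows "flow (s + t) u = flow t (flow s u)"
proof (rule flow_unique[where v = "\<lambda>t. flow (s + t) u"])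
  fix t :: real assume t: "0 \<le> t"
  have "((\<lambda>r. flow r u) \<circ> (\<lambda>t. s + t) has_vector_derivative 1 *\<^sub>R R (flow (s + t) u)) (at t within {0..})"
  proof (rule vector_diff_chain_within)
    show "((\<lambda>t. s + t) has_vector_derivative 1) (at t within {0..})"
      by (auto intro!: derivative_eq_intros)
    show "((\<lambda>r. flow r u) has_vector_derivative R (flow (s + t) u)) (at (s + t) within (\<lambda>t. s + t) ` {0..})"
      by (rule has_vector_derivative_within_subset[OF flow_deriv[OF u]]) (use s t in auto)
  qed
  then show "((\<lambda>t. flow (s + t) u) has_vector_derivative R (flow (s + t) u)) (at t within {0..})"
    by (simp add: o_def)
qed (use assms in \<open>auto intro: flow_in\<close>)

lemma continuous_on_flow: "u \<in> K \<Longrightarrow> continuous_on {0..} (\<lambda>t. flow t u)"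
  unfolding continuous_on_eq_continuous_within
  by (auto intro: has_vector_derivative_continuous flow_deriv)

lemma continuous_on_R: "continuous_on K R"
  unfolding continuous_on_iff
proof (intro ballI allI impI)
  fix v and e :: real assume v: "v \<in> K" and e: "e > 0"
  define C where "C = L * (1 + norm v + (norm v + 1)) + 1"
  have C: "C > 0" using const_nonneg by (auto simp: C_def intro!: add_nonneg_pos)
  show "\<exists>d>0. \<forall>w\<in>K. dist w v < d \<longrightarrow> dist (R w) (R v) < e"
  proof (intro exI[of _ "min 1 (e / C)"] conjI ballI impI)
    fix w assume w: "w \<in> K" "dist w v < min 1 (e / C)"
    have nw: "norm w \<le> norm v + 1"
      using w(2) norm_triangle_sub[of w v] by (simp add: dist_norm)
    have "norm (R w - R v) \<le> L * (1 + norm w + norm v) * norm (w - v)"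
      by (rule lipschitz[OF w(1) v])
    also have "\<dots> \<le> C * norm (w - v)"
    proof (rule mult_right_mono)
      have "L * (1 + norm w + norm v) \<le> L * (1 + norm v + (norm v + 1))"
        using const_nonneg nw by (intro mult_left_mono) auto
      then show "L * (1 + norm w + norm v) \<le> C" by (simp add: C_def)
    qed simp
    also have "\<dots> < e" using w(2) C by (simp add: dist_norm field_simps)
    finally show "dist (R w) (R v) < e" by (simp add: dist_norm)
  qed (use e C in auto)
qed

lemma continuous_on_R_flow: "u \<in> K \<Longrightarrow> continuous_on {0..} (\<lambda>t. R (flow t u))"
  by (rule continuous_on_compose2[OF continuous_on_R continuous_on_flow]) (auto intro: flow_in)

end

section \<open>Integration against cone-valued measures\<close>

definition add_measure :: "'s measure \<Rightarrow> 's measure \<Rightarrow> 's measure" where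
  "add_measure M N = measure_of (space M) (sets M) (\<lambda>A. emeasure M A + emeasure N A)"

lemma space_add_measure [simp]: "space (add_measure M N) = space M"
  and sets_add_measure [simp, measurable_cong]: "sets (add_measure M N) = sets M"
  by (simp_all add: add_measure_def)

lemma emeasure_add_measure:
  assumes N: "sets N = sets M" and A: "A \<in> sets M"
  shows "emeasure (add_measure M N) A = emeasure M A + emeasure N A"
  unfolding add_measure_def
proof (rule emeasure_measure_of_sigma)
  show "sigma_algebra (space M) (sets M)" ..
  show "positive (sets M) (\<lambda>A. emeasure M A + emeasure N A)" by (simp add: positive_def)
  show "countably_additive (sets M) (\<lambda>A. emeasure M A + emeasure N A)"
  proof (rule countably_additiveI)
    fix A :: "nat \<Rightarrow> _" assume A: "range A \<subseteq> sets M" "disjoint_family A" "(\<Union>i. A i) \<in> sets M"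
    have "(\<Sum>i. emeasure M (A i) + emeasure N (A i)) = (\<Sum>i. emeasure M (A i)) + (\<Sum>i. emeasure N (A i))"
      by (rule suminf_add[symmetric]) auto
    also have "\<dots> = emeasure M (\<Union>i. A i) + emeasure N (\<Union>i. A i)"
      using A N by (simp add: suminf_emeasure)
    finally show "(\<Sum>i. emeasure M (A i) + emeasure N (A i)) = emeasure M (\<Union>i. A i) + emeasure N (\<Union>i. A i)" .
  qed
qed (rule A)

lemma nn_integral_add_measure:
  assumes N: "sets N = sets M" and f: "f \<in> borel_measurable M"
  shows "(\<integral>\<^sup>+x. f x \<partial>add_measure M N) = (\<integral>\<^sup>+x. f x \<partial>M) + (\<integral>\<^sup>+x. f x \<partial>N)"
  using f
proof induction
  case (cong f g)
  have [simp]: "space N = space M" using N by (rule sets_eq_imp_space_eq)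
  have "integral\<^sup>N L f = integral\<^sup>N L g" if "space L = space M" for L
    using cong that by (intro nn_integral_cong) auto
  then show ?case using cong by simp
next
  case (set A)
  then show ?case using N by (simp add: emeasure_add_measure)
next
  case (mult u c)
  have [measurable]: "u \<in> borel_measurable N" using mult N by (simp cong: measurable_cong_sets)
  show ?case using mult by (simp add: nn_integral_cmult distrib_left)
next
  case (add u v)
  have [measurable]: "u \<in> borel_measurable N" "v \<in> borel_measurable N"
    using add N by (simp_all cong: measurable_cong_sets)
  show ?case using add by (simp add: nn_integral_add ac_simps)
next
  case (seq U)
  have m: "U i \<in> borel_measurable N" for i using seq N by (simp cong: measurable_cong_sets)
  have eq: "(\<integral>\<^sup>+x. (SUP i. U i) x \<partial>L) = (SUP i. \<integral>\<^sup>+x. U i x \<partial>L)"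
    if "\<And>i. U i \<in> borel_measurable L" for L
    unfolding SUP_apply using seq that by (intro nn_integral_monotone_convergence_SUP) auto
  have i: "incseq (\<lambda>i. \<integral>\<^sup>+x. U i x \<partial>L)" for L
    using seq by (intro incseq_SucI nn_integral_mono) (auto simp: incseq_Suc_iff le_fun_def)
  have "(\<integral>\<^sup>+x. (SUP i. U i) x \<partial>add_measure M N) = (SUP i. (\<integral>\<^sup>+x. U i x \<partial>M) + (\<integral>\<^sup>+x. U i x \<partial>N))"
    using seq by (subst eq) (auto intro!: SUP_cong)
  also have "\<dots> = (SUP i. \<integral>\<^sup>+x. U i x \<partial>M) + (SUP i. \<integral>\<^sup>+x. U i x \<partial>N)"
    by (rule ennreal_SUP_add[OF i i])
  finally show ?case using eq[of M] eq[of N] seq(1) m by simp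
qed

lemma integrable_add_measure:
  fixes f :: "'s \<Rightarrow> real"
  assumes N: "sets N = sets M"
  shows "integrable (add_measure M N) f \<longleftrightarrow> integrable M f \<and> integrable N f"
proof -
  have "f \<in> borel_measurable (add_measure M N) \<longleftrightarrow> f \<in> borel_measurable M"
    "f \<in> borel_measurable N \<longleftrightarrow> f \<in> borel_measurable M"
    using N by (simp_all cong: measurable_cong_sets)
  then show ?thesis
    by (auto simp: integrable_iff_bounded nn_integral_add_measure[OF N] less_top)
qed

lemma integral_add_measure:
  fixes f :: "'s \<Rightarrow> real"
  assumes N: "sets N = sets M" and f: "integrable M f" "integrable N f"
  shows "(\<integral>x. f x \<partial>add_measure M N) = (\<integral>x. f x \<partial>M) + (\<integral>x. f x \<partial>N)"
proof -
  have fin: "(\<integral>\<^sup>+x. ennreal (g x) \<partial>L) < \<top>" if "g = f \<or> g = (\<lambda>x. - f x)" "L = M \<or> L = N" for L g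
  proof -
    have "(\<integral>\<^sup>+x. ennreal (g x) \<partial>L) \<le> (\<integral>\<^sup>+x. ennreal (norm (f x)) \<partial>L)"
      using that by (intro nn_integral_mono ennreal_leI) auto
    also have "\<dots> < \<top>" using f that by (auto simp: integrable_iff_bounded)
    finally show ?thesis .
  qed
  have m: "f \<in> borel_measurable M" using f by auto
  have i: "integrable (add_measure M N) f" using f integrable_add_measure[OF N] by blast
  have "(\<integral>\<^sup>+x. ennreal (f x) \<partial>add_measure M N) = (\<integral>\<^sup>+x. ennreal (f x) \<partial>M) + (\<integral>\<^sup>+x. ennreal (f x) \<partial>N)"
    "(\<integral>\<^sup>+x. ennreal (- f x) \<partial>add_measure M N) = (\<integral>\<^sup>+x. ennreal (- f x) \<partial>M) + (\<integral>\<^sup>+x. ennreal (- f x) \<partial>N)"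
    using m by (intro nn_integral_add_measure[OF N]; measurable)+
  then show ?thesis using fin[of f] fin[of "\<lambda>x. - f x"]
    by (simp add: real_lebesgue_integral_def[OF i] real_lebesgue_integral_def[OF f(1)]
        real_lebesgue_integral_def[OF f(2)] enn2real_plus)
qed

lemma integrable_bounded:
  fixes f :: "'s \<Rightarrow> real"
  assumes "finite_measure M" "f \<in> borel_measurable M" "\<And>x. x \<in> space M \<Longrightarrow> \<bar>f x\<bar> \<le> C"
  shows "integrable M f"
proof -
  interpret finite_measure M by fact
  show ?thesis using assms(2,3) by (intro integrable_const_bound[of _ C]) auto
qed

text \<open>For a Hahn set \<open>Y\<close> the positive part of \<open>N1 - N2\<close> is its
  restriction to \<open>Y\<close>: passing from a subset \<open>B\<close> of \<open>A\<close> to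
  \<open>B \<inter> Y\<close> and then to \<open>A \<inter> Y\<close> can only increase the
  difference.\<close>

lemma upper_variation_diff:
  fixes f :: "'s \<Rightarrow> real"
  assumes fin: "finite_measure N1" "finite_measure N2" and sets: "sets N1 = sets S" "sets N2 = sets S"
    and Y: "Y \<in> sets S" "\<And>X. X \<in> sets S \<Longrightarrow> X \<subseteq> Y \<Longrightarrow> emeasure N2 X \<le> emeasure N1 X"
      "\<And>X. X \<in> sets S \<Longrightarrow> X \<inter> Y = {} \<Longrightarrow> emeasure N1 X \<le> emeasure N2 X"
    and f: "f \<in> borel_measurable S" "\<And>x. x \<in> space S \<Longrightarrow> \<bar>f x\<bar> \<le> C"
  shows "(\<integral>x. f x \<partial>upper_variation S (\<lambda>A. measure N1 A - measure N2 A))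
    = (\<integral>x. indicator Y x * f x \<partial>N1) - (\<integral>x. indicator Y x * f x \<partial>N2)"
proof -
  interpret N1: finite_measure N1 by fact
  interpret N2: finite_measure N2 by fact
  define D1 where "D1 = density N1 (indicator Y)"
  define D2 where "D2 = density N2 (indicator Y)"
  define Q where "Q = diff_measure D1 D2"
  have sD [simp]: "sets D1 = sets S" "sets D2 = sets S" by (simp_all add: D1_def D2_def sets)
  have spD [simp]: "space D1 = space S" "space D2 = space S" by (auto intro!: sets_eq_imp_space_eq)
  have eD: "emeasure D1 A = emeasure N1 (A \<inter> Y)" "emeasure D2 A = emeasure N2 (A \<inter> Y)" if "A \<in> sets S" for A
    using that Y(1) sets by (simp_all add: D1_def D2_def emeasure_density indicator_inter_arith[symmetric] mult.commute[of "indicator Y _"] Int_commute)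
  have le: "emeasure D2 A \<le> emeasure D1 A" if "A \<in> sets S" for A
    using that Y by (simp add: eD)
  have finD: "finite_measure D1" "finite_measure D2"
    using eD[OF sets.top] by (auto intro!: finite_measureI)
  have eQ: "emeasure Q A = emeasure D1 A - emeasure D2 A" if "A \<in> sets S" for A
    unfolding Q_def using finD le that by (intro emeasure_diff_measure) auto
  have sQ [simp]: "sets Q = sets S" by (simp add: Q_def)
  then have spQ [simp]: "space Q = space S" by (rule sets_eq_imp_space_eq)
  have "(SUP B\<in>{B\<in>sets S. B \<subseteq> A}. ennreal (measure N1 B - measure N2 B)) = emeasure Q A" if A: "A \<in> sets S" for A
  proof -
    have Q: "emeasure Q A = ennreal (measure N1 (A \<inter> Y) - measure N2 (A \<inter> Y))"
      using A by (simp add: eQ eD N1.emeasure_eq_measure N2.emeasure_eq_measure ennreal_minus)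
    show ?thesis unfolding Q
    proof (rule antisym)
      show "(SUP B\<in>{B\<in>sets S. B \<subseteq> A}. ennreal (measure N1 B - measure N2 B)) \<le> ennreal (measure N1 (A \<inter> Y) - measure N2 (A \<inter> Y))"
      proof (rule SUP_least, rule ennreal_leI)
        fix B assume "B \<in> {B \<in> sets S. B \<subseteq> A}"
        then have B: "B \<in> sets S" "B \<subseteq> A" by auto
        have split: "measure N B = measure N (B \<inter> Y) + measure N (B - Y)"
          if "finite_measure N" "sets N = sets S" for N
          using B Y(1) that finite_measure.finite_measure_Union[of N "B \<inter> Y" "B - Y"]
          by (simp add: Int_Diff_Un Int_Diff_disjoint)
        have "emeasure N1 (B - Y) \<le> emeasure N2 (B - Y)" using B Y by (intro Y(3)) auto
        then have 1: "measure N1 (B - Y) \<le> measure N2 (B - Y)"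
          by (simp add: N1.emeasure_eq_measure N2.emeasure_eq_measure)
        define E where "E = A \<inter> Y - B \<inter> Y"
        have E: "E \<in> sets S" "E \<subseteq> Y" using A B Y by (auto simp: E_def)
        have "emeasure N2 E \<le> emeasure N1 E" using E by (intro Y(2)) auto
        then have 2: "measure N2 E \<le> measure N1 E"
          by (simp add: N1.emeasure_eq_measure N2.emeasure_eq_measure)
        have "measure N E = measure N (A \<inter> Y) - measure N (B \<inter> Y)"
          if "finite_measure N" "sets N = sets S" for N
          unfolding E_def using A B Y(1) that by (intro finite_measure.finite_measure_Diff) auto
        from this[OF fin(1) sets(1)] this[OF fin(2) sets(2)] split[OF fin(1) sets(1)] split[OF fin(2) sets(2)] 1 2
        show "measure N1 B - measure N2 B \<le> measure N1 (A \<inter> Y) - measure N2 (A \<inter> Y)" by linarith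
      qed
      show "ennreal (measure N1 (A \<inter> Y) - measure N2 (A \<inter> Y)) \<le> (SUP B\<in>{B\<in>sets S. B \<subseteq> A}. ennreal (measure N1 B - measure N2 B))"
        using A Y(1) by (intro SUP_upper) auto
    qed
  qed
  then have "upper_variation S (\<lambda>A. measure N1 A - measure N2 A) = measure_of (space S) (sets S) (emeasure Q)"
    unfolding upper_variation_def
    by (intro measure_of_eq sets.space_closed) (simp add: sets.sigma_sets_eq)
  also have "\<dots> = Q" using measure_of_of_measure[of Q] by simp
  finally have U: "upper_variation S (\<lambda>A. measure N1 A - measure N2 A) = Q" .
  \<comment> \<open>The difference of measures is turned back into a sum, for which the integral is
    additive.\<close>
  have "add_measure Q D2 = D1"
  proof (rule measure_eqI)
    fix A assume "A \<in> sets (add_measure Q D2)"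
    then have A: "A \<in> sets S" by simp
    then show "emeasure (add_measure Q D2) A = emeasure D1 A"
      using le[OF A] by (simp add: emeasure_add_measure eQ diff_add_cancel_ennreal)
  qed simp
  moreover have "finite_measure Q"
    using finite_measure.emeasure_finite[OF finD(1)]
    by (intro finite_measureI) (simp add: eQ ennreal_minus_eq_top)
  then have "integrable Q f" using f by (intro integrable_bounded[of _ _ C]) (simp_all cong: measurable_cong_sets)
  moreover have "integrable D2 f" using f finD by (intro integrable_bounded[of _ _ C]) (simp_all cong: measurable_cong_sets)
  ultimately have "(\<integral>x. f x \<partial>D1) = (\<integral>x. f x \<partial>Q) + (\<integral>x. f x \<partial>D2)"
    using integral_add_measure[of D2 Q f] by simp
  moreover have "(\<integral>x. f x \<partial>D1) = (\<integral>x. indicator Y x * f x \<partial>N1)" "(\<integral>x. f x \<partial>D2) = (\<integral>x. indicator Y x * f x \<partial>N2)"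
  proof -
    have ind: "(indicator Y :: 's \<Rightarrow> ennreal) = (\<lambda>x. ennreal (indicator Y x))" by (auto simp: indicator_def)
    show "(\<integral>x. f x \<partial>D1) = (\<integral>x. indicator Y x * f x \<partial>N1)" "(\<integral>x. f x \<partial>D2) = (\<integral>x. indicator Y x * f x \<partial>N2)"
      unfolding D1_def D2_def ind using f(1) Y(1) sets
      by (subst integral_density; simp cong: measurable_cong_sets)+
  qed
  ultimately show ?thesis unfolding U by simp
qed

text \<open>The definition uses the Jordan decomposition, but any decomposition into finite measures
  computes the same integral. This makes integration against \<open>\<mu>\<close> linear in the test
  vector.\<close>

lemma signed_integral_diff:
  fixes f :: "'s \<Rightarrow> real"
  assumes fin: "finite_measure N1" "finite_measure N2" and sets: "sets N1 = sets S" "sets N2 = sets S"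
    and f: "f \<in> borel_measurable S" "\<And>x. x \<in> space S \<Longrightarrow> \<bar>f x\<bar> \<le> C"
  shows "signed_integral S (\<lambda>A. measure N1 A - measure N2 A) f = (\<integral>x. f x \<partial>N1) - (\<integral>x. f x \<partial>N2)"
proof -
  obtain Y where Y: "Y \<in> sets S" "\<And>X. X \<in> sets S \<Longrightarrow> X \<subseteq> Y \<Longrightarrow> emeasure N2 X \<le> emeasure N1 X"
      "\<And>X. X \<in> sets S \<Longrightarrow> X \<inter> Y = {} \<Longrightarrow> emeasure N1 X \<le> emeasure N2 X"
    using finite_unsigned_Hahn_decomposition[OF fin] sets by auto
  have sub: "X \<subseteq> Y" if "X \<in> sets S" "X \<inter> (space S - Y) = {}" for X
    using sets.sets_into_space[OF that(1)] that(2) by auto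
  have split: "(\<integral>x. indicator Y x * f x \<partial>N) + (\<integral>x. indicator (space S - Y) x * f x \<partial>N) = (\<integral>x. f x \<partial>N)"
    if N: "finite_measure N" "sets N = sets S" for N
  proof -
    have sp: "space N = space S" using N(2) by (rule sets_eq_imp_space_eq)
    have [measurable]: "f \<in> borel_measurable N" "Y \<in> sets N" using f(1) N(2) Y(1) by (simp_all cong: measurable_cong_sets)
    have i: "integrable N (\<lambda>x. indicator Z x * f x)" if [measurable]: "Z \<in> sets N" for Z
    proof (rule integrable_bounded[OF N(1), of _ C])
      fix x assume "x \<in> space N"
      then have "\<bar>f x\<bar> \<le> C" using f(2) sp by auto
      then show "\<bar>indicator Z x * f x\<bar> \<le> C" by (auto simp: indicator_def)
    qed measurable
    have "(\<integral>x. indicator Y x * f x \<partial>N) + (\<integral>x. indicator (space S - Y) x * f x \<partial>N)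
        = (\<integral>x. indicator Y x * f x + indicator (space S - Y) x * f x \<partial>N)"
      by (intro Bochner_Integration.integral_add[symmetric] i) (simp_all flip: sp)
    also have "\<dots> = (\<integral>x. f x \<partial>N)" by (intro Bochner_Integration.integral_cong) (auto simp: sp indicator_def)
    finally show ?thesis .
  qed
  have L: "(\<integral>x. f x \<partial>upper_variation S (\<lambda>A. measure N2 A - measure N1 A))
      = (\<integral>x. indicator (space S - Y) x * f x \<partial>N2) - (\<integral>x. indicator (space S - Y) x * f x \<partial>N1)"
  proof (rule upper_variation_diff[OF fin(2,1) sets(2,1) _ _ _ f])
    show "emeasure N1 X \<le> emeasure N2 X" if "X \<in> sets S" "X \<subseteq> space S - Y" for X
      using that by (intro Y(3)) auto
    show "emeasure N2 X \<le> emeasure N1 X" if "X \<in> sets S" "X \<inter> (space S - Y) = {}" for X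
      using that by (intro Y(2) sub)
  qed (use Y(1) in auto)
  have eq: "(\<lambda>A. - (measure N1 A - measure N2 A)) = (\<lambda>A. measure N2 A - measure N1 A)" by auto
  show ?thesis
    unfolding signed_integral_def lower_variation_def eq L
    using upper_variation_diff[OF fin sets Y f] split[OF fin(1) sets(1)] split[OF fin(2) sets(2)] by linarith
qed

section \<open>Weak integrals against a cone-valued measure\<close>

locale cone_vector_measure = self_dual_cone K for K :: "'a::{real_inner,banach} set" +
  fixes S :: "'s measure" and \<mu> :: "'s set \<Rightarrow> 'a"
  assumes vm_in_cone: "A \<in> sets S \<Longrightarrow> \<mu> A \<in> K"
    and vm_sums: "range F \<subseteq> sets S \<Longrightarrow> disjoint_family F \<Longrightarrow> (\<lambda>i. \<mu> (F i) \<bullet> h) sums (\<mu> (\<Union>i::nat. F i) \<bullet> h)"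
begin

lemma vm_empty: "\<mu> {} = 0"
proof (rule inner_eqI)
  fix h
  have "(\<lambda>i::nat. \<mu> {} \<bullet> h) sums (\<mu> {} \<bullet> h)"
    using vm_sums[of "\<lambda>_. {}" h] by (simp add: disjoint_family_on_def)
  \<comment> \<open>A constant series converges only if its terms vanish.\<close>
  then show "\<mu> {} \<bullet> h = 0 \<bullet> h" using summable_const_iff sums_summable by fastforce
qed

text \<open>For \<open>x\<close> in the cone this is a finite positive measure, since the values of
  \<open>\<mu>\<close> have nonnegative inner product with \<open>x\<close>. General test vectors
  are handled as differences of cone elements.\<close>

definition scal :: "'a \<Rightarrow> 's measure" where
  "scal x = measure_of (space S) (sets S) (\<lambda>A. ennreal (\<mu> A \<bullet> x))"

lemma space_scal [simp]: "space (scal x) = space S"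
  and sets_scal [simp, measurable_cong]: "sets (scal x) = sets S"
  by (simp_all add: scal_def)

lemma measurable_scal [simp]: "measurable (scal x) N = measurable S N"
  by (rule measurable_cong_sets) simp_all

lemma emeasure_scal:
  assumes x: "x \<in> K" and A: "A \<in> sets S"
  shows "emeasure (scal x) A = ennreal (\<mu> A \<bullet> x)"
  unfolding scal_def
proof (rule emeasure_measure_of_sigma)
  show "sigma_algebra (space S) (sets S)" ..
  show "positive (sets S) (\<lambda>A. ennreal (\<mu> A \<bullet> x))" by (simp add: positive_def vm_empty)
  show "countably_additive (sets S) (\<lambda>A. ennreal (\<mu> A \<bullet> x))"
  proof (rule countably_additiveI)
    fix A :: "nat \<Rightarrow> _" assume A: "range A \<subseteq> sets S" "disjoint_family A" "(\<Union>i. A i) \<in> sets S"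
    then show "(\<Sum>i. ennreal (\<mu> (A i) \<bullet> x)) = ennreal (\<mu> (\<Union>i. A i) \<bullet> x)"
      using vm_sums[OF A(1,2), of x] x
      by (intro suminf_ennreal_eq) (auto intro: inner_nonneg vm_in_cone)
  qed
qed (rule A)

lemma measure_scal: "x \<in> K \<Longrightarrow> A \<in> sets S \<Longrightarrow> measure (scal x) A = \<mu> A \<bullet> x"
  by (simp add: measure_def emeasure_scal inner_nonneg vm_in_cone)

lemma finite_scal: "x \<in> K \<Longrightarrow> finite_measure (scal x)"
  by (rule finite_measureI) (simp add: emeasure_scal)

lemma scal_add: "x \<in> K \<Longrightarrow> y \<in> K \<Longrightarrow> scal (x + y) = add_measure (scal x) (scal y)"
  by (rule measure_eqI)
     (simp_all add: emeasure_add_measure emeasure_scal cone_add inner_add_right inner_nonneg vm_in_cone)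

lemma scal_scale: "x \<in> K \<Longrightarrow> 0 \<le> r \<Longrightarrow> scal (r *\<^sub>R x) = density (scal x) (\<lambda>_. ennreal r)"
  by (rule measure_eqI) (simp_all add: emeasure_density_const emeasure_scal cone_scale ennreal_mult')

lemma signed_integral_cone:
  assumes x: "x \<in> K"
  shows "signed_integral S (\<lambda>A. \<mu> A \<bullet> x) f = (\<integral>s. f s \<partial>scal x)"
    and "signed_integrable S (\<lambda>A. \<mu> A \<bullet> x) f \<longleftrightarrow> integrable (scal x) f"
proof -
  have upper: "upper_variation S (\<lambda>A. \<mu> A \<bullet> x) = scal x"
  proof -
    have "upper_variation S (\<lambda>A. \<mu> A \<bullet> x) = upper_variation S (measure (scal x))"
      unfolding upper_variation_def using x
      by (intro measure_of_eq sets.space_closed) (auto simp: sets.sigma_sets_eq measure_scal intro!: SUP_cong)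
    then show ?thesis using upper_variation_measure[OF finite_scal[OF x]] by simp
  qed
  have "(SUP B\<in>{B\<in>sets S. B \<subseteq> A}. ennreal (- (\<mu> B \<bullet> x))) = 0" if "A \<in> sets S" for A
  proof (rule antisym)
    show "(SUP B\<in>{B\<in>sets S. B \<subseteq> A}. ennreal (- (\<mu> B \<bullet> x))) \<le> 0"
      using x by (intro SUP_least) (auto simp: ennreal_neg inner_nonneg vm_in_cone)
  qed simp
  then have "lower_variation S (\<lambda>A. \<mu> A \<bullet> x) = measure_of (space S) (sets S) (\<lambda>_. 0)"
    unfolding lower_variation_def upper_variation_def
    by (intro measure_of_eq sets.space_closed) (simp add: sets.sigma_sets_eq)
  also have "\<dots> = null_measure S"
    by (simp add: null_measure_def)
  finally have lower: "lower_variation S (\<lambda>A. \<mu> A \<bullet> x) = null_measure S" .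
  have "total_variation S (\<lambda>A. \<mu> A \<bullet> x) = scal x"
    unfolding total_variation_def upper lower using measure_of_of_measure[of "scal x"] by simp
  then show "signed_integrable S (\<lambda>A. \<mu> A \<bullet> x) f \<longleftrightarrow> integrable (scal x) f"
    by (simp add: signed_integrable_def)
  show "signed_integral S (\<lambda>A. \<mu> A \<bullet> x) f = (\<integral>s. f s \<partial>scal x)"
    unfolding signed_integral_def upper lower by simp
qed

text \<open>The jump integrands are bounded after division by the squared norm, so this class avoids
  integrability conditions that depend on the test vector.\<close>

definition bdd_measurable :: "('s \<Rightarrow> real) \<Rightarrow> bool" where
  "bdd_measurable f \<longleftrightarrow> f \<in> borel_measurable S \<and> (\<exists>C. \<forall>s\<in>space S. \<bar>f s\<bar> \<le> C)"

lemma bdd_measurableI: "f \<in> borel_measurable S \<Longrightarrow> (\<And>s. s \<in> space S \<Longrightarrow> \<bar>f s\<bar> \<le> C) \<Longrightarrow> bdd_measurable f"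
  unfolding bdd_measurable_def by blast

lemma bdd_measurable_integrable: "bdd_measurable f \<Longrightarrow> x \<in> K \<Longrightarrow> integrable (scal x) f"
  unfolding bdd_measurable_def by (auto intro!: integrable_bounded[OF finite_scal])

lemma bdd_measurable_add: "bdd_measurable f \<Longrightarrow> bdd_measurable g \<Longrightarrow> bdd_measurable (\<lambda>s. f s + g s)"
  unfolding bdd_measurable_def
  by (auto intro!: borel_measurable_add) (meson abs_triangle_ineq add_mono order_trans)

lemma bdd_measurable_cmult: "bdd_measurable f \<Longrightarrow> bdd_measurable (\<lambda>s. r * f s)"
  unfolding bdd_measurable_def
  by (auto simp: abs_mult) (meson abs_ge_zero mult_left_mono)

lemma bdd_measurable_diff: "bdd_measurable f \<Longrightarrow> bdd_measurable g \<Longrightarrow> bdd_measurable (\<lambda>s. f s - g s)"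
  using bdd_measurable_add[of f "\<lambda>s. (-1) * g s"] bdd_measurable_cmult[of g "-1"] by simp

lemma signed_integral_decomp:
  assumes f: "bdd_measurable f" and K: "p \<in> K" "n \<in> K"
  shows "signed_integral S (\<lambda>A. \<mu> A \<bullet> (p - n)) f = (\<integral>s. f s \<partial>scal p) - (\<integral>s. f s \<partial>scal n)"
proof -
  obtain C where C: "f \<in> borel_measurable S" "\<And>s. s \<in> space S \<Longrightarrow> \<bar>f s\<bar> \<le> C"
    using f unfolding bdd_measurable_def by blast
  have uv: "upper_variation S (\<lambda>A. \<mu> A \<bullet> (p - n)) = upper_variation S (\<lambda>A. measure (scal p) A - measure (scal n) A)"
    "lower_variation S (\<lambda>A. \<mu> A \<bullet> (p - n)) = lower_variation S (\<lambda>A. measure (scal p) A - measure (scal n) A)"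
    unfolding upper_variation_def lower_variation_def using K
    by (intro measure_of_eq sets.space_closed; auto simp: sets.sigma_sets_eq measure_scal inner_diff_right intro!: SUP_cong)+
  show ?thesis
    using signed_integral_diff[OF finite_scal[OF K(1)] finite_scal[OF K(2)] _ _ C]
    unfolding signed_integral_def uv by simp
qed

lemma integral_scal_add:
  "bdd_measurable f \<Longrightarrow> x \<in> K \<Longrightarrow> y \<in> K \<Longrightarrow> (\<integral>s. f s \<partial>scal (x + y)) = (\<integral>s. f s \<partial>scal x) + (\<integral>s. f s \<partial>scal y)"
  by (simp add: scal_add integral_add_measure bdd_measurable_integrable)

lemma integral_scal_scale:
  "bdd_measurable f \<Longrightarrow> x \<in> K \<Longrightarrow> 0 \<le> r \<Longrightarrow> (\<integral>s. f s \<partial>scal (r *\<^sub>R x)) = r * (\<integral>s. f s \<partial>scal x)"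
  using integral_density[of f "scal x" "\<lambda>_. r"] by (simp add: scal_scale bdd_measurable_def)

lemma integral_scal_bound:
  assumes "bdd_measurable f" "\<And>s. s \<in> space S \<Longrightarrow> \<bar>f s\<bar> \<le> C" "x \<in> K"
  shows "\<bar>\<integral>s. f s \<partial>scal x\<bar> \<le> C * (\<mu> (space S) \<bullet> x)"
proof -
  interpret finite_measure "scal x" by (rule finite_scal) fact
  have "\<bar>\<integral>s. f s \<partial>scal x\<bar> \<le> (\<integral>s. C \<partial>scal x)"
    using assms bdd_measurable_integrable[OF assms(1,3)]
    by (intro order_trans[OF integral_abs_bound] integral_mono) auto
  then show ?thesis using assms by (simp add: measure_scal mult.commute)
qed

definition wint :: "('s \<Rightarrow> real) \<Rightarrow> 'a" where
  "wint f = weak_integral S \<mu> f"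

text \<open>The functional is linear because it can be computed from any decomposition of
  \<open>h\<close> into cone elements, and bounded because Moreau's decomposition does not increase
  norms. Riesz representation then supplies the vector that the definite description picks.\<close>

lemma wint_signed:
  assumes f: "bdd_measurable f"
  shows "wint f \<bullet> h = signed_integral S (\<lambda>A. \<mu> A \<bullet> h) f"
proof -
  obtain C where C: "\<And>s. s \<in> space S \<Longrightarrow> \<bar>f s\<bar> \<le> C" using f unfolding bdd_measurable_def by blast
  \<comment> \<open>On an empty space a bound may be negative; the absolute value excludes
    this.\<close>
  define C' where "C' = \<bar>C\<bar>"
  have C': "C' \<ge> 0" "\<And>s. s \<in> space S \<Longrightarrow> \<bar>f s\<bar> \<le> C'" using C by (force simp: C'_def)+
  define \<Phi> where "\<Phi> h = signed_integral S (\<lambda>A. \<mu> A \<bullet> h) f" for h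
  have \<Phi>: "\<Phi> (p - n) = (\<integral>s. f s \<partial>scal p) - (\<integral>s. f s \<partial>scal n)" if "p \<in> K" "n \<in> K" for p n
    unfolding \<Phi>_def by (rule signed_integral_decomp[OF f that])
  have "bounded_linear \<Phi>"
  proof (rule bounded_linear_intro)
    fix x y :: 'a and r :: real
    obtain p n where x: "p \<in> K" "n \<in> K" "x = p - n" "norm p \<le> norm x" "norm n \<le> norm x" by (rule cone_decomp)
    obtain q l where y: "q \<in> K" "l \<in> K" "y = q - l" by (rule cone_decomp)
    have "\<Phi> ((p + q) - (n + l)) = \<Phi> x + \<Phi> y"
      using x y by (simp add: \<Phi> cone_add integral_scal_add f)
    then show "\<Phi> (x + y) = \<Phi> x + \<Phi> y" by (simp add: x y algebra_simps)
    show "\<Phi> (r *\<^sub>R x) = r *\<^sub>R \<Phi> x"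
    proof (cases "0 \<le> r")
      case True
      have "\<Phi> (r *\<^sub>R p - r *\<^sub>R n) = r * \<Phi> x"
        using x True by (simp add: \<Phi> cone_scale integral_scal_scale f right_diff_distrib)
      then show ?thesis by (simp add: x scaleR_diff_right)
    next
      case False
      have "\<Phi> ((- r) *\<^sub>R n - (- r) *\<^sub>R p) = r * \<Phi> x"
        using x(1,2) False by (subst \<Phi>) (simp_all add: x(3) \<Phi> cone_scale integral_scal_scale[OF f] algebra_simps del: scaleR_minus_left)
      then show ?thesis by (simp add: x scaleR_diff_right)
    qed
    have b: "\<bar>\<integral>s. f s \<partial>scal z\<bar> \<le> C' * norm (\<mu> (space S)) * norm x" if "z \<in> K" "norm z \<le> norm x" for z
    proof -
      have "\<bar>\<integral>s. f s \<partial>scal z\<bar> \<le> C' * (\<mu> (space S) \<bullet> z)" by (rule integral_scal_bound[OF f C'(2) that(1)])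
      also have "\<dots> \<le> C' * (norm (\<mu> (space S)) * norm x)"
        using that C'(1) by (intro mult_left_mono order_trans[OF norm_cauchy_schwarz] mult_left_mono) auto
      finally show ?thesis by (simp add: mult.assoc)
    qed
    show "norm (\<Phi> x) \<le> norm x * (2 * C' * norm (\<mu> (space S)))"
      using b[OF x(1,4)] b[OF x(2,5)] unfolding x(3)[symmetric] by (subst x(3)) (simp add: \<Phi> x(1,2) mult_ac)
  qed
  from riesz_representation[OF this] obtain v where v: "\<forall>h. \<Phi> h = v \<bullet> h" by blast
  have "wint f = v" unfolding wint_def weak_integral_def
    by (rule the_equality) (use v in \<open>auto simp: \<Phi>_def intro: inner_eqI\<close>)
  then show ?thesis using v by (simp add: \<Phi>_def)
qed

lemma wint_inner: "bdd_measurable f \<Longrightarrow> x \<in> K \<Longrightarrow> wint f \<bullet> x = (\<integral>s. f s \<partial>scal x)"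
  by (simp add: wint_signed signed_integral_cone)

lemma cone_inner_eqI:
  assumes "\<And>x. x \<in> K \<Longrightarrow> v \<bullet> x = w \<bullet> x"
  shows "v = w"
proof (rule inner_eqI)
  fix h
  obtain p n where "p \<in> K" "n \<in> K" "h = p - n" by (rule cone_decomp)
  then show "v \<bullet> h = w \<bullet> h" using assms by (simp add: inner_diff_right)
qed

lemma wint_add: "bdd_measurable f \<Longrightarrow> bdd_measurable g \<Longrightarrow> wint (\<lambda>s. f s + g s) = wint f + wint g"
  by (rule cone_inner_eqI)
     (simp add: wint_inner bdd_measurable_add inner_add_left bdd_measurable_integrable)

lemma wint_cmult: "bdd_measurable f \<Longrightarrow> wint (\<lambda>s. r * f s) = r *\<^sub>R wint f"
  by (rule cone_inner_eqI) (simp add: wint_inner bdd_measurable_cmult)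

lemma wint_diff: "bdd_measurable f \<Longrightarrow> bdd_measurable g \<Longrightarrow> wint (\<lambda>s. f s - g s) = wint f - wint g"
  by (rule cone_inner_eqI)
     (simp add: wint_inner bdd_measurable_diff inner_diff_left bdd_measurable_integrable)

lemma wint_indicator:
  assumes A: "A \<in> sets S"
  shows "bdd_measurable (indicator A)" "wint (indicator A) = \<mu> A"
proof -
  show *: "bdd_measurable (indicator A)"
    using A by (intro bdd_measurableI[of _ 1]) (auto simp: indicator_def)
  have "A \<inter> space S = A" using sets.sets_into_space[OF A] by auto
  then show "wint (indicator A) = \<mu> A"
    by (intro cone_inner_eqI) (simp add: wint_inner[OF *] measure_scal A)
qed

lemma wint_nonneg:
  assumes "bdd_measurable f" "\<And>s. s \<in> space S \<Longrightarrow> 0 \<le> f s"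
  shows "wint f \<in> K"
  by (subst self_dual) (auto simp: wint_inner assms intro!: integral_nonneg_AE)

text \<open>\<open>wint g\<close> dominates both \<open>wint f\<close> and its negative in the order
  of the cone, and \<open>norm_mono_symmetric\<close> applies.\<close>

lemma wint_norm_mono:
  assumes "bdd_measurable f" "bdd_measurable g" "\<And>s. s \<in> space S \<Longrightarrow> \<bar>f s\<bar> \<le> g s"
  shows "norm (wint f) \<le> norm (wint g)"
proof (rule norm_mono_symmetric)
  have "0 \<le> g s - f s \<and> 0 \<le> g s + f s" if "s \<in> space S" for s using assms(3)[OF that] by auto
  then show "wint g - wint f \<in> K" "wint g + wint f \<in> K"
    using assms by (auto simp: bdd_measurable_add bdd_measurable_diff intro!: wint_nonneg simp flip: wint_diff wint_add)
qed

lemma wint_norm_le: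
  assumes f: "f \<in> borel_measurable S" "\<And>s. s \<in> space S \<Longrightarrow> \<bar>f s\<bar> \<le> C * indicator A s" and A: "A \<in> sets S" and C: "0 \<le> C"
  shows "norm (wint f) \<le> C * norm (\<mu> A)"
proof -
  have b: "bdd_measurable (\<lambda>s. C * indicator A s)"
    by (intro bdd_measurable_cmult wint_indicator(1) A)
  have "norm (wint f) \<le> norm (wint (\<lambda>s. C * indicator A s))"
  proof (rule wint_norm_mono)
    show "bdd_measurable f"
    proof (rule bdd_measurableI[of _ C])
      fix s assume "s \<in> space S"
      then have "\<bar>f s\<bar> \<le> C * indicator A s" by (rule f(2))
      also have "\<dots> \<le> C" using C by (auto simp: indicator_def)
      finally show "\<bar>f s\<bar> \<le> C" .
    qed (rule f(1))
  qed (use b f in auto)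
  also have "\<dots> = C * norm (\<mu> A)" using C A by (simp add: wint_cmult wint_indicator)
  finally show ?thesis .
qed

text \<open>Weak countable additivity gives continuity in norm, because the values lie in the cone:
  the squared norm of \<open>\<mu> (A i)\<close> is at most its inner product with the fixed vector
  \<open>\<mu> (A 0)\<close>, and that is a scalar measure of \<open>A i\<close>.\<close>

lemma vm_decseq_tendsto_0:
  assumes A: "range A \<subseteq> sets S" "decseq A" "(\<Inter>i. A i) = {}"
  shows "(\<lambda>i. norm (\<mu> (A i))) \<longlonglongrightarrow> 0"
proof -
  have K: "\<mu> (A i) \<in> K" for i using A by (intro vm_in_cone) auto
  interpret finite_measure "scal (\<mu> (A 0))" by (rule finite_scal) (rule K)
  have lim: "(\<lambda>i. measure (scal (\<mu> (A 0))) (A i)) \<longlonglongrightarrow> measure (scal (\<mu> (A 0))) (\<Inter>i. A i)"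
    using A by (intro finite_Lim_measure_decseq) auto
  have "(norm (\<mu> (A i)))\<^sup>2 \<le> measure (scal (\<mu> (A 0))) (A i)" for i
  proof -
    have "A i \<subseteq> A 0" using A(2) by (simp add: decseq_def)
    interpret i: finite_measure "scal (\<mu> (A i))" by (rule finite_scal) (rule K)
    have "measure (scal (\<mu> (A i))) (A i) \<le> measure (scal (\<mu> (A i))) (A 0)"
      using A \<open>A i \<subseteq> A 0\<close> by (intro i.finite_measure_mono) auto
    then have "\<mu> (A i) \<bullet> \<mu> (A i) \<le> \<mu> (A 0) \<bullet> \<mu> (A i)" using A K by (simp add: measure_scal image_subset_iff)
    then show ?thesis using A K by (simp add: measure_scal power2_norm_eq_inner inner_commute image_subset_iff)
  qed
  then have "(\<lambda>i. (norm (\<mu> (A i)))\<^sup>2) \<longlonglongrightarrow> 0"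
    using lim A(3) by (intro tendsto_sandwich[OF _ _ tendsto_const lim[unfolded A(3) measure_empty]]) auto
  then have "(\<lambda>i. sqrt ((norm (\<mu> (A i)))\<^sup>2)) \<longlonglongrightarrow> sqrt 0" by (rule tendsto_real_sqrt)
  then show ?thesis by simp
qed

end

section \<open>Laplace transforms on a cone\<close>

lemma countable_dense_sequence:
  obtains d :: "nat \<Rightarrow> 'a::{metric_space,second_countable_topology}"
  where "\<And>x e. 0 < e \<Longrightarrow> \<exists>k. dist (d k) x < e"
proof -
  obtain D :: "'a set" where D: "countable D" "\<And>X. open X \<Longrightarrow> X \<noteq> {} \<Longrightarrow> \<exists>d\<in>D. d \<in> X"
    using countable_dense_exists by blast
  have ne: "D \<noteq> {}" using D(2)[of UNIV] by auto
  show thesis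
  proof
    fix x :: 'a and e :: real assume "0 < e"
    then obtain y where "y \<in> D" "y \<in> ball x e" using D(2)[of "ball x e"] by auto
    then show "\<exists>k. dist (from_nat_into D k) x < e"
      by (metis D(1) dist_commute from_nat_into_surj mem_ball)
  qed
qed

text \<open>Describes closed balls by countably many linear inequalities, which makes them
  measurable as soon as linear functionals are.\<close>

lemma norm_le_iff_dense_inner:
  fixes y :: "'a::real_inner"
  assumes d: "\<And>x e. 0 < e \<Longrightarrow> \<exists>k. dist (d k) x < e" and r: "0 \<le> r"
  shows "norm y \<le> r \<longleftrightarrow> (\<forall>k. y \<bullet> d k \<le> r * norm (d k))"
proof
  assume "norm y \<le> r"
  then show "\<forall>k. y \<bullet> d k \<le> r * norm (d k)"
    by (intro allI order_trans[OF norm_cauchy_schwarz] mult_right_mono) auto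
next
  assume le: "\<forall>k. y \<bullet> d k \<le> r * norm (d k)"
  have "\<forall>n. \<exists>k. dist (d k) y < 1 / real (Suc n)" by (intro allI d) simp
  then obtain k where k: "\<And>n. dist (d (k n)) y < 1 / real (Suc n)" by metis
  have lim: "(\<lambda>n. d (k n)) \<longlonglongrightarrow> y"
    by (rule tendsto_dist_iff[THEN iffD2], rule tendsto_sandwich[OF _ _ tendsto_const LIMSEQ_inverse_real_of_nat])
       (use k in \<open>auto simp: inverse_eq_divide intro!: always_eventually less_imp_le\<close>)
  have "y \<bullet> y \<le> r * norm y"
    by (rule LIMSEQ_le[of "\<lambda>n. y \<bullet> d (k n)" _ "\<lambda>n. r * norm (d (k n))"]) (auto intro!: tendsto_intros lim le[rule_format])
  then have "norm y * norm y \<le> r * norm y" by (simp flip: power2_norm_eq_inner add: power2_eq_square)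
  then show "norm y \<le> r" using r by (cases "y = 0") auto
qed

text \<open>Weak measurability suffices in a separable space, since open sets are countable unions
  of closed balls with centers in a dense sequence.\<close>

lemma borel_measurable_innerI:
  fixes f :: "'s \<Rightarrow> 'a::{real_inner,second_countable_topology}"
  assumes f: "\<And>u. (\<lambda>s. f s \<bullet> u) \<in> borel_measurable M"
  shows "f \<in> borel_measurable M"
proof (rule borel_measurableI)
  fix U :: "'a set" assume U: "open U"
  obtain d :: "nat \<Rightarrow> 'a" where d: "\<And>x e. 0 < e \<Longrightarrow> \<exists>k. dist (d k) x < e"
    using countable_dense_sequence by blast
  define I where "I = {(k, n). cball (d k) (1 / real (Suc n)) \<subseteq> U}"
  have "U = (\<Union>(k, n)\<in>I. cball (d k) (1 / real (Suc n)))"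
  proof (intro equalityI subsetI)
    fix x assume "x \<in> U"
    then obtain e where e: "e > 0" "ball x e \<subseteq> U" using U open_contains_ball by blast
    obtain n where n: "1 / real (Suc n) < e / 2" using nat_approx_posE[of "e/2"] e by auto
    obtain k where k: "dist (d k) x < 1 / real (Suc n)" using d[of "1 / real (Suc n)" x] by auto
    have "cball (d k) (1 / real (Suc n)) \<subseteq> ball x e"
    proof
      fix y assume "y \<in> cball (d k) (1 / real (Suc n))"
      then show "y \<in> ball x e"
        using dist_triangle[of x y "d k"] k n by (simp add: dist_commute)
    qed
    then have "(k, n) \<in> I" using e by (auto simp: I_def)
    then show "x \<in> (\<Union>(k, n)\<in>I. cball (d k) (1 / real (Suc n)))" using k by (auto simp: intro!: bexI[of _ "(k, n)"])
  qed (auto simp: I_def)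
  then have "f -` U \<inter> space M = (\<Union>(k, n)\<in>I. f -` cball (d k) (1 / real (Suc n)) \<inter> space M)" by auto
  also have "\<dots> \<in> sets M"
  proof (intro sets.countable_UN' countableI_type, clarify)
    fix k n
    have "f -` cball (d k) (1 / real (Suc n)) \<inter> space M
        = {s \<in> space M. \<forall>j. f s \<bullet> d j - d k \<bullet> d j \<le> 1 / real (Suc n) * norm (d j)}"
    proof -
      have "dist (d k) y \<le> 1 / real (Suc n) \<longleftrightarrow> (\<forall>j. y \<bullet> d j - d k \<bullet> d j \<le> 1 / real (Suc n) * norm (d j))" for y
        using norm_le_iff_dense_inner[OF d, of "1 / real (Suc n)" "y - d k"]
        by (simp add: dist_norm norm_minus_commute inner_diff_left)
      then show ?thesis by auto
    qed
    also have "\<dots> \<in> sets M" using f by measurable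
    finally show "f -` cball (d k) (1 / real (Suc n)) \<inter> space M \<in> sets M" .
  qed
  finally show "f -` U \<inter> space M \<in> sets M" .
qed

section \<open>Laws on the cone and their Laplace transforms\<close>

locale polish_cone = self_dual_cone K for K :: "'a::{real_inner,banach,polish_space} set"
begin

lemma measurable_pr [measurable]: "pr \<in> borel_measurable borel"
  using continuous_pr by (rule borel_measurable_continuous_onI)

lemma cone_borel [measurable]: "K \<in> sets borel"
  using cone_closed by (rule borel_closed)

text \<open>An intersection-stable generator of the Borel sets. Only functionals from the cone
  occur, because Laplace transforms are given only there.\<close>

definition cylinders :: "'a set set" where
  "cylinders = {\<Inter>(u, c)\<in>J. {y. y \<bullet> u < c} | J. finite J \<and> J \<subseteq> K \<times> (UNIV :: real set)}"

lemma cylinders_sub: "cylinders \<subseteq> Pow UNIV" by simp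

lemma Int_stable_cylinders: "Int_stable cylinders"
proof (rule Int_stableI)
  fix A B assume "A \<in> cylinders" "B \<in> cylinders"
  then obtain I J where "finite I" "I \<subseteq> K \<times> (UNIV :: real set)" "A = (\<Inter>(u, c)\<in>I. {y. y \<bullet> u < c})"
      "finite J" "J \<subseteq> K \<times> (UNIV :: real set)" "B = (\<Inter>(u, c)\<in>J. {y. y \<bullet> u < c})"
    unfolding cylinders_def by blast
  then show "A \<inter> B \<in> cylinders" unfolding cylinders_def
    by (intro CollectI exI[of _ "I \<union> J"]) auto
qed

lemma sets_borel_cylinders: "sets borel = sigma_sets UNIV cylinders"
proof (rule antisym)
  have s: "sets (sigma UNIV cylinders) = sigma_sets UNIV cylinders" by (simp add: cylinders_sub)
  have K: "(\<lambda>y. y \<bullet> u) \<in> borel_measurable (sigma UNIV cylinders)" if "u \<in> K" for u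
  proof (rule borel_measurable_iff_less[THEN iffD2], intro allI)
    fix c :: real
    have "{y. y \<bullet> u < c} \<in> cylinders" unfolding cylinders_def
      using that by (intro CollectI exI[of _ "{(u, c)}"]) auto
    then show "{y \<in> space (sigma UNIV cylinders). y \<bullet> u < c} \<in> sets (sigma UNIV cylinders)"
      by (auto simp: s space_measure_of_conv)
  qed
  have "(\<lambda>y. y) \<in> borel_measurable (sigma UNIV cylinders)"
  proof (rule borel_measurable_innerI)
    fix u :: 'a
    obtain p n where "p \<in> K" "n \<in> K" "u = p - n" by (rule cone_decomp)
    then show "(\<lambda>y. y \<bullet> u) \<in> borel_measurable (sigma UNIV cylinders)"
      using K by (simp add: inner_diff_right)
  qed
  then show "sets borel \<subseteq> sigma_sets UNIV cylinders"
    unfolding s[symmetric] by (auto dest: measurable_sets simp: space_measure_of_conv)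
  have "A \<in> sets borel" if "A \<in> cylinders" for A
  proof -
    obtain J where J: "finite J" "A = (\<Inter>(u, c)\<in>J. {y. y \<bullet> u < (c::real)})"
      using \<open>A \<in> cylinders\<close> unfolding cylinders_def by blast
    have "open A" unfolding J(2) using J(1)
      by (intro open_INT) (auto intro!: open_Collect_less continuous_intros)
    then show ?thesis by (rule borel_open)
  qed
  then have "cylinders \<subseteq> sets borel" by blast
  from sets.sigma_sets_subset[OF this]
  show "sigma_sets UNIV cylinders \<subseteq> sets (borel :: 'a measure)" by simp
qed

text \<open>A functional monotone class theorem for exponentials, which are closed under products.
  Weierstrass approximation produces continuous functions of one exponential, limits of these
  produce half-spaces, and Dynkin's theorem leads from cylinders to Borel sets. Composition with
  \<open>pr\<close> keeps the exponentials bounded outside the cone.\<close>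

lemma laplace_monotone_class:
  fixes V :: "('a \<Rightarrow> real) \<Rightarrow> bool"
  assumes base: "\<And>v. v \<in> K \<Longrightarrow> V (\<lambda>y. exp (- (pr y \<bullet> v)))"
    and lin: "\<And>a f g. V f \<Longrightarrow> V g \<Longrightarrow> V (\<lambda>y. a * f y + g y)"
    and lim: "\<And>F g C. (\<And>n. V (F n)) \<Longrightarrow> (\<And>n y. \<bar>F n y\<bar> \<le> C) \<Longrightarrow> (\<And>y. (\<lambda>n::nat. F n y) \<longlonglongrightarrow> g y) \<Longrightarrow> V g"
    and A: "A \<in> sets borel"
  shows "V (\<lambda>y. indicator A (pr y))"
proof -
  define bd where "bd g \<longleftrightarrow> (\<exists>C. \<forall>y::'a. \<bar>g y\<bar> \<le> (C::real))" for g
  \<comment> \<open>The exponential weight is built in so that multiplication by an exponential maps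
    \<open>W\<close> to itself.\<close>
  define W where "W g \<longleftrightarrow> bd g \<and> (\<forall>v\<in>K. V (\<lambda>y. exp (- (pr y \<bullet> v)) * g y))" for g
  \<comment> \<open>The multipliers of \<open>W\<close>: unlike \<open>W\<close> they are closed under products.\<close>
  define Mu where "Mu h \<longleftrightarrow> bd h \<and> (\<forall>g. W g \<longrightarrow> W (\<lambda>y. h y * g y))" for h
  have exp_le: "0 < exp (- (pr y \<bullet> v))" "exp (- (pr y \<bullet> v)) \<le> 1" if "v \<in> K" for v y
    using that by (auto intro: inner_nonneg)
  have bd_mult: "bd (\<lambda>y. f y * g y)" if "bd f" "bd g" for f g
  proof -
    obtain a b where "\<And>y. \<bar>f y\<bar> \<le> a" "\<And>y. \<bar>g y\<bar> \<le> b" using \<open>bd f\<close> \<open>bd g\<close> unfolding bd_def by blast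
    then have "\<bar>f y * g y\<bar> \<le> a * b" for y
      unfolding abs_mult by (intro mult_mono) (auto intro: order_trans[OF abs_ge_zero])
    then show ?thesis unfolding bd_def by blast
  qed
  have bd_lin: "bd (\<lambda>y. a * f y + g y)" if "bd f" "bd g" for a f g
  proof -
    obtain c b where "\<And>y. \<bar>f y\<bar> \<le> c" "\<And>y. \<bar>g y\<bar> \<le> b" using \<open>bd f\<close> \<open>bd g\<close> unfolding bd_def by blast
    then have "\<bar>a * f y + g y\<bar> \<le> \<bar>a\<bar> * c + b" for y
      by (intro order_trans[OF abs_triangle_ineq] add_mono) (auto simp: abs_mult intro: mult_left_mono)
    then show ?thesis unfolding bd_def by blast
  qed
  have W_lin: "W (\<lambda>y. a * f y + g y)" if f: "W f" and g: "W g" for a f g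
    unfolding W_def
  proof (intro conjI ballI)
    fix v assume "v \<in> K"
    then have "V (\<lambda>y. a * (exp (- (pr y \<bullet> v)) * f y) + exp (- (pr y \<bullet> v)) * g y)"
      using f g by (intro lin) (auto simp: W_def)
    then show "V (\<lambda>y. exp (- (pr y \<bullet> v)) * (a * f y + g y))" by (simp add: algebra_simps)
  qed (use f g bd_lin in \<open>auto simp: W_def\<close>)
  have W_lim: "W g" if F: "\<And>n::nat. W (F n)" and C: "\<And>n y. \<bar>F n y\<bar> \<le> C" and l: "\<And>y. (\<lambda>n. F n y) \<longlonglongrightarrow> g y" for F g C
    unfolding W_def
  proof (intro conjI ballI)
    have "\<bar>g y\<bar> \<le> C" for y
      using tendsto_rabs[OF l[of y]] C by (intro LIMSEQ_le_const2) auto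
    then show "bd g" unfolding bd_def by blast
    fix v assume v: "v \<in> K"
    show "V (\<lambda>y. exp (- (pr y \<bullet> v)) * g y)"
    proof (rule lim)
      show "V (\<lambda>y. exp (- (pr y \<bullet> v)) * F n y)" for n using F[of n] v by (simp add: W_def)
      show "\<bar>exp (- (pr y \<bullet> v)) * F n y\<bar> \<le> C" for n y
      proof -
        have "\<bar>exp (- (pr y \<bullet> v)) * F n y\<bar> \<le> 1 * \<bar>F n y\<bar>"
          unfolding abs_mult using exp_le[OF v, of y] by (intro mult_right_mono) auto
        then show ?thesis using C[of n y] by simp
      qed
    qed (rule tendsto_mult[OF tendsto_const l])
  qed
  have Mu_lin: "Mu (\<lambda>y. a * f y + g y)" if f: "Mu f" and g: "Mu g" for a f g
    unfolding Mu_def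
  proof (intro conjI allI impI)
    fix h assume "W h"
    then have "W (\<lambda>y. a * (f y * h y) + g y * h y)" using f g by (intro W_lin) (auto simp: Mu_def)
    then show "W (\<lambda>y. (a * f y + g y) * h y)" by (simp add: algebra_simps)
  qed (use f g bd_lin in \<open>auto simp: Mu_def\<close>)
  have Mu_mult: "Mu (\<lambda>y. f y * g y)" if f: "Mu f" and g: "Mu g" for f g
    unfolding Mu_def
  proof (intro conjI allI impI)
    fix h assume "W h"
    then have "W (\<lambda>y. f y * (g y * h y))" using f g by (auto simp: Mu_def)
    then show "W (\<lambda>y. f y * g y * h y)" by (simp add: mult.assoc)
  qed (use f g bd_mult in \<open>auto simp: Mu_def\<close>)
  have Mu_lim: "Mu g" if F: "\<And>n::nat. Mu (F n)" and C: "\<And>n y. \<bar>F n y\<bar> \<le> C" and l: "\<And>y. (\<lambda>n. F n y) \<longlonglongrightarrow> g y" for F g C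
    unfolding Mu_def
  proof (intro conjI allI impI)
    have "\<bar>g y\<bar> \<le> C" for y
      using tendsto_rabs[OF l[of y]] C by (intro LIMSEQ_le_const2) auto
    then show "bd g" unfolding bd_def by blast
    fix h assume h: "W h"
    then obtain b where b: "\<And>y. \<bar>h y\<bar> \<le> b" unfolding W_def bd_def by blast
    show "W (\<lambda>y. g y * h y)"
    proof (rule W_lim)
      show "W (\<lambda>y. F n y * h y)" for n using F h by (auto simp: Mu_def)
      show "\<bar>F n y * h y\<bar> \<le> C * b" for n y
        unfolding abs_mult using C b by (intro mult_mono) (auto intro: order_trans[OF abs_ge_zero])
    qed (rule tendsto_mult[OF l tendsto_const])
  qed
  have Mu_one: "Mu (\<lambda>_. 1)" unfolding Mu_def bd_def by auto
  have Mu_zero: "Mu (\<lambda>_. 0)" using Mu_lin[OF Mu_one Mu_one, of "- 1"] by simp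
  have Mu_smult: "Mu (\<lambda>y. a * f y)" if "Mu f" for a f using Mu_lin[OF that Mu_zero, of a] by simp
  have Mu_sum: "Mu (\<lambda>y. \<Sum>i\<le>n. f i y)" if "\<And>i. Mu (f i)" for f and n :: nat
  proof (induction n)
    case (Suc n) then show ?case using Mu_lin[OF that[of "Suc n"] Suc, of 1] by (simp add: add.commute)
  qed (use that in simp)
  have Mu_exp: "Mu (\<lambda>y. exp (- (pr y \<bullet> u)))" if u: "u \<in> K" for u
    unfolding Mu_def
  proof (intro conjI allI impI)
    show bde: "bd (\<lambda>y. exp (- (pr y \<bullet> u)))" unfolding bd_def using exp_le[OF u] by (intro exI[of _ 1]) auto
    fix g assume g: "W g"
    show "W (\<lambda>y. exp (- (pr y \<bullet> u)) * g y)" unfolding W_def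
    proof (intro conjI ballI)
      fix v assume "v \<in> K"
      then have "V (\<lambda>y. exp (- (pr y \<bullet> (v + u))) * g y)"
        using g u by (auto simp: W_def intro: cone_add)
      then show "V (\<lambda>y. exp (- (pr y \<bullet> v)) * (exp (- (pr y \<bullet> u)) * g y))"
        by (simp add: inner_add_right exp_add[symmetric] mult.assoc[symmetric] add.commute)
    qed (use g bde bd_mult in \<open>auto simp: W_def\<close>)
  qed
  have Mu_power: "Mu (\<lambda>y. f y ^ i)" if "Mu f" for f i
    by (induction i) (auto intro: Mu_one Mu_mult that)
  have Mu_cont: "Mu (\<lambda>y. f (exp (- (pr y \<bullet> u))))" if u: "u \<in> K" and f: "continuous_on {0..1} f" for u and f :: "real \<Rightarrow> real"
  proof -
    have "\<forall>n. \<exists>p. real_polynomial_function p \<and> (\<forall>x\<in>{0..1}. \<bar>f x - p x\<bar> < 1 / real (Suc n))"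
      using Stone_Weierstrass_real_polynomial_function[OF compact_Icc f] by (metis of_nat_0_less_iff zero_less_Suc zero_less_divide_1_iff)
    then obtain p where p: "\<And>n. real_polynomial_function (p n)" "\<And>n x. x \<in> {0..1} \<Longrightarrow> \<bar>f x - p n x\<bar> < 1 / real (Suc n)"
      by metis
    have x01: "exp (- (pr y \<bullet> u)) \<in> {0..1}" for y using exp_le[OF u, of y] by auto
    have "bounded (f ` {0..1})"
      by (intro compact_imp_bounded compact_continuous_image f compact_Icc)
    then obtain B where "\<forall>z\<in>f ` {0..1}. norm z \<le> B" unfolding bounded_iff by blast
    then have B: "\<bar>f x\<bar> \<le> B" if "x \<in> {0..1}" for x using that by auto
    show ?thesis
    proof (rule Mu_lim)
      fix n
      obtain a m where "p n = (\<lambda>x. \<Sum>i\<le>m. a i * x ^ i)" using p(1)[of n] unfolding real_polynomial_function_iff_sum by blast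
      then show "Mu (\<lambda>y. p n (exp (- (pr y \<bullet> u))))"
        using u by (auto intro!: Mu_sum Mu_smult Mu_power Mu_exp)
    next
      fix n y
      have "1 / real (Suc n) \<le> 1" by simp
      then show "\<bar>p n (exp (- (pr y \<bullet> u)))\<bar> \<le> B + 1"
        using p(2)[OF x01[of y], of n] B[OF x01[of y]] by linarith
    next
      fix y
      show "(\<lambda>n. p n (exp (- (pr y \<bullet> u)))) \<longlonglongrightarrow> f (exp (- (pr y \<bullet> u)))"
        by (rule tendsto_dist_iff[THEN iffD2], rule tendsto_sandwich[OF _ _ tendsto_const LIMSEQ_inverse_real_of_nat])
           (use p(2)[OF x01[of y]] in \<open>auto simp: inverse_eq_divide dist_real_def abs_minus_commute intro!: always_eventually less_imp_le\<close>)
    qed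
  qed
  have Mu_half: "Mu (\<lambda>y. indicator {y. y \<bullet> u < c} (pr y))" if u: "u \<in> K" for u c
  proof (rule Mu_lim)
    \<comment> \<open>Ramps of slope \<open>n\<close> starting at \<open>exp (- c)\<close>: they
      vanish where \<open>y \<bullet> u = c\<close>, so their limit is the indicator of the strict
      inequality.\<close>
    let ?f = "\<lambda>n x. min 1 (max 0 (real n * (x - exp (- c))))"
    show "Mu (\<lambda>y. ?f n (exp (- (pr y \<bullet> u))))" for n
      using u by (rule Mu_cont) (intro continuous_intros)
    show "\<bar>?f n (exp (- (pr y \<bullet> u)))\<bar> \<le> 1" for n y by auto
    fix y
    show "(\<lambda>n. ?f n (exp (- (pr y \<bullet> u)))) \<longlonglongrightarrow> indicator {y. y \<bullet> u < c} (pr y)"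
    proof (cases "pr y \<bullet> u < c")
      case True
      define e where "e = exp (- (pr y \<bullet> u)) - exp (- c)"
      have e: "e > 0" using True by (simp add: e_def)
      obtain N where N: "real N > 1 / e" using reals_Archimedean2 by blast
      have "?f n (exp (- (pr y \<bullet> u))) = 1" if "n \<ge> N" for n
      proof -
        have "1 / e < real n" using N that by (metis less_le_trans of_nat_le_iff)
        then have "1 < real n * e" using e by (simp add: divide_less_eq)
        then show ?thesis by (simp add: e_def)
      qed
      then have "\<forall>\<^sub>F n in sequentially. 1 = ?f n (exp (- (pr y \<bullet> u)))"
        unfolding eventually_sequentially by (intro exI[of _ N]) auto
      then show ?thesis using True by (auto intro: Lim_transform_eventually[OF tendsto_const])
    next
      case False
      then have "exp (- (pr y \<bullet> u)) - exp (- c) \<le> 0" by simp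
      then have "?f n (exp (- (pr y \<bullet> u))) = 0" for n
        by (simp add: max_absorb1 mult_nonneg_nonpos)
      then show ?thesis using False by simp
    qed
  qed
  have W_one: "W (\<lambda>_. 1)" using base by (auto simp: W_def bd_def)
  have fin: "Mu (\<lambda>y. indicator (\<Inter>(u, c)\<in>J. {y. y \<bullet> u < (c::real)}) (pr y))" if "finite J" "J \<subseteq> K \<times> UNIV" for J
    using that
  proof (induction J rule: finite_induct)
    case empty then show ?case using Mu_one by simp
  next
    case (insert j J)
    obtain u c where j: "j = (u, c)" by fastforce
    have "Mu (\<lambda>y. indicator {y. y \<bullet> u < c} (pr y) * indicator (\<Inter>(u, c)\<in>J. {y. y \<bullet> u < c}) (pr y))"
      using insert j by (intro Mu_mult Mu_half) auto
    then show ?case by (simp add: j indicator_inter_arith)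
  qed
  \<comment> \<open>A multiplier is recovered by applying it to the constant 1 and taking the
    trivial weight \<open>v = 0\<close>.\<close>
  have VMu: "V h" if "Mu h" for h
  proof -
    have "W (\<lambda>y. h y * 1)" using that W_one unfolding Mu_def by blast
    then have "V (\<lambda>y. exp (- (pr y \<bullet> 0)) * (h y * 1))" unfolding W_def using cone_zero by blast
    then show ?thesis by simp
  qed
  have V1: "V (\<lambda>_. 1)" using VMu Mu_one .
  from A have "A \<in> sigma_sets UNIV cylinders" by (simp add: sets_borel_cylinders)
  with Int_stable_cylinders cylinders_sub show ?thesis
  proof (induction rule: sigma_sets_induct_disjoint)
    case (basic A)
    then show ?case using fin VMu unfolding cylinders_def by blast
  next
    case empty
    then show ?case using VMu[OF Mu_zero] by simp
  next
    case (compl A)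
    from lin[OF compl(2) V1, of "- 1"] show ?case
      by (rule back_subst[of V]) (auto simp: indicator_def)
  next
    case (union A)
    have sum: "V (\<lambda>y. indicator (\<Union>i<n. A i) (pr y))" for n
    proof (induction n)
      case 0 show ?case using VMu[OF Mu_zero] by simp
    next
      case (Suc n)
      have "A n \<inter> A i = {}" if "i < n" for i
        using disjoint_family_onD[OF union(1), of n i] that by auto
      then have "A n \<inter> (\<Union>i<n. A i) = {}" by blast
      then have "(\<lambda>y. 1 * indicator (A n) (pr y) + indicator (\<Union>i<n. A i) (pr y) :: real) = (\<lambda>y. indicator (\<Union>i<Suc n. A i) (pr y))"
        by (auto simp: indicator_def less_Suc_eq fun_eq_iff)
      then show ?case using lin[OF union(3)[of n] Suc, of 1] by simp
    qed
    show ?case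
    proof (rule lim[where C = 1, OF sum])
      show "(\<lambda>n. indicator (\<Union>i<n. A i) (pr y) :: real) \<longlonglongrightarrow> indicator (\<Union>i. A i) (pr y)" for y
        by (rule LIMSEQ_indicator_UN)
    qed (auto simp: indicator_def)
  qed
qed

lemma integral_pr:
  assumes "sets M = sets borel" "AE y in M. y \<in> K" "f \<in> borel_measurable borel"
  shows "(\<integral>y. f (pr y) \<partial>M) = (\<integral>y. f y \<partial>M :: real)"
proof (rule integral_cong_AE)
  have [measurable_cong]: "sets M = sets borel" by fact
  show "(\<lambda>y. f (pr y)) \<in> borel_measurable M" "f \<in> borel_measurable M" using assms(3) by measurable
  show "AE y in M. f (pr y) = f y" using assms(2) by eventually_elim (simp add: pr_ident)
qed

lemma measurable_exp_inner [measurable]: "(\<lambda>y. exp (- (y \<bullet> v))) \<in> borel_measurable borel"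
  by (intro borel_measurable_continuous_onI continuous_intros)

text \<open>The bounded functions with equal integrals under \<open>M\<close> and \<open>N\<close>
  form a class as in \<open>laplace_monotone_class\<close>.\<close>

theorem laplace_unique:
  assumes M: "prob_space M" "sets M = sets borel" "AE y in M. y \<in> K"
    and N: "prob_space N" "sets N = sets borel" "AE y in N. y \<in> K"
    and eq: "\<And>v. v \<in> K \<Longrightarrow> (\<integral>y. exp (- (y \<bullet> v)) \<partial>M) = (\<integral>y. exp (- (y \<bullet> v)) \<partial>N)"
  shows "M = N"
proof (rule measure_eqI)
  interpret M: prob_space M by fact
  interpret N: prob_space N by fact
  have [measurable_cong]: "sets M = sets borel" "sets N = sets borel" by fact+
  fix A assume "A \<in> sets M"
  then have A [measurable]: "A \<in> sets borel" using M by simp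
  let ?V = "\<lambda>g :: 'a \<Rightarrow> real. g \<in> borel_measurable borel \<and> (\<exists>C. \<forall>y. \<bar>g y\<bar> \<le> C) \<and> (\<integral>y. g y \<partial>M) = (\<integral>y. g y \<partial>N)"
  have "?V (\<lambda>y. indicator A (pr y))"
  proof (rule laplace_monotone_class[where V = ?V, OF _ _ _ A])
    fix v assume v: "v \<in> K"
    have "(\<integral>y. exp (- (pr y \<bullet> v)) \<partial>M) = (\<integral>y. exp (- (pr y \<bullet> v)) \<partial>N)"
      using integral_pr[OF M(2,3) measurable_exp_inner[of v]] integral_pr[OF N(2,3) measurable_exp_inner[of v]] eq[OF v] by simp
    moreover have "\<exists>C. \<forall>y. \<bar>exp (- (pr y \<bullet> v))\<bar> \<le> C"
      using v by (intro exI[of _ 1]) (auto intro: inner_nonneg)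
    ultimately show "?V (\<lambda>y. exp (- (pr y \<bullet> v)))" by simp
  next
    fix a f g assume f: "?V f" and g: "?V g"
    obtain C D where C: "\<And>y. \<bar>f y\<bar> \<le> C" "\<And>y. \<bar>g y\<bar> \<le> D" using f g by blast
    have [measurable]: "f \<in> borel_measurable borel" "g \<in> borel_measurable borel" using f g by auto
    have i: "integrable M f" "integrable M g" "integrable N f" "integrable N g"
      by (auto intro!: M.integrable_const_bound[of f C] M.integrable_const_bound[of g D]
          N.integrable_const_bound[of f C] N.integrable_const_bound[of g D] C)
    have "\<bar>a * f y + g y\<bar> \<le> \<bar>a\<bar> * C + D" for y
      using C by (intro order_trans[OF abs_triangle_ineq] add_mono) (auto simp: abs_mult intro: mult_left_mono)
    then have "\<exists>C. \<forall>y. \<bar>a * f y + g y\<bar> \<le> C" by blast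
    then show "?V (\<lambda>y. a * f y + g y)" using f g i by simp
  next
    fix F :: "nat \<Rightarrow> 'a \<Rightarrow> real" and g and C
    assume F: "\<And>n. ?V (F n)" and C: "\<And>n y. \<bar>F n y\<bar> \<le> C" and l: "\<And>y. (\<lambda>n. F n y) \<longlonglongrightarrow> g y"
    have Fm [measurable]: "F n \<in> borel_measurable borel" for n using F by auto
    have g [measurable]: "g \<in> borel_measurable borel" by (rule borel_measurable_LIMSEQ_real[OF l Fm])
    have "(\<lambda>n. \<integral>y. F n y \<partial>M) \<longlonglongrightarrow> (\<integral>y. g y \<partial>M)" "(\<lambda>n. \<integral>y. F n y \<partial>N) \<longlonglongrightarrow> (\<integral>y. g y \<partial>N)"
      by (rule integral_dominated_convergence[where w = "\<lambda>_. C"]; use l C in simp)+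
    moreover have "(\<lambda>n. \<integral>y. F n y \<partial>M) = (\<lambda>n. \<integral>y. F n y \<partial>N)" using F by auto
    ultimately have "(\<integral>y. g y \<partial>M) = (\<integral>y. g y \<partial>N)" using LIMSEQ_unique by metis
    moreover have "\<bar>g y\<bar> \<le> C" for y using tendsto_rabs[OF l[of y]] C by (intro LIMSEQ_le_const2) auto
    ultimately show "?V g" using g by blast
  qed
  then have "(\<integral>y. indicator A y \<partial>M) = (\<integral>y. indicator A y \<partial>N :: real)"
    using integral_pr[OF M(2,3), of "indicator A"] integral_pr[OF N(2,3), of "indicator A"] by simp
  then have "measure M A = measure N A" using M(2) N(2) sets_eq_imp_space_eq[OF M(2)] sets_eq_imp_space_eq[OF N(2)] by simp
  then show "emeasure M A = emeasure N A"
    by (simp add: M.emeasure_eq_measure N.emeasure_eq_measure)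
qed (simp add: M N)

text \<open>The monotone class consists of the functions whose integral is measurable in
  \<open>x\<close>. This gives measurability of kernels known only through their Laplace transforms,
  even when they arise by choice.\<close>

theorem laplace_kernel_measurable:
  assumes k: "\<And>x. x \<in> space X \<Longrightarrow> prob_space (k x)" "\<And>x. x \<in> space X \<Longrightarrow> sets (k x) = sets borel"
      "\<And>x. x \<in> space X \<Longrightarrow> AE y in k x. y \<in> K"
    and meas: "\<And>v. v \<in> K \<Longrightarrow> (\<lambda>x. \<integral>y. exp (- (y \<bullet> v)) \<partial>k x) \<in> borel_measurable X"
  shows "k \<in> measurable X (prob_algebra borel)"
proof (rule measurable_prob_algebraI)
  show "prob_space (k x)" if "x \<in> space X" for x using k(1)[OF that] .
  show "k \<in> measurable X (subprob_algebra borel)"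
  proof (rule measurable_subprob_algebra)
    fix x assume "x \<in> space X" then show "subprob_space (k x)" "sets (k x) = sets borel"
      using k by (auto intro: prob_space_imp_subprob_space)
  next
    fix A :: "'a set" assume A [measurable]: "A \<in> sets borel"
    let ?V = "\<lambda>g :: 'a \<Rightarrow> real. g \<in> borel_measurable borel \<and> (\<exists>C. \<forall>y. \<bar>g y\<bar> \<le> C) \<and> (\<lambda>x. \<integral>y. g y \<partial>k x) \<in> borel_measurable X"
    have "?V (\<lambda>y. indicator A (pr y))"
    proof (rule laplace_monotone_class[where V = ?V, OF _ _ _ A])
      fix v assume v: "v \<in> K"
      have "(\<lambda>x. \<integral>y. exp (- (pr y \<bullet> v)) \<partial>k x) \<in> borel_measurable X"
        using integral_pr[OF k(2,3) measurable_exp_inner[of v]]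
        by (subst measurable_cong[of X _ "\<lambda>x. \<integral>y. exp (- (y \<bullet> v)) \<partial>k x"]) (auto intro: meas v)
      moreover have "\<exists>C. \<forall>y. \<bar>exp (- (pr y \<bullet> v))\<bar> \<le> C"
        using v by (intro exI[of _ 1]) (auto intro: inner_nonneg)
      ultimately show "?V (\<lambda>y. exp (- (pr y \<bullet> v)))" by simp
    next
      fix a f g assume f: "?V f" and g: "?V g"
      obtain C D where C: "\<And>y. \<bar>f y\<bar> \<le> C" "\<And>y. \<bar>g y\<bar> \<le> D" using f g by blast
      have i: "integrable (k x) f" "integrable (k x) g" if x: "x \<in> space X" for x
      proof -
        interpret prob_space "k x" by (rule k(1)[OF x])
        have [measurable_cong]: "sets (k x) = sets borel" by (rule k(2)[OF x])
        have [measurable]: "f \<in> borel_measurable borel" "g \<in> borel_measurable borel" using f g by auto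
        show "integrable (k x) f" "integrable (k x) g"
          by (auto intro!: integrable_const_bound[of f C] integrable_const_bound[of g D] C)
      qed
      have "(\<lambda>x. \<integral>y. a * f y + g y \<partial>k x) \<in> borel_measurable X"
        using f g by (subst measurable_cong[of X _ "\<lambda>x. a * (\<integral>y. f y \<partial>k x) + (\<integral>y. g y \<partial>k x)"]) (auto simp: i)
      moreover have "\<bar>a * f y + g y\<bar> \<le> \<bar>a\<bar> * C + D" for y
        using C by (intro order_trans[OF abs_triangle_ineq] add_mono) (auto simp: abs_mult intro: mult_left_mono)
      then have "\<exists>C. \<forall>y. \<bar>a * f y + g y\<bar> \<le> C" by blast
      moreover have "(\<lambda>y. a * f y + g y) \<in> borel_measurable borel"
        using f g by (intro borel_measurable_add borel_measurable_times) auto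
      ultimately show "?V (\<lambda>y. a * f y + g y)" using f g by simp
    next
      fix F :: "nat \<Rightarrow> 'a \<Rightarrow> real" and g and C
      assume F: "\<And>n. ?V (F n)" and C: "\<And>n y. \<bar>F n y\<bar> \<le> C" and l: "\<And>y. (\<lambda>n. F n y) \<longlonglongrightarrow> g y"
      have Fm [measurable]: "F n \<in> borel_measurable borel" for n using F by auto
      have g [measurable]: "g \<in> borel_measurable borel" by (rule borel_measurable_LIMSEQ_real[OF l Fm])
      have "(\<lambda>n. \<integral>y. F n y \<partial>k x) \<longlonglongrightarrow> (\<integral>y. g y \<partial>k x)" if x: "x \<in> space X" for x
      proof -
        interpret prob_space "k x" by (rule k(1)[OF x])
        have [measurable_cong]: "sets (k x) = sets borel" by (rule k(2)[OF x])
        show ?thesis by (rule integral_dominated_convergence[where w = "\<lambda>_. C"]; use l C in simp)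
      qed
      then have "(\<lambda>x. \<integral>y. g y \<partial>k x) \<in> borel_measurable X"
        by (rule borel_measurable_LIMSEQ_real) (use F in auto)
      moreover have "\<bar>g y\<bar> \<le> C" for y using tendsto_rabs[OF l[of y]] C by (intro LIMSEQ_le_const2) auto
      ultimately show "?V g" using g by blast
    qed
    then have "(\<lambda>x. ennreal (\<integral>y. indicator A (pr y) \<partial>k x)) \<in> borel_measurable X" by simp
    then show "(\<lambda>x. emeasure (k x) A) \<in> borel_measurable X"
    proof (rule measurable_cong[THEN iffD1, rotated])
      fix x assume x: "x \<in> space X"
      interpret prob_space "k x" by (rule k(1)[OF x])
      have "(\<integral>y. indicator A (pr y) \<partial>k x) = (\<integral>y. indicator A y \<partial>k x :: real)"
        by (rule integral_pr[OF k(2,3)[OF x]]) simp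
      also have "\<dots> = measure (k x) A"
        using k(2)[OF x] sets_eq_imp_space_eq[OF k(2)[OF x]] by simp
      finally show "ennreal (\<integral>y. indicator A (pr y) \<partial>k x) = emeasure (k x) A"
        by (simp add: emeasure_eq_measure)
    qed
  qed
qed

end

section \<open>Limits of Laplace transforms\<close>

lemma exp_minus_lipschitz:
  fixes s t :: real
  assumes st: "0 \<le> s" "0 \<le> t"
  shows "\<bar>exp (- s) - exp (- t)\<bar> \<le> \<bar>s - t\<bar>"
proof -
  have *: "exp (- s) - exp (- t) \<le> t - s \<and> exp (- t) \<le> exp (- s)" if "0 \<le> s" "s \<le> t" for s t :: real
  proof -
    have "1 - exp (s - t) \<le> t - s" using exp_ge_add_one_self[of "s - t"] by linarith
    moreover have "0 \<le> 1 - exp (s - t)" using that by simp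
    ultimately have "exp (- s) * (1 - exp (s - t)) \<le> 1 * (t - s)"
      using that by (intro mult_mono) auto
    then show ?thesis using that by (simp add: right_diff_distrib flip: exp_add)
  qed
  show ?thesis
  proof (cases "s \<le> t")
    case True then show ?thesis using *[OF st(1) True] by simp
  next
    case False then show ?thesis using *[OF st(2), of s] by simp
  qed
qed

text \<open>
  Schoenberg's curve: the map sending \<open>t\<close> to the sequence \<open>schoenberg k t\<close> is a continuous
  surjection of the line onto the Hilbert cube, with the measurable right inverse
  \<open>schoenberg_code\<close>.  It reduces the compactness of laws on the Hilbert cube to Helly's
  selection theorem on the line.  On a ternary expansion with digits 0 and 2 the function
  \<open>switch (3 ^ j * t)\<close> reads off the \<open>j\<close>-th digit.
\<close>

definition switch :: "real \<Rightarrow> real" where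
  "switch t = max 0 (min 1 (1 / 2 - cos (pi * t)))"

definition schoenberg :: "nat \<Rightarrow> real \<Rightarrow> real" where
  "schoenberg k t = (\<Sum>j. (1 / 2) ^ Suc j * switch (3 ^ prod_encode (k, j) * t))"

definition bit_of :: "real \<Rightarrow> nat \<Rightarrow> real" where
  "bit_of a j = of_int \<lfloor>2 ^ Suc j * a\<rfloor> - 2 * of_int \<lfloor>2 ^ j * a\<rfloor>"

definition schoenberg_code :: "(nat \<Rightarrow> real) \<Rightarrow> real" where
  "schoenberg_code a = (\<Sum>i. 2 * (case prod_decode i of (k, j) \<Rightarrow> bit_of (a k) j) / 3 ^ Suc i)"

lemma switch_bounds: "0 \<le> switch t" "switch t \<le> 1"
  by (auto simp: switch_def)

lemma bit_of_01: "bit_of a j \<in> {0, 1}"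
proof -
  define x where "x = 2 ^ j * a"
  have "\<lfloor>2 * x\<rfloor> = 2 * \<lfloor>x\<rfloor> \<or> \<lfloor>2 * x\<rfloor> = 2 * \<lfloor>x\<rfloor> + 1" by linarith
  then show ?thesis unfolding bit_of_def by (auto simp: x_def mult.assoc)
qed

text \<open>The binary digits are the increments of the dyadic floors, which converge to
  \<open>a\<close>; \<open>a < 1\<close> makes the initial floor vanish.\<close>

lemma bit_of_sums:
  assumes a: "0 \<le> a" "a < 1"
  shows "(\<lambda>j. (1 / 2) ^ Suc j * bit_of a j) sums a"
proof -
  define f where "f n = of_int \<lfloor>2 ^ n * a\<rfloor> / (2 ^ n :: real)" for n
  have "f \<longlonglongrightarrow> a"
  proof (rule tendsto_sandwich[of "\<lambda>n. a - (1 / 2) ^ n" _ _ "\<lambda>_. a"])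
    have "a - (1 / 2) ^ n \<le> f n \<and> f n \<le> a" for n
    proof -
      have "2 ^ n * a - 1 \<le> of_int \<lfloor>2 ^ n * a\<rfloor>" "of_int \<lfloor>2 ^ n * a\<rfloor> \<le> 2 ^ n * a" by linarith+
      then have "(2 ^ n * a - 1) / 2 ^ n \<le> f n" "f n \<le> (2 ^ n * a) / 2 ^ n"
        unfolding f_def by (intro divide_right_mono; simp)+
      then show ?thesis by (simp add: diff_divide_distrib power_divide)
    qed
    then show "\<forall>\<^sub>F n in sequentially. a - (1 / 2) ^ n \<le> f n" "\<forall>\<^sub>F n in sequentially. f n \<le> a" by auto
    have "(\<lambda>n. a - (1 / 2) ^ n) \<longlonglongrightarrow> a - 0" by (intro tendsto_intros LIMSEQ_power_zero) auto
    then show "(\<lambda>n. a - (1 / 2) ^ n) \<longlonglongrightarrow> a" by simp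
  qed simp
  then have "(\<lambda>n. f (Suc n) - f n) sums (a - f 0)" by (rule telescope_sums)
  moreover have "f 0 = 0" using a by (simp add: f_def floor_eq_iff)
  moreover have "f (Suc n) - f n = (1 / 2) ^ Suc n * bit_of a n" for n
    by (simp add: f_def bit_of_def field_simps power_divide)
  ultimately show ?thesis by simp
qed

text \<open>After multiplication by \<open>3 ^ j\<close> the earlier digits contribute an even
  integer, which the cosine ignores, and digit \<open>j\<close> with the tail puts the remaining
  argument into [0, 1/3] or [2/3, 1]. There the cosine is at least 1/2 or at most -1/2, so
  \<open>switch\<close> saturates at the digit.\<close>

lemma ternary_digit:
  fixes \<beta> :: "nat \<Rightarrow> real"
  assumes \<beta>: "\<And>i. \<beta> i \<in> {0, 1}"
  shows "switch (3 ^ j * (\<Sum>i. 2 * \<beta> i / 3 ^ Suc i)) = \<beta> j"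
proof -
  define g where "g i = 2 * \<beta> i / 3 ^ Suc i" for i
  have b01: "0 \<le> \<beta> i" "\<beta> i \<le> 1" for i using \<beta>[of i] by auto
  have geo: "(\<lambda>i. 2 / 3 ^ Suc i) sums (1::real)"
  proof -
    have "(\<lambda>i. (2/3) * (1 / 3) ^ i) sums ((2/3) * (1 / (1 - 1 / 3 :: real)))"
      by (intro sums_mult geometric_sums) simp
    then show ?thesis by (simp add: power_divide)
  qed
  have g: "0 \<le> g i" "g i \<le> 2 / 3 ^ Suc i" for i using b01[of i] by (auto simp: g_def divide_right_mono)
  have summ: "summable g"
    by (rule summable_comparison_test'[OF sums_summable[OF geo], of 0]) (use g in auto)
  define r where "r = (\<Sum>i. 3 ^ j * g (i + Suc j))"
  have r: "0 \<le> r" "r \<le> 1 / 3"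
  proof -
    have e: "3 ^ j * g (i + Suc j) \<le> (1 / 3) * (2 / 3 ^ Suc i)" for i
    proof -
      have "3 ^ j * g (i + Suc j) \<le> 3 ^ j * (2 / 3 ^ Suc (i + Suc j))"
        by (intro mult_left_mono g(2)) simp
      also have "\<dots> = (1 / 3) * (2 / 3 ^ Suc i)" by (simp add: power_add field_simps)
      finally show ?thesis .
    qed
    have s: "summable (\<lambda>i. 3 ^ j * g (i + Suc j))"
      by (intro summable_mult summable_ignore_initial_segment summ)
    show "0 \<le> r" unfolding r_def by (rule suminf_nonneg[OF s]) (simp add: g)
    have "r \<le> (\<Sum>i. (1 / 3) * (2 / 3 ^ Suc i))"
      unfolding r_def by (intro suminf_le[OF e s] summable_mult sums_summable[OF geo])
    also have "\<dots> = 1 / 3" using sums_mult[OF geo, of "1/3"] by (simp add: sums_iff)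
    finally show "r \<le> 1 / 3" .
  qed
  define m where "m = (\<Sum>i<j. (if \<beta> i = 1 then 3 ^ (j - Suc i) else 0 :: int))"
  have "3 ^ j * (\<Sum>i<j. g i) = 2 * of_int m"
    unfolding m_def of_int_sum sum_distrib_left
  proof (rule sum.cong[OF refl])
    fix i assume "i \<in> {..<j}"
    then have "(3::real) ^ j = 3 ^ (j - Suc i) * 3 ^ Suc i" by (simp flip: power_add power_Suc)
    then show "3 ^ j * g i = 2 * of_int (if \<beta> i = 1 then 3 ^ (j - Suc i) else 0)"
      using \<beta>[of i] by (auto simp: g_def)
  qed
  moreover have "3 ^ j * g j = 2 * \<beta> j / 3" by (simp add: g_def)
  moreover have "suminf g = (\<Sum>i. g (i + Suc j)) + (\<Sum>i<Suc j. g i)"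
    by (rule suminf_split_initial_segment[OF summ])
  moreover have "r = 3 ^ j * (\<Sum>i. g (i + Suc j))"
    unfolding r_def by (intro suminf_mult summable_ignore_initial_segment summ)
  ultimately have t: "3 ^ j * suminf g = 2 * of_int m + (2 * \<beta> j / 3 + r)"
    by (simp add: distrib_left)
  have "cos (pi * (3 ^ j * suminf g)) = cos (pi * (2 * \<beta> j / 3 + r) + (2 * pi) * of_int m)"
    unfolding t by (simp add: algebra_simps)
  also have "\<dots> = cos (pi * (2 * \<beta> j / 3 + r))" by (simp add: cos_add)
  finally have c: "cos (pi * (3 ^ j * suminf g)) = cos (pi * (2 * \<beta> j / 3 + r))" .
  consider "\<beta> j = 0" | "\<beta> j = 1" using \<beta>[of j] by blast
  then have "switch (3 ^ j * suminf g) = \<beta> j"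
  proof cases
    case 1
    have "cos (pi / 3) \<le> cos (pi * r)"
      using r by (intro cos_monotone_0_pi_le) (auto simp: field_simps)
    then show ?thesis using 1 c by (simp add: switch_def cos_60)
  next
    case 2
    have "cos (pi * (2 / 3 + r)) \<le> cos (pi * (2 / 3))"
      using r by (intro cos_monotone_0_pi_le) (auto simp: field_simps)
    also have "cos (pi * (2 / 3)) = - 1 / 2"
      using cos_120 by (simp add: mult.commute)
    finally show ?thesis using 2 c by (simp add: switch_def)
  qed
  then show ?thesis by (simp add: g_def[abs_def])
qed

lemma schoenberg_schoenberg_code:
  assumes "0 \<le> a k" "a k < 1"
  shows "schoenberg k (schoenberg_code a) = a k"
proof -
  have "switch (3 ^ prod_encode (k, j) * schoenberg_code a) = bit_of (a k) j" for j
    unfolding schoenberg_code_def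
    by (subst ternary_digit) (use bit_of_01 in \<open>auto split: prod.splits\<close>)
  then show ?thesis unfolding schoenberg_def
    using bit_of_sums[OF assms] by (simp add: sums_iff)
qed

lemma schoenberg_code_bounds: "schoenberg_code a \<in> {0..1}"
proof -
  define g where "g i = 2 * (case prod_decode i of (k, j) \<Rightarrow> bit_of (a k) j) / 3 ^ Suc i" for i
  have geo: "(\<lambda>i. 2 / 3 ^ Suc i) sums (1::real)"
  proof -
    have "(\<lambda>i. (2/3) * (1 / 3) ^ i) sums ((2/3) * (1 / (1 - 1 / 3 :: real)))"
      by (intro sums_mult geometric_sums) simp
    then show ?thesis by (simp add: power_divide)
  qed
  have g: "0 \<le> g i" "g i \<le> 2 / 3 ^ Suc i" for i
  proof -
    obtain k j where kj: "prod_decode i = (k, j)" by fastforce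
    show "0 \<le> g i" "g i \<le> 2 / 3 ^ Suc i"
      using bit_of_01[of "a k" j] by (auto simp: g_def kj)
  qed
  have s: "summable g"
    by (rule summable_comparison_test'[OF sums_summable[OF geo], of 0]) (use g in auto)
  have "suminf g \<le> (\<Sum>i. 2 / 3 ^ Suc i)" by (rule suminf_le[OF g(2) s sums_summable[OF geo]])
  then show ?thesis
    using suminf_nonneg[OF s g(1)] geo by (simp add: schoenberg_code_def g_def[abs_def] sums_iff)
qed

lemma measurable_schoenberg_code:
  assumes [measurable]: "\<And>k. (\<lambda>s. a s k) \<in> borel_measurable M"
  shows "(\<lambda>s. schoenberg_code (a s)) \<in> borel_measurable M"
  unfolding schoenberg_code_def bit_of_def by (simp split: prod.split add: split_beta)

lemma continuous_schoenberg: "continuous_on UNIV (schoenberg k)"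
proof -
  have "uniform_limit UNIV (\<lambda>n t. \<Sum>j<n. (1 / 2) ^ Suc j * switch (3 ^ prod_encode (k, j) * t)) (schoenberg k) sequentially"
    unfolding schoenberg_def[abs_def]
  proof (rule Weierstrass_m_test)
    show "norm ((1 / 2) ^ Suc j * switch (3 ^ prod_encode (k, j) * t)) \<le> (1 / 2) ^ Suc j" for j t
      using switch_bounds[of "3 ^ prod_encode (k, j) * t"] by (simp add: abs_mult)
    show "summable (\<lambda>j. (1 / 2 :: real) ^ Suc j)" by (simp only: summable_Suc_iff) (intro summable_geometric, simp)
  qed
  then show ?thesis
    by (rule uniform_limit_theorem[rotated])
       (auto simp: switch_def intro!: always_eventually continuous_intros)
qed

lemma schoenberg_bounds: "0 \<le> schoenberg k t" "schoenberg k t \<le> 1"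
proof -
  have p: "(\<lambda>j. (1 / 2 :: real) ^ Suc j) sums 1" by (rule power_half_series)
  have le: "(1 / 2) ^ Suc j * switch (3 ^ prod_encode (k, j) * t) \<le> (1 / 2) ^ Suc j" for j
    using switch_bounds[of "3 ^ prod_encode (k, j) * t"] by simp
  have nn: "0 \<le> (1 / 2) ^ Suc j * switch (3 ^ prod_encode (k, j) * t)" for j
    using switch_bounds by simp
  have s: "summable (\<lambda>j. (1 / 2) ^ Suc j * switch (3 ^ prod_encode (k, j) * t))"
    by (rule summable_comparison_test'[OF sums_summable[OF p], of 0]) (use le nn in auto)
  show "0 \<le> schoenberg k t" unfolding schoenberg_def by (rule suminf_nonneg[OF s nn])
  show "schoenberg k t \<le> 1" unfolding schoenberg_def
    using suminf_le[OF le s sums_summable[OF p]] p by (simp add: sums_iff)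
qed

section \<open>Weak compactness and limits of laws on the cone\<close>

context polish_cone
begin

lemma cone_dense_sequence:
  obtains u :: "nat \<Rightarrow> 'a" where "\<And>k. u k \<in> K" "\<And>x e. x \<in> K \<Longrightarrow> 0 < e \<Longrightarrow> \<exists>k. norm (u k - x) < e"
proof -
  obtain d :: "nat \<Rightarrow> 'a" where d: "\<And>x e. 0 < e \<Longrightarrow> \<exists>k. dist (d k) x < e"
    using countable_dense_sequence by blast
  show thesis
  proof
    show "pr (d k) \<in> K" for k by simp
    fix x and e :: real assume x: "x \<in> K" and "0 < e"
    then obtain k where "dist (d k) x < e" using d by blast
    moreover have "norm (pr (d k) - x) \<le> norm (d k - x)" using pr_lipschitz[of "d k" x] by (simp add: pr_ident x)
    ultimately show "\<exists>k. norm (pr (d k) - x) < e" by (auto simp: dist_norm intro: le_less_trans)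
  qed
qed

text \<open>The norm bound extends convergence from the dense sequence to the cone, differences
  extend it to the whole space, and Riesz represents the limit functional. The limit stays in the
  cone because the cone is cut out by inner products.\<close>

lemma weak_compactness:
  assumes u: "\<And>k. u k \<in> K" "\<And>x e. x \<in> K \<Longrightarrow> 0 < e \<Longrightarrow> \<exists>k. norm (u k - x) < e"
    and y: "\<And>n. y n \<in> K" "\<And>n. norm (y n) \<le> R" and conv: "\<And>k::nat. convergent (\<lambda>n. y n \<bullet> u k)"
  shows "\<exists>z\<in>K. norm z \<le> R \<and> (\<forall>h. (\<lambda>n::nat. y n \<bullet> h) \<longlonglongrightarrow> z \<bullet> h)"
proof -
  have R: "0 \<le> R" using y(2)[of 0] norm_ge_zero order_trans by blast
  have c: "Cauchy (\<lambda>n. y n \<bullet> h)" if h: "h \<in> K" for h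
  proof (rule metric_CauchyI)
    fix e :: real assume e: "e > 0"
    obtain k where k: "norm (u k - h) < e / (3 * (R + 1))" using u(2)[OF h, of "e / (3 * (R + 1))"] e R by auto
    have "R * norm (u k - h) \<le> (R + 1) * norm (u k - h)" by (intro mult_right_mono) auto
    also have "\<dots> < e / 3" using k R by (simp add: field_simps)
    finally have Rk: "R * norm (u k - h) < e / 3" .
    have close: "\<bar>y n \<bullet> h - y n \<bullet> u k\<bar> < e / 3" for n
    proof -
      have "\<bar>y n \<bullet> h - y n \<bullet> u k\<bar> \<le> norm (y n) * norm (h - u k)"
        using Cauchy_Schwarz_ineq2[of "y n" "h - u k"] by (simp add: inner_diff_right)
      also have "\<dots> \<le> R * norm (h - u k)" by (intro mult_right_mono y) simp
      finally show ?thesis using Rk by (simp add: norm_minus_commute)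
    qed
    have "Cauchy (\<lambda>n. y n \<bullet> u k)" using conv by (rule convergent_Cauchy)
    then obtain N where N: "\<And>m n. m \<ge> N \<Longrightarrow> n \<ge> N \<Longrightarrow> dist (y m \<bullet> u k) (y n \<bullet> u k) < e / 3"
      using metric_CauchyD[of _ "e / 3"] e by (metis divide_pos_pos zero_less_numeral)
    have "dist (y m \<bullet> h) (y n \<bullet> h) < e" if "m \<ge> N" "n \<ge> N" for m n
      using N[OF that] close[of m] close[of n] unfolding dist_real_def by linarith
    then show "\<exists>M. \<forall>m\<ge>M. \<forall>n\<ge>M. dist (y m \<bullet> h) (y n \<bullet> h) < e" by blast
  qed
  have conv': "convergent (\<lambda>n. y n \<bullet> h)" for h
  proof -
    obtain p q where "p \<in> K" "q \<in> K" "h = p - q" by (rule cone_decomp)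
    then show ?thesis using c by (simp add: inner_diff_right convergent_diff Cauchy_convergent)
  qed
  define \<Phi> where "\<Phi> h = Topological_Spaces.lim (\<lambda>n. y n \<bullet> h)" for h
  have lim: "(\<lambda>n. y n \<bullet> h) \<longlonglongrightarrow> \<Phi> h" for h
    unfolding \<Phi>_def using conv' convergent_LIMSEQ_iff by blast
  have "bounded_linear \<Phi>"
  proof (rule bounded_linear_intro)
    fix g h :: 'a and r :: real
    have "(\<lambda>n. y n \<bullet> (g + h)) \<longlonglongrightarrow> \<Phi> g + \<Phi> h" unfolding inner_add_right by (intro tendsto_add lim)
    then show "\<Phi> (g + h) = \<Phi> g + \<Phi> h" using lim LIMSEQ_unique by blast
    have "(\<lambda>n. y n \<bullet> (r *\<^sub>R g)) \<longlonglongrightarrow> r *\<^sub>R \<Phi> g"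
      unfolding inner_scaleR_right real_scaleR_def by (intro tendsto_mult tendsto_const lim)
    then show "\<Phi> (r *\<^sub>R g) = r *\<^sub>R \<Phi> g" using lim LIMSEQ_unique by blast
    have "\<bar>y n \<bullet> g\<bar> \<le> norm g * R" for n
      using Cauchy_Schwarz_ineq2[of "y n" g] mult_right_mono[OF y(2)[of n], of "norm g"] by (simp add: mult.commute)
    then show "norm (\<Phi> g) \<le> norm g * R"
      using tendsto_norm[OF lim[of g]] by (intro LIMSEQ_le_const2) auto
  qed
  from riesz_representation[OF this] obtain z where z: "\<And>h. \<Phi> h = z \<bullet> h" by blast
  have limz: "(\<lambda>n. y n \<bullet> h) \<longlonglongrightarrow> z \<bullet> h" for h using lim z by simp
  have "z \<in> K"
    by (subst self_dual, intro ballI LIMSEQ_le_const[OF limz]) (auto intro: inner_nonneg y)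
  moreover have "norm z \<le> R"
  proof -
    have "y n \<bullet> z \<le> R * norm z" for n
      by (intro order_trans[OF norm_cauchy_schwarz] mult_right_mono y) simp
    then have "z \<bullet> z \<le> R * norm z" by (intro LIMSEQ_le_const2[OF limz]) auto
    then have "norm z * norm z \<le> R * norm z" by (simp flip: power2_norm_eq_inner add: power2_eq_square)
    then show ?thesis using R by (cases "z = 0") auto
  qed
  ultimately show ?thesis using limz by blast
qed

text \<open>Prokhorov's argument for the weak topology, carried out on the line. Coding turns the
  laws into laws on the unit interval, where a subsequence converges. By Chebyshev's inequality and
  weak compactness of balls the limit lives on codes of cone elements and can be decoded. A
  subsequence suffices, since the transforms converge along the whole sequence.\<close>

theorem laplace_limit:
  fixes p :: "nat \<Rightarrow> 'a measure"
  assumes p: "\<And>n. prob_space (p n)" "\<And>n. sets (p n) = sets borel" "\<And>n. AE y in p n. y \<in> K"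
    and moment: "\<And>n. (\<integral>\<^sup>+y. ennreal ((norm y)\<^sup>2) \<partial>p n) \<le> ennreal C" and C: "0 \<le> C"
    and conv: "\<And>v. v \<in> K \<Longrightarrow> (\<lambda>n. \<integral>y. exp (- (y \<bullet> v)) \<partial>p n) \<longlonglongrightarrow> \<Lambda> v"
  shows "\<exists>q. prob_space q \<and> sets q = sets borel \<and> (AE y in q. y \<in> K) \<and> (\<forall>v\<in>K. (\<integral>y. exp (- (y \<bullet> v)) \<partial>q) = \<Lambda> v)"
proof -
  obtain u :: "nat \<Rightarrow> 'a" where u: "\<And>k. u k \<in> K" "\<And>x e. x \<in> K \<Longrightarrow> 0 < e \<Longrightarrow> \<exists>k. norm (u k - x) < e"
    using cone_dense_sequence by blast
  interpret p: prob_space "p n" for n by (rule p)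
  have [measurable_cong]: "sets (p n) = sets borel" for n by (rule p)
  \<comment> \<open>Halving keeps the coordinates below 1, as the dyadic code requires.\<close>
  define a where "a y k = exp (- (pr y \<bullet> u k)) / 2" for y k
  have a01: "0 \<le> a y k" "a y k < 1" for y k
  proof -
    have "exp (- (pr y \<bullet> u k)) \<le> 1" using inner_nonneg[OF pr_in[of y] u(1)[of k]] by simp
    then have "exp (- (pr y \<bullet> u k)) < 2" by linarith
    then show "0 \<le> a y k" "a y k < 1" by (simp_all add: a_def)
  qed
  define T where "T y = schoenberg_code (a y)" for y
  have T [measurable]: "T \<in> borel_measurable borel"
    unfolding T_def a_def by (intro measurable_schoenberg_code) measurable
  have ST: "schoenberg k (T y) = a y k" for k y
    unfolding T_def by (rule schoenberg_schoenberg_code) (rule a01)+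
  have [measurable]: "schoenberg k \<in> borel_measurable borel" for k
    using continuous_schoenberg by (rule borel_measurable_continuous_onI)
  define \<nu> where "\<nu> n = distr (p n) borel T" for n
  have \<nu>: "real_distribution (\<nu> n)" for n unfolding \<nu>_def by (intro p.real_distribution_distr) measurable
  \<comment> \<open>All codes lie in \<open>{0..1}\<close>, so tightness on the line is
    automatic.\<close>
  have "tight \<nu>" unfolding tight_def
  proof (intro conjI allI impI \<nu>)
    fix e :: real assume e: "e > 0"
    have "T y \<in> {-1<..2}" for y
      using schoenberg_code_bounds[of "a y"] by (auto simp: T_def)
    then have "measure (\<nu> n) {-1<..2} = measure (p n) (space (p n))" for n
      unfolding \<nu>_def by (subst measure_distr) (auto intro!: arg_cong2[where f=measure])
    then have "\<forall>n. 1 - e < measure (\<nu> n) {-1<..2}" using e by (simp add: p.prob_space)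
    then show "\<exists>a b. a < b \<and> (\<forall>n. 1 - e < measure (\<nu> n) {a<..b})"
      by (intro exI[of _ "-1"] exI[of _ 2]) simp
  qed
  from tight_imp_convergent_subsubsequence[OF this strict_mono_id]
  obtain r \<rho> where r: "strict_mono (r :: nat \<Rightarrow> nat)" and \<rho>: "real_distribution \<rho>" and wc: "weak_conv_m (\<nu> \<circ> id \<circ> r) \<rho>"
    by blast
  interpret \<rho>: real_distribution \<rho> by (rule \<rho>)
  have wconv: "(\<lambda>n. \<integral>y. f (T y) \<partial>p (r n)) \<longlonglongrightarrow> (\<integral>t. f t \<partial>\<rho>)"
    if f: "continuous_on UNIV f" "\<And>t. \<bar>f t\<bar> \<le> B" for f :: "real \<Rightarrow> real" and B
  proof -
    have [measurable]: "f \<in> borel_measurable borel" using f(1) by (rule borel_measurable_continuous_onI)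
    have "(\<lambda>n. \<integral>t. f t \<partial>(\<nu> \<circ> id \<circ> r) n) \<longlonglongrightarrow> (\<integral>t. f t \<partial>\<rho>)"
    proof (rule weak_conv_imp_integral_bdd_continuous_conv[OF _ \<rho> wc])
      show "real_distribution ((\<nu> \<circ> id \<circ> r) n)" for n using \<nu> by simp
      show "isCont f x" for x using f(1) by (simp add: continuous_on_eq_continuous_at)
      show "norm (f x) \<le> B" for x using f(2) by simp
    qed
    moreover have "(\<integral>t. f t \<partial>(\<nu> \<circ> id \<circ> r) n) = (\<integral>y. f (T y) \<partial>p (r n))" for n
      unfolding \<nu>_def comp_def id_def by (rule integral_distr) measurable
    ultimately show ?thesis by simp
  qed
  \<comment> \<open>The parameters on the curve of points of norm at most \<open>R\<close>; this set is closed by weak compactness of balls.\<close>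
  define A where "A R = {t. \<exists>y\<in>K. norm y \<le> R \<and> (\<forall>k. schoenberg k t = exp (- (y \<bullet> u k)) / 2)}" for R :: real
  have A_T: "T y \<in> A R" if "y \<in> K" "norm y \<le> R" for y R
    unfolding A_def using that ST by (auto simp: a_def pr_ident intro!: bexI[of _ y])
  have closedA: "closed (A R)" for R
    unfolding closed_sequential_limits
  proof (intro allI impI, elim conjE)
    fix x l assume x: "\<forall>n. x n \<in> A R" and l: "x \<longlonglongrightarrow> l"
    from x obtain y where y: "\<And>n. y n \<in> K" "\<And>n. norm (y n) \<le> R" "\<And>n k. schoenberg k (x n) = exp (- (y n \<bullet> u k)) / 2"
      unfolding A_def mem_Collect_eq by metis
    have s: "(\<lambda>n. exp (- (y n \<bullet> u k)) / 2) \<longlonglongrightarrow> schoenberg k l" for k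
      unfolding y(3)[symmetric] using continuous_schoenberg l
      by (metis UNIV_I continuous_on_eq_continuous_within isCont_tendsto_compose)
    have "convergent (\<lambda>n. y n \<bullet> u k)" for k
    proof -
      have "exp (- (R * norm (u k))) \<le> exp (- (y n \<bullet> u k))" for n
        using order_trans[OF norm_cauchy_schwarz mult_right_mono[OF y(2)[of n]]] by simp
      then have "exp (- (R * norm (u k))) / 2 \<le> schoenberg k l"
        by (intro LIMSEQ_le_const[OF s]) auto
      then have pos: "0 < schoenberg k l" by (rule less_le_trans[rotated]) simp
      have "(\<lambda>n. - ln (2 * (exp (- (y n \<bullet> u k)) / 2))) \<longlonglongrightarrow> - ln (2 * schoenberg k l)"
        using pos by (intro tendsto_intros s) auto
      then show ?thesis by (auto simp: convergent_def)
    qed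
    from weak_compactness[OF u y(1,2) this] obtain z where z: "z \<in> K" "norm z \<le> R" "\<And>h. (\<lambda>n. y n \<bullet> h) \<longlonglongrightarrow> z \<bullet> h"
      by blast
    have "schoenberg k l = exp (- (z \<bullet> u k)) / 2" for k
      by (rule LIMSEQ_unique[OF s]) (intro tendsto_intros z, simp)
    then show "l \<in> A R" using z unfolding A_def by auto
  qed
  have Am [measurable]: "A R \<in> sets borel" for R using closedA by (rule borel_closed)
  have A_ne: "A R \<noteq> {}" if "0 \<le> R" for R using A_T[of 0 R] that by auto
  \<comment> \<open>One half of the portmanteau theorem: the functions \<open>g m\<close> are
    continuous, dominate the indicator of the closed set \<open>A R\<close> and decrease to it, so
    Chebyshev's bound \<open>1 - C / R\<^sup>2\<close> passes to the limit law.\<close>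
  have tail: "1 - C / R\<^sup>2 \<le> measure \<rho> (A R)" if R: "0 < R" for R
  proof -
    define g where "g m t = max 0 (1 - real m * infdist t (A R))" for m t
    have g01: "0 \<le> g m t" "g m t \<le> 1" for m t by (auto simp: g_def infdist_nonneg)
    have contg: "continuous_on UNIV (g m)" for m
      unfolding g_def by (intro continuous_intros)
    have gm [measurable]: "g m \<in> borel_measurable borel" for m
      using contg by (rule borel_measurable_continuous_onI)
    have low: "1 - C / R\<^sup>2 \<le> (\<integral>y. g m (T y) \<partial>p n)" for m n
    proof -
      have int2: "integrable (p n) (\<lambda>y. (norm y)\<^sup>2)"
        using le_less_trans[OF moment[of n]] by (intro integrableI_bounded) auto
      have i2: "(\<integral>y. (norm y)\<^sup>2 \<partial>p n) \<le> C"
        using moment[of n] C by (subst integral_eq_nn_integral) (auto intro!: enn2real_leI)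
      have ig: "integrable (p n) (\<lambda>y. g m (T y))"
        using g01 by (intro p.integrable_const_bound[of _ 1]) auto
      have "1 - C / R\<^sup>2 \<le> 1 - (\<integral>y. (norm y)\<^sup>2 \<partial>p n) / R\<^sup>2"
        using i2 by (simp add: divide_right_mono)
      also have "\<dots> = (\<integral>y. 1 - (norm y)\<^sup>2 / R\<^sup>2 \<partial>p n)"
        using int2 by (simp add: p.prob_space)
      also have "\<dots> \<le> (\<integral>y. g m (T y) \<partial>p n)"
      proof (rule integral_mono_AE)
        show "AE y in p n. 1 - (norm y)\<^sup>2 / R\<^sup>2 \<le> g m (T y)"
          using p(3)
        proof eventually_elim
          case (elim y)
          show ?case
          proof (cases "norm y \<le> R")
            case True
            then have "infdist (T y) (A R) = 0" using A_T[OF elim] by (simp add: infdist_zero)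
            then show ?thesis by (simp add: g_def)
          next
            case False
            then have "R\<^sup>2 \<le> (norm y)\<^sup>2" using R by (intro power_mono) auto
            then have "1 - (norm y)\<^sup>2 / R\<^sup>2 \<le> 0" using R by (simp add: field_simps)
            then show ?thesis using g01 order_trans by blast
          qed
        qed
      qed (use int2 ig in auto)
      finally show ?thesis .
    qed
    have "1 - C / R\<^sup>2 \<le> (\<integral>t. g m t \<partial>\<rho>)" for m
    proof (rule LIMSEQ_le_const[OF wconv[OF contg, of m 1]])
      show "\<bar>g m t\<bar> \<le> 1" for t using g01[of m t] by auto
    qed (use low in auto)
    moreover have "(\<lambda>m. \<integral>t. g m t \<partial>\<rho>) \<longlonglongrightarrow> (\<integral>t. indicator (A R) t \<partial>\<rho>)"
    proof (rule integral_dominated_convergence[where w = "\<lambda>_. 1"])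
      show "AE t in \<rho>. (\<lambda>m. g m t) \<longlonglongrightarrow> indicator (A R) t"
      proof (rule AE_I2)
        fix t
        show "(\<lambda>m. g m t) \<longlonglongrightarrow> indicator (A R) t"
        proof (cases "t \<in> A R")
          case True then show ?thesis by (simp add: g_def infdist_zero)
        next
          case False
          then have d: "0 < infdist t (A R)" using in_closed_iff_infdist_zero[OF closedA A_ne] R infdist_nonneg[of t "A R"]
            by (metis less_eq_real_def)
          obtain N where N: "1 / infdist t (A R) < real N" using reals_Archimedean2 by blast
          have "g m t = 0" if "N \<le> m" for m
          proof -
            have "1 / infdist t (A R) < real m" using N that by (metis less_le_trans of_nat_le_iff)
            then show ?thesis using d by (simp add: g_def field_simps)
          qed
          then have "\<forall>\<^sub>F m in sequentially. 0 = g m t" unfolding eventually_sequentially by (intro exI[of _ N]) auto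
          then show ?thesis using False by (auto intro: Lim_transform_eventually[OF tendsto_const])
        qed
      qed
    qed (use g01 in auto)
    ultimately have "1 - C / R\<^sup>2 \<le> (\<integral>t. indicator (A R) t \<partial>\<rho>)" by (intro LIMSEQ_le_const) auto
    then show ?thesis by simp
  qed
  define G where "G = (\<Union>n. A (real n))"
  have G [measurable]: "G \<in> sets borel" unfolding G_def by measurable
  have "measure \<rho> G = 1"
  proof (rule antisym)
    show "measure \<rho> G \<le> 1" by (rule \<rho>.prob_le_1)
    show "1 \<le> measure \<rho> G"
    proof (rule LIMSEQ_le_const2)
      have "(\<lambda>n. 1 - C * (inverse (real (Suc n)))\<^sup>2) \<longlonglongrightarrow> 1 - C * 0\<^sup>2"
        by (intro tendsto_intros LIMSEQ_inverse_real_of_nat)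
      then show "(\<lambda>n. 1 - C / (real (Suc n))\<^sup>2) \<longlonglongrightarrow> 1"
        by (simp add: field_simps power_divide)
      have "1 - C / (real (Suc n))\<^sup>2 \<le> measure \<rho> G" for n
      proof (rule order_trans[OF tail \<rho>.finite_measure_mono])
        show "A (real (Suc n)) \<subseteq> G" unfolding G_def by blast
      qed auto
      then show "\<exists>N. \<forall>n\<ge>N. 1 - C / (real (Suc n))\<^sup>2 \<le> measure \<rho> G" by blast
    qed
  qed
  then have AEG: "AE t in \<rho>. t \<in> G" by (subst \<rho>.AE_in_set_eq_1) auto
  define Q where "Q t y \<longleftrightarrow> y \<in> K \<and> (\<forall>k. schoenberg k t = exp (- (y \<bullet> u k)) / 2)" for t y
  \<comment> \<open>Decodes a parameter of the curve; outside the null complement of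
    \<open>G\<close> this is a point with the prescribed coordinates, and the default 0 also lies in
    the cone.\<close>
  define Y where "Y t = (if t \<in> G then SOME y. Q t y else 0)" for t
  have Y: "Y t \<in> K \<and> (\<forall>k. schoenberg k t = exp (- (Y t \<bullet> u k)) / 2)" if "t \<in> G" for t
  proof -
    have "\<exists>y. Q t y" using that by (auto simp: G_def A_def Q_def)
    then have "Q t (Y t)" using that unfolding Y_def by (simp add: someI_ex)
    then show ?thesis unfolding Q_def .
  qed
  have YK: "Y t \<in> K" for t using Y[of t] by (cases "t \<in> G") (auto simp: Y_def)
  have seq: "\<exists>\<kappa>. (\<lambda>n. u (\<kappa> n)) \<longlonglongrightarrow> v" if v: "v \<in> K" for v
  proof -
    have "\<forall>n. \<exists>k. norm (u k - v) < 1 / real (Suc n)" by (intro allI u(2)[OF v]) simp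
    then obtain \<kappa> where \<kappa>: "\<And>n. norm (u (\<kappa> n) - v) < 1 / real (Suc n)" by metis
    have "(\<lambda>n. u (\<kappa> n)) \<longlonglongrightarrow> v"
      by (rule tendsto_dist_iff[THEN iffD2], rule tendsto_sandwich[OF _ _ tendsto_const LIMSEQ_inverse_real_of_nat])
         (use \<kappa> in \<open>auto simp: inverse_eq_divide dist_norm intro!: always_eventually less_imp_le\<close>)
    then show ?thesis by blast
  qed
  \<comment> \<open>\<open>Y\<close> comes from a choice, but its pairings with the dense sequence
    are explicit functions of the curve, and weak measurability is enough.\<close>
  have Ym [measurable]: "Y \<in> borel_measurable borel"
  proof (rule borel_measurable_innerI)
    have "(\<lambda>t. Y t \<bullet> u k) = (\<lambda>t. if t \<in> G then - ln (2 * schoenberg k t) else 0)" for k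
    proof
      fix t
      show "Y t \<bullet> u k = (if t \<in> G then - ln (2 * schoenberg k t) else 0)"
      proof (cases "t \<in> G")
        case True
        then have "schoenberg k t = exp (- (Y t \<bullet> u k)) / 2" using Y by blast
        then have "2 * schoenberg k t = exp (- (Y t \<bullet> u k))" by simp
        then show ?thesis using True by (simp only: ln_exp if_True minus_minus)
      qed (simp add: Y_def)
    qed
    then have uk: "(\<lambda>t. Y t \<bullet> u k) \<in> borel_measurable borel" for k by simp
    have K: "(\<lambda>t. Y t \<bullet> v) \<in> borel_measurable borel" if v: "v \<in> K" for v
    proof -
      obtain \<kappa> where "(\<lambda>n. u (\<kappa> n)) \<longlonglongrightarrow> v" using seq[OF v] by blast
      then show ?thesis
        by (intro borel_measurable_LIMSEQ_real[OF _ uk]) (auto intro: tendsto_intros)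
    qed
    fix v :: 'a
    obtain x y where "x \<in> K" "y \<in> K" "v = x - y" by (rule cone_decomp)
    then show "(\<lambda>t. Y t \<bullet> v) \<in> borel_measurable borel" using K by (simp add: inner_diff_right)
  qed
  define q where "q = distr \<rho> borel Y"
  have qp: "prob_space q" unfolding q_def by (rule \<rho>.prob_space_distr) simp
  interpret q: prob_space q by (rule qp)
  have qs [measurable_cong, simp]: "sets q = sets borel" by (simp add: q_def)
  have qK: "AE y in q. y \<in> K" unfolding q_def by (subst AE_distr_iff) (auto simp: YK)
  have Lu: "(\<integral>y. exp (- (y \<bullet> u k)) \<partial>q) = \<Lambda> (u k)" for k
  proof -
    have "(\<integral>y. exp (- (y \<bullet> u k)) \<partial>q) = (\<integral>t. exp (- (Y t \<bullet> u k)) \<partial>\<rho>)"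
      unfolding q_def by (rule integral_distr) measurable
    also have "\<dots> = (\<integral>t. 2 * schoenberg k t \<partial>\<rho>)"
    proof (rule integral_cong_AE)
      show "AE t in \<rho>. exp (- (Y t \<bullet> u k)) = 2 * schoenberg k t"
        using AEG
      proof eventually_elim
        case (elim t)
        then have "schoenberg k t = exp (- (Y t \<bullet> u k)) / 2" using Y by blast
        then show ?case by simp
      qed
    qed measurable
    finally have e: "(\<integral>y. exp (- (y \<bullet> u k)) \<partial>q) = (\<integral>t. 2 * schoenberg k t \<partial>\<rho>)" .
    have l1: "(\<lambda>n. \<integral>y. 2 * schoenberg k (T y) \<partial>p (r n)) \<longlonglongrightarrow> (\<integral>t. 2 * schoenberg k t \<partial>\<rho>)"
      by (rule wconv[of _ 2]) (use schoenberg_bounds[of k] continuous_schoenberg[of k] in \<open>auto intro!: continuous_intros\<close>)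
    have l2: "(\<integral>y. 2 * schoenberg k (T y) \<partial>p (r n)) = (\<integral>y. exp (- (y \<bullet> u k)) \<partial>p (r n))" for n
      using integral_pr[OF p(2,3) measurable_exp_inner[of "u k"], of "r n"] by (simp add: ST a_def)
    have l3: "(\<lambda>n. \<integral>y. exp (- (y \<bullet> u k)) \<partial>p (r n)) \<longlonglongrightarrow> \<Lambda> (u k)"
      using LIMSEQ_subseq_LIMSEQ[OF conv[OF u(1)[of k]] r] by (simp add: comp_def)
    have "(\<integral>t. 2 * schoenberg k t \<partial>\<rho>) = \<Lambda> (u k)"
      by (rule LIMSEQ_unique[OF l1[unfolded l2] l3])
    then show ?thesis using e by simp
  qed
  \<comment> \<open>The moment bound makes \<open>\<Lambda>\<close> Lipschitz on the cone, so
    agreement on the dense sequence extends to every \<open>v\<close>.\<close>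
  have Lip: "\<bar>\<Lambda> v - \<Lambda> w\<bar> \<le> (1 + C) * norm (v - w)" if vw: "v \<in> K" "w \<in> K" for v w
  proof (rule LIMSEQ_le_const2)
    show "(\<lambda>n. \<bar>(\<integral>y. exp (- (y \<bullet> v)) \<partial>p n) - (\<integral>y. exp (- (y \<bullet> w)) \<partial>p n)\<bar>) \<longlonglongrightarrow> \<bar>\<Lambda> v - \<Lambda> w\<bar>"
      by (intro tendsto_intros conv vw)
    have "\<bar>(\<integral>y. exp (- (y \<bullet> v)) \<partial>p n) - (\<integral>y. exp (- (y \<bullet> w)) \<partial>p n)\<bar> \<le> (1 + C) * norm (v - w)" for n
    proof -
      have int2: "integrable (p n) (\<lambda>y. (norm y)\<^sup>2)"
        using le_less_trans[OF moment[of n]] by (intro integrableI_bounded) auto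
      have i2: "(\<integral>y. (norm y)\<^sup>2 \<partial>p n) \<le> C"
        using moment[of n] C by (subst integral_eq_nn_integral) (auto intro!: enn2real_leI)
      have ie: "integrable (p n) (\<lambda>y. exp (- (y \<bullet> v)))" if "v \<in> K" for v
      proof (rule p.integrable_const_bound[of _ 1])
        show "AE y in p n. norm (exp (- (y \<bullet> v))) \<le> 1"
          using p(3)[of n] by eventually_elim (use that in \<open>auto intro: inner_nonneg\<close>)
      qed measurable
      have "\<bar>(\<integral>y. exp (- (y \<bullet> v)) \<partial>p n) - (\<integral>y. exp (- (y \<bullet> w)) \<partial>p n)\<bar> = \<bar>\<integral>y. exp (- (y \<bullet> v)) - exp (- (y \<bullet> w)) \<partial>p n\<bar>"
        using ie vw by simp
      also have "\<dots> \<le> (\<integral>y. \<bar>exp (- (y \<bullet> v)) - exp (- (y \<bullet> w))\<bar> \<partial>p n)"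
        by (rule integral_abs_bound)
      also have "\<dots> \<le> (\<integral>y. (1 + (norm y)\<^sup>2) * norm (v - w) \<partial>p n)"
      proof (rule integral_mono_AE)
        show "AE y in p n. \<bar>exp (- (y \<bullet> v)) - exp (- (y \<bullet> w))\<bar> \<le> (1 + (norm y)\<^sup>2) * norm (v - w)"
          using p(3)[of n]
        proof eventually_elim
          case (elim y)
          have "\<bar>exp (- (y \<bullet> v)) - exp (- (y \<bullet> w))\<bar> \<le> \<bar>y \<bullet> v - y \<bullet> w\<bar>"
            by (intro exp_minus_lipschitz inner_nonneg elim vw)
          also have "\<dots> \<le> norm y * norm (v - w)"
            using Cauchy_Schwarz_ineq2[of y "v - w"] by (simp add: inner_diff_right)
          also have "\<dots> \<le> (1 + (norm y)\<^sup>2) * norm (v - w)"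
            using le_one_plus_square by (intro mult_right_mono) auto
          finally show ?case .
        qed
      qed (use ie vw int2 in auto)
      also have "\<dots> = (1 + (\<integral>y. (norm y)\<^sup>2 \<partial>p n)) * norm (v - w)"
        using int2 by (simp add: p.prob_space)
      also have "\<dots> \<le> (1 + C) * norm (v - w)" using i2 by (intro mult_right_mono) auto
      finally show ?thesis .
    qed
    then show "\<exists>N. \<forall>n\<ge>N. \<bar>(\<integral>y. exp (- (y \<bullet> v)) \<partial>p n) - (\<integral>y. exp (- (y \<bullet> w)) \<partial>p n)\<bar> \<le> (1 + C) * norm (v - w)" by blast
  qed
  have "(\<integral>y. exp (- (y \<bullet> v)) \<partial>q) = \<Lambda> v" if v: "v \<in> K" for v
  proof -
    obtain \<kappa> where \<kappa>: "(\<lambda>n. u (\<kappa> n)) \<longlonglongrightarrow> v" using seq[OF v] by blast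
    have "(\<lambda>n. \<integral>y. exp (- (y \<bullet> u (\<kappa> n))) \<partial>q) \<longlonglongrightarrow> (\<integral>y. exp (- (y \<bullet> v)) \<partial>q)"
    proof (rule integral_dominated_convergence[where w = "\<lambda>_. 1"])
      show "AE y in q. (\<lambda>n. exp (- (y \<bullet> u (\<kappa> n)))) \<longlonglongrightarrow> exp (- (y \<bullet> v))"
        by (intro AE_I2 tendsto_intros \<kappa>)
      show "AE y in q. norm (exp (- (y \<bullet> u (\<kappa> n)))) \<le> 1" for n
        using qK by eventually_elim (use u(1) in \<open>auto intro: inner_nonneg\<close>)
    qed measurable
    moreover have "(\<lambda>n. \<Lambda> (u (\<kappa> n))) \<longlonglongrightarrow> \<Lambda> v"
    proof (rule tendsto_dist_iff[THEN iffD2], rule tendsto_sandwich[OF _ _ tendsto_const])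
      have "(\<lambda>n. (1 + C) * norm (u (\<kappa> n) - v)) \<longlonglongrightarrow> (1 + C) * norm (v - v)"
        by (intro tendsto_intros \<kappa>)
      then show "(\<lambda>n. (1 + C) * norm (u (\<kappa> n) - v)) \<longlonglongrightarrow> 0" by simp
      show "\<forall>\<^sub>F n in sequentially. dist (\<Lambda> (u (\<kappa> n))) (\<Lambda> v) \<le> (1 + C) * norm (u (\<kappa> n) - v)"
        using Lip u(1) v by (auto simp: dist_real_def)
    qed simp
    ultimately show ?thesis unfolding Lu by (rule LIMSEQ_unique)
  qed
  then show ?thesis using qp qK by (intro exI[of _ q]) auto
qed

end

section \<open>The generalized Riccati equations\<close>

text \<open>The truncation function on an abstract space; \<open>trunc_eq_cutoff\<close> identifies
  it with \<open>trunc\<close>.\<close>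

definition cutoff :: "'a::real_normed_vector \<Rightarrow> 'a" where
  "cutoff \<xi> = indicator {\<xi>. norm \<xi> \<le> 1} \<xi> *\<^sub>R \<xi>"

lemma cutoff_simps: "norm \<xi> \<le> 1 \<Longrightarrow> cutoff \<xi> = \<xi>" "1 < norm \<xi> \<Longrightarrow> cutoff \<xi> = 0"
  by (auto simp: cutoff_def)

text \<open>The derivative of \<open>exp (- s) - 1 + s\<close> is at most \<open>s\<close>, so
  differences are of second order at the origin; the compensated jump integrand inherits
  this.\<close>

lemma exp_taylor_lipschitz:
  fixes s t :: real
  assumes st: "0 \<le> s" "0 \<le> t"
  shows "\<bar>(exp (- s) - 1 + s) - (exp (- t) - 1 + t)\<bar> \<le> (s + t) * \<bar>s - t\<bar>"
proof -
  have *: "\<bar>(exp (- s) - 1 + s) - (exp (- t) - 1 + t)\<bar> \<le> t * (t - s)" if st: "0 \<le> s" "s \<le> t" for s t :: real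
  proof -
    have "1 - t \<le> exp (- t)" using exp_ge_add_one_self[of "- t"] by simp
    then have "(1 - t) * (t - s) \<le> exp (- t) * (t - s)" using st by (intro mult_right_mono) auto
    also have "exp (- t) * (t - s) \<le> exp (- s) - exp (- t)"
    proof -
      have "exp (- t) * (1 + (t - s)) \<le> exp (- t) * exp (t - s)"
        using exp_ge_add_one_self[of "t - s"] by (intro mult_left_mono) auto
      then show ?thesis by (simp add: algebra_simps flip: exp_add)
    qed
    finally have "(1 - t) * (t - s) \<le> exp (- s) - exp (- t)" .
    moreover have "exp (- s) - exp (- t) \<le> t - s" using exp_minus_lipschitz[of s t] st by auto
    moreover have "0 \<le> t * (t - s)" using st by simp
    ultimately show ?thesis by (simp add: algebra_simps abs_le_iff)
  qed
  have mono: "t * (t - s) \<le> (s + t) * \<bar>s - t\<bar>" if "0 \<le> s" "s \<le> t" for s t :: real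
    using that by (intro mult_mono) auto
  show ?thesis
  proof (cases "s \<le> t")
    case True
    then show ?thesis using *[OF st(1) True] mono[OF st(1) True] by linarith
  next
    case False
    then have "t \<le> s" by simp
    from *[OF st(2) this] mono[OF st(2) this] show ?thesis
      by (simp add: abs_minus_commute add.commute)
  qed
qed

definition compensated :: "'a::real_inner \<Rightarrow> 'a \<Rightarrow> real" where
  "compensated \<xi> v = exp (- (\<xi> \<bullet> v)) - 1 + cutoff \<xi> \<bullet> v"

text \<open>Admissibility for a self-dual cone in a separable Hilbert space. For cone elements
  \<open>x\<close> the signed integrals are integrals against the positive measure
  \<open>scal x\<close>, and they are written that way here.\<close>

locale affine_parameters = polish_cone K + cone_vector_measure K "restrict_space borel (K - {0})" \<mu>
  for K :: "'a::{real_inner,banach,polish_space} set" and \<mu> :: "'a set \<Rightarrow> 'a" +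
  fixes b :: 'a and B :: "'a \<Rightarrow>\<^sub>L 'a" and m :: "'a measure"
  assumes sets_m [measurable_cong]: "sets m = sets (restrict_space borel (K - {0}))"
    and second_moment_m: "(\<integral>\<^sup>+\<xi>. ennreal ((norm \<xi>)\<^sup>2) \<partial>m) < \<infinity>"
    and cutoff_integrable_m: "(\<integral>\<^sup>+\<xi>. ennreal \<bar>cutoff \<xi> \<bullet> h\<bar> \<partial>m) < \<infinity>"
    and drift_b: "v \<in> K \<Longrightarrow> 0 \<le> b \<bullet> v - (\<integral>\<xi>. cutoff \<xi> \<bullet> v \<partial>m)"
    and cutoff_integrable_scal: "u \<in> K \<Longrightarrow> x \<in> K \<Longrightarrow> u \<bullet> x = 0 \<Longrightarrow>
      integrable (scal x) (\<lambda>\<xi>. (cutoff \<xi> \<bullet> u) / (norm \<xi>)\<^sup>2)"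
    and drift_B: "u \<in> K \<Longrightarrow> x \<in> K \<Longrightarrow> u \<bullet> x = 0 \<Longrightarrow>
      0 \<le> adjoint (blinfun_apply B) u \<bullet> x - (\<integral>\<xi>. (cutoff \<xi> \<bullet> u) / (norm \<xi>)\<^sup>2 \<partial>scal x)"
begin

abbreviation S :: "'a measure" where "S \<equiv> restrict_space borel (K - {0})"

abbreviation Bs :: "'a \<Rightarrow> 'a" where "Bs \<equiv> adjoint (blinfun_apply B)"

lemma space_S: "space S = K - {0}" by (simp add: space_restrict_space)

lemma S_sets [simp]: "K - {0} \<in> sets S"
  using sets.top[of S] unfolding space_S .

lemma space_m [simp]: "space m = K - {0}"
  using sets_eq_imp_space_eq[OF sets_m] by (simp add: space_S)

lemma in_S: "\<xi> \<in> space S \<Longrightarrow> \<xi> \<in> K" "\<xi> \<in> space S \<Longrightarrow> \<xi> \<noteq> 0" "\<xi> \<in> space S \<Longrightarrow> 0 < norm \<xi>"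
  by (auto simp: space_S)

lemma measurable_S: "f \<in> borel_measurable borel \<Longrightarrow> f \<in> borel_measurable S"
  by (rule measurable_restrict_space1)

lemma measurable_m: "f \<in> borel_measurable S \<Longrightarrow> f \<in> borel_measurable m"
  by (simp cong: measurable_cong_sets add: sets_m)

lemma measurable_cutoff [measurable]: "(cutoff :: 'a \<Rightarrow> 'a) \<in> borel_measurable borel"
  unfolding cutoff_def[abs_def] by measurable

lemma measurable_compensated [measurable]: "(\<lambda>\<xi>. compensated \<xi> (v :: 'a)) \<in> borel_measurable borel"
  unfolding compensated_def by measurable

lemma Bs_inner: "Bs v \<bullet> x = blinfun_apply B x \<bullet> v"
  using adjoint_bounded_linear_works[OF blinfun.bounded_linear_right, of B x v] by (simp add: inner_commute)

lemma bounded_linear_Bs: "bounded_linear Bs" and norm_Bs: "norm (Bs v) \<le> norm B * norm v"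
  using adjoint_bounded_linear[OF blinfun.bounded_linear_right, of B] by (simp_all add: norm_blinfun.rep_eq)

text \<open>
  Weighting \<open>m\<close> by the squared norm makes it finite, so that both jump measures enter through
  the finite measure \<open>sig x\<close>, divided by the squared norm.
\<close>

definition m2 :: "'a measure" where
  "m2 = density m (\<lambda>\<xi>. ennreal ((norm \<xi>)\<^sup>2))"

lemma sets_m2 [simp, measurable_cong]: "sets m2 = sets S"
  by (simp add: m2_def sets_m)

lemma space_m2 [simp]: "space m2 = space S"
  by (rule sets_eq_imp_space_eq) simp

lemma measurable_norm_m [measurable]: "norm \<in> borel_measurable m"
  by (rule measurable_m) (rule measurable_S, measurable)

lemma finite_m2: "finite_measure m2"
proof (rule finite_measureI)
  have "emeasure m2 (space m2) = (\<integral>\<^sup>+\<xi>. ennreal ((norm \<xi>)\<^sup>2) * indicator (space m) \<xi> \<partial>m)"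
    unfolding space_m2 m2_def by (subst emeasure_density) (auto simp: space_S sets_m intro: sets.top)
  also have "\<dots> = (\<integral>\<^sup>+\<xi>. ennreal ((norm \<xi>)\<^sup>2) \<partial>m)" by (intro nn_integral_cong) simp
  finally show "emeasure m2 (space m2) \<noteq> \<infinity>" using second_moment_m by simp
qed

lemma integral_m2:
  assumes f: "f \<in> borel_measurable S"
  shows "(\<integral>\<xi>. f \<xi> / (norm \<xi>)\<^sup>2 \<partial>m2) = (\<integral>\<xi>. f \<xi> \<partial>m)"
    and "integrable m2 (\<lambda>\<xi>. f \<xi> / (norm \<xi>)\<^sup>2) \<longleftrightarrow> integrable m f"
proof -
  have [measurable]: "f \<in> borel_measurable m" using f by (rule measurable_m)
  have "(\<integral>\<xi>. f \<xi> / (norm \<xi>)\<^sup>2 \<partial>m2) = (\<integral>\<xi>. (norm \<xi>)\<^sup>2 *\<^sub>R (f \<xi> / (norm \<xi>)\<^sup>2) \<partial>m)"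
    unfolding m2_def by (rule integral_density) auto
  also have "\<dots> = (\<integral>\<xi>. f \<xi> \<partial>m)" by (intro Bochner_Integration.integral_cong) auto
  finally show "(\<integral>\<xi>. f \<xi> / (norm \<xi>)\<^sup>2 \<partial>m2) = (\<integral>\<xi>. f \<xi> \<partial>m)" .
  have "integrable m2 (\<lambda>\<xi>. f \<xi> / (norm \<xi>)\<^sup>2) \<longleftrightarrow> integrable m (\<lambda>\<xi>. (norm \<xi>)\<^sup>2 *\<^sub>R (f \<xi> / (norm \<xi>)\<^sup>2))"
    unfolding m2_def by (rule integrable_density) auto
  also have "\<dots> \<longleftrightarrow> integrable m f" by (intro Bochner_Integration.integrable_cong) auto
  finally show "integrable m2 (\<lambda>\<xi>. f \<xi> / (norm \<xi>)\<^sup>2) \<longleftrightarrow> integrable m f" .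
qed

definition sig :: "'a \<Rightarrow> 'a measure" where
  "sig x = add_measure m2 (scal x)"

lemma sets_sig [simp, measurable_cong]: "sets (sig x) = sets S" by (simp add: sig_def)

lemma space_sig [simp]: "space (sig x) = space S" by (simp add: sig_def)

lemma measurable_sig [simp]: "measurable (sig x) N = measurable S N"
  by (rule measurable_cong_sets) simp_all

text \<open>Bounds the measure of \<open>A\<close> under every \<open>sig x\<close> up to the factor
  \<open>1 + norm x\<close>. Because of the norm it need not be additive in
  \<open>A\<close>.\<close>

definition mass :: "'a set \<Rightarrow> real" where
  "mass A = measure m2 A + norm (\<mu> A)"

definition total :: real where "total = mass (space S)"

lemma mass_nonneg: "0 \<le> mass A" by (simp add: mass_def)

lemma finite_sig: "x \<in> K \<Longrightarrow> finite_measure (sig x)"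
  using finite_measure.emeasure_finite[OF finite_m2] finite_measure.emeasure_finite[OF finite_scal]
  by (intro finite_measureI) (simp add: sig_def emeasure_add_measure)

lemma measure_sig_le: "x \<in> K \<Longrightarrow> A \<in> sets S \<Longrightarrow> measure (sig x) A \<le> mass A * (1 + norm x)"
proof -
  assume x: "x \<in> K" and A: "A \<in> sets S"
  interpret s: finite_measure "scal x" by (rule finite_scal[OF x])
  interpret m2: finite_measure m2 by (rule finite_m2)
  have "measure (sig x) A = measure m2 A + measure (scal x) A"
    unfolding measure_def sig_def using A
    by (simp add: emeasure_add_measure m2.emeasure_eq_measure s.emeasure_eq_measure flip: ennreal_plus)
  also have "measure (scal x) A \<le> norm (\<mu> A) * norm x"
    using A x by (simp add: measure_scal norm_cauchy_schwarz)
  finally have "measure (sig x) A \<le> measure m2 A * 1 + norm (\<mu> A) * norm x" by simp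
  also have "\<dots> \<le> measure m2 A * (1 + norm x) + norm (\<mu> A) * (1 + norm x)"
    by (intro add_mono mult_left_mono) auto
  finally show ?thesis by (simp add: mass_def distrib_right)
qed

lemma bdd_measurable_m2: "bdd_measurable f \<Longrightarrow> integrable m2 f"
  unfolding bdd_measurable_def by (auto intro!: integrable_bounded[OF finite_m2] simp: measurable_cong_sets[OF sets_m2 refl])

lemma bdd_measurable_sig: "bdd_measurable f \<Longrightarrow> x \<in> K \<Longrightarrow> integrable (sig x) f"
  unfolding sig_def by (subst integrable_add_measure) (auto simp: bdd_measurable_m2 bdd_measurable_integrable)

lemma integral_sig:
  "bdd_measurable f \<Longrightarrow> x \<in> K \<Longrightarrow> (\<integral>\<xi>. f \<xi> \<partial>sig x) = (\<integral>\<xi>. f \<xi> \<partial>m2) + wint f \<bullet> x"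
  unfolding sig_def by (subst integral_add_measure) (auto simp: bdd_measurable_m2 bdd_measurable_integrable wint_inner)

lemma integral_sig_bound:
  assumes f: "f \<in> borel_measurable S" "\<And>\<xi>. \<xi> \<in> space S \<Longrightarrow> \<bar>f \<xi>\<bar> \<le> C * indicator A \<xi>"
    and A: "A \<in> sets S" and C: "0 \<le> C" and x: "x \<in> K"
  shows "\<bar>\<integral>\<xi>. f \<xi> \<partial>sig x\<bar> \<le> C * mass A * (1 + norm x)"
proof -
  interpret finite_measure "sig x" by (rule finite_sig[OF x])
  have bf: "bdd_measurable f"
  proof (rule bdd_measurableI[of _ C])
    fix \<xi> assume "\<xi> \<in> space S"
    from f(2)[OF this] have "\<bar>f \<xi>\<bar> \<le> C * indicator A \<xi>" .
    also have "\<dots> \<le> C" using C by (auto simp: indicator_def)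
    finally show "\<bar>f \<xi>\<bar> \<le> C" .
  qed (rule f)
  have "\<bar>\<integral>\<xi>. f \<xi> \<partial>sig x\<bar> \<le> (\<integral>\<xi>. C * indicator A \<xi> \<partial>sig x)"
    using f(2) x A bdd_measurable_sig[OF bf x]
    by (intro order_trans[OF integral_abs_bound] integral_mono)
       (auto intro!: integrable_mult_right integrable_real_indicator simp: emeasure_finite less_top[symmetric])
  also have "\<dots> = C * measure (sig x) A"
    using A sets.sets_into_space[OF A] by (simp add: Int_absorb2)
  also have "\<dots> \<le> C * (mass A * (1 + norm x))" by (intro mult_left_mono measure_sig_le x A C)
  finally show ?thesis by (simp add: mult.assoc)
qed

lemma integral_sig_bound_total:
  assumes f: "f \<in> borel_measurable S" "\<And>\<xi>. \<xi> \<in> space S \<Longrightarrow> \<bar>f \<xi>\<bar> \<le> C" and C: "0 \<le> C" and x: "x \<in> K"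
  shows "\<bar>\<integral>\<xi>. f \<xi> \<partial>sig x\<bar> \<le> C * total * (1 + norm x)"
  unfolding total_def by (rule integral_sig_bound) (use assms in auto)

text \<open>Small jumps are compensated and give a second-order estimate; large jumps are not, but
  for them \<open>norm \<xi>\<close> is at most its square. In both cases the squared norm factors
  out, and the quotient is bounded in \<xi>.\<close>

lemma compensated_lipschitz:
  assumes K: "\<xi> \<in> K" "v \<in> K" "w \<in> K"
  shows "\<bar>compensated \<xi> v - compensated \<xi> w\<bar> \<le> (norm \<xi>)\<^sup>2 * ((1 + norm v + norm w) * norm (v - w))"
proof -
  have nn: "0 \<le> \<xi> \<bullet> v" "0 \<le> \<xi> \<bullet> w" using K by (auto intro: inner_nonneg)
  have d: "\<bar>\<xi> \<bullet> v - \<xi> \<bullet> w\<bar> \<le> norm \<xi> * norm (v - w)"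
    using Cauchy_Schwarz_ineq2[of \<xi> "v - w"] by (simp add: inner_diff_right)
  show ?thesis
  proof (cases "norm \<xi> \<le> 1")
    case True
    have "\<bar>compensated \<xi> v - compensated \<xi> w\<bar> \<le> (\<xi> \<bullet> v + \<xi> \<bullet> w) * \<bar>\<xi> \<bullet> v - \<xi> \<bullet> w\<bar>"
      using exp_taylor_lipschitz[OF nn] True by (simp add: compensated_def cutoff_simps)
    also have "\<dots> \<le> (norm \<xi> * norm v + norm \<xi> * norm w) * (norm \<xi> * norm (v - w))"
      using nn d by (intro mult_mono add_mono norm_cauchy_schwarz) auto
    also have "\<dots> = (norm \<xi>)\<^sup>2 * ((norm v + norm w) * norm (v - w))"
      by (simp add: power2_eq_square algebra_simps)
    also have "\<dots> \<le> (norm \<xi>)\<^sup>2 * ((1 + norm v + norm w) * norm (v - w))"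
      by (intro mult_left_mono mult_right_mono) auto
    finally show ?thesis .
  next
    case False
    have "\<bar>compensated \<xi> v - compensated \<xi> w\<bar> \<le> \<bar>\<xi> \<bullet> v - \<xi> \<bullet> w\<bar>"
      using exp_minus_lipschitz[OF nn] False by (simp add: compensated_def cutoff_simps)
    also have "\<dots> \<le> norm \<xi> * norm (v - w)" by (rule d)
    also have "\<dots> \<le> (norm \<xi>)\<^sup>2 * ((1 + norm v + norm w) * norm (v - w))"
    proof (rule mult_mono)
      show "norm \<xi> \<le> (norm \<xi>)\<^sup>2" using False self_le_power[of "norm \<xi>" 2] by simp
      show "norm (v - w) \<le> (1 + norm v + norm w) * norm (v - w)"
        using mult_right_mono[of 1 "1 + norm v + norm w" "norm (v - w)"] by simp
    qed auto
    finally show ?thesis .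
  qed
qed

lemma compensated_bound:
  assumes "\<xi> \<in> K" "v \<in> K"
  shows "\<bar>compensated \<xi> v\<bar> \<le> (norm \<xi>)\<^sup>2 * ((1 + norm v) * norm v)"
  using compensated_lipschitz[OF assms cone_zero] by (simp add: compensated_def)

lemma bdd_compensated:
  assumes v: "v \<in> K"
  shows "bdd_measurable (\<lambda>\<xi>. compensated \<xi> v / (norm \<xi>)\<^sup>2)"
proof (rule bdd_measurableI)
  show "(\<lambda>\<xi>. compensated \<xi> v / (norm \<xi>)\<^sup>2) \<in> borel_measurable S"
    by (rule measurable_S) measurable
  fix \<xi> assume \<xi>: "\<xi> \<in> space S"
  show "\<bar>compensated \<xi> v / (norm \<xi>)\<^sup>2\<bar> \<le> (1 + norm v) * norm v"
    using compensated_bound[OF in_S(1)[OF \<xi>] v] in_S(3)[OF \<xi>] by (simp add: divide_le_eq mult.commute)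
qed

section \<open>The Riccati fields and their estimates\<close>

definition R :: "'a \<Rightarrow> 'a" where
  "R v = Bs v - wint (\<lambda>\<xi>. compensated \<xi> v / (norm \<xi>)\<^sup>2)"

definition F :: "'a \<Rightarrow> real" where
  "F v = b \<bullet> v - (\<integral>\<xi>. compensated \<xi> v \<partial>m)"

lemma F_eq: "F v = b \<bullet> v - (\<integral>\<xi>. compensated \<xi> v / (norm \<xi>)\<^sup>2 \<partial>m2)"
  unfolding F_def by (subst integral_m2(1)) (auto intro: measurable_S)

text \<open>The left side is minus the generator applied to \<open>exp (- (x \<bullet> v))\<close>,
  divided by that exponential. Both jump measures merge into \<open>sig x\<close>.\<close>

lemma generator_eq:
  assumes "v \<in> K" "x \<in> K"
  shows "F v + R v \<bullet> x = b \<bullet> v + Bs v \<bullet> x - (\<integral>\<xi>. compensated \<xi> v / (norm \<xi>)\<^sup>2 \<partial>sig x)"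
  using assms by (simp add: F_eq R_def inner_diff_left integral_sig bdd_compensated)

text \<open>One constant dominating all coefficients; the summand 1 lets it absorb numerical
  constants, as in the moment estimate.\<close>

definition A0 :: real where "A0 = 1 + norm b + norm B + total"

lemma A0_ge: "1 \<le> A0" "norm b \<le> A0" "norm B \<le> A0" "total \<le> A0" "norm b + norm B + total \<le> A0"
  using mass_nonneg[of "space S"] by (auto simp: A0_def total_def)

lemma norm_mu_le: "norm (\<mu> (space S)) \<le> total" "measure m2 (space S) \<le> total"
  by (auto simp: total_def mass_def)

lemma compensated_diff_bound:
  assumes vw: "v \<in> K" "w \<in> K" and \<xi>: "\<xi> \<in> space S"
  shows "\<bar>compensated \<xi> v / (norm \<xi>)\<^sup>2 - compensated \<xi> w / (norm \<xi>)\<^sup>2\<bar> \<le> (1 + norm v + norm w) * norm (v - w)"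
proof -
  have "\<bar>compensated \<xi> v / (norm \<xi>)\<^sup>2 - compensated \<xi> w / (norm \<xi>)\<^sup>2\<bar> = \<bar>compensated \<xi> v - compensated \<xi> w\<bar> / (norm \<xi>)\<^sup>2"
    by (simp flip: diff_divide_distrib)
  also have "\<dots> \<le> (1 + norm v + norm w) * norm (v - w)"
    using compensated_lipschitz[OF in_S(1)[OF \<xi>] vw] in_S(3)[OF \<xi>] by (simp add: divide_le_eq mult.commute)
  finally show ?thesis .
qed

lemma R_lipschitz:
  assumes vw: "v \<in> K" "w \<in> K"
  shows "norm (R v - R w) \<le> A0 * (1 + norm v + norm w) * norm (v - w)"
proof -
  let ?c = "\<lambda>v \<xi>. compensated \<xi> v / (norm \<xi>)\<^sup>2"
  have "R v - R w = Bs (v - w) - wint (\<lambda>\<xi>. ?c v \<xi> - ?c w \<xi>)"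
    using vw by (simp add: R_def wint_diff bdd_compensated linear_diff[OF bounded_linear.linear[OF bounded_linear_Bs]])
  also have "norm \<dots> \<le> norm (Bs (v - w)) + norm (wint (\<lambda>\<xi>. ?c v \<xi> - ?c w \<xi>))" by (rule norm_triangle_ineq4)
  also have "norm (Bs (v - w)) \<le> norm B * ((1 + norm v + norm w) * norm (v - w))"
    using mult_right_mono[of 1 "1 + norm v + norm w" "norm (v - w)"]
    by (intro order_trans[OF norm_Bs] mult_left_mono) auto
  also have "norm (wint (\<lambda>\<xi>. ?c v \<xi> - ?c w \<xi>)) \<le> ((1 + norm v + norm w) * norm (v - w)) * norm (\<mu> (space S))"
  proof (rule wint_norm_le)
    show "(\<lambda>\<xi>. ?c v \<xi> - ?c w \<xi>) \<in> borel_measurable S" by (rule measurable_S) measurable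
  qed (use compensated_diff_bound[OF vw] in auto)
  also have "norm B * ((1 + norm v + norm w) * norm (v - w)) + ((1 + norm v + norm w) * norm (v - w)) * norm (\<mu> (space S))
      = (norm B + norm (\<mu> (space S))) * ((1 + norm v + norm w) * norm (v - w))" by (simp add: algebra_simps)
  also have "\<dots> \<le> A0 * ((1 + norm v + norm w) * norm (v - w))"
  proof (rule mult_right_mono)
    show "norm B + norm (\<mu> (space S)) \<le> A0"
      using norm_mu_le(1) A0_ge(5) norm_ge_zero[of b] by linarith
  qed simp
  finally show ?thesis by (simp add: mult.assoc add_mono)
qed

lemma F_lipschitz:
  assumes vw: "v \<in> K" "w \<in> K"
  shows "\<bar>F v - F w\<bar> \<le> A0 * (1 + norm v + norm w) * norm (v - w)"
proof -
  let ?c = "\<lambda>v \<xi>. compensated \<xi> v / (norm \<xi>)\<^sup>2"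
  interpret m2: finite_measure m2 by (rule finite_m2)
  have "F v - F w = b \<bullet> (v - w) - (\<integral>\<xi>. ?c v \<xi> - ?c w \<xi> \<partial>m2)"
    using vw by (simp add: F_eq inner_diff_right bdd_measurable_m2 bdd_compensated)
  also have "\<bar>\<dots>\<bar> \<le> \<bar>b \<bullet> (v - w)\<bar> + \<bar>\<integral>\<xi>. ?c v \<xi> - ?c w \<xi> \<partial>m2\<bar>" by (rule abs_triangle_ineq4)
  also have "\<bar>b \<bullet> (v - w)\<bar> \<le> norm b * ((1 + norm v + norm w) * norm (v - w))"
    using mult_right_mono[of 1 "1 + norm v + norm w" "norm (v - w)"]
    by (intro order_trans[OF Cauchy_Schwarz_ineq2] mult_left_mono) auto
  also have "\<bar>\<integral>\<xi>. ?c v \<xi> - ?c w \<xi> \<partial>m2\<bar> \<le> (\<integral>\<xi>. (1 + norm v + norm w) * norm (v - w) \<partial>m2)"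
  proof (rule order_trans[OF integral_abs_bound integral_mono])
    show "integrable m2 (\<lambda>\<xi>. \<bar>?c v \<xi> - ?c w \<xi>\<bar>)"
      by (intro integrable_abs Bochner_Integration.integrable_diff bdd_measurable_m2 bdd_compensated vw)
  qed (use compensated_diff_bound[OF vw] in auto)
  also have "\<dots> = measure m2 (space S) * ((1 + norm v + norm w) * norm (v - w))" by simp
  also have "norm b * ((1 + norm v + norm w) * norm (v - w)) + measure m2 (space S) * ((1 + norm v + norm w) * norm (v - w))
      = (norm b + measure m2 (space S)) * ((1 + norm v + norm w) * norm (v - w))" by (simp add: algebra_simps)
  also have "\<dots> \<le> A0 * ((1 + norm v + norm w) * norm (v - w))"
  proof (rule mult_right_mono)
    show "norm b + measure m2 (space S) \<le> A0"
      using norm_mu_le(2) A0_ge(5) norm_ge_zero[of B] by linarith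
  qed simp
  finally show ?thesis by (simp add: mult.assoc)
qed

lemma cutoff_inner_nonneg: "\<xi> \<in> K \<Longrightarrow> v \<in> K \<Longrightarrow> 0 \<le> cutoff \<xi> \<bullet> v"
  by (auto simp: cutoff_def indicator_def intro: inner_nonneg)

lemma cutoff_integrable_m': "integrable m (\<lambda>\<xi>. cutoff \<xi> \<bullet> v)"
proof (rule integrableI_bounded)
  show "(\<lambda>\<xi>. cutoff \<xi> \<bullet> v) \<in> borel_measurable m" by (intro measurable_m measurable_S) measurable
qed (use cutoff_integrable_m[of v] in simp)

text \<open>As \<open>exp (- s) - 1\<close> is nonpositive, the compensated integrand lies below the
  pure compensator, whose integral is bounded by the linear part. That integral is assumed finite
  for orthogonal \<open>v\<close> and \<open>x\<close>, exactly the case at hand.\<close>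

lemma R_quasi_positive:
  assumes v: "v \<in> K" and x: "x \<in> K" and o: "v \<bullet> x = 0"
  shows "0 \<le> R v \<bullet> x"
proof -
  have i: "integrable (scal x) (\<lambda>\<xi>. cutoff \<xi> \<bullet> v / (norm \<xi>)\<^sup>2)" by (rule cutoff_integrable_scal[OF v x o])
  have "(\<integral>\<xi>. compensated \<xi> v / (norm \<xi>)\<^sup>2 \<partial>scal x) \<le> (\<integral>\<xi>. cutoff \<xi> \<bullet> v / (norm \<xi>)\<^sup>2 \<partial>scal x)"
  proof (rule integral_mono)
    fix \<xi> assume "\<xi> \<in> space (scal x)"
    then have "0 \<le> \<xi> \<bullet> v" using v by (auto intro: inner_nonneg simp: space_S)
    then show "compensated \<xi> v / (norm \<xi>)\<^sup>2 \<le> cutoff \<xi> \<bullet> v / (norm \<xi>)\<^sup>2"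
      by (intro divide_right_mono) (auto simp: compensated_def)
  qed (use i bdd_measurable_integrable[OF bdd_compensated[OF v] x] in auto)
  then show ?thesis using drift_B[OF v x o] x v by (simp add: R_def inner_diff_left wint_inner bdd_compensated)
qed

lemma F_nonneg:
  assumes v: "v \<in> K"
  shows "0 \<le> F v"
proof -
  have "integrable m (\<lambda>\<xi>. compensated \<xi> v)"
    using bdd_measurable_m2[OF bdd_compensated[OF v]] integral_m2(2)[OF measurable_S[OF measurable_compensated]] by simp
  then have "(\<integral>\<xi>. compensated \<xi> v \<partial>m) \<le> (\<integral>\<xi>. cutoff \<xi> \<bullet> v \<partial>m)"
    using v by (intro integral_mono cutoff_integrable_m') (auto simp: compensated_def intro: inner_nonneg)
  then show ?thesis using drift_b[OF v] by (simp add: F_def)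
qed

text \<open>Small jumps contribute a nonnegative convex remainder, large ones at least -1, and
  division by a squared norm above 1 does not make this worse.\<close>

lemma compensated_lower: "\<xi> \<in> space S \<Longrightarrow> v \<in> K \<Longrightarrow> - 1 \<le> compensated \<xi> v / (norm \<xi>)\<^sup>2"
proof -
  assume \<xi>: "\<xi> \<in> space S" and v: "v \<in> K"
  have n: "0 < norm \<xi>" "0 \<le> \<xi> \<bullet> v" using in_S[OF \<xi>] v by (auto intro: inner_nonneg)
  have "- (norm \<xi>)\<^sup>2 \<le> compensated \<xi> v"
  proof (cases "norm \<xi> \<le> 1")
    case True
    then show ?thesis using exp_ge_add_one_self[of "- (\<xi> \<bullet> v)"] zero_le_power2[of "norm \<xi>"]
      unfolding compensated_def cutoff_simps(1)[OF True] by linarith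
  next
    case False
    then have "1 \<le> (norm \<xi>)\<^sup>2" by (simp add: one_le_power)
    moreover have "cutoff \<xi> \<bullet> v = 0" using False by (simp add: cutoff_simps)
    ultimately show ?thesis using exp_gt_zero[of "- (\<xi> \<bullet> v)"]
      unfolding compensated_def by linarith
  qed
  then show ?thesis using n by (simp add: le_divide_eq)
qed

text \<open>The jump integral may grow quadratically in \<open>v\<close>, but with the favourable
  sign: only its lower bound enters the radial component.\<close>

lemma R_growth:
  assumes v: "v \<in> K"
  shows "v \<bullet> R v \<le> A0 * (norm v + (norm v)\<^sup>2)"
proof -
  interpret finite_measure "scal v" by (rule finite_scal[OF v])
  have "(\<integral>\<xi>. - 1 \<partial>scal v) \<le> (\<integral>\<xi>. compensated \<xi> v / (norm \<xi>)\<^sup>2 \<partial>scal v)"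
    using compensated_lower v bdd_measurable_integrable[OF bdd_compensated[OF v] v] by (intro integral_mono) auto
  then have "- (\<mu> (space S) \<bullet> v) \<le> wint (\<lambda>\<xi>. compensated \<xi> v / (norm \<xi>)\<^sup>2) \<bullet> v"
    using v by (simp add: wint_inner bdd_compensated measure_scal)
  then have "v \<bullet> R v \<le> Bs v \<bullet> v + \<mu> (space S) \<bullet> v" by (simp add: R_def inner_diff_right inner_commute)
  also have "\<dots> \<le> norm B * norm v * norm v + norm (\<mu> (space S)) * norm v"
    by (intro add_mono order_trans[OF norm_cauchy_schwarz] mult_right_mono norm_Bs) auto
  also have "\<dots> \<le> A0 * (norm v)\<^sup>2 + A0 * norm v"
    unfolding power2_eq_square mult.assoc using A0_ge norm_mu_le by (intro add_mono mult_right_mono) auto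
  finally show ?thesis by (simp add: algebra_simps)
qed

sublocale cone_ode K R A0 A0
  by unfold_locales (fact R_lipschitz R_quasi_positive R_growth | use A0_ge(1) in linarith)+

lemma continuous_on_F: "continuous_on K F"
  unfolding continuous_on_iff
proof (intro ballI allI impI)
  fix v and e :: real assume v: "v \<in> K" and e: "e > 0"
  define C where "C = A0 * (1 + norm v + (norm v + 1))"
  have "0 < 1 + norm v + (norm v + 1)" using norm_ge_zero[of v] by linarith
  then have C: "C > 0" using A0_ge(1) by (simp add: C_def)
  show "\<exists>d>0. \<forall>w\<in>K. dist w v < d \<longrightarrow> dist (F w) (F v) < e"
  proof (intro exI[of _ "min 1 (e / C)"] conjI ballI impI)
    fix w assume w: "w \<in> K" "dist w v < min 1 (e / C)"
    have nw: "norm w \<le> norm v + 1"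
      using w(2) norm_triangle_sub[of w v] by (simp add: dist_norm)
    have "\<bar>F w - F v\<bar> \<le> A0 * (1 + norm w + norm v) * norm (w - v)"
      by (rule F_lipschitz[OF w(1) v])
    also have "\<dots> \<le> C * norm (w - v)"
      unfolding C_def using A0_ge nw by (intro mult_right_mono mult_left_mono) auto
    also have "\<dots> < e" using w(2) C by (simp add: dist_norm field_simps)
    finally show "dist (F w) (F v) < e" by (simp add: dist_real_def)
  qed (use e C in auto)
qed

lemma continuous_on_F_flow: "u \<in> K \<Longrightarrow> continuous_on {0..} (\<lambda>t. F (flow t u))"
  by (rule continuous_on_compose2[OF continuous_on_F continuous_on_flow]) (auto intro: flow_in)

text \<open>\<open>flow\<close> and \<open>exponent\<close> are \<open>\<psi>\<close> and \<open>\<phi>\<close> of the informal statement.\<close>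

definition exponent :: "real \<Rightarrow> 'a \<Rightarrow> real" where
  "exponent t u = integral {0..t} (\<lambda>s. F (flow s u))"

lemma exponent_0 [simp]: "exponent 0 u = 0" by (simp add: exponent_def)

lemma exponent_nonneg: "u \<in> K \<Longrightarrow> 0 \<le> t \<Longrightarrow> 0 \<le> exponent t u"
  unfolding exponent_def
  by (intro Henstock_Kurzweil_Integration.integral_nonneg integrable_continuous_real continuous_on_subset[OF continuous_on_F_flow] F_nonneg)
     (auto intro: flow_in)

lemma exponent_deriv:
  assumes u: "u \<in> K" and t: "0 \<le> t"
  shows "((\<lambda>t. exponent t u) has_real_derivative F (flow t u)) (at t within {0..})"
proof -
  have "((\<lambda>t. integral {0..t} (\<lambda>s. F (flow s u))) has_vector_derivative F (flow t u)) (at t within {0..t + 1})"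
    using t by (intro integral_has_vector_derivative continuous_on_subset[OF continuous_on_F_flow[OF u]]) auto
  then show ?thesis
    using at_within_Icc_eq_Ici[of t "t + 1"] t by (simp add: exponent_def[abs_def] has_real_derivative_iff_has_vector_derivative)
qed

lemma exponent_unique:
  assumes u: "u \<in> K" and f: "f 0 = 0" "\<And>t. 0 \<le> t \<Longrightarrow> (f has_real_derivative F (flow t u)) (at t within {0..})" and t: "0 \<le> t"
  shows "f t = exponent t u"
proof -
  have "((\<lambda>s. F (flow s u)) has_integral (f t - f 0)) {0..t}"
    using t f(2) by (intro fundamental_theorem_of_calculus)
      (auto simp: has_real_derivative_iff_has_vector_derivative intro: has_vector_derivative_within_subset[where S = "{0..}"])
  then show ?thesis using f(1) by (simp add: exponent_def integral_unique)
qed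

lemma exponent_add:
  assumes u: "u \<in> K" and s: "0 \<le> s" and t: "0 \<le> t"
  shows "exponent (s + t) u = exponent s u + exponent t (flow s u)"
proof -
  have "exponent (s + t) u - exponent s u = exponent t (flow s u)"
  proof (rule exponent_unique[where f = "\<lambda>t. exponent (s + t) u - exponent s u"])
    fix t :: real assume t: "0 \<le> t"
    have "((\<lambda>t. exponent t u) has_real_derivative F (flow (s + t) u)) (at (s + t) within (\<lambda>t. s + t) ` {0..})"
      by (rule DERIV_subset[OF exponent_deriv[OF u]]) (use s t in auto)
    moreover have "((\<lambda>t. s + t) has_real_derivative 1) (at t within {0..})"
      by (auto intro!: derivative_eq_intros)
    ultimately have "((\<lambda>t. exponent t u) \<circ> (\<lambda>t. s + t) has_real_derivative F (flow (s + t) u) * 1) (at t within {0..})"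
      by (rule DERIV_image_chain)
    then show "((\<lambda>t. exponent (s + t) u - exponent s u) has_real_derivative F (flow t (flow s u))) (at t within {0..})"
      using flow_add[OF u s t] by (auto simp: o_def intro!: derivative_eq_intros)
  qed (use assms in \<open>auto intro: flow_in\<close>)
  then show ?thesis by simp
qed

end

section \<open>One step of the approximation\<close>

lemma AE_add_measure:
  assumes N: "sets N = sets M" and P: "Measurable.pred M P" and AE: "AE x in M. P x" "AE x in N. P x"
  shows "AE x in add_measure M N. P x"
proof -
  have sp: "space N = space M" using N by (rule sets_eq_imp_space_eq)
  have A: "{x \<in> space M. \<not> P x} \<in> sets M" using P by measurable
  have "emeasure M {x \<in> space M. \<not> P x} = 0" "emeasure N {x \<in> space M. \<not> P x} = 0"
    using AE A N by (auto simp: AE_iff_measurable[OF _ refl] sp)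
  then have "emeasure (add_measure M N) {x \<in> space M. \<not> P x} = 0"
    using A N by (simp add: emeasure_add_measure)
  then show ?thesis using A by (subst AE_iff_measurable[OF _ refl]) auto
qed

lemma one_plus_norm_sq: "(1 + r)\<^sup>2 \<le> 2 * (1 + r\<^sup>2)" for r :: real
  using sum_squares_bound[of 1 r] by (simp add: power2_sum)

lemma abs_telescope_le:
  fixes p q r w i j k l :: real
  assumes "\<bar>p - q\<bar> \<le> A" "\<bar>q - r\<bar> \<le> \<bar>w\<bar>" "w = i + j - k - l"
    and "\<bar>i\<bar> \<le> I" "\<bar>j\<bar> \<le> J" "\<bar>k\<bar> \<le> C" "\<bar>l\<bar> \<le> L"
  shows "\<bar>p - r\<bar> \<le> A + (I + J + C + L)"
  using assms by linarith

lemma exp_minus_linear_bound: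
  assumes "0 \<le> (y::real)"
  shows "\<bar>(1 - y) - exp (- y)\<bar> \<le> y\<^sup>2"
proof -
  have "\<bar>(exp (- y) - 1 + y) - (exp (- 0) - 1 + 0)\<bar> \<le> (y + 0) * \<bar>y - 0\<bar>"
    using assms by (intro exp_taylor_lipschitz) auto
  then show ?thesis using assms by (simp add: power2_eq_square abs_minus_commute algebra_simps)
qed

text \<open>Quasi-positivity controls the field only in directions orthogonal to the point where it
  is evaluated, so an explicit step could leave the cone. The projected implicit equation has a
  fixed point by contraction. Its defect \<open>z - y\<close> is a cone element orthogonal to
  \<open>z\<close>; pairing it with \<open>x\<close> and with \<open>\<beta> z\<close> shows that it
  vanishes, so the projection acts trivially.\<close>

lemma (in self_dual_cone) implicit_step_ex:
  assumes lip: "\<And>x y. x \<in> K \<Longrightarrow> y \<in> K \<Longrightarrow> norm (\<beta> x - \<beta> y) \<le> D * norm (x - y)"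
    and qp: "\<And>x v. x \<in> K \<Longrightarrow> v \<in> K \<Longrightarrow> x \<bullet> v = 0 \<Longrightarrow> 0 \<le> \<beta> x \<bullet> v"
    and h: "0 \<le> h" "h * D \<le> 1 / 2" and x: "x \<in> K"
  shows "\<exists>z\<in>K. z = x + h *\<^sub>R \<beta> z"
proof -
  have "\<exists>!z\<in>K. pr (x + h *\<^sub>R \<beta> z) = z"
  proof (rule Banach_fix[where c = "1 / 2", OF complete_eq_closed[THEN iffD2, OF cone_closed]])
    show "K \<noteq> {}" using cone_zero by blast
    show "(\<lambda>z. pr (x + h *\<^sub>R \<beta> z)) ` K \<subseteq> K" by auto
    fix y z assume yz: "y \<in> K" "z \<in> K"
    have "dist (pr (x + h *\<^sub>R \<beta> y)) (pr (x + h *\<^sub>R \<beta> z)) \<le> norm ((x + h *\<^sub>R \<beta> y) - (x + h *\<^sub>R \<beta> z))"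
      unfolding dist_norm by (rule pr_lipschitz)
    also have "\<dots> = h * norm (\<beta> y - \<beta> z)" using h by (simp flip: scaleR_diff_right)
    also have "\<dots> \<le> h * (D * norm (y - z))" by (intro mult_left_mono lip yz h)
    also have "\<dots> \<le> 1 / 2 * norm (y - z)"
      using mult_right_mono[OF h(2), of "norm (y - z)"] by (simp add: mult.assoc)
    finally show "dist (pr (x + h *\<^sub>R \<beta> y)) (pr (x + h *\<^sub>R \<beta> z)) \<le> 1 / 2 * dist y z" by (simp add: dist_norm)
  qed auto
  then obtain z where z: "z \<in> K" "pr (x + h *\<^sub>R \<beta> z) = z" by blast
  define y where "y = x + h *\<^sub>R \<beta> z"
  have pz: "pr y = z" using z by (simp add: y_def)
  have n: "z - y \<in> K" "(z - y) \<bullet> z = 0" using pr_minus_in[of y] pr_orth[of y] pz by auto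
  have "0 \<le> \<beta> z \<bullet> (z - y)" using n z by (intro qp) (auto simp: inner_commute)
  moreover have "0 \<le> x \<bullet> (z - y)" using x n by (intro inner_nonneg)
  ultimately have "0 \<le> (z - y) \<bullet> y" using h by (simp add: y_def inner_commute inner_add_left inner_add_right)
  then have "(z - y) \<bullet> (z - y) \<le> 0" using n by (simp add: inner_diff_right)
  then have "z - y = 0" using inner_ge_zero[of "z - y"] inner_eq_zero_iff[of "z - y"] by linarith
  then show ?thesis using z by (auto simp: y_def)
qed

section \<open>Truncated characteristics and the one-step law\<close>

context affine_parameters
begin

definition big :: "real \<Rightarrow> 'a \<Rightarrow> real" where
  "big \<delta> \<xi> = indicator {\<xi>. \<delta> < norm \<xi>} \<xi>"

lemma measurable_big [measurable]: "big \<delta> \<in> borel_measurable borel"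
  unfolding big_def[abs_def] by measurable

lemma big_cases: "big \<delta> \<xi> = 0 \<and> norm \<xi> \<le> \<delta> \<or> big \<delta> \<xi> = 1 \<and> \<delta> < norm \<xi>"
  by (auto simp: big_def indicator_def)

lemma big_01: "0 \<le> big \<delta> \<xi>" "big \<delta> \<xi> \<le> 1"
  using big_cases[of \<delta> \<xi>] by auto

text \<open>The truncated intensity is bounded by a multiple of \<open>1 / \<delta>\<^sup>2\<close>,
  the Lipschitz constant of the truncated drift by a multiple of \<open>1 / \<delta>\<close>; this
  dominates both.\<close>

definition D :: "real \<Rightarrow> real" where "D \<delta> = A0 / \<delta>\<^sup>2"

definition trunc_cutoff :: "real \<Rightarrow> 'a \<Rightarrow> 'a \<Rightarrow> real" where
  "trunc_cutoff \<delta> v \<xi> = big \<delta> \<xi> * (cutoff \<xi> \<bullet> v) / (norm \<xi>)\<^sup>2"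

definition comp_vec :: "real \<Rightarrow> 'a" where
  "comp_vec \<delta> = (SOME c. \<forall>v. (\<integral>\<xi>. trunc_cutoff \<delta> v \<xi> \<partial>m2) = c \<bullet> v)"

definition comp_op :: "real \<Rightarrow> 'a \<Rightarrow> 'a" where
  "comp_op \<delta> v = wint (trunc_cutoff \<delta> v)"

text \<open>The retained jumps enter the chain uncompensated, so their truncated mean, affine in the
  state, is subtracted here. \<open>drift_inner\<close> computes the pairing with a test
  vector.\<close>

definition drift :: "real \<Rightarrow> 'a \<Rightarrow> 'a" where
  "drift \<delta> x = b - comp_vec \<delta> + blinfun_apply B x - adjoint (comp_op \<delta>) x"

definition intensity :: "real \<Rightarrow> 'a \<Rightarrow> real" where
  "intensity \<delta> x = (\<integral>\<xi>. big \<delta> \<xi> / (norm \<xi>)\<^sup>2 \<partial>sig x)"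

text \<open>Laplace exponent of the retained jumps at state \<open>x\<close>: in one step the jump
  contributes the factor \<open>1 - h * jump_exponent \<delta> v x\<close>, see
  \<open>step_law_exp\<close>.\<close>

definition jump_exponent :: "real \<Rightarrow> 'a \<Rightarrow> 'a \<Rightarrow> real" where
  "jump_exponent \<delta> v x = (\<integral>\<xi>. big \<delta> \<xi> * (1 - exp (- (\<xi> \<bullet> v))) / (norm \<xi>)\<^sup>2 \<partial>sig x)"

definition implicit_step :: "real \<Rightarrow> real \<Rightarrow> 'a \<Rightarrow> 'a" where
  "implicit_step \<delta> h x = (SOME z. z \<in> K \<and> z = x + h *\<^sub>R drift \<delta> z)"

text \<open>
  The state \<open>x\<close> stays put if the jump probability would exceed 1; this happens only for large \<open>x\<close>
  and is absorbed by the moment bound.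
\<close>

definition step_law :: "real \<Rightarrow> real \<Rightarrow> 'a \<Rightarrow> 'a measure" where
  "step_law \<delta> h x = (if h * intensity \<delta> x \<le> 1
     then add_measure
       (distr (density (sig x) (\<lambda>\<xi>. ennreal (h * (big \<delta> \<xi> / (norm \<xi>)\<^sup>2)))) borel (\<lambda>\<xi>. implicit_step \<delta> h x + \<xi>))
       (density (return borel (implicit_step \<delta> h x)) (\<lambda>_. ennreal (1 - h * intensity \<delta> x)))
     else return borel x)"

definition step_kernel :: "real \<Rightarrow> real \<Rightarrow> 'a \<Rightarrow> 'a measure" where
  "step_kernel \<delta> h x = step_law \<delta> h (pr x)"

lemma measurable_trunc_cutoff: "trunc_cutoff \<delta> v \<in> borel_measurable borel"
  unfolding trunc_cutoff_def[abs_def] by measurable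

lemma small_set: "{\<xi> \<in> space S. norm \<xi> \<le> \<delta>} \<in> sets S"
proof -
  have "norm \<in> borel_measurable S" by (rule measurable_S) measurable
  then show ?thesis by measurable
qed

context
  fixes \<delta> :: real
  assumes \<delta>: "0 < \<delta>" "\<delta> \<le> 1"
begin

lemma D_ge: "1 \<le> D \<delta>" "A0 \<le> D \<delta>" "A0 / \<delta> \<le> D \<delta>"
proof -
  have d: "\<delta>\<^sup>2 \<le> \<delta>" using \<delta> by (simp add: power2_eq_square mult_left_le)
  have d': "0 < \<delta>\<^sup>2" using \<delta> by simp
  show "A0 / \<delta> \<le> D \<delta>" unfolding D_def using d d' \<delta> A0_ge(1) by (intro divide_left_mono) auto
  moreover have "A0 / 1 \<le> A0 / \<delta>" using \<delta> A0_ge(1) by (intro divide_left_mono) auto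
  ultimately show "A0 \<le> D \<delta>" by simp
  then show "1 \<le> D \<delta>" using A0_ge(1) by simp
qed

lemma big_ratio: "0 \<le> big \<delta> \<xi> / (norm \<xi>)\<^sup>2" "big \<delta> \<xi> / (norm \<xi>)\<^sup>2 \<le> 1 / \<delta>\<^sup>2" "big \<delta> \<xi> * norm \<xi> / (norm \<xi>)\<^sup>2 \<le> 1 / \<delta>"
proof -
  have "0 \<le> big \<delta> \<xi> / (norm \<xi>)\<^sup>2 \<and> big \<delta> \<xi> / (norm \<xi>)\<^sup>2 \<le> 1 / \<delta>\<^sup>2 \<and> big \<delta> \<xi> * norm \<xi> / (norm \<xi>)\<^sup>2 \<le> 1 / \<delta>"
  proof (cases "\<delta> < norm \<xi>")
    case True
    then have "\<delta>\<^sup>2 \<le> (norm \<xi>)\<^sup>2" using \<delta> by (intro power_mono) auto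
    moreover have "norm \<xi> / (norm \<xi>)\<^sup>2 = 1 / norm \<xi>" by (simp add: power2_eq_square)
    moreover have "big \<delta> \<xi> = 1" using True big_cases[of \<delta> \<xi>] by auto
    ultimately show ?thesis using True \<delta> by (auto intro!: divide_left_mono mult_pos_pos simp: zero_less_power)
  next
    case False
    then have "big \<delta> \<xi> = 0" using big_cases[of \<delta> \<xi>] by auto
    then show ?thesis using \<delta> by simp
  qed
  then show "0 \<le> big \<delta> \<xi> / (norm \<xi>)\<^sup>2" "big \<delta> \<xi> / (norm \<xi>)\<^sup>2 \<le> 1 / \<delta>\<^sup>2" "big \<delta> \<xi> * norm \<xi> / (norm \<xi>)\<^sup>2 \<le> 1 / \<delta>" by auto
qed

lemma trunc_cutoff_bound: "\<bar>trunc_cutoff \<delta> v \<xi>\<bar> \<le> norm v / \<delta>"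
proof -
  have "norm (cutoff \<xi>) \<le> norm \<xi>" by (simp add: cutoff_def indicator_def)
  then have "\<bar>cutoff \<xi> \<bullet> v\<bar> \<le> norm \<xi> * norm v"
    by (intro order_trans[OF Cauchy_Schwarz_ineq2] mult_right_mono) auto
  then have "\<bar>trunc_cutoff \<delta> v \<xi>\<bar> \<le> big \<delta> \<xi> * (norm \<xi> * norm v) / (norm \<xi>)\<^sup>2"
    unfolding trunc_cutoff_def abs_divide abs_mult abs_of_nonneg[OF big_01(1)] abs_of_nonneg[OF zero_le_power2]
    by (intro divide_right_mono mult_left_mono big_01) auto
  also have "\<dots> = (big \<delta> \<xi> * norm \<xi> / (norm \<xi>)\<^sup>2) * norm v" by simp
  also have "\<dots> \<le> 1 / \<delta> * norm v" by (intro mult_right_mono big_ratio) simp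
  finally show ?thesis by simp
qed

lemma bdd_trunc_cutoff: "bdd_measurable (trunc_cutoff \<delta> v)"
  by (rule bdd_measurableI[OF measurable_S[OF measurable_trunc_cutoff] trunc_cutoff_bound])

lemma trunc_cutoff_add: "trunc_cutoff \<delta> (v + w) = (\<lambda>\<xi>. trunc_cutoff \<delta> v \<xi> + trunc_cutoff \<delta> w \<xi>)"
  and trunc_cutoff_scale: "trunc_cutoff \<delta> (r *\<^sub>R v) = (\<lambda>\<xi>. r * trunc_cutoff \<delta> v \<xi>)"
  by (auto simp: trunc_cutoff_def inner_add_right add_divide_distrib distrib_left)

lemma comp_vec: "(\<integral>\<xi>. trunc_cutoff \<delta> v \<xi> \<partial>m2) = comp_vec \<delta> \<bullet> v"
  and norm_comp_vec: "norm (comp_vec \<delta>) \<le> measure m2 (space S) / \<delta>"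
proof -
  interpret m2: finite_measure m2 by (rule finite_m2)
  have bnd: "\<bar>\<integral>\<xi>. trunc_cutoff \<delta> v \<xi> \<partial>m2\<bar> \<le> norm v * (measure m2 (space S) / \<delta>)" for v
  proof -
    have "\<bar>\<integral>\<xi>. trunc_cutoff \<delta> v \<xi> \<partial>m2\<bar> \<le> (\<integral>\<xi>. norm v / \<delta> \<partial>m2)"
      using trunc_cutoff_bound bdd_measurable_m2[OF bdd_trunc_cutoff]
      by (intro order_trans[OF integral_abs_bound] integral_mono integrable_abs) auto
    then show ?thesis by (simp add: mult.commute)
  qed
  have "bounded_linear (\<lambda>v. \<integral>\<xi>. trunc_cutoff \<delta> v \<xi> \<partial>m2)"
    by (rule bounded_linear_intro[of _ "measure m2 (space S) / \<delta>"])
       (use bnd in \<open>auto simp: trunc_cutoff_add trunc_cutoff_scale bdd_measurable_m2[OF bdd_trunc_cutoff]\<close>)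
  then have "\<exists>c. \<forall>v. (\<integral>\<xi>. trunc_cutoff \<delta> v \<xi> \<partial>m2) = c \<bullet> v" by (rule riesz_representation)
  from someI_ex[OF this] have c: "(\<integral>\<xi>. trunc_cutoff \<delta> v \<xi> \<partial>m2) = comp_vec \<delta> \<bullet> v" for v
    unfolding comp_vec_def by blast
  then show "(\<integral>\<xi>. trunc_cutoff \<delta> v \<xi> \<partial>m2) = comp_vec \<delta> \<bullet> v" .
  have "norm (comp_vec \<delta>) * norm (comp_vec \<delta>) \<le> norm (comp_vec \<delta>) * (measure m2 (space S) / \<delta>)"
    using bnd[of "comp_vec \<delta>"] c[of "comp_vec \<delta>"] by (simp flip: power2_norm_eq_inner add: power2_eq_square)
  then show "norm (comp_vec \<delta>) \<le> measure m2 (space S) / \<delta>"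
  proof (cases "comp_vec \<delta> = 0")
    case False
    then show ?thesis using \<open>norm (comp_vec \<delta>) * norm (comp_vec \<delta>) \<le> _\<close> by (subst (asm) mult_le_cancel_left_pos) auto
  qed (use \<delta> in simp)
qed

lemma comp_op_bounded_linear: "bounded_linear (comp_op \<delta>)"
  and norm_comp_op: "norm (comp_op \<delta> v) \<le> norm (\<mu> (space S)) / \<delta> * norm v"
proof -
  have bnd: "norm (comp_op \<delta> v) \<le> norm v * (norm (\<mu> (space S)) / \<delta>)" for v
  proof -
    have "norm (comp_op \<delta> v) \<le> norm v / \<delta> * norm (\<mu> (space S))"
      unfolding comp_op_def
      by (rule wint_norm_le) (use trunc_cutoff_bound measurable_trunc_cutoff \<delta> in \<open>auto intro: measurable_S\<close>)
    then show ?thesis by simp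
  qed
  then show "norm (comp_op \<delta> v) \<le> norm (\<mu> (space S)) / \<delta> * norm v" by (simp add: mult.commute)
  show "bounded_linear (comp_op \<delta>)"
    by (rule bounded_linear_intro[OF _ _ bnd])
       (simp_all add: comp_op_def trunc_cutoff_add trunc_cutoff_scale wint_add wint_cmult bdd_trunc_cutoff)
qed

lemma norm_comp_op_adjoint: "norm (adjoint (comp_op \<delta>) x) \<le> norm (\<mu> (space S)) / \<delta> * norm x"
proof -
  have "onorm (comp_op \<delta>) \<le> norm (\<mu> (space S)) / \<delta>"
    using \<delta> norm_comp_op by (intro onorm_bound) auto
  then show ?thesis
    by (intro order_trans[OF adjoint_bounded_linear(2)[OF comp_op_bounded_linear]] mult_right_mono) auto
qed

lemma drift_inner:
  assumes x: "x \<in> K"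
  shows "drift \<delta> x \<bullet> v = b \<bullet> v + Bs v \<bullet> x - (\<integral>\<xi>. trunc_cutoff \<delta> v \<xi> \<partial>sig x)"
proof -
  have "adjoint (comp_op \<delta>) x \<bullet> v = comp_op \<delta> v \<bullet> x"
    using adjoint_bounded_linear_works[OF comp_op_bounded_linear, of v x] by (simp add: inner_commute)
  then show ?thesis
    using x by (simp add: drift_def inner_diff_left inner_add_left Bs_inner integral_sig bdd_trunc_cutoff comp_vec comp_op_def)
qed

lemma drift_lipschitz: "norm (drift \<delta> x - drift \<delta> y) \<le> D \<delta> * norm (x - y)"
proof -
  have "drift \<delta> x - drift \<delta> y = blinfun_apply B (x - y) - adjoint (comp_op \<delta>) (x - y)"
    using linear_diff[OF bounded_linear.linear[OF adjoint_bounded_linear(1)[OF comp_op_bounded_linear]]]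
    by (simp add: drift_def blinfun.diff_right)
  also have "norm \<dots> \<le> norm B * norm (x - y) + norm (\<mu> (space S)) / \<delta> * norm (x - y)"
    by (intro order_trans[OF norm_triangle_ineq4] add_mono norm_blinfun norm_comp_op_adjoint)
  also have "\<dots> = (norm B + norm (\<mu> (space S)) / \<delta>) * norm (x - y)" by (simp add: distrib_right)
  also have "\<dots> \<le> D \<delta> * norm (x - y)"
  proof (rule mult_right_mono)
    have "norm B + norm (\<mu> (space S)) / \<delta> \<le> norm B / \<delta> + norm (\<mu> (space S)) / \<delta>"
      using \<delta> by (simp add: le_divide_eq mult_left_le)
    also have "\<dots> = (norm B + norm (\<mu> (space S))) / \<delta>" by (simp add: add_divide_distrib)
    also have "\<dots> \<le> A0 / \<delta>"
    proof (rule divide_right_mono)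
      show "norm B + norm (\<mu> (space S)) \<le> A0"
        using norm_mu_le(1) A0_ge(5) norm_ge_zero[of b] by linarith
    qed (use \<delta> in simp)
    finally show "norm B + norm (\<mu> (space S)) / \<delta> \<le> D \<delta>" using D_ge(3) by linarith
  qed simp
  finally show ?thesis .
qed

lemma drift_bound: "norm (drift \<delta> x) \<le> D \<delta> * (1 + norm x)"
proof -
  have a0: "adjoint (comp_op \<delta>) 0 = 0"
    by (rule linear_0[OF bounded_linear.linear[OF adjoint_bounded_linear(1)[OF comp_op_bounded_linear]]])
  have "norm (drift \<delta> 0) \<le> norm b + norm (comp_vec \<delta>)"
    by (simp add: drift_def a0 norm_triangle_ineq4)
  also have "\<dots> \<le> norm b / \<delta> + measure m2 (space S) / \<delta>"
    using \<delta> norm_comp_vec by (intro add_mono) (auto simp: le_divide_eq mult_left_le)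
  also have "\<dots> = (norm b + measure m2 (space S)) / \<delta>" by (simp add: add_divide_distrib)
  also have "\<dots> \<le> A0 / \<delta>"
  proof (rule divide_right_mono)
    show "norm b + measure m2 (space S) \<le> A0"
      using norm_mu_le(2) A0_ge(5) norm_ge_zero[of B] by linarith
  qed (use \<delta> in simp)
  finally have "norm (drift \<delta> 0) \<le> D \<delta>" using D_ge(3) by linarith
  moreover have "norm (drift \<delta> x) \<le> norm (drift \<delta> x - drift \<delta> 0) + norm (drift \<delta> 0)"
    using norm_triangle_ineq[of "drift \<delta> x - drift \<delta> 0" "drift \<delta> 0"] by simp
  ultimately show ?thesis using drift_lipschitz[of x 0] by (simp add: distrib_left)
qed

text \<open>Truncation subtracts less: the compensator integrand is nonnegative on the cone, so the
  truncated drift dominates the one with full compensators. Admissibility makes the constant part of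
  the latter nonnegative in every cone direction and the linear part in directions orthogonal to
  \<open>x\<close>.\<close>

lemma drift_quasi_positive:
  assumes x: "x \<in> K" and v: "v \<in> K" and o: "x \<bullet> v = 0"
  shows "0 \<le> drift \<delta> x \<bullet> v"
proof -
  have vx: "v \<bullet> x = 0" using o by (simp add: inner_commute)
  have le: "trunc_cutoff \<delta> v \<xi> \<le> cutoff \<xi> \<bullet> v / (norm \<xi>)\<^sup>2" if "\<xi> \<in> space S" for \<xi>
    unfolding trunc_cutoff_def using big_01[of \<delta> \<xi>] cutoff_inner_nonneg[OF in_S(1)[OF that] v]
    by (intro divide_right_mono) (auto simp: mult_left_le_one_le)
  have "(\<integral>\<xi>. trunc_cutoff \<delta> v \<xi> \<partial>scal x) \<le> (\<integral>\<xi>. cutoff \<xi> \<bullet> v / (norm \<xi>)\<^sup>2 \<partial>scal x)"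
    using le by (intro integral_mono bdd_measurable_integrable bdd_trunc_cutoff cutoff_integrable_scal v x vx) auto
  moreover have "(\<integral>\<xi>. trunc_cutoff \<delta> v \<xi> \<partial>m2) \<le> (\<integral>\<xi>. cutoff \<xi> \<bullet> v / (norm \<xi>)\<^sup>2 \<partial>m2)"
  proof (rule integral_mono[OF bdd_measurable_m2[OF bdd_trunc_cutoff]])
    show "integrable m2 (\<lambda>\<xi>. cutoff \<xi> \<bullet> v / (norm \<xi>)\<^sup>2)"
      using cutoff_integrable_m' by (subst integral_m2(2)) (auto intro!: measurable_S)
  qed (use le in auto)
  moreover have "(\<integral>\<xi>. cutoff \<xi> \<bullet> v / (norm \<xi>)\<^sup>2 \<partial>m2) = (\<integral>\<xi>. cutoff \<xi> \<bullet> v \<partial>m)"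
    by (subst integral_m2(1)) (auto intro!: measurable_S)
  ultimately show ?thesis
    using drift_b[OF v] drift_B[OF v x vx] x
    by (simp add: drift_inner integral_sig bdd_trunc_cutoff wint_inner)
qed

lemma bdd_big: "bdd_measurable (\<lambda>\<xi>. big \<delta> \<xi> / (norm \<xi>)\<^sup>2)"
proof (rule bdd_measurableI[of _ "1 / \<delta>\<^sup>2"])
  show "(\<lambda>\<xi>. big \<delta> \<xi> / (norm \<xi>)\<^sup>2) \<in> borel_measurable S" by (rule measurable_S) measurable
qed (use big_ratio in \<open>simp only: abs_of_nonneg\<close>)

lemma bdd_jump_exponent:
  assumes v: "v \<in> K"
  shows "bdd_measurable (\<lambda>\<xi>. big \<delta> \<xi> * (1 - exp (- (\<xi> \<bullet> v))) / (norm \<xi>)\<^sup>2)"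
    and "\<xi> \<in> space S \<Longrightarrow> big \<delta> \<xi> * (1 - exp (- (\<xi> \<bullet> v))) / (norm \<xi>)\<^sup>2 \<in> {0..big \<delta> \<xi> / (norm \<xi>)\<^sup>2}"
proof -
  have *: "big \<delta> \<xi> * (1 - exp (- (\<xi> \<bullet> v))) / (norm \<xi>)\<^sup>2 \<in> {0..big \<delta> \<xi> / (norm \<xi>)\<^sup>2}" if "\<xi> \<in> space S" for \<xi>
  proof -
    have "exp (- (\<xi> \<bullet> v)) \<le> 1" using inner_nonneg[OF in_S(1)[OF that] v] by simp
    then have "0 \<le> 1 - exp (- (\<xi> \<bullet> v))" "1 - exp (- (\<xi> \<bullet> v)) \<le> 1" by auto
    then show ?thesis using big_01[of \<delta> \<xi>] by (auto intro!: divide_right_mono mult_nonneg_nonneg mult_left_le)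
  qed
  then show "\<xi> \<in> space S \<Longrightarrow> big \<delta> \<xi> * (1 - exp (- (\<xi> \<bullet> v))) / (norm \<xi>)\<^sup>2 \<in> {0..big \<delta> \<xi> / (norm \<xi>)\<^sup>2}" .
  show "bdd_measurable (\<lambda>\<xi>. big \<delta> \<xi> * (1 - exp (- (\<xi> \<bullet> v))) / (norm \<xi>)\<^sup>2)"
  proof (rule bdd_measurableI[of _ "1 / \<delta>\<^sup>2"])
    show "(\<lambda>\<xi>. big \<delta> \<xi> * (1 - exp (- (\<xi> \<bullet> v))) / (norm \<xi>)\<^sup>2) \<in> borel_measurable S" by (rule measurable_S) measurable
    fix \<xi> assume "\<xi> \<in> space S"
    from *[OF this] big_ratio(2)[of \<xi>]
    show "\<bar>big \<delta> \<xi> * (1 - exp (- (\<xi> \<bullet> v))) / (norm \<xi>)\<^sup>2\<bar> \<le> 1 / \<delta>\<^sup>2" by auto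
  qed
qed

lemma intensity_bounds:
  assumes x: "x \<in> K"
  shows "0 \<le> intensity \<delta> x" "intensity \<delta> x \<le> D \<delta> * (1 + norm x)"
proof -
  show "0 \<le> intensity \<delta> x" unfolding intensity_def using big_ratio by (intro integral_nonneg_AE) auto
  have "\<bar>intensity \<delta> x\<bar> \<le> 1 / \<delta>\<^sup>2 * total * (1 + norm x)"
    unfolding intensity_def
    by (rule integral_sig_bound_total[OF _ _ _ x]) (use bdd_big big_ratio \<delta> in \<open>auto simp: bdd_measurable_def abs_of_nonneg[OF big_ratio(1)] simp del: abs_divide abs_mult\<close>)
  also have "\<dots> \<le> D \<delta> * (1 + norm x)"
    unfolding D_def using A0_ge(4) \<delta> by (intro mult_right_mono) (auto simp: divide_right_mono)
  finally show "intensity \<delta> x \<le> D \<delta> * (1 + norm x)" by simp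
qed

lemma jump_exponent_bounds:
  assumes x: "x \<in> K" and v: "v \<in> K"
  shows "0 \<le> jump_exponent \<delta> v x" "jump_exponent \<delta> v x \<le> intensity \<delta> x"
  unfolding jump_exponent_def intensity_def
  using bdd_jump_exponent[OF v] bdd_big x
  by (auto intro!: integral_nonneg_AE integral_mono bdd_measurable_sig)

context
  fixes h :: real
  assumes h: "0 \<le> h" "h * (D \<delta>)\<^sup>2 \<le> 1 / 2"
begin

text \<open>Makes the implicit equation a contraction with factor 1/2. The stronger bound with the
  square of \<open>D \<delta>\<close> pays for evaluating the drift at the new instead of the old
  state.\<close>

lemma hD: "h * D \<delta> \<le> 1 / 2"
proof -
  have "h * D \<delta> \<le> h * (D \<delta>)\<^sup>2"
    using h D_ge(1) self_le_power[of "D \<delta>" 2] by (intro mult_left_mono) auto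
  then show ?thesis using h by linarith
qed

lemma implicit_step:
  assumes x: "x \<in> K"
  shows "implicit_step \<delta> h x \<in> K" "implicit_step \<delta> h x = x + h *\<^sub>R drift \<delta> (implicit_step \<delta> h x)"
proof -
  have "\<exists>z\<in>K. z = x + h *\<^sub>R drift \<delta> z"
    by (rule implicit_step_ex[OF drift_lipschitz drift_quasi_positive h(1) hD x])
  then have "\<exists>z. z \<in> K \<and> z = x + h *\<^sub>R drift \<delta> z" by blast
  from someI_ex[OF this]
  show "implicit_step \<delta> h x \<in> K" "implicit_step \<delta> h x = x + h *\<^sub>R drift \<delta> (implicit_step \<delta> h x)"
    unfolding implicit_step_def by blast+
qed

lemma implicit_step_lipschitz:
  assumes x: "x \<in> K" and y: "y \<in> K"
  shows "norm (implicit_step \<delta> h x - implicit_step \<delta> h y) \<le> 2 * norm (x - y)"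
proof -
  let ?z = "implicit_step \<delta> h"
  have "?z x - ?z y = (x - y) + h *\<^sub>R (drift \<delta> (?z x) - drift \<delta> (?z y))"
    using implicit_step(2)[OF x] implicit_step(2)[OF y] by (metis add_diff_add scaleR_diff_right)
  then have "norm (?z x - ?z y) \<le> norm (x - y) + h * norm (drift \<delta> (?z x) - drift \<delta> (?z y))"
    using h norm_triangle_ineq[of "x - y" "h *\<^sub>R (drift \<delta> (?z x) - drift \<delta> (?z y))"] by simp
  also have "h * norm (drift \<delta> (?z x) - drift \<delta> (?z y)) \<le> h * (D \<delta> * norm (?z x - ?z y))"
    using h by (intro mult_left_mono drift_lipschitz)
  also have "\<dots> \<le> 1 / 2 * norm (?z x - ?z y)"
    using mult_right_mono[OF hD, of "norm (?z x - ?z y)"] by (simp add: mult.assoc)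
  finally show ?thesis by simp
qed

lemma implicit_step_bounds:
  assumes x: "x \<in> K"
  shows "norm (implicit_step \<delta> h x) \<le> 2 * (1 + norm x)"
    and "norm (implicit_step \<delta> h x - x) \<le> 2 * h * D \<delta> * (1 + norm x)"
proof -
  let ?z = "implicit_step \<delta> h x"
  have e: "norm (?z - x) = h * norm (drift \<delta> ?z)"
    using implicit_step(2)[OF x] h by (metis abs_of_nonneg add_diff_cancel_left' norm_scaleR)
  also have le: "\<dots> \<le> h * (D \<delta> * (1 + norm ?z))" using h by (intro mult_left_mono drift_bound)
  finally have 1: "norm (?z - x) \<le> h * D \<delta> * (1 + norm ?z)" by (simp add: mult.assoc)
  have "h * D \<delta> * (1 + norm ?z) \<le> 1 / 2 * (1 + norm ?z)"
    by (intro mult_right_mono hD) simp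
  moreover have "norm ?z \<le> norm (?z - x) + norm x" using norm_triangle_ineq[of "?z - x" x] by simp
  ultimately have 2: "1 + norm ?z \<le> 2 * (1 + norm x)" using 1 by simp
  then show "norm ?z \<le> 2 * (1 + norm x)" by simp
  have "h * D \<delta> * (1 + norm ?z) \<le> h * D \<delta> * (2 * (1 + norm x))"
    using 2 h D_ge(1) by (intro mult_left_mono) auto
  then show "norm (?z - x) \<le> 2 * h * D \<delta> * (1 + norm x)" using 1 by (simp add: algebra_simps)
qed

text \<open>Boundedness is required only after weighting with the jump density, so that the squared
  norm qualifies as \<open>f\<close>.\<close>

lemma step_law_integral:
  assumes x: "x \<in> K" and good: "h * intensity \<delta> x \<le> 1"
    and f: "f \<in> borel_measurable borel" "bdd_measurable (\<lambda>\<xi>. big \<delta> \<xi> / (norm \<xi>)\<^sup>2 * f (implicit_step \<delta> h x + \<xi>))"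
  shows "integrable (step_law \<delta> h x) f"
    and "(\<integral>y. f y \<partial>step_law \<delta> h x)
      = h * (\<integral>\<xi>. big \<delta> \<xi> / (norm \<xi>)\<^sup>2 * f (implicit_step \<delta> h x + \<xi>) \<partial>sig x) + (1 - h * intensity \<delta> x) * f (implicit_step \<delta> h x)"
proof -
  let ?z = "implicit_step \<delta> h x"
  let ?w = "\<lambda>\<xi>. h * (big \<delta> \<xi> / (norm \<xi>)\<^sup>2)"
  let ?J = "distr (density (sig x) (\<lambda>\<xi>. ennreal (?w \<xi>))) borel (\<lambda>\<xi>. ?z + \<xi>)"
  let ?N = "density (return borel ?z) (\<lambda>_. ennreal (1 - h * intensity \<delta> x))"
  have q: "step_law \<delta> h x = add_measure ?J ?N" using good by (simp add: step_law_def)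
  have w: "?w \<in> borel_measurable S" "AE \<xi> in sig x. 0 \<le> ?w \<xi>"
  proof -
    show "?w \<in> borel_measurable S" by (rule measurable_S) measurable
    show "AE \<xi> in sig x. 0 \<le> ?w \<xi>" by (rule AE_I2, rule mult_nonneg_nonneg[OF h(1) big_ratio(1)])
  qed
  have zm: "(\<lambda>\<xi>. ?z + \<xi>) \<in> borel_measurable S" by (rule measurable_S) measurable
  have fz: "(\<lambda>\<xi>. f (?z + \<xi>)) \<in> borel_measurable S" using measurable_compose[OF zm f(1)] .
  have iJ: "integrable ?J f \<longleftrightarrow> integrable (sig x) (\<lambda>\<xi>. ?w \<xi> *\<^sub>R f (?z + \<xi>))"
  proof -
    have "integrable ?J f \<longleftrightarrow> integrable (density (sig x) (\<lambda>\<xi>. ennreal (?w \<xi>))) (\<lambda>\<xi>. f (?z + \<xi>))"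
      using zm f(1) by (intro integrable_distr_eq) auto
    also have "\<dots> \<longleftrightarrow> integrable (sig x) (\<lambda>\<xi>. ?w \<xi> *\<^sub>R f (?z + \<xi>))"
      using fz w by (intro integrable_density) auto
    finally show ?thesis .
  qed
  have eJ: "(\<integral>y. f y \<partial>?J) = (\<integral>\<xi>. ?w \<xi> *\<^sub>R f (?z + \<xi>) \<partial>sig x)"
  proof -
    have "(\<integral>y. f y \<partial>?J) = (\<integral>\<xi>. f (?z + \<xi>) \<partial>density (sig x) (\<lambda>\<xi>. ennreal (?w \<xi>)))"
      using zm f(1) by (intro integral_distr) auto
    also have "\<dots> = (\<integral>\<xi>. ?w \<xi> *\<^sub>R f (?z + \<xi>) \<partial>sig x)"
      using fz w by (intro integral_density) auto
    finally show ?thesis .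
  qed
  have i: "integrable (sig x) (\<lambda>\<xi>. h * (big \<delta> \<xi> / (norm \<xi>)\<^sup>2 * f (?z + \<xi>)))"
    by (intro integrable_mult_right bdd_measurable_sig f x)
  have iJ': "integrable ?J f" unfolding iJ using i by (simp add: mult.assoc)
  have c: "0 \<le> 1 - h * intensity \<delta> x" using good by simp
  have fr: "integrable (return borel ?z) f"
  proof (rule integrableI_bounded)
    show "(\<integral>\<^sup>+y. ennreal (norm (f y)) \<partial>return borel ?z) < \<infinity>"
      using f(1) by (subst nn_integral_return) auto
  qed (use f(1) in simp)
  have iN: "integrable ?N f"
    using f(1) c fr by (subst integrable_density) auto
  have eN: "(\<integral>y. f y \<partial>?N) = (1 - h * intensity \<delta> x) * f ?z"
    using f(1) c by (subst integral_density) (auto simp: integral_return)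
  have sets: "sets ?N = sets ?J" by simp
  show "integrable (step_law \<delta> h x) f" unfolding q using iJ' iN by (simp add: integrable_add_measure)
  show "(\<integral>y. f y \<partial>step_law \<delta> h x)
      = h * (\<integral>\<xi>. big \<delta> \<xi> / (norm \<xi>)\<^sup>2 * f (?z + \<xi>) \<partial>sig x) + (1 - h * intensity \<delta> x) * f ?z"
    unfolding q integral_add_measure[OF sets iJ' iN] eJ eN by (simp only: real_scaleR_def mult.assoc integral_mult_right_zero)
qed

lemma step_law_props:
  assumes x: "x \<in> K"
  shows "prob_space (step_law \<delta> h x)" "sets (step_law \<delta> h x) = sets borel" "AE y in step_law \<delta> h x. y \<in> K"
proof -
  let ?z = "implicit_step \<delta> h x"
  let ?w = "\<lambda>\<xi>. h * (big \<delta> \<xi> / (norm \<xi>)\<^sup>2)"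
  let ?J = "distr (density (sig x) (\<lambda>\<xi>. ennreal (?w \<xi>))) borel (\<lambda>\<xi>. ?z + \<xi>)"
  let ?N = "density (return borel ?z) (\<lambda>_. ennreal (1 - h * intensity \<delta> x))"
  have zm: "(\<lambda>\<xi>. ?z + \<xi>) \<in> borel_measurable S" by (rule measurable_S) measurable
  have wm: "(\<lambda>\<xi>. ennreal (?w \<xi>)) \<in> borel_measurable S"
    by (rule measurable_compose[OF _ measurable_ennreal], rule measurable_S) measurable
  show "sets (step_law \<delta> h x) = sets borel" by (simp add: step_law_def)
  show "prob_space (step_law \<delta> h x)"
  proof (cases "h * intensity \<delta> x \<le> 1")
    case True
    have "emeasure ?J UNIV = emeasure (density (sig x) (\<lambda>\<xi>. ennreal (?w \<xi>))) (space S)"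
      using zm by (subst emeasure_distr) auto
    also have "\<dots> = (\<integral>\<^sup>+\<xi>. ennreal (?w \<xi>) * indicator (space S) \<xi> \<partial>sig x)"
      using wm by (subst emeasure_density) (auto intro: sets.top)
    also have "\<dots> = (\<integral>\<^sup>+\<xi>. ennreal (?w \<xi>) \<partial>sig x)" by (intro nn_integral_cong) auto
    also have "\<dots> = ennreal (\<integral>\<xi>. ?w \<xi> \<partial>sig x)"
      by (intro nn_integral_eq_integral integrable_mult_right bdd_measurable_sig bdd_big x AE_I2 mult_nonneg_nonneg h(1) big_ratio(1))
    also have "\<dots> = ennreal (h * intensity \<delta> x)" by (simp only: intensity_def integral_mult_right_zero)
    finally have J: "emeasure ?J UNIV = ennreal (h * intensity \<delta> x)" .
    have N: "emeasure ?N UNIV = ennreal (1 - h * intensity \<delta> x)"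
      by (simp add: emeasure_density_const)
    have "emeasure (step_law \<delta> h x) (space (step_law \<delta> h x)) = ennreal (h * intensity \<delta> x) + ennreal (1 - h * intensity \<delta> x)"
      using True J N by (simp add: step_law_def emeasure_add_measure)
    also have "\<dots> = 1" using True h intensity_bounds(1)[OF x] by (simp flip: ennreal_plus)
    finally show ?thesis by (rule prob_spaceI)
  qed (simp add: step_law_def prob_space_return)
  show "AE y in step_law \<delta> h x. y \<in> K"
  proof (cases "h * intensity \<delta> x \<le> 1")
    case True
    have "AE y in ?J. y \<in> K"
    proof (subst AE_distr_iff)
      show "AE \<xi> in density (sig x) (\<lambda>\<xi>. ennreal (?w \<xi>)). ?z + \<xi> \<in> K"
        using wm by (subst AE_density) (auto intro!: AE_I2 cone_add implicit_step x dest: in_S)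
    qed (use zm in auto)
    moreover have "AE y in ?N. y \<in> K"
    proof (subst AE_density)
      have "AE y in return borel ?z. y \<in> K" by (subst AE_return) (auto intro: implicit_step x)
      then show "AE y in return borel ?z. 0 < ennreal (1 - h * intensity \<delta> x) \<longrightarrow> y \<in> K" by (rule AE_mp) simp
    qed simp
    ultimately have "AE y in add_measure ?J ?N. y \<in> K" by (intro AE_add_measure) auto
    then show ?thesis unfolding step_law_def using True by (simp only: if_True)
  next
    case False
    have "AE y in return borel x. y \<in> K" by (subst AE_return) (auto intro: x)
    then show ?thesis unfolding step_law_def using False by (simp only: if_False)
  qed
qed

section \<open>Laplace transform, moments and local error of one step\<close>

lemma step_law_exp:
  assumes x: "x \<in> K" and v: "v \<in> K"
  shows "(\<integral>y. exp (- (y \<bullet> v)) \<partial>step_law \<delta> h x)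
    = (if h * intensity \<delta> x \<le> 1 then exp (- (implicit_step \<delta> h x \<bullet> v)) * (1 - h * jump_exponent \<delta> v x) else exp (- (x \<bullet> v)))"
proof (cases "h * intensity \<delta> x \<le> 1")
  case True
  let ?z = "implicit_step \<delta> h x"
  let ?g = "\<lambda>\<xi>. big \<delta> \<xi> / (norm \<xi>)\<^sup>2 - big \<delta> \<xi> * (1 - exp (- (\<xi> \<bullet> v))) / (norm \<xi>)\<^sup>2"
  have eq: "big \<delta> \<xi> / (norm \<xi>)\<^sup>2 * exp (- ((?z + \<xi>) \<bullet> v)) = exp (- (?z \<bullet> v)) * ?g \<xi>" for \<xi>
  proof -
    have "?g \<xi> = big \<delta> \<xi> / (norm \<xi>)\<^sup>2 * exp (- (\<xi> \<bullet> v))"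
      by (simp add: right_diff_distrib diff_divide_distrib)
    then show ?thesis by (simp add: inner_add_left exp_diff exp_minus divide_inverse mult_ac)
  qed
  have b: "bdd_measurable (\<lambda>\<xi>. exp (- (?z \<bullet> v)) * ?g \<xi>)"
    by (intro bdd_measurable_cmult bdd_measurable_diff bdd_big bdd_jump_exponent v)
  have int: "(\<integral>\<xi>. exp (- (?z \<bullet> v)) * ?g \<xi> \<partial>sig x) = exp (- (?z \<bullet> v)) * (intensity \<delta> x - jump_exponent \<delta> v x)"
    unfolding intensity_def jump_exponent_def integral_mult_right_zero
    by (subst Bochner_Integration.integral_diff) (auto intro!: bdd_measurable_sig bdd_big bdd_jump_exponent v x)
  show ?thesis
    unfolding step_law_integral(2)[OF x True measurable_exp_inner b[folded eq]] eq int
    by (simp only: True if_True) (simp add: algebra_simps)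
next
  case False
  then show ?thesis by (simp add: step_law_def integral_return)
qed

lemma norm_cutoff_diff: "norm (big \<delta> \<xi> * ((\<xi> - cutoff \<xi>) \<bullet> v) / (norm \<xi>)\<^sup>2) \<le> norm v"
proof (cases "norm \<xi> \<le> 1")
  case False
  then have n: "1 < norm \<xi>" by simp
  have "\<bar>\<xi> \<bullet> v\<bar> \<le> norm \<xi> * norm v" by (rule Cauchy_Schwarz_ineq2)
  also have "\<dots> \<le> (norm \<xi>)\<^sup>2 * norm v"
    using n self_le_power[of "norm \<xi>" 2] by (intro mult_right_mono) auto
  finally have le: "\<bar>\<xi> \<bullet> v\<bar> / (norm \<xi>)\<^sup>2 \<le> norm v" using n by (simp add: divide_le_eq mult.commute)
  have "big \<delta> \<xi> * (\<bar>\<xi> \<bullet> v\<bar> / (norm \<xi>)\<^sup>2) \<le> 1 * (\<bar>\<xi> \<bullet> v\<bar> / (norm \<xi>)\<^sup>2)"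
    using big_01 by (intro mult_right_mono) auto
  then show ?thesis using le n big_01[of \<delta> \<xi>] by (simp add: cutoff_simps abs_mult)
qed (simp add: cutoff_simps)

text \<open>The factor must not depend on \<delta>, since it is iterated over a number of steps
  chosen after \<delta>. The contributions to drift and mean jump that blow up with \<delta> cancel,
  and the shift of the drift to the new state is absorbed by the bound on
  \<open>h * (D \<delta>)\<^sup>2\<close>.\<close>

lemma step_law_moment:
  assumes x: "x \<in> K"
  shows "integrable (step_law \<delta> h x) (\<lambda>y. (norm y)\<^sup>2)"
    and "1 + (\<integral>y. (norm y)\<^sup>2 \<partial>step_law \<delta> h x) \<le> (1 + 18 * A0 * h) * (1 + (norm x)\<^sup>2)"
proof -
  let ?z = "implicit_step \<delta> h x"
  have A: "0 \<le> 18 * A0 * h" using A0_ge h by simp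
  have "integrable (step_law \<delta> h x) (\<lambda>y. (norm y)\<^sup>2) \<and>
    1 + (\<integral>y. (norm y)\<^sup>2 \<partial>step_law \<delta> h x) \<le> (1 + 18 * A0 * h) * (1 + (norm x)\<^sup>2)"
  proof (cases "h * intensity \<delta> x \<le> 1")
    case False
    have "integrable (return borel x) (\<lambda>y. (norm y)\<^sup>2)"
      by (rule integrableI_bounded) (auto simp: nn_integral_return)
    moreover have "1 * (1 + (norm x)\<^sup>2) \<le> (1 + 18 * A0 * h) * (1 + (norm x)\<^sup>2)"
      using A by (intro mult_right_mono) auto
    ultimately show ?thesis using False by (simp add: step_law_def integral_return)
  next
    case True
    have zK: "?z \<in> K" by (rule implicit_step[OF x])
    let ?k = "\<lambda>\<xi>. big \<delta> \<xi> / (norm \<xi>)\<^sup>2"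
    let ?d = "\<lambda>\<xi>. big \<delta> \<xi> * ((\<xi> - cutoff \<xi>) \<bullet> ?z) / (norm \<xi>)\<^sup>2"
    have eq: "?k \<xi> * (norm (?z + \<xi>))\<^sup>2 = (norm ?z)\<^sup>2 * ?k \<xi> + (2 * (trunc_cutoff \<delta> ?z \<xi> + ?d \<xi>) + big \<delta> \<xi>)"
      if "\<xi> \<in> space S" for \<xi>
    proof -
      have "(norm (?z + \<xi>))\<^sup>2 = (norm ?z)\<^sup>2 + 2 * (\<xi> \<bullet> ?z) + (norm \<xi>)\<^sup>2"
        unfolding power2_norm_eq_inner by (simp add: inner_add_left inner_add_right inner_commute)
      moreover have "trunc_cutoff \<delta> ?z \<xi> + ?d \<xi> = ?k \<xi> * (\<xi> \<bullet> ?z)"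
        unfolding trunc_cutoff_def by (simp add: inner_diff_left algebra_simps flip: add_divide_distrib)
      moreover have "?k \<xi> * (norm \<xi>)\<^sup>2 = big \<delta> \<xi>" using in_S(3)[OF that] by simp
      ultimately show ?thesis by (simp add: algebra_simps)
    qed
    have bd: "bdd_measurable ?d"
    proof (rule bdd_measurableI)
      show "?d \<in> borel_measurable S" by (rule measurable_S) measurable
    qed (use norm_cutoff_diff[of _ ?z] in simp)
    have bb: "bdd_measurable (big \<delta>)"
      by (rule bdd_measurableI[of _ 1]) (use big_01 in \<open>auto intro!: measurable_S\<close>)
    let ?r = "\<lambda>\<xi>. (norm ?z)\<^sup>2 * ?k \<xi> + (2 * (trunc_cutoff \<delta> ?z \<xi> + ?d \<xi>) + big \<delta> \<xi>)"
    have br: "bdd_measurable ?r"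
      by (intro bdd_measurable_add bdd_measurable_cmult bdd_big bdd_trunc_cutoff bd bb)
    have bl: "bdd_measurable (\<lambda>\<xi>. ?k \<xi> * (norm (?z + \<xi>))\<^sup>2)"
    proof -
      obtain C where C: "\<And>\<xi>. \<xi> \<in> space S \<Longrightarrow> \<bar>?r \<xi>\<bar> \<le> C" using br unfolding bdd_measurable_def by blast
      show ?thesis
      proof (rule bdd_measurableI)
        show "(\<lambda>\<xi>. ?k \<xi> * (norm (?z + \<xi>))\<^sup>2) \<in> borel_measurable S" by (rule measurable_S) measurable
        show "\<bar>?k \<xi> * (norm (?z + \<xi>))\<^sup>2\<bar> \<le> C" if "\<xi> \<in> space S" for \<xi> using C[OF that] unfolding eq[OF that] .
      qed
    qed
    note int = step_law_integral[OF x True _ bl]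
    define T where "T = (\<integral>\<xi>. trunc_cutoff \<delta> ?z \<xi> \<partial>sig x)"
    define E where "E = (\<integral>\<xi>. ?d \<xi> \<partial>sig x)"
    define G where "G = (\<integral>\<xi>. big \<delta> \<xi> \<partial>sig x)"
    have i: "integrable (sig x) ?k" "integrable (sig x) (trunc_cutoff \<delta> ?z)" "integrable (sig x) ?d" "integrable (sig x) (big \<delta>)"
      using x by (auto intro!: bdd_measurable_sig bdd_big bdd_trunc_cutoff bd bb)
    have "(\<integral>\<xi>. ?k \<xi> * (norm (?z + \<xi>))\<^sup>2 \<partial>sig x) = (\<integral>\<xi>. ?r \<xi> \<partial>sig x)"
      by (rule Bochner_Integration.integral_cong[OF refl]) (use eq in simp)
    also have "\<dots> = (norm ?z)\<^sup>2 * intensity \<delta> x + (2 * (T + E) + G)"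
    proof -
      have "(\<integral>\<xi>. ?r \<xi> \<partial>sig x) = (\<integral>\<xi>. (norm ?z)\<^sup>2 * ?k \<xi> \<partial>sig x) + (\<integral>\<xi>. 2 * (trunc_cutoff \<delta> ?z \<xi> + ?d \<xi>) + big \<delta> \<xi> \<partial>sig x)"
        using i by (intro Bochner_Integration.integral_add integrable_mult_right Bochner_Integration.integrable_add)
      also have "(\<integral>\<xi>. 2 * (trunc_cutoff \<delta> ?z \<xi> + ?d \<xi>) + big \<delta> \<xi> \<partial>sig x) = (\<integral>\<xi>. 2 * (trunc_cutoff \<delta> ?z \<xi> + ?d \<xi>) \<partial>sig x) + G"
        unfolding G_def using i by (intro Bochner_Integration.integral_add integrable_mult_right Bochner_Integration.integrable_add)
      also have "(\<integral>\<xi>. 2 * (trunc_cutoff \<delta> ?z \<xi> + ?d \<xi>) \<partial>sig x) = 2 * (T + E)"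
        unfolding integral_mult_right_zero T_def E_def using i by (subst Bochner_Integration.integral_add) auto
      finally show ?thesis by (simp only: intensity_def integral_mult_right_zero)
    qed
    finally have val: "(\<integral>y. (norm y)\<^sup>2 \<partial>step_law \<delta> h x) = (norm ?z)\<^sup>2 + 2 * h * (T + E) + h * G"
      using int(2) by (simp add: algebra_simps)
    let ?n = "1 + norm x"
    have n1: "1 \<le> ?n" "0 \<le> ?n" by auto
    have Gb: "G \<le> A0 * ?n"
    proof -
      have "\<bar>G\<bar> \<le> 1 * total * ?n" unfolding G_def
        by (rule integral_sig_bound_total[OF _ _ _ x]) (use bb big_01 in \<open>auto simp: bdd_measurable_def\<close>)
      also have "\<dots> \<le> A0 * ?n" using A0_ge(4) n1 by (intro mult_right_mono) auto
      finally show ?thesis by simp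
    qed
    have Eb: "E \<le> norm ?z * total * ?n"
    proof -
      have "\<bar>E\<bar> \<le> norm ?z * total * ?n" unfolding E_def
        by (rule integral_sig_bound_total[OF _ _ _ x]) (use bd norm_cutoff_diff[of _ ?z] in \<open>auto simp: bdd_measurable_def\<close>)
      then show ?thesis by simp
    qed
    \<comment> \<open>The compensator inside the drift and the truncated jump mean \<open>T\<close>
      cancel; what remains is bounded through \<open>A0\<close>.\<close>
    have dx: "drift \<delta> x \<bullet> ?z + T = b \<bullet> ?z + Bs ?z \<bullet> x" by (simp add: drift_inner[OF x] T_def)
    have "b \<bullet> ?z + Bs ?z \<bullet> x + E \<le> norm b * norm ?z * ?n + norm B * norm ?z * ?n + norm ?z * total * ?n"
    proof (intro add_mono Eb)
      have "norm b * norm ?z * 1 \<le> norm b * norm ?z * ?n" by (intro mult_left_mono) auto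
      then show "b \<bullet> ?z \<le> norm b * norm ?z * ?n" using norm_cauchy_schwarz[of b ?z] by simp
      have "Bs ?z \<bullet> x \<le> norm (Bs ?z) * norm x" by (rule norm_cauchy_schwarz)
      also have "\<dots> \<le> norm B * norm ?z * ?n" by (intro mult_mono norm_Bs) auto
      finally show "Bs ?z \<bullet> x \<le> norm B * norm ?z * ?n" .
    qed
    also have "\<dots> = (norm b + norm B + total) * (norm ?z * ?n)" by (simp add: algebra_simps)
    also have "\<dots> \<le> A0 * (2 * ?n * ?n)"
      using A0_ge(1,5) implicit_step_bounds(1)[OF x] by (intro mult_mono mult_right_mono) auto
    finally have key: "drift \<delta> x \<bullet> ?z + T + E \<le> 2 * A0 * ?n\<^sup>2" using dx by (simp add: power2_eq_square algebra_simps)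
    have "(drift \<delta> ?z - drift \<delta> x) \<bullet> ?z \<le> norm (drift \<delta> ?z - drift \<delta> x) * norm ?z" by (rule norm_cauchy_schwarz)
    also have "\<dots> \<le> (D \<delta> * (2 * h * D \<delta> * ?n)) * (2 * ?n)"
      using D_ge(1) h implicit_step_bounds[OF x]
      by (intro mult_mono order_trans[OF drift_lipschitz] mult_left_mono) auto
    also have "\<dots> = 4 * (h * (D \<delta>)\<^sup>2) * ?n\<^sup>2" by (simp add: power2_eq_square)
    also have "\<dots> \<le> 4 * (1 / 2) * ?n\<^sup>2" by (intro mult_right_mono mult_left_mono h) auto
    finally have dz: "(drift \<delta> ?z - drift \<delta> x) \<bullet> ?z \<le> 2 * ?n\<^sup>2" by simp
    have zz: "(norm ?z)\<^sup>2 \<le> (norm x)\<^sup>2 + 2 * h * (drift \<delta> ?z \<bullet> ?z)"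
    proof -
      have "x = ?z - h *\<^sub>R drift \<delta> ?z" using implicit_step(2)[OF x] by (simp add: algebra_simps)
      then have "(norm x)\<^sup>2 = (norm (?z - h *\<^sub>R drift \<delta> ?z))\<^sup>2" by metis
      also have "\<dots> = (norm ?z)\<^sup>2 - 2 * h * (drift \<delta> ?z \<bullet> ?z) + (norm (h *\<^sub>R drift \<delta> ?z))\<^sup>2"
        unfolding power2_norm_eq_inner by (simp add: inner_diff_left inner_diff_right inner_commute)
      finally show ?thesis using zero_le_power2[of "norm (h *\<^sub>R drift \<delta> ?z)"] by linarith
    qed
    have "(norm ?z)\<^sup>2 + 2 * h * (T + E) + h * G
        \<le> (norm x)\<^sup>2 + 2 * h * (drift \<delta> ?z \<bullet> ?z) + 2 * h * (T + E) + h * G" using zz by simp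
    also have "\<dots> = (norm x)\<^sup>2 + h * (2 * ((drift \<delta> ?z - drift \<delta> x) \<bullet> ?z + (drift \<delta> x \<bullet> ?z + T + E)) + G)"
      by (simp add: inner_diff_left algebra_simps)
    also have "\<dots> \<le> (norm x)\<^sup>2 + h * (2 * (2 * ?n\<^sup>2 + 2 * A0 * ?n\<^sup>2) + A0 * ?n\<^sup>2)"
    proof -
      have "G \<le> A0 * ?n\<^sup>2"
        using self_le_power[of ?n 2] A0_ge(1) by (intro order_trans[OF Gb] mult_left_mono) auto
      then show ?thesis using h dz key by (intro add_left_mono mult_left_mono add_mono) auto
    qed
    also have "\<dots> = (norm x)\<^sup>2 + h * ((4 + 5 * A0) * ?n\<^sup>2)" by (simp add: algebra_simps)
    \<comment> \<open>Origin of the 18: \<open>4 + 5 * A0\<close> is at most \<open>9 * A0\<close>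
      because \<open>A0\<close> is at least 1, and the square of \<open>1 + norm x\<close> is at
      most twice \<open>1 + (norm x)\<^sup>2\<close>.\<close>
    also have "\<dots> \<le> (norm x)\<^sup>2 + h * ((9 * A0) * (2 * (1 + (norm x)\<^sup>2)))"
      using h A0_ge(1) one_plus_norm_sq[of "norm x"] by (intro add_left_mono mult_left_mono mult_mono) auto
    finally have "(\<integral>y. (norm y)\<^sup>2 \<partial>step_law \<delta> h x) \<le> (norm x)\<^sup>2 + h * ((9 * A0) * (2 * (1 + (norm x)\<^sup>2)))"
      unfolding val .
    then show ?thesis using int(1) by (simp add: algebra_simps)
  qed
  then show "integrable (step_law \<delta> h x) (\<lambda>y. (norm y)\<^sup>2)"
    "1 + (\<integral>y. (norm y)\<^sup>2 \<partial>step_law \<delta> h x) \<le> (1 + 18 * A0 * h) * (1 + (norm x)\<^sup>2)" by auto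
qed

text \<open>Drift and jump exponent together reproduce the compensated jumps above \<delta> exactly,
  so only the integral over the removed jumps remains.\<close>

lemma truncation_error:
  assumes x: "x \<in> K" and v: "v \<in> K" "norm v \<le> M"
  shows "\<bar>drift \<delta> x \<bullet> v + jump_exponent \<delta> v x - (F v + R v \<bullet> x)\<bar>
    \<le> (1 + M) * M * mass {\<xi> \<in> space S. norm \<xi> \<le> \<delta>} * (1 + norm x)"
proof -
  have M: "0 \<le> M" using v(2) norm_ge_zero[of v] by linarith
  let ?c = "\<lambda>\<xi>. compensated \<xi> v / (norm \<xi>)\<^sup>2"
  let ?j = "\<lambda>\<xi>. big \<delta> \<xi> * (1 - exp (- (\<xi> \<bullet> v))) / (norm \<xi>)\<^sup>2"
  have i: "integrable (sig x) ?c" "integrable (sig x) (trunc_cutoff \<delta> v)" "integrable (sig x) ?j"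
    using x v by (auto intro!: bdd_measurable_sig bdd_compensated bdd_trunc_cutoff bdd_jump_exponent)
  have "drift \<delta> x \<bullet> v + jump_exponent \<delta> v x - (F v + R v \<bullet> x) = (\<integral>\<xi>. ?c \<xi> - (trunc_cutoff \<delta> v \<xi> - ?j \<xi>) \<partial>sig x)"
    using i by (simp add: drift_inner[OF x] generator_eq[OF v(1) x] jump_exponent_def)
  also have "\<bar>\<dots>\<bar> \<le> (1 + M) * M * mass {\<xi> \<in> space S. norm \<xi> \<le> \<delta>} * (1 + norm x)"
  proof (rule integral_sig_bound[OF _ _ small_set _ x])
    show "(\<lambda>\<xi>. ?c \<xi> - (trunc_cutoff \<delta> v \<xi> - ?j \<xi>)) \<in> borel_measurable S"
      unfolding trunc_cutoff_def by (rule measurable_S) measurable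
    show "0 \<le> (1 + M) * M" using M by simp
    fix \<xi> assume \<xi>: "\<xi> \<in> space S"
    have "trunc_cutoff \<delta> v \<xi> - ?j \<xi> = big \<delta> \<xi> * ?c \<xi>"
      by (simp add: trunc_cutoff_def compensated_def algebra_simps diff_divide_distrib add_divide_distrib)
    then have eq: "?c \<xi> - (trunc_cutoff \<delta> v \<xi> - ?j \<xi>) = (1 - big \<delta> \<xi>) * ?c \<xi>" by (simp only: left_diff_distrib mult_1_left)
    have "\<bar>?c \<xi>\<bar> \<le> (1 + norm v) * norm v"
      using compensated_bound[OF in_S(1)[OF \<xi>] v(1)] in_S(3)[OF \<xi>] by (simp add: divide_le_eq mult.commute)
    also have "\<dots> \<le> (1 + M) * M" using v(2) M by (intro mult_mono) auto
    finally have c: "\<bar>?c \<xi>\<bar> \<le> (1 + M) * M" .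
    show "\<bar>?c \<xi> - (trunc_cutoff \<delta> v \<xi> - ?j \<xi>)\<bar> \<le> (1 + M) * M * indicator {\<xi> \<in> space S. norm \<xi> \<le> \<delta>} \<xi>"
      unfolding eq using big_cases[of \<delta> \<xi>] c \<xi> by (auto simp: indicator_def)
  qed
  finally show ?thesis .
qed

text \<open>Error per unit of time: the terms stem from time discretization, from the removed small
  jumps and from linearizing exponent and flow. The outer 2 converts the square of
  \<open>1 + norm x\<close> into \<open>1 + (norm x)\<^sup>2\<close>.\<close>

definition step_error :: "real \<Rightarrow> real \<Rightarrow> real" where
  "step_error M \<omega> = 2 * ((1 + 2 * M) * (h * (D \<delta>)\<^sup>2) + (1 + M) * M * mass {\<xi> \<in> space S. norm \<xi> \<le> \<delta>} + 2 * \<omega>)"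

text \<open>Here \<open>(a, v)\<close> and \<open>(a', v')\<close> stand for exponent and flow at
  times \<open>s\<close> and \<open>s + h\<close>. A step of the chain started at \<open>x\<close>
  carries the exponential of the first pair approximately into that of the second. All exponents are
  nonnegative, so exponentials are compared through their exponents.\<close>

lemma one_step:
  assumes x: "x \<in> K" and v: "v \<in> K" "norm v \<le> M" and v': "v' \<in> K" and a: "0 \<le> a" "0 \<le> a'"
    and da: "\<bar>a' - a - h * F v\<bar> \<le> h * \<omega>" and dv: "norm (v' - v - h *\<^sub>R R v) \<le> h * \<omega>"
  shows "\<bar>exp (- a) * (\<integral>y. exp (- (y \<bullet> v)) \<partial>step_law \<delta> h x) - exp (- (a' + x \<bullet> v'))\<bar>
    \<le> h * step_error M \<omega> * (1 + (norm x)\<^sup>2)"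
proof -
  let ?n = "1 + norm x"
  let ?z = "implicit_step \<delta> h x"
  let ?\<eta> = "mass {\<xi> \<in> space S. norm \<xi> \<le> \<delta>}"
  let ?\<Lambda> = "intensity \<delta> x"
  let ?G = "jump_exponent \<delta> v x"
  have M: "0 \<le> M" using v(2) norm_ge_zero[of v] by linarith
  have n1: "1 \<le> ?n" by simp
  have n2: "?n \<le> ?n\<^sup>2" using self_le_power[of ?n 2] by simp
  have D1: "1 \<le> D \<delta>" by (rule D_ge)
  have hw: "0 \<le> h * \<omega>" using da by linarith
  have hM: "0 \<le> h * ((1 + M) * M * ?\<eta>)" using h M mass_nonneg by (intro mult_nonneg_nonneg) auto
  have hL: "(h * ?\<Lambda>)\<^sup>2 \<le> h * (h * (D \<delta>)\<^sup>2) * ?n\<^sup>2"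
  proof -
    have "(h * ?\<Lambda>)\<^sup>2 \<le> (h * (D \<delta> * ?n))\<^sup>2"
      using h intensity_bounds[OF x] by (intro power_mono mult_left_mono mult_nonneg_nonneg) auto
    then show ?thesis by (simp add: power_mult_distrib power2_eq_square mult_ac)
  qed
  have main: "\<bar>exp (- a) * (\<integral>y. exp (- (y \<bullet> v)) \<partial>step_law \<delta> h x) - exp (- (a' + x \<bullet> v'))\<bar>
    \<le> ((1 + 2 * M) * (h * (h * (D \<delta>)\<^sup>2)) + h * ((1 + M) * M * ?\<eta>) + 2 * (h * \<omega>)) * ?n\<^sup>2"
  proof (cases "h * ?\<Lambda> \<le> 1")
    case False
    have e01: "exp (- a) * exp (- (x \<bullet> v)) \<in> {0..1}" "exp (- (a' + x \<bullet> v')) \<in> {0..1}"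
      using a inner_nonneg[OF x v(1)] inner_nonneg[OF x v'] by (auto simp flip: exp_add)
    have "\<bar>exp (- a) * (\<integral>y. exp (- (y \<bullet> v)) \<partial>step_law \<delta> h x) - exp (- (a' + x \<bullet> v'))\<bar> \<le> 1"
    proof -
      have "exp (- a) * (\<integral>y. exp (- (y \<bullet> v)) \<partial>step_law \<delta> h x) = exp (- a) * exp (- (x \<bullet> v))"
        using False by (simp add: step_law_exp[OF x v(1)])
      then show ?thesis using e01 by (simp only: atLeastAtMost_iff abs_le_iff) linarith
    qed
    \<comment> \<open>Where the chain stays put, the trivial error 1 is already of the required
      order, since \<open>h\<close> times the intensity exceeds 1.\<close>
    also have "1 \<le> (h * ?\<Lambda>)\<^sup>2" using False by (simp add: one_le_power)
    also have "\<dots> \<le> h * (h * (D \<delta>)\<^sup>2) * ?n\<^sup>2" by (rule hL)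
    also have "\<dots> \<le> ((1 + 2 * M) * (h * (h * (D \<delta>)\<^sup>2)) + h * ((1 + M) * M * ?\<eta>) + 2 * (h * \<omega>)) * ?n\<^sup>2"
    proof (rule mult_right_mono)
      have "0 \<le> 2 * M * (h * (h * (D \<delta>)\<^sup>2))" using M h by simp
      then show "h * (h * (D \<delta>)\<^sup>2) \<le> (1 + 2 * M) * (h * (h * (D \<delta>)\<^sup>2)) + h * ((1 + M) * M * ?\<eta>) + 2 * (h * \<omega>)"
        using hM hw by (simp add: distrib_right)
    qed simp
    finally show ?thesis .
  next
    case True
    \<comment> \<open>The exponent that results when \<open>1 - h * ?G\<close> is replaced by
      \<open>exp (- (h * ?G))\<close>.\<close>
    define P where "P = a + ?z \<bullet> v + h * ?G"
    have hG: "0 \<le> h * ?G" "h * ?G \<le> h * ?\<Lambda>"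
      using h jump_exponent_bounds[OF x v(1)] by (auto intro: mult_left_mono)
    have az: "0 \<le> a + ?z \<bullet> v" using a inner_nonneg[OF implicit_step(1)[OF x] v(1)] by simp
    have t1: "\<bar>exp (- (a + ?z \<bullet> v)) * (1 - h * ?G) - exp (- P)\<bar> \<le> h * (h * (D \<delta>)\<^sup>2) * ?n\<^sup>2"
    proof -
      have "exp (- (a + ?z \<bullet> v)) * (1 - h * ?G) - exp (- P) = exp (- (a + ?z \<bullet> v)) * ((1 - h * ?G) - exp (- (h * ?G)))"
        by (simp add: P_def right_diff_distrib flip: exp_add)
      also have "\<bar>\<dots>\<bar> \<le> 1 * (h * ?G)\<^sup>2"
        unfolding abs_mult using az hG by (intro mult_mono exp_minus_linear_bound) auto
      also have "\<dots> \<le> (h * ?\<Lambda>)\<^sup>2" using hG by (simp add: power_mono)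
      finally show ?thesis using hL by linarith
    qed
    have t2: "\<bar>exp (- P) - exp (- (a' + x \<bullet> v'))\<bar> \<le> \<bar>P - (a' + x \<bullet> v')\<bar>"
      using az hG a inner_nonneg[OF x v'] by (intro exp_minus_lipschitz) (auto simp: P_def)
    have zv: "?z \<bullet> v = x \<bullet> v + h * (drift \<delta> ?z \<bullet> v)"
      using arg_cong[OF implicit_step(2)[OF x], of "\<lambda>z. z \<bullet> v"] by (simp add: inner_add_left)
    \<comment> \<open>Four sources of error: implicit instead of explicit drift, removal of small
      jumps, and the linearizations of \<open>a\<close> and of \<open>v\<close>.\<close>
    have split: "P - (a' + x \<bullet> v') = h * ((drift \<delta> ?z - drift \<delta> x) \<bullet> v)
        + h * (drift \<delta> x \<bullet> v + ?G - (F v + R v \<bullet> x)) - (a' - a - h * F v) - x \<bullet> (v' - v - h *\<^sub>R R v)"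
      unfolding P_def zv by (simp add: inner_diff_left inner_diff_right inner_commute algebra_simps)
    have b1: "\<bar>h * ((drift \<delta> ?z - drift \<delta> x) \<bullet> v)\<bar> \<le> 2 * M * (h * (h * (D \<delta>)\<^sup>2)) * ?n\<^sup>2"
    proof -
      have "\<bar>(drift \<delta> ?z - drift \<delta> x) \<bullet> v\<bar> \<le> norm (drift \<delta> ?z - drift \<delta> x) * norm v" by (rule Cauchy_Schwarz_ineq2)
      also have "\<dots> \<le> (D \<delta> * (2 * h * D \<delta> * ?n)) * M"
        using D1 h v(2) implicit_step_bounds(2)[OF x]
        by (intro mult_mono order_trans[OF drift_lipschitz] mult_left_mono) auto
      also have "\<dots> = 2 * M * (h * (D \<delta>)\<^sup>2) * ?n" by (simp add: power2_eq_square)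
      also have "\<dots> \<le> 2 * M * (h * (D \<delta>)\<^sup>2) * ?n\<^sup>2" using n2 M h by (intro mult_left_mono) auto
      finally have "h * \<bar>(drift \<delta> ?z - drift \<delta> x) \<bullet> v\<bar> \<le> h * (2 * M * (h * (D \<delta>)\<^sup>2) * ?n\<^sup>2)"
        using h by (intro mult_left_mono) auto
      then show ?thesis using h by (simp add: abs_mult mult_ac)
    qed
    have b2: "\<bar>h * (drift \<delta> x \<bullet> v + ?G - (F v + R v \<bullet> x))\<bar> \<le> h * ((1 + M) * M * ?\<eta>) * ?n\<^sup>2"
    proof -
      have "\<bar>h * (drift \<delta> x \<bullet> v + ?G - (F v + R v \<bullet> x))\<bar> \<le> h * ((1 + M) * M * ?\<eta> * ?n)"
        unfolding abs_mult using h truncation_error[OF x v] by (simp add: mult_left_mono)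
      also have "\<dots> = (h * ((1 + M) * M * ?\<eta>)) * ?n" by simp
      also have "\<dots> \<le> (h * ((1 + M) * M * ?\<eta>)) * ?n\<^sup>2" by (intro mult_left_mono n2 hM)
      finally show ?thesis .
    qed
    have b3: "\<bar>a' - a - h * F v\<bar> \<le> h * \<omega> * ?n\<^sup>2"
    proof -
      have "h * \<omega> * 1 \<le> h * \<omega> * ?n\<^sup>2" using n1 n2 by (intro mult_left_mono hw) linarith
      then show ?thesis using da by linarith
    qed
    have b4: "\<bar>x \<bullet> (v' - v - h *\<^sub>R R v)\<bar> \<le> h * \<omega> * ?n\<^sup>2"
    proof -
      have "\<bar>x \<bullet> (v' - v - h *\<^sub>R R v)\<bar> \<le> norm x * norm (v' - v - h *\<^sub>R R v)" by (rule Cauchy_Schwarz_ineq2)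
      also have "\<dots> \<le> ?n\<^sup>2 * (h * \<omega>)" using n2 dv by (intro mult_mono) auto
      finally show ?thesis by (simp add: mult.commute)
    qed
    have L: "exp (- a) * (\<integral>y. exp (- (y \<bullet> v)) \<partial>step_law \<delta> h x) = exp (- (a + ?z \<bullet> v)) * (1 - h * ?G)"
    proof -
      have "exp (- (a + ?z \<bullet> v)) = exp (- a) * exp (- (?z \<bullet> v))" by (simp flip: exp_add)
      then show ?thesis using True by (simp only: step_law_exp[OF x v(1)] if_True mult.assoc)
    qed
    have "\<bar>exp (- a) * (\<integral>y. exp (- (y \<bullet> v)) \<partial>step_law \<delta> h x) - exp (- (a' + x \<bullet> v'))\<bar>
        \<le> h * (h * (D \<delta>)\<^sup>2) * ?n\<^sup>2 + (2 * M * (h * (h * (D \<delta>)\<^sup>2)) * ?n\<^sup>2 + h * ((1 + M) * M * ?\<eta>) * ?n\<^sup>2 + h * \<omega> * ?n\<^sup>2 + h * \<omega> * ?n\<^sup>2)"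
      by (rule abs_telescope_le[OF t1 t2 split b1 b2 b3 b4, folded L])
    then show ?thesis by (simp only: distrib_right mult_1_left)
  qed
  also have "\<dots> = h * (step_error M \<omega> / 2) * ?n\<^sup>2" by (simp add: step_error_def algebra_simps)
  also have "\<dots> \<le> h * (step_error M \<omega> / 2) * (2 * (1 + (norm x)\<^sup>2))"
  proof (rule mult_left_mono[OF one_plus_norm_sq])
    have "0 \<le> h * ((1 + 2 * M) * (h * (D \<delta>)\<^sup>2))" using h M by simp
    then show "0 \<le> h * (step_error M \<omega> / 2)" using hM hw by (simp add: step_error_def distrib_left)
  qed
  also have "\<dots> = h * step_error M \<omega> * (1 + (norm x)\<^sup>2)" by simp
  finally show ?thesis .
qed

text \<open>By \<open>step_law_exp\<close> the Laplace transform depends on the projected state only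
  through the Lipschitz implicit step and two affine functionals.\<close>

lemma step_kernel_measurable: "step_kernel \<delta> h \<in> borel \<rightarrow>\<^sub>M prob_algebra borel"
proof (rule laplace_kernel_measurable)
  fix v assume v: "v \<in> K"
  have "continuous_on UNIV (\<lambda>x. implicit_step \<delta> h (pr x))"
  proof (rule lipschitz_on_continuous_on[of 2])
    show "2-lipschitz_on UNIV (\<lambda>x. implicit_step \<delta> h (pr x))"
    proof (rule lipschitz_onI)
      fix x y :: 'a
      have "norm (implicit_step \<delta> h (pr x) - implicit_step \<delta> h (pr y)) \<le> 2 * norm (pr x - pr y)"
        by (intro implicit_step_lipschitz pr_in)
      then show "dist (implicit_step \<delta> h (pr x)) (implicit_step \<delta> h (pr y)) \<le> 2 * dist x y"
        using pr_lipschitz[of x y] by (simp add: dist_norm)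
    qed simp
  qed
  then have [measurable]: "(\<lambda>x. implicit_step \<delta> h (pr x)) \<in> borel_measurable borel"
    by (rule borel_measurable_continuous_onI)
  have "(\<lambda>x. intensity \<delta> (pr x)) = (\<lambda>x. (\<integral>\<xi>. big \<delta> \<xi> / (norm \<xi>)\<^sup>2 \<partial>m2) + wint (\<lambda>\<xi>. big \<delta> \<xi> / (norm \<xi>)\<^sup>2) \<bullet> pr x)"
    by (simp add: intensity_def integral_sig bdd_big)
  then have [measurable]: "(\<lambda>x. intensity \<delta> (pr x)) \<in> borel_measurable borel" by simp
  have "(\<lambda>x. jump_exponent \<delta> v (pr x)) = (\<lambda>x. (\<integral>\<xi>. big \<delta> \<xi> * (1 - exp (- (\<xi> \<bullet> v))) / (norm \<xi>)\<^sup>2 \<partial>m2)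
      + wint (\<lambda>\<xi>. big \<delta> \<xi> * (1 - exp (- (\<xi> \<bullet> v))) / (norm \<xi>)\<^sup>2) \<bullet> pr x)"
    by (simp add: jump_exponent_def integral_sig bdd_jump_exponent(1)[OF v])
  then have [measurable]: "(\<lambda>x. jump_exponent \<delta> v (pr x)) \<in> borel_measurable borel" by simp
  show "(\<lambda>x. \<integral>y. exp (- (y \<bullet> v)) \<partial>step_kernel \<delta> h x) \<in> borel_measurable borel"
    by (simp add: step_kernel_def step_law_exp v)
qed (unfold step_kernel_def, (rule step_law_props[OF pr_in])+)

end

end

end

section \<open>Markov processes from transition kernels\<close>

lemma prod_indicator_eq:
  "finite J \<Longrightarrow> (\<Prod>t\<in>J. indicator (A t) (f t)) = (if \<forall>t\<in>J. f t \<in> A t then 1 else 0 :: ennreal)"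
  by (induction J rule: finite_induct) auto

text \<open>The kernels live on the whole Polish space, where the extension theorem applies. The
  retraction \<open>r\<close> onto the state space \<open>K\<close> reconciles this with a process
  in \<open>K\<close>: starting points are first moved into \<open>K\<close>, also at time
  0.\<close>

locale kernel_semigroup =
  fixes k :: "real \<Rightarrow> 'a::polish_space \<Rightarrow> 'a measure" and K :: "'a set" and r :: "'a \<Rightarrow> 'a"
  assumes kernel: "0 \<le> t \<Longrightarrow> k t \<in> borel \<rightarrow>\<^sub>M prob_algebra borel"
    and chapman_kolmogorov: "0 \<le> s \<Longrightarrow> 0 \<le> t \<Longrightarrow> k (s + t) x = k s x \<bind> k t"
    and kernel_0: "k 0 x = return borel (r x)"
    and kernel_r: "0 \<le> t \<Longrightarrow> k t (r x) = k t x"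
    and r_measurable [measurable]: "r \<in> borel_measurable borel"
    and r_in: "r x \<in> K" and r_ident: "x \<in> K \<Longrightarrow> r x = x"
    and K_borel [measurable]: "K \<in> sets borel"
begin

lemma kernel_sub: "0 \<le> t \<Longrightarrow> k t \<in> borel \<rightarrow>\<^sub>M subprob_algebra borel"
  by (rule measurable_prob_algebraD[OF kernel])

lemma prob_space_kernel: "0 \<le> t \<Longrightarrow> prob_space (k t x)"
  and sets_kernel_borel: "0 \<le> t \<Longrightarrow> sets (k t x) = sets borel"
  using measurable_space[OF kernel, of t x] by (auto simp: space_prob_algebra)

lemma space_kernel_UNIV: "0 \<le> t \<Longrightarrow> space (k t x) = UNIV"
  using sets_eq_imp_space_eq[OF sets_kernel_borel[of t x]] by simp

text \<open>Finite-dimensional law after time \<open>s\<close> from state \<open>x\<close>, for an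
  increasing list of times. The base case is the point mass at the only function in the product over
  no times.\<close>

fun fdd :: "real \<Rightarrow> 'a \<Rightarrow> real list \<Rightarrow> (real \<Rightarrow> 'a) measure" where
  "fdd s x [] = return (PiM {} (\<lambda>_. borel)) (\<lambda>_. undefined)"
| "fdd s x (t # ts) = k (t - s) x \<bind>
     (\<lambda>y. distr (fdd t y ts) (PiM (insert t (set ts)) (\<lambda>_. borel)) (\<lambda>\<omega>. fun_upd \<omega> t y))"

text \<open>Iterated integral of a product of functions of single coordinates. Such products
  determine the finite-dimensional laws and turn consistency and the Markov property into
  manipulations of lists.\<close>

fun chain :: "(real \<Rightarrow> 'a \<Rightarrow> ennreal) \<Rightarrow> real \<Rightarrow> 'a \<Rightarrow> real list \<Rightarrow> ennreal" where
  "chain g s x [] = 1"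
| "chain g s x (t # ts) = (\<integral>\<^sup>+y. g t y * chain g t y ts \<partial>k (t - s) x)"

lemma measurable_fdd:
  "sorted (s # ts) \<Longrightarrow> (\<lambda>x. fdd s x ts) \<in> borel \<rightarrow>\<^sub>M prob_algebra (PiM (set ts) (\<lambda>_. borel))"
proof (induction ts arbitrary: s)
  case Nil
  then show ?case
    by (auto intro!: measurable_const simp: space_prob_algebra prob_space_return space_PiM)
next
  case (Cons t ts)
  have IH: "(\<lambda>y. fdd t y ts) \<in> borel \<rightarrow>\<^sub>M prob_algebra (PiM (set ts) (\<lambda>_. borel))"
    using Cons by simp
  have "(\<lambda>y. distr (fdd t y ts) (PiM (insert t (set ts)) (\<lambda>_. borel)) (\<lambda>\<omega>. fun_upd \<omega> t y))
      \<in> borel \<rightarrow>\<^sub>M prob_algebra (PiM (set (t # ts)) (\<lambda>_. borel))"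
    unfolding list.set
  proof (rule measurable_distr_prob_space2[OF IH])
    show "(\<lambda>(y, \<omega>). fun_upd \<omega> t y) \<in> borel \<Otimes>\<^sub>M PiM (set ts) (\<lambda>_. borel) \<rightarrow>\<^sub>M PiM (insert t (set ts)) (\<lambda>_. borel)"
      unfolding split_beta' by (rule measurable_fun_upd[where J = "set ts"]) auto
  qed
  moreover have "k (t - s) \<in> borel \<rightarrow>\<^sub>M prob_algebra borel" using Cons.prems by (intro kernel) simp
  ultimately show ?case unfolding fdd.simps by (intro measurable_bind_prob_space)
qed

lemma measurable_chain:
  assumes g: "\<And>t. g t \<in> borel_measurable borel" and s: "sorted (s # ts)"
  shows "(\<lambda>x. chain g s x ts) \<in> borel_measurable borel"
  using s
proof (induction ts arbitrary: s)
  case (Cons t ts)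
  have [measurable]: "(\<lambda>y. chain g t y ts) \<in> borel_measurable borel" using Cons by simp
  have [measurable]: "k (t - s) \<in> borel \<rightarrow>\<^sub>M subprob_algebra borel" using Cons.prems by (intro kernel_sub) simp
  have [measurable]: "g t \<in> borel_measurable borel" by (rule g)
  show ?case unfolding chain.simps
    by (rule measurable_compose[OF _ nn_integral_measurable_subprob_algebra]) measurable
qed simp

lemma nn_integral_fdd:
  assumes g: "\<And>t. g t \<in> borel_measurable borel" and s: "sorted (s # ts)" "distinct ts"
  shows "(\<integral>\<^sup>+\<omega>. (\<Prod>t\<in>set ts. g t (\<omega> t)) \<partial>fdd s x ts) = chain g s x ts"
  using s
proof (induction ts arbitrary: s x)
  case Nil
  then show ?case
    using prob_space.emeasure_space_1[OF prob_space_return[of "\<lambda>_. undefined" "PiM {} (\<lambda>_. borel)"]]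
    by (simp add: space_PiM)
next
  case (Cons t ts)
  note [measurable] = g
  have st: "0 \<le> t - s" and srt: "sorted (t # ts)" and dst: "distinct ts" "t \<notin> set ts" using Cons.prems by auto
  let ?P = "\<lambda>ts. PiM (set ts) (\<lambda>_. borel :: 'a measure)"
  have m: "(\<lambda>\<omega>. \<Prod>u\<in>set ts'. g u (\<omega> u)) \<in> borel_measurable (PiM J (\<lambda>_. borel))" if "set ts' \<subseteq> J" for ts' J
    using that by (intro borel_measurable_prod_ennreal measurable_compose[OF measurable_component_singleton[where M = "\<lambda>_. borel"] g]) auto
  have fddm: "(\<lambda>y. fdd t y ts) \<in> borel \<rightarrow>\<^sub>M prob_algebra (?P ts)" by (rule measurable_fdd[OF srt])
  have sets_fdd: "sets (fdd t y ts) = sets (?P ts)" for y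
    using measurable_space[OF fddm, of y] by (simp add: space_prob_algebra)
  have D: "(\<lambda>y. distr (fdd t y ts) (?P (t # ts)) (\<lambda>\<omega>. fun_upd \<omega> t y)) \<in> borel \<rightarrow>\<^sub>M prob_algebra (?P (t # ts))"
  proof (rule measurable_distr_prob_space2[OF fddm])
    show "(\<lambda>(y, \<omega>). fun_upd \<omega> t y) \<in> borel \<Otimes>\<^sub>M ?P ts \<rightarrow>\<^sub>M ?P (t # ts)"
      unfolding split_beta' by (rule measurable_fun_upd[where J = "set ts"]) auto
  qed
  have "(\<integral>\<^sup>+\<omega>. (\<Prod>u\<in>set (t # ts). g u (\<omega> u)) \<partial>fdd s x (t # ts))
      = (\<integral>\<^sup>+y. \<integral>\<^sup>+\<omega>. (\<Prod>u\<in>set (t # ts). g u (\<omega> u)) \<partial>distr (fdd t y ts) (?P (t # ts)) (\<lambda>\<omega>. fun_upd \<omega> t y) \<partial>k (t - s) x)"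
    unfolding fdd.simps list.set
  proof (rule nn_integral_bind[where B = "PiM (insert t (set ts)) (\<lambda>_. borel)"])
    show "(\<lambda>\<omega>. \<Prod>u\<in>insert t (set ts). g u (\<omega> u)) \<in> borel_measurable (PiM (insert t (set ts)) (\<lambda>_. borel))"
      using m[of "t # ts" "insert t (set ts)"] by simp
    show "(\<lambda>y. distr (fdd t y ts) (PiM (insert t (set ts)) (\<lambda>_. borel)) (\<lambda>\<omega>. fun_upd \<omega> t y))
        \<in> k (t - s) x \<rightarrow>\<^sub>M subprob_algebra (PiM (insert t (set ts)) (\<lambda>_. borel))"
      using measurable_prob_algebraD[OF D] by (simp cong: measurable_cong_sets add: sets_kernel_borel[OF st])
  qed
  also have "\<dots> = (\<integral>\<^sup>+y. g t y * chain g t y ts \<partial>k (t - s) x)"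
  proof (rule nn_integral_cong)
    fix y
    have upd: "(\<lambda>\<omega>. fun_upd \<omega> t y) \<in> fdd t y ts \<rightarrow>\<^sub>M ?P (t # ts)"
      unfolding measurable_cong_sets[OF sets_fdd refl]
      by (rule measurable_fun_upd[where J = "set ts"]) auto
    have "(\<integral>\<^sup>+\<omega>. (\<Prod>u\<in>set (t # ts). g u (\<omega> u)) \<partial>distr (fdd t y ts) (?P (t # ts)) (\<lambda>\<omega>. fun_upd \<omega> t y))
        = (\<integral>\<^sup>+\<omega>. (\<Prod>u\<in>set (t # ts). g u ((fun_upd \<omega> t y) u)) \<partial>fdd t y ts)"
      by (rule nn_integral_distr[OF upd]) (use m[of "t # ts" "set (t # ts)"] in simp)
    also have "\<dots> = (\<integral>\<^sup>+\<omega>. g t y * (\<Prod>u\<in>set ts. g u (\<omega> u)) \<partial>fdd t y ts)"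
    proof (rule nn_integral_cong)
      fix \<omega> :: "real \<Rightarrow> 'a"
      have "(\<Prod>u\<in>set ts. g u ((fun_upd \<omega> t y) u)) = (\<Prod>u\<in>set ts. g u (\<omega> u))"
        using dst(2) by (intro prod.cong) auto
      then show "(\<Prod>u\<in>set (t # ts). g u ((fun_upd \<omega> t y) u)) = g t y * (\<Prod>u\<in>set ts. g u (\<omega> u))"
        using dst(2) by simp
    qed
    also have "\<dots> = g t y * chain g t y ts"
      using Cons.IH[OF srt dst(1), of y] m[of ts "set ts"]
      by (subst nn_integral_cmult) (simp_all cong: measurable_cong_sets add: sets_fdd)
    finally show "(\<integral>\<^sup>+\<omega>. (\<Prod>u\<in>set (t # ts). g u (\<omega> u)) \<partial>distr (fdd t y ts) (?P (t # ts)) (\<lambda>\<omega>. fun_upd \<omega> t y)) = g t y * chain g t y ts" .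
  qed
  finally show ?case by simp
qed

lemma nn_integral_chapman_kolmogorov:
  assumes "0 \<le> s" "0 \<le> t" and f: "f \<in> borel_measurable borel"
  shows "(\<integral>\<^sup>+y. \<integral>\<^sup>+z. f z \<partial>k t y \<partial>k s x) = (\<integral>\<^sup>+z. f z \<partial>k (s + t) x)"
  unfolding chapman_kolmogorov[OF assms(1,2)]
  by (rule nn_integral_bind[OF f, symmetric])
     (use kernel_sub[OF assms(2)] in \<open>simp cong: measurable_cong_sets add: sets_kernel_borel[OF assms(1)]\<close>)

text \<open>A time at which nothing is observed disappears by Chapman-Kolmogorov, and at the end of
  the list because the kernels have mass one.\<close>

lemma chain_skip:
  assumes g: "\<And>t. g t \<in> borel_measurable borel" and s: "s \<le> t" "sorted (t # ts)"
  shows "(\<integral>\<^sup>+y. chain g t y ts \<partial>k (t - s) x) = chain g s x ts"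
proof (cases ts)
  case Nil
  then show ?thesis
    using s prob_space.emeasure_space_1[OF prob_space_kernel[of "t - s" x]] by simp
next
  case (Cons u us)
  have "(\<lambda>z. g u z * chain g u z us) \<in> borel_measurable borel"
  proof -
    have [measurable]: "g u \<in> borel_measurable borel" by (rule g)
    have [measurable]: "(\<lambda>z. chain g u z us) \<in> borel_measurable borel"
      by (rule measurable_chain[OF g]) (use s Cons in auto)
    show ?thesis by measurable
  qed
  from nn_integral_chapman_kolmogorov[OF _ _ this, of "t - s" "u - t" x]
  show ?thesis using s Cons by simp
qed

lemma chain_filter:
  assumes g: "\<And>t. g t \<in> borel_measurable borel" and s: "sorted (s # ts)"
    and one: "\<And>t y. t \<in> set ts \<Longrightarrow> t \<notin> J \<Longrightarrow> g t y = 1"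
  shows "chain g s x ts = chain g s x (filter (\<lambda>t. t \<in> J) ts)"
  using s one
proof (induction ts arbitrary: s x)
  case (Cons t ts)
  have srt: "sorted (t # ts)" and st: "s \<le> t" using Cons.prems by auto
  have IH: "chain g t y ts = chain g t y (filter (\<lambda>t. t \<in> J) ts)" for y
    by (rule Cons.IH[OF srt]) (use Cons.prems in auto)
  show ?case
  proof (cases "t \<in> J")
    case True
    then show ?thesis using IH by simp
  next
    case False
    have "chain g s x (t # ts) = (\<integral>\<^sup>+y. chain g t y (filter (\<lambda>t. t \<in> J) ts) \<partial>k (t - s) x)"
      using Cons.prems(2)[of t] False IH by simp
    also have "\<dots> = chain g s x (filter (\<lambda>t. t \<in> J) ts)"
      using srt by (intro chain_skip g st) (auto simp: sorted_wrt_filter)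
    finally show ?thesis using False by simp
  qed
qed simp

text \<open>The integral over the last time is absorbed into the function observed before it: the
  Markov property in terms of chains.\<close>

lemma chain_append:
  assumes g: "\<And>u. u \<in> set ts \<Longrightarrow> g' u = g u" and u: "\<And>z. g' u z = g u z * (\<integral>\<^sup>+w. g v w \<partial>k (v - u) z)"
  shows "chain g s x (ts @ [u, v]) = chain g' s x (ts @ [u])"
  using g by (induction ts arbitrary: s x) (auto simp: u intro!: nn_integral_cong)

definition law :: "'a \<Rightarrow> real set \<Rightarrow> (real \<Rightarrow> 'a) measure" where
  "law x J = fdd 0 x (sorted_list_of_set J)"

lemma sorted_times:
  "finite J \<Longrightarrow> J \<subseteq> {0..} \<Longrightarrow> sorted (0 # sorted_list_of_set J)"
  by auto

lemma law_props:
  assumes J: "finite J" "J \<subseteq> {0..}"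
  shows "prob_space (law x J)" "sets (law x J) = sets (PiM J (\<lambda>_. borel))"
  using measurable_space[OF measurable_fdd[OF sorted_times[OF J]], of x] J
  by (auto simp: law_def space_prob_algebra)

lemma nn_integral_law:
  assumes g: "\<And>t. g t \<in> borel_measurable borel" and J: "finite J" "J \<subseteq> {0..}"
  shows "(\<integral>\<^sup>+\<omega>. (\<Prod>t\<in>J. g t (\<omega> t)) \<partial>law x J) = chain g 0 x (sorted_list_of_set J)"
  using nn_integral_fdd[OF g sorted_times[OF J], of x] J by (simp add: law_def)

lemma emeasure_law:
  assumes A: "\<And>t. A t \<in> sets borel" and J: "finite J" "J \<subseteq> {0..}"
  shows "emeasure (law x J) (Pi\<^sub>E J A) = chain (\<lambda>t. indicator (A t)) 0 x (sorted_list_of_set J)"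
proof -
  have "emeasure (law x J) (Pi\<^sub>E J A) = (\<integral>\<^sup>+\<omega>. indicator (Pi\<^sub>E J A) \<omega> \<partial>law x J)"
    using A J by (intro nn_integral_indicator[symmetric]) (auto simp: law_props intro!: sets_PiM_I_finite)
  also have "\<dots> = (\<integral>\<^sup>+\<omega>. (\<Prod>t\<in>J. indicator (A t) (\<omega> t)) \<partial>law x J)"
  proof (rule nn_integral_cong)
    fix \<omega> assume "\<omega> \<in> space (law x J)"
    then have "\<omega> \<in> extensional J"
      using sets_eq_imp_space_eq[OF law_props(2)[OF J]] by (auto simp: space_PiM PiE_def)
    then show "indicator (Pi\<^sub>E J A) \<omega> = (\<Prod>t\<in>J. indicator (A t) (\<omega> t) :: ennreal)"
      using J by (auto simp: prod_indicator_eq PiE_def Pi_def indicator_def)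
  qed
  also have "\<dots> = chain (\<lambda>t. indicator (A t)) 0 x (sorted_list_of_set J)"
    using A by (intro nn_integral_law J) simp
  finally show ?thesis .
qed

lemma filter_sorted_list_of_set:
  assumes "finite H" "J \<subseteq> H"
  shows "filter (\<lambda>t. t \<in> J) (sorted_list_of_set H) = sorted_list_of_set (J :: real set)"
proof -
  have "finite J" using assms finite_subset by blast
  moreover have "sorted (filter (\<lambda>t. t \<in> J) (sorted_list_of_set H))" by (rule sorted_wrt_filter) simp
  ultimately show ?thesis using assms
    by (intro sorted_distinct_set_unique) auto
qed

text \<open>Kolmogorov consistency is tested on boxes: at the additional times the factor is the
  whole space, and \<open>chain_filter\<close> drops it.\<close>

lemma law_projective: "polish_projective {0..} (law x)"
  unfolding polish_projective_def projective_family_def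
proof (intro conjI allI impI)
  fix J H :: "real set" assume JH: "J \<subseteq> H" "finite H" "H \<subseteq> {0..}"
  have J: "finite J" "J \<subseteq> {0..}" using JH finite_subset by auto
  have rm: "(\<lambda>f. restrict f J) \<in> law x H \<rightarrow>\<^sub>M PiM J (\<lambda>_. borel)"
    unfolding measurable_cong_sets[OF law_props(2)[OF JH(2,3)] refl] by (rule measurable_restrict_subset[OF JH(1)])
  interpret H: prob_space "law x H" by (rule law_props[OF JH(2,3)])
  interpret J: prob_space "law x J" by (rule law_props[OF J])
  show "law x J = distr (law x H) (PiM J (\<lambda>_. borel)) (\<lambda>f. restrict f J)"
  proof (rule measure_eqI_PiM_finite[OF J(1)])
    show "sets (law x J) = sets (PiM J (\<lambda>_. borel))" by (rule law_props[OF J])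
    fix A :: "real \<Rightarrow> 'a set" assume A: "\<And>i. i \<in> J \<Longrightarrow> A i \<in> sets borel"
    define B where "B t = (if t \<in> J then A t else UNIV)" for t
    have B: "B t \<in> sets borel" for t using A by (auto simp: B_def)
    have AB: "Pi\<^sub>E J A = Pi\<^sub>E J B" by (rule PiE_cong) (simp add: B_def)
    have "emeasure (distr (law x H) (PiM J (\<lambda>_. borel)) (\<lambda>f. restrict f J)) (Pi\<^sub>E J A)
        = emeasure (law x H) ((\<lambda>f. restrict f J) -` Pi\<^sub>E J A \<inter> space (law x H))"
      using A J by (intro emeasure_distr rm sets_PiM_I_finite) auto
    also have "(\<lambda>f. restrict f J) -` Pi\<^sub>E J A \<inter> space (law x H) = Pi\<^sub>E H B"
    proof (rule set_eqI)
      fix f :: "real \<Rightarrow> 'a"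
      have "f \<in> space (law x H) \<longleftrightarrow> f \<in> extensional H"
        by (simp add: sets_eq_imp_space_eq[OF law_props(2)[OF JH(2,3)]] space_PiM PiE_def)
      moreover have "(\<forall>i\<in>J. f i \<in> A i) \<longleftrightarrow> (\<forall>i\<in>H. f i \<in> B i)"
        using JH(1) by (auto simp: B_def)
      ultimately show "f \<in> (\<lambda>f. restrict f J) -` Pi\<^sub>E J A \<inter> space (law x H) \<longleftrightarrow> f \<in> Pi\<^sub>E H B"
        by (auto simp: PiE_iff)
    qed
    also have "emeasure (law x H) (Pi\<^sub>E H B) = chain (\<lambda>t. indicator (B t)) 0 x (sorted_list_of_set H)"
      by (rule emeasure_law[OF B JH(2,3)])
    also have "\<dots> = chain (\<lambda>t. indicator (B t)) 0 x (filter (\<lambda>t. t \<in> J) (sorted_list_of_set H))"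
      using B by (intro chain_filter sorted_times JH) (auto simp: B_def)
    also have "\<dots> = chain (\<lambda>t. indicator (B t)) 0 x (sorted_list_of_set J)"
      using JH by (simp add: filter_sorted_list_of_set)
    also have "\<dots> = emeasure (law x J) (Pi\<^sub>E J A)"
      unfolding AB by (rule emeasure_law[OF B J, symmetric])
    finally show "emeasure (law x J) (Pi\<^sub>E J A) = emeasure (distr (law x H) (PiM J (\<lambda>_. borel)) (\<lambda>f. restrict f J)) (Pi\<^sub>E J A)"
      by (rule sym)
  next
    show "range (\<lambda>_::nat. Pi\<^sub>E J (\<lambda>_. UNIV)) \<subseteq> prod_algebra J (\<lambda>_. borel)"
      using J by (auto simp: prod_algebra_eq_finite)
    show "(\<Union>i::nat. Pi\<^sub>E J (\<lambda>_. UNIV)) = space (PiM J (\<lambda>_. borel :: 'a measure))"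
      by (simp add: space_PiM)
    show "emeasure (law x J) (Pi\<^sub>E J (\<lambda>_. UNIV)) \<noteq> \<infinity>" for i :: nat by simp
  qed simp
qed (rule law_props)

section \<open>The path measure of Kolmogorov's extension theorem\<close>

definition path_measure :: "'a \<Rightarrow> (real \<Rightarrow> 'a) measure" where
  "path_measure x = projective_family.lim {0..} (law x) (\<lambda>_. borel)"

abbreviation path_space :: "(real \<Rightarrow> 'a) measure" where
  "path_space \<equiv> PiM {0..} (\<lambda>_. borel)"

lemma prob_space_path: "prob_space (path_measure x)"
  and sets_path [measurable_cong]: "sets (path_measure x) = sets path_space"
proof -
  interpret polish_projective "{0..}" "law x" by (rule law_projective)
  show "prob_space (path_measure x)" unfolding path_measure_def by (rule P.prob_space_axioms)
  show "sets (path_measure x) = sets path_space" unfolding path_measure_def by simp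
qed

lemma space_path [simp]: "space (path_measure x) = space path_space"
  by (rule sets_eq_imp_space_eq) (rule sets_path)

lemma nn_integral_path:
  assumes g: "\<And>t. g t \<in> borel_measurable borel" and J: "finite J" "J \<subseteq> {0..}"
  shows "(\<integral>\<^sup>+\<omega>. (\<Prod>t\<in>J. g t (\<omega> t)) \<partial>path_measure x) = chain g 0 x (sorted_list_of_set J)"
proof -
  interpret polish_projective "{0..}" "law x" by (rule law_projective)
  have rm: "(\<lambda>f. restrict f J) \<in> path_measure x \<rightarrow>\<^sub>M PiM J (\<lambda>_. borel)"
    unfolding measurable_cong_sets[OF sets_path refl] by (rule measurable_restrict_subset[OF J(2)])
  have "law x J = distr (path_measure x) (PiM J (\<lambda>_. borel)) (\<lambda>f. restrict f J)"
  proof (rule measure_eqI)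
    fix A assume "A \<in> sets (law x J)"
    then have A: "A \<in> sets (PiM J (\<lambda>_. borel))" by (simp add: law_props[OF J])
    have "emeasure (distr (path_measure x) (PiM J (\<lambda>_. borel)) (\<lambda>f. restrict f J)) A = emeasure lim (emb {0..} J A)"
      using A rm by (subst emeasure_distr) (auto simp: prod_emb_def space_PiM path_measure_def)
    also have "\<dots> = emeasure (law x J) A" by (rule emeasure_lim_emb[OF J(2,1) A])
    finally show "emeasure (law x J) A = emeasure (distr (path_measure x) (PiM J (\<lambda>_. borel)) (\<lambda>f. restrict f J)) A" by simp
  qed (simp add: law_props[OF J])
  then have "(\<integral>\<^sup>+\<omega>. (\<Prod>t\<in>J. g t (\<omega> t)) \<partial>law x J) = (\<integral>\<^sup>+\<omega>. (\<Prod>t\<in>J. g t (restrict \<omega> J t)) \<partial>path_measure x)"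
    using J by (simp only:) (rule nn_integral_distr[OF rm], auto intro!: borel_measurable_prod_ennreal measurable_compose[OF measurable_component_singleton[where M = "\<lambda>_. borel"] g])
  also have "\<dots> = (\<integral>\<^sup>+\<omega>. (\<Prod>t\<in>J. g t (\<omega> t)) \<partial>path_measure x)"
    by (intro nn_integral_cong prod.cong) auto
  finally show ?thesis using nn_integral_law[OF g J, of x] by simp
qed

lemma measurable_path: "path_measure \<in> borel \<rightarrow>\<^sub>M prob_algebra path_space"
proof (rule measurable_prob_algebra_generated[OF sets_PiM Int_stable_prod_algebra prod_algebra_sets_into_space])
  fix A :: "(real \<Rightarrow> 'a) set" assume "A \<in> prod_algebra {0..} (\<lambda>_. borel)"
  then obtain J E where A: "A = prod_emb {0..} (\<lambda>_. borel) J (Pi\<^sub>E J E)" and J: "finite J" "J \<subseteq> {0..}"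
      and E: "\<And>i. i \<in> J \<Longrightarrow> E i \<in> sets borel" by (elim prod_algebraE) auto
  define B where "B t = (if t \<in> J then E t else UNIV)" for t
  have B: "B t \<in> sets borel" for t using E by (auto simp: B_def)
  have Am: "A \<in> sets path_space" unfolding A using J E by (intro sets_PiM_I) auto
  have "emeasure (path_measure x) A = chain (\<lambda>t. indicator (B t)) 0 x (sorted_list_of_set J)" for x
  proof -
    have "emeasure (path_measure x) A = (\<integral>\<^sup>+\<omega>. indicator A \<omega> \<partial>path_measure x)"
      using Am by (simp add: sets_path)
    also have "\<dots> = (\<integral>\<^sup>+\<omega>. (\<Prod>t\<in>J. indicator (B t) (\<omega> t)) \<partial>path_measure x)"
    proof (rule nn_integral_cong)
      fix \<omega> assume "\<omega> \<in> space (path_measure x)"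
      then show "indicator A \<omega> = (\<Prod>t\<in>J. indicator (B t) (\<omega> t) :: ennreal)"
        using J by (auto simp: prod_indicator_eq A prod_emb_def indicator_def B_def space_PiM PiE_iff)
    qed
    also have "\<dots> = chain (\<lambda>t. indicator (B t)) 0 x (sorted_list_of_set J)"
      using B by (intro nn_integral_path J) simp
    finally show ?thesis .
  qed
  then show "(\<lambda>x. emeasure (path_measure x) A) \<in> borel_measurable borel"
    using B by (simp add: measurable_chain[OF _ sorted_times[OF J]])
qed (auto simp: prob_space_path sets_path)

abbreviation state_space :: "'a measure" where
  "state_space \<equiv> restrict_space borel K"

text \<open>Applying \<open>r\<close> puts every path into the state space at every time, not only
  almost surely.\<close>

definition coord :: "real \<Rightarrow> (real \<Rightarrow> 'a) \<Rightarrow> 'a" where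
  "coord t \<omega> = r (\<omega> t)"

lemma coord_measurable: "0 \<le> t \<Longrightarrow> coord t \<in> path_space \<rightarrow>\<^sub>M state_space"
  unfolding coord_def by (intro measurable_restrict_space2) (auto simp: r_in)

lemma coord_borel: "0 \<le> t \<Longrightarrow> coord t \<in> borel_measurable path_space"
  using coord_measurable[of t] by (rule measurable_restrict_space2_iff[THEN iffD1, THEN conjunct1])

lemma distr_coord:
  assumes t: "0 \<le> t"
  shows "distr (path_measure x) borel (coord t) = distr (k t x) borel r"
proof (rule measure_eqI)
  have [measurable]: "coord t \<in> borel_measurable path_space" by (rule coord_borel[OF t])
  have [measurable_cong]: "sets (k t x) = sets borel" by (rule sets_kernel_borel[OF t])
  fix A assume "A \<in> sets (distr (path_measure x) borel (coord t))"
  then have A [measurable]: "A \<in> sets borel" by simp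
  have "emeasure (distr (path_measure x) borel (coord t)) A = (\<integral>\<^sup>+\<omega>. indicator A (coord t \<omega>) \<partial>path_measure x)"
    by (subst nn_integral_indicator[symmetric], simp, subst nn_integral_distr) simp_all
  also have "\<dots> = (\<integral>\<^sup>+\<omega>. (\<Prod>u\<in>{t}. indicator A (r (\<omega> u))) \<partial>path_measure x)"
    by (simp add: coord_def)
  also have "\<dots> = (\<integral>\<^sup>+y. indicator A (r y) \<partial>k t x)"
    using t by (subst nn_integral_path) auto
  also have "\<dots> = emeasure (distr (k t x) borel r) A"
    by (subst nn_integral_indicator[symmetric], simp, subst nn_integral_distr) simp_all
  finally show "emeasure (distr (path_measure x) borel (coord t)) A = emeasure (distr (k t x) borel r) A" .
qed simp

lemma measure_coord:
  assumes t: "0 \<le> t" and A: "A \<in> sets borel"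
  shows "measure (path_measure x) {\<omega> \<in> space path_space. coord t \<omega> \<in> A} = measure (k t x) (r -` A)"
proof -
  have [measurable_cong]: "sets (k t x) = sets borel" by (rule sets_kernel_borel[OF t])
  have m: "coord t \<in> path_measure x \<rightarrow>\<^sub>M borel" using coord_borel[OF t] by simp
  have "measure (path_measure x) {\<omega> \<in> space path_space. coord t \<omega> \<in> A} = measure (distr (path_measure x) borel (coord t)) A"
    using m A by (subst measure_distr) (auto intro!: arg_cong2[where f=measure])
  also have "\<dots> = measure (k t x) (r -` A)"
    unfolding distr_coord[OF t] using A by (subst measure_distr) (auto simp: space_kernel_UNIV t)
  finally show ?thesis .
qed

lemma kernel_preimage_measurable:
  assumes "0 \<le> t" "A \<in> sets borel"
  shows "(\<lambda>y. measure (k t y) (r -` A)) \<in> borel_measurable borel"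
proof -
  have "r -` A \<in> sets borel" using measurable_sets[OF r_measurable assms(2)] by simp
  then show ?thesis by (rule measurable_compose[OF kernel_sub[OF assms(1)] measurable_measure_subprob_algebra])
qed

section \<open>The Markov property for the natural filtration\<close>

abbreviation past :: "real \<Rightarrow> (real \<Rightarrow> 'a) measure" where
  "past s \<equiv> natural_filtration path_space state_space coord s"

definition past_cylinders :: "real \<Rightarrow> (real \<Rightarrow> 'a) set set" where
  "past_cylinders s = {{\<omega> \<in> space path_space. \<forall>u\<in>J. coord u \<omega> \<in> A u} | J A.
     finite J \<and> J \<subseteq> {0..s} \<and> (\<forall>u. A u \<in> sets borel)}"

lemma past_generator_sub:
  "{coord u -` A \<inter> space path_space | u A. 0 \<le> u \<and> u \<le> s \<and> A \<in> sets state_space} \<subseteq> sets path_space"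
  using coord_measurable by (auto intro: measurable_sets)

lemma past_sub: "sets (past s) \<subseteq> sets path_space" and past_space: "space (past s) = space path_space"
proof -
  have "{coord u -` A \<inter> space path_space | u A. 0 \<le> u \<and> u \<le> s \<and> A \<in> sets state_space} \<subseteq> Pow (space path_space)" by auto
  then show "sets (past s) \<subseteq> sets path_space" "space (past s) = space path_space"
    unfolding natural_filtration_def using sets.sigma_sets_subset[OF past_generator_sub]
    by (simp_all add: space_measure_of_conv)
qed

lemma coord_past: "0 \<le> u \<Longrightarrow> u \<le> s \<Longrightarrow> coord u \<in> past s \<rightarrow>\<^sub>M state_space"
  using coord_measurable[of u] past_space[of s]
  by (intro measurableI) (auto simp: natural_filtration_def dest: measurable_space)

lemma past_cylinders_sub: "past_cylinders s \<subseteq> Pow (space path_space)"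
  by (auto simp: past_cylinders_def)

lemma Int_stable_past_cylinders: "Int_stable (past_cylinders s)"
proof (rule Int_stableI)
  fix X Y assume "X \<in> past_cylinders s" "Y \<in> past_cylinders s"
  then obtain I J A B where X: "X = {\<omega> \<in> space path_space. \<forall>u\<in>I. coord u \<omega> \<in> A u}" "finite I" "I \<subseteq> {0..s}" "\<And>u. A u \<in> sets borel"
    and Y: "Y = {\<omega> \<in> space path_space. \<forall>u\<in>J. coord u \<omega> \<in> B u}" "finite J" "J \<subseteq> {0..s}" "\<And>u. B u \<in> sets borel"
    unfolding past_cylinders_def by blast
  define C where "C u = (if u \<in> I then A u else UNIV) \<inter> (if u \<in> J then B u else UNIV)" for u
  have "X \<inter> Y = {\<omega> \<in> space path_space. \<forall>u\<in>I \<union> J. coord u \<omega> \<in> C u}"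
    unfolding X Y C_def by auto
  moreover have "C u \<in> sets borel" for u using X Y by (auto simp: C_def)
  ultimately show "X \<inter> Y \<in> past_cylinders s" unfolding past_cylinders_def
    using X Y by (intro CollectI exI[of _ "I \<union> J"] exI[of _ C]) auto
qed

lemma sets_past: "sets (past s) = sigma_sets (space path_space) (past_cylinders s)"
proof -
  let ?G = "{coord u -` A \<inter> space path_space | u A. 0 \<le> u \<and> u \<le> s \<and> A \<in> sets state_space}"
  have G: "sets (past s) = sigma_sets (space path_space) ?G"
    unfolding natural_filtration_def by (rule sets_measure_of) auto
  show ?thesis
  proof (rule antisym)
    have "?G \<subseteq> past_cylinders s"
    proof clarify
      fix u A assume "0 \<le> u" "u \<le> s" "A \<in> sets state_space"
      then show "coord u -` A \<inter> space path_space \<in> past_cylinders s"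
        unfolding past_cylinders_def
        by (intro CollectI exI[of _ "{u}"] exI[of _ "\<lambda>_. A"]) (auto simp: sets_restrict_space)
    qed
    then show "sets (past s) \<subseteq> sigma_sets (space path_space) (past_cylinders s)"
      unfolding G by (rule sigma_sets_mono')
    have "past_cylinders s \<subseteq> sets (past s)"
    proof
      fix X assume "X \<in> past_cylinders s"
      then obtain J A where X: "X = {\<omega> \<in> space path_space. \<forall>u\<in>J. coord u \<omega> \<in> A u}" "finite J" "J \<subseteq> {0..s}" "\<And>u. A u \<in> sets borel"
        unfolding past_cylinders_def by blast
      have m: "coord u \<in> past s \<rightarrow>\<^sub>M borel" if "u \<in> J" for u
        using coord_past[of u s] that X(3) by (auto simp: measurable_restrict_space2_iff)
      have "{\<omega> \<in> space (past s). \<forall>u\<in>J. coord u \<omega> \<in> A u} \<in> sets (past s)"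
      proof (rule sets.sets_Collect_finite_All[OF _ X(2)])
        fix u assume "u \<in> J"
        then show "{\<omega> \<in> space (past s). coord u \<omega> \<in> A u} \<in> sets (past s)"
          using measurable_sets[OF m X(4), of u u] by (simp add: vimage_def Int_def conj_commute)
      qed
      then show "X \<in> sets (past s)" by (simp add: X past_space)
    qed
    then show "sigma_sets (space path_space) (past_cylinders s) \<subseteq> sets (past s)"
      using sets.sigma_sets_subset[of "past_cylinders s" "past s"] by (simp add: past_space)
  qed
qed

text \<open>The defining identity of the conditional expectation, on an intersection-stable
  generator of the past.\<close>

lemma past_cylinder_identity:
  assumes s: "0 \<le> s" and t: "0 \<le> t" and A: "A \<in> sets borel" and E: "E \<in> past_cylinders s"
  shows "(\<integral>\<^sup>+\<omega>. indicator E \<omega> * indicator A (coord (s + t) \<omega>) \<partial>path_measure x)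
    = (\<integral>\<^sup>+\<omega>. indicator E \<omega> * emeasure (k t (coord s \<omega>)) (r -` A) \<partial>path_measure x)"
\<comment> \<open>For \<open>t = 0\<close> the times \<open>s\<close> and \<open>s + t\<close>
  coincide, and the product over distinct times used below would lose a factor.\<close>
proof (cases "t = 0")
  case True
  have "indicator A (coord s \<omega>) = emeasure (k 0 (coord s \<omega>)) (r -` A)" for \<omega>
  proof -
    have "r -` A \<in> sets borel" using measurable_sets[OF r_measurable A] by simp
    then show ?thesis by (simp add: kernel_0 coord_def r_ident r_in indicator_def)
  qed
  then show ?thesis using True by simp
next
  case False
  then have t: "0 < t" using t by simp
  from E obtain J B where E: "E = {\<omega> \<in> space path_space. \<forall>u\<in>J. coord u \<omega> \<in> B u}" "finite J" "J \<subseteq> {0..s}" "\<And>u. B u \<in> sets borel"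
    unfolding past_cylinders_def by blast
  have rA: "r -` A \<in> sets borel" using measurable_sets[OF r_measurable A] by simp
  \<comment> \<open>The time \<open>s\<close> is set apart and always included, with the constant 1
    if it is not observed, because the last kernel starts there.\<close>
  define I where "I = J - {s}"
  define g where "g u z = (if u = s + t then indicator A (r z) else if u \<in> J then indicator (B u) (r z) else 1 :: ennreal)" for u z
  define g' where "g' u z = (if u = s then g s z * emeasure (k t z) (r -` A) else g u z)" for u z
  have gm [measurable]: "g u \<in> borel_measurable borel" for u
    unfolding g_def using A E(4) by (cases "u = s + t"; cases "u \<in> J") (auto intro!: borel_measurable_indicator' simp: measurable_sets_borel[OF r_measurable])
  have g'm: "g' u \<in> borel_measurable borel" for u
    unfolding g'_def using measurable_compose[OF kernel_sub measurable_emeasure_subprob_algebra[OF rA], of t] t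
    by (cases "u = s") auto
  have I: "finite I" "I \<subseteq> {0..<s}" using E by (auto simp: I_def)
  have "sorted_list_of_set (set (sorted_list_of_set I @ [s])) = sorted_list_of_set I @ [s]"
    using I by (intro sorted_list_of_set.idem_if_sorted_distinct) (auto simp: sorted_append)
  then have l1: "sorted_list_of_set (insert s I) = sorted_list_of_set I @ [s]" using I by simp
  have "sorted_list_of_set (set (sorted_list_of_set I @ [s, s + t])) = sorted_list_of_set I @ [s, s + t]"
    using I t by (intro sorted_list_of_set.idem_if_sorted_distinct) (auto simp: sorted_append)
  moreover have "set (sorted_list_of_set I @ [s, s + t]) = insert (s + t) (insert s I)" using I by auto
  ultimately have l2: "sorted_list_of_set (insert (s + t) (insert s I)) = sorted_list_of_set I @ [s, s + t]"
    by (simp only:)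
  have ind: "indicator E \<omega> = (\<Prod>u\<in>insert s I. g u (\<omega> u))" if "\<omega> \<in> space path_space" for \<omega>
  proof -
    have "(\<Prod>u\<in>insert s I. g u (\<omega> u)) = (\<Prod>u\<in>insert s I. if u \<in> J then indicator (B u) (coord u \<omega>) else 1)"
      using I t by (intro prod.cong) (auto simp: g_def coord_def)
    also have "\<dots> = (\<Prod>u\<in>J. indicator (B u) (coord u \<omega>))"
      using E(2) by (intro prod.mono_neutral_cong_right) (auto simp: I_def)
    also have "\<dots> = indicator E \<omega>" using that E(2) by (auto simp: E(1) indicator_def prod_indicator_eq)
    finally show ?thesis by simp
  qed
  have "(\<integral>\<^sup>+\<omega>. indicator E \<omega> * indicator A (coord (s + t) \<omega>) \<partial>path_measure x)
      = (\<integral>\<^sup>+\<omega>. (\<Prod>u\<in>insert (s + t) (insert s I). g u (\<omega> u)) \<partial>path_measure x)"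
  proof (rule nn_integral_cong)
    fix \<omega> assume "\<omega> \<in> space (path_measure x)"
    moreover have "s + t \<notin> insert s I" using I t by auto
    ultimately show "indicator E \<omega> * indicator A (coord (s + t) \<omega>) = (\<Prod>u\<in>insert (s + t) (insert s I). g u (\<omega> u))"
      using I by (simp add: ind mult.commute del: prod.insert_if) (simp add: g_def coord_def)
  qed
  also have "\<dots> = chain g 0 x (sorted_list_of_set I @ [s, s + t])"
    unfolding l2[symmetric] using I s t by (intro nn_integral_path gm) auto
  also have "\<dots> = chain g' 0 x (sorted_list_of_set I @ [s])"
  proof (rule chain_append)
    fix z
    have "(\<integral>\<^sup>+w. g (s + t) w \<partial>k (s + t - s) z) = (\<integral>\<^sup>+w. indicator (r -` A) w \<partial>k t z)"
      by (simp add: g_def indicator_def)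
    also have "\<dots> = emeasure (k t z) (r -` A)" using rA t by (simp add: sets_kernel_borel)
    finally show "g' s z = g s z * (\<integral>\<^sup>+w. g (s + t) w \<partial>k (s + t - s) z)" by (simp add: g'_def)
  qed (use I in \<open>auto simp: g'_def fun_eq_iff\<close>)
  also have "\<dots> = (\<integral>\<^sup>+\<omega>. (\<Prod>u\<in>insert s I. g' u (\<omega> u)) \<partial>path_measure x)"
    unfolding l1[symmetric] using I s by (intro nn_integral_path[symmetric] g'm) auto
  also have "\<dots> = (\<integral>\<^sup>+\<omega>. indicator E \<omega> * emeasure (k t (coord s \<omega>)) (r -` A) \<partial>path_measure x)"
  proof (rule nn_integral_cong)
    fix \<omega> assume w: "\<omega> \<in> space (path_measure x)"
    have "(\<Prod>u\<in>I. g' u (\<omega> u)) = (\<Prod>u\<in>I. g u (\<omega> u))"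
      using I by (intro prod.cong) (auto simp: g'_def)
    moreover have "s \<notin> I" using I by auto
    ultimately show "(\<Prod>u\<in>insert s I. g' u (\<omega> u)) = indicator E \<omega> * emeasure (k t (coord s \<omega>)) (r -` A)"
      using w I t by (simp add: ind g'_def coord_def kernel_r mult_ac)
  qed
  finally show ?thesis .
qed

theorem markov_process_path:
  "markov_process state_space path_space path_measure coord"
  unfolding markov_process_def
proof (intro conjI allI impI ballI)
  show "path_measure \<in> state_space \<rightarrow>\<^sub>M prob_algebra path_space"
    using measurable_path by (rule measurable_restrict_space1)
  show "coord t \<in> path_space \<rightarrow>\<^sub>M state_space" if "0 \<le> t" for t using that by (rule coord_measurable)
next
  fix x assume "x \<in> space state_space"
  then have x: "x \<in> K" by (simp add: space_restrict_space)
  interpret prob_space "path_measure x" by (rule prob_space_path)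
  have [measurable]: "coord 0 \<in> borel_measurable path_space" by (rule coord_borel) simp
  have "AE y in distr (k 0 x) borel r. y = x"
  proof (subst AE_distr_iff)
    show "AE y in k 0 x. r y = x"
      unfolding kernel_0 by (subst AE_return) (use x in \<open>auto simp: r_ident\<close>)
  qed (auto simp: kernel_0)
  then have "AE y in distr (path_measure x) borel (coord 0). y = x" unfolding distr_coord[OF order_refl] .
  then show "AE \<omega> in path_measure x. coord 0 \<omega> = x"
    by (subst (asm) AE_distr_iff) auto
next
  fix x and s t :: real and A :: "'a set" assume "x \<in> space state_space" and s: "0 \<le> s" and t: "0 \<le> t" and AS: "A \<in> sets state_space"
  have A: "A \<in> sets borel" using AS by (auto simp: sets_restrict_space)
  have rA: "r -` A \<in> sets borel" using measurable_sets[OF r_measurable A] by simp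
  interpret P: prob_space "path_measure x" by (rule prob_space_path)
  have sub: "subalgebra (path_measure x) (past s)"
    by (simp add: subalgebra_def past_space sets_path past_sub)
  interpret P: finite_measure_subalgebra "path_measure x" "past s"
    by unfold_locales (rule sub)
  let ?Y = "\<lambda>\<omega>. indicator A (coord (s + t) \<omega>) :: real"
  let ?Z = "\<lambda>\<omega>. measure (k t (coord s \<omega>)) (r -` A)"
  have [measurable]: "coord (s + t) \<in> borel_measurable path_space" "coord s \<in> borel_measurable path_space" "A \<in> sets borel"
    using s t A by (auto intro: coord_borel)
  have kpm [measurable]: "(\<lambda>y. measure (k t y) (r -` A)) \<in> borel_measurable borel"
    by (rule kernel_preimage_measurable[OF t A])
  have Zp: "?Z \<in> borel_measurable (past s)"
    using coord_past[of s s] s by (intro measurable_compose[OF _ kpm]) (simp add: measurable_restrict_space2_iff)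
  have emk: "emeasure (k t y) (r -` A) = ennreal (measure (k t y) (r -` A))" for y
    using prob_space.finite_measure[OF prob_space_kernel[OF t]] by (rule finite_measure.emeasure_eq_measure)
  have Z01: "0 \<le> ?Z \<omega>" "?Z \<omega> \<le> 1" for \<omega>
    using prob_space.prob_le_1[OF prob_space_kernel[OF t]] by auto
  have Zm [measurable]: "?Z \<in> borel_measurable path_space" by measurable
  have Ym [measurable]: "?Y \<in> borel_measurable path_space" by measurable
  \<comment> \<open>Both candidates for the conditional expectation become densities of finite
    measures on the past; these agree on the cylinders and hence everywhere.\<close>
  define MY where "MY = distr (density (path_measure x) ?Y) (past s) (\<lambda>\<omega>. \<omega>)"
  define MZ where "MZ = distr (density (path_measure x) ?Z) (past s) (\<lambda>\<omega>. \<omega>)"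
  have idm: "(\<lambda>\<omega>. \<omega>) \<in> density (path_measure x) f \<rightarrow>\<^sub>M past s" for f
    using past_sub[of s] past_space[of s] by (intro measurableI) (auto simp: sets_path intro: subsetD)
  have e: "emeasure (distr (density (path_measure x) f) (past s) (\<lambda>\<omega>. \<omega>)) E = (\<integral>\<^sup>+\<omega>. indicator E \<omega> * ennreal (f \<omega>) \<partial>path_measure x)"
    if "E \<in> sets (past s)" "f \<in> borel_measurable path_space" for E f
  proof -
    have E: "E \<in> sets path_space" "E \<subseteq> space path_space" using that(1) past_sub sets.sets_into_space by blast+
    then show ?thesis using that
      by (simp add: emeasure_distr[OF idm] Int_absorb2 emeasure_density sets_path mult.commute)
  qed
  have "MY = MZ"
  proof (rule measure_eqI_generator_eq[OF Int_stable_past_cylinders past_cylinders_sub])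
    show "sets MY = sigma_sets (space path_space) (past_cylinders s)" "sets MZ = sigma_sets (space path_space) (past_cylinders s)"
      by (simp_all add: MY_def MZ_def sets_past)
    fix E assume E: "E \<in> past_cylinders s"
    then have Es: "E \<in> sets (past s)" by (simp add: sets_past sigma_sets.Basic)
    have "ennreal (indicator A (coord (s + t) \<omega>)) = indicator A (coord (s + t) \<omega>)" for \<omega> by (simp add: indicator_def)
    then show "emeasure MY E = emeasure MZ E"
      using past_cylinder_identity[OF s t A E, of x]
      unfolding MY_def MZ_def e[OF Es Ym] e[OF Es Zm] by (simp add: emk)
  next
    have "space path_space \<in> past_cylinders s" unfolding past_cylinders_def
      by (intro CollectI exI[of _ "{}"] exI[of _ "\<lambda>_. UNIV"]) auto
    then show "range (\<lambda>_::nat. space path_space) \<subseteq> past_cylinders s" by auto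
    have "emeasure MY (space path_space) \<le> (\<integral>\<^sup>+\<omega>. 1 \<partial>path_measure x)"
    proof -
      have sp: "space path_space \<in> sets (past s)" using sets.top[of "past s"] by (simp add: past_space)
      show ?thesis unfolding MY_def e[OF sp Ym] by (rule nn_integral_mono) (simp add: indicator_def)
    qed
    then show "emeasure MY (space path_space) \<noteq> \<infinity>" for i :: nat
      using P.emeasure_space_1 by (auto simp: top_unique)
  qed auto
  have "(\<integral>\<omega>\<in>E. ?Y \<omega> \<partial>path_measure x) = (\<integral>\<omega>\<in>E. ?Z \<omega> \<partial>path_measure x)" if E: "E \<in> sets (past s)" for E
  proof -
    have Em [measurable]: "E \<in> sets path_space" using E past_sub by blast
    have "(\<integral>\<omega>. indicator E \<omega> * f \<omega> \<partial>path_measure x) = enn2real (\<integral>\<^sup>+\<omega>. indicator E \<omega> * ennreal (f \<omega>) \<partial>path_measure x)"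
      if [measurable]: "f \<in> borel_measurable path_space" and f: "\<And>\<omega>. 0 \<le> f \<omega>" for f :: "_ \<Rightarrow> real"
      using f by (subst integral_eq_nn_integral) (auto intro!: arg_cong[where f=enn2real] nn_integral_cong simp: indicator_def)
    from this[OF Ym] this[OF Zm] show ?thesis
      using e[OF E Ym] e[OF E Zm] \<open>MY = MZ\<close> Z01 unfolding MY_def MZ_def set_lebesgue_integral_def by simp
  qed
  moreover have "integrable (path_measure x) ?Y" by (rule P.integrable_const_bound[of _ 1]) (auto simp: indicator_def)
  moreover have "integrable (path_measure x) ?Z" by (rule P.integrable_const_bound[of _ 1]) (use Z01 in auto)
  ultimately have "AE \<omega> in path_measure x. real_cond_exp (path_measure x) (past s) ?Y \<omega> = ?Z \<omega>"
    using Zp by (intro P.real_cond_exp_charact) auto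
  then show "AE \<omega> in path_measure x. real_cond_exp (path_measure x) (past s) (\<lambda>\<omega>. indicator A (coord (s + t) \<omega>)) \<omega>
      = measure (path_measure (coord s \<omega>)) {\<omega>' \<in> space path_space. coord t \<omega>' \<in> A}"
    by (simp add: measure_coord[OF t A])
qed

end

section \<open>Convergence of the approximation\<close>

text \<open>Uniform continuity of the derivative on a compact interval makes the bound uniform in
  the starting time \<open>s\<close>, so all steps of the chain share one error bound.\<close>

lemma uniform_linearization:
  fixes f f' :: "real \<Rightarrow> 'b::real_normed_vector"
  assumes f: "\<And>t. 0 \<le> t \<Longrightarrow> (f has_vector_derivative f' t) (at t within {0..})"
    and f': "continuous_on {0..} f'" and e: "0 < e"
  shows "\<exists>d>0. \<forall>s h. 0 \<le> s \<longrightarrow> 0 \<le> h \<longrightarrow> h < d \<longrightarrow> s + h \<le> T \<longrightarrow> norm (f (s + h) - f s - h *\<^sub>R f' s) \<le> h * e"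
proof -
  have "uniformly_continuous_on {0..T} f'"
    by (intro compact_uniformly_continuous continuous_on_subset[OF f']) auto
  then obtain d where d: "d > 0" "\<And>x y. x \<in> {0..T} \<Longrightarrow> y \<in> {0..T} \<Longrightarrow> dist y x < d \<Longrightarrow> dist (f' y) (f' x) < e"
    using e unfolding uniformly_continuous_on_def by meson
  show ?thesis
  proof (intro exI[of _ d] conjI allI impI d)
    fix s h assume s: "0 \<le> s" "0 \<le> h" "h < d" "s + h \<le> T"
    have "norm (f (s + h) - f s - (s + h - s) *\<^sub>R f' s) \<le> norm (s + h - s) * e"
    proof (rule vector_differentiable_bound_linearization[where S = "{s..s + h}"])
      fix x assume x: "x \<in> {s..s + h}"
      show "(f has_vector_derivative f' x) (at x within {s..s + h})"
        by (rule has_vector_derivative_within_subset[OF f]) (use x s in auto)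
      have "dist (f' x) (f' s) < e" by (rule d(2)) (use x s in \<open>auto simp: dist_real_def\<close>)
      then show "norm (f' x - f' s) \<le> e" by (simp add: dist_norm)
    qed (use s in \<open>auto simp: closed_segment_eq_real_ivl\<close>)
    then show "norm (f (s + h) - f s - h *\<^sub>R f' s) \<le> h * e" using s by simp
  qed
qed

text \<open>Separates two limits: \<open>g\<close> collects errors that vanish along the
  approximation, while \<open>\<omega>\<close> is arbitrary and the bound holds from an index
  depending on it.\<close>

lemma tendsto_zero_approx:
  fixes a g :: "nat \<Rightarrow> real"
  assumes G: "0 \<le> G" and g: "g \<longlonglongrightarrow> 0"
    and le: "\<And>\<omega>. 0 < \<omega> \<Longrightarrow> eventually (\<lambda>n. \<bar>a n\<bar> \<le> G * (g n + \<omega>)) sequentially"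
  shows "a \<longlonglongrightarrow> 0"
proof (rule tendstoI)
  fix e :: real assume e: "0 < e"
  define \<omega> where "\<omega> = e / (2 * (G + 1))"
  have \<omega>: "0 < \<omega>" using G e by (simp add: \<omega>_def)
  have "eventually (\<lambda>n. g n < \<omega>) sequentially" using order_tendstoD(2)[OF g \<omega>] .
  with le[OF \<omega>] show "eventually (\<lambda>n. dist (a n) 0 < e) sequentially"
  proof eventually_elim
    case (elim n)
    have "G * (g n + \<omega>) \<le> G * (2 * \<omega>)" using elim G by (intro mult_left_mono) auto
    also have "\<dots> < (G + 1) * (2 * \<omega>)" using \<omega> by simp
    also have "\<dots> = e" using G by (simp add: \<omega>_def field_simps)
    finally show ?case using elim by simp
  qed
qed

section \<open>The iterated chain, its limit and the transition semigroup\<close>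

context affine_parameters
begin

lemma integral_mono_AE_abs:
  assumes "prob_space q" and "integrable q g" "integrable q (f :: 'a \<Rightarrow> real)" "AE y in q. \<bar>f y\<bar> \<le> g y"
  shows "\<bar>\<integral>y. f y \<partial>q\<bar> \<le> (\<integral>y. g y \<partial>q)"
  using assms by (intro order_trans[OF integral_abs_bound] integral_mono_AE integrable_abs)

lemma exp_pr_01: "v \<in> K \<Longrightarrow> 0 \<le> exp (- (pr y \<bullet> v))" "v \<in> K \<Longrightarrow> exp (- (pr y \<bullet> v)) \<le> 1"
  by (auto intro: inner_nonneg)

lemma measurable_exp_pr [measurable]: "(\<lambda>y. exp (- (pr y \<bullet> v))) \<in> borel_measurable borel"
  by (rule measurable_compose[OF measurable_pr measurable_exp_inner])

lemma integrable_exp_pr: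
  assumes "prob_space q" "sets q = sets borel" "v \<in> K"
  shows "integrable q (\<lambda>y. exp (- (pr y \<bullet> v)))"
proof -
  interpret prob_space q by fact
  have [measurable_cong]: "sets q = sets borel" by fact
  show ?thesis by (rule integrable_const_bound[of _ 1]) (use exp_pr_01[OF assms(3)] in auto)
qed

lemma integral_exp_bind:
  assumes M: "prob_space q" "sets q = sets borel" and N: "\<kappa> \<in> borel \<rightarrow>\<^sub>M prob_algebra borel" and v: "v \<in> K"
  shows "(\<integral>y. exp (- (pr y \<bullet> v)) \<partial>(q \<bind> \<kappa>)) = (\<integral>x. (\<integral>y. exp (- (pr y \<bullet> v)) \<partial>\<kappa> x) \<partial>q)"
    and "integrable q (\<lambda>x. \<integral>y. exp (- (pr y \<bullet> v)) \<partial>\<kappa> x)"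
proof -
  interpret prob_space q by fact
  have [measurable_cong]: "sets q = sets borel" by fact
  have Ns: "\<kappa> \<in> q \<rightarrow>\<^sub>M subprob_algebra borel" using measurable_prob_algebraD[OF N] by simp
  have b: "\<bar>exp (- (pr y \<bullet> v))\<bar> \<le> 1" for y using exp_pr_01[OF v, of y] by simp
  have pk: "prob_space (\<kappa> x)" "sets (\<kappa> x) = sets borel" for x
    using measurable_space[OF N, of x] by (auto simp: space_prob_algebra)
  show "(\<integral>y. exp (- (pr y \<bullet> v)) \<partial>(q \<bind> \<kappa>)) = (\<integral>x. (\<integral>y. exp (- (pr y \<bullet> v)) \<partial>\<kappa> x) \<partial>q)"
    by (rule integral_bind[OF measurable_exp_pr _ Ns, where B' = 1 and B = 1])
       (use b in \<open>auto simp: prob_space.emeasure_space_1[OF pk(1)] intro: finite_measure_axioms\<close>)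
  show "integrable q (\<lambda>x. \<integral>y. exp (- (pr y \<bullet> v)) \<partial>\<kappa> x)"
  proof (rule integrable_const_bound[of _ 1])
    show "(\<lambda>x. \<integral>y. exp (- (pr y \<bullet> v)) \<partial>\<kappa> x) \<in> borel_measurable q"
      using measurable_compose[OF Ns integral_measurable_subprob_algebra[OF measurable_exp_pr]] .
    have "\<bar>\<integral>y. exp (- (pr y \<bullet> v)) \<partial>\<kappa> x\<bar> \<le> (\<integral>y. 1 \<partial>\<kappa> x)" for x
    proof (rule integral_mono_AE_abs[OF pk(1) _ integrable_exp_pr[OF pk v]])
      interpret k: prob_space "\<kappa> x" by (rule pk)
      show "integrable (\<kappa> x) (\<lambda>y. 1 :: real)" by simp
    qed (use b in simp)
    then show "AE x in q. norm (\<integral>y. exp (- (pr y \<bullet> v)) \<partial>\<kappa> x) \<le> 1"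
      using pk by (simp add: prob_space.prob_space)
  qed
qed

lemma AE_bind_cone:
  assumes M: "sets q = sets borel" "AE y in q. y \<in> K" and N: "\<kappa> \<in> borel \<rightarrow>\<^sub>M prob_algebra borel" "\<And>x. x \<in> K \<Longrightarrow> AE y in \<kappa> x. y \<in> K"
  shows "AE y in q \<bind> \<kappa>. y \<in> K"
proof -
  have [measurable_cong]: "sets q = sets borel" by fact
  have Ns: "\<kappa> \<in> q \<rightarrow>\<^sub>M subprob_algebra borel" using measurable_prob_algebraD[OF N(1)] by simp
  have "AE x in q. AE y in \<kappa> x. y \<in> K" using M(2) by eventually_elim (rule N(2))
  then show ?thesis by (subst AE_bind[OF Ns]) auto
qed

text \<open>The first step is split off, so that inductions generalize over the initial state and
  the remaining steps can be described by the Riccati flow.\<close>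

primrec iterated :: "real \<Rightarrow> real \<Rightarrow> nat \<Rightarrow> 'a \<Rightarrow> 'a measure" where
  "iterated \<delta> h 0 x = return borel x"
| "iterated \<delta> h (Suc n) x = step_kernel \<delta> h x \<bind> iterated \<delta> h n"

context
  fixes \<delta> h :: real
  assumes \<delta>: "0 < \<delta>" "\<delta> \<le> 1" and h: "0 \<le> h" "h * (D \<delta>)\<^sup>2 \<le> 1 / 2"
begin

lemma iterated_measurable: "iterated \<delta> h n \<in> borel \<rightarrow>\<^sub>M prob_algebra borel"
proof (induction n)
  case 0
  show ?case unfolding iterated.simps by (rule measurable_return_prob_space)
next
  case (Suc n)
  show ?case unfolding iterated.simps
    by (rule measurable_bind_prob_space[OF step_kernel_measurable[OF \<delta> h] Suc])
qed

lemma iterated_prob: "prob_space (iterated \<delta> h n x)" "sets (iterated \<delta> h n x) = sets borel"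
  using measurable_space[OF iterated_measurable, of x n] by (auto simp: space_prob_algebra)

lemma step_kernel_eq: "x \<in> K \<Longrightarrow> step_kernel \<delta> h x = step_law \<delta> h x"
  by (simp add: step_kernel_def pr_ident)

lemma iterated_cone: "x \<in> K \<Longrightarrow> AE y in iterated \<delta> h n x. y \<in> K"
proof (induction n arbitrary: x)
  case 0
  then show ?case unfolding iterated.simps by (subst AE_return) auto
next
  case (Suc n)
  show ?case unfolding iterated.simps step_kernel_eq[OF Suc.prems]
    by (rule AE_bind_cone) (use Suc step_law_props[OF \<delta> h Suc.prems] iterated_measurable in auto)
qed

lemma iterated_moment:
  assumes "x \<in> K"
  shows "(\<integral>\<^sup>+y. ennreal (1 + (norm y)\<^sup>2) \<partial>iterated \<delta> h n x) \<le> ennreal ((1 + 18 * A0 * h) ^ n * (1 + (norm x)\<^sup>2))"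
  using assms
proof (induction n arbitrary: x)
  case 0
  show ?case unfolding iterated.simps by (subst nn_integral_return) auto
next
  case (Suc n)
  note q = step_law_props[OF \<delta> h Suc.prems]
  interpret prob_space "step_law \<delta> h x" by (rule q)
  have [measurable_cong]: "sets (step_law \<delta> h x) = sets borel" by (rule q)
  have c: "0 \<le> 18 * A0 * h" using A0_ge(1) h by simp
  have Ns: "iterated \<delta> h n \<in> step_law \<delta> h x \<rightarrow>\<^sub>M subprob_algebra borel" using measurable_prob_algebraD[OF iterated_measurable] by simp
  have "(\<integral>\<^sup>+y. ennreal (1 + (norm y)\<^sup>2) \<partial>iterated \<delta> h (Suc n) x)
      = (\<integral>\<^sup>+z. (\<integral>\<^sup>+y. ennreal (1 + (norm y)\<^sup>2) \<partial>iterated \<delta> h n z) \<partial>step_law \<delta> h x)"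
    unfolding iterated.simps step_kernel_eq[OF Suc.prems] by (rule nn_integral_bind[OF _ Ns]) measurable
  also have "\<dots> \<le> (\<integral>\<^sup>+z. ennreal ((1 + 18 * A0 * h) ^ n * (1 + (norm z)\<^sup>2)) \<partial>step_law \<delta> h x)"
  proof (rule nn_integral_mono_AE)
    show "AE z in step_law \<delta> h x. (\<integral>\<^sup>+y. ennreal (1 + (norm y)\<^sup>2) \<partial>iterated \<delta> h n z)
        \<le> ennreal ((1 + 18 * A0 * h) ^ n * (1 + (norm z)\<^sup>2))"
      using q(3) by eventually_elim (rule Suc.IH)
  qed
  also have "\<dots> = ennreal (\<integral>z. (1 + 18 * A0 * h) ^ n * (1 + (norm z)\<^sup>2) \<partial>step_law \<delta> h x)"
    using c step_law_moment(1)[OF \<delta> h Suc.prems] by (intro nn_integral_eq_integral integrable_mult_right Bochner_Integration.integrable_add) auto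
  also have "\<dots> = ennreal ((1 + 18 * A0 * h) ^ n * (1 + (\<integral>z. (norm z)\<^sup>2 \<partial>step_law \<delta> h x)))"
    using step_law_moment(1)[OF \<delta> h Suc.prems] by (simp add: prob_space)
  also have "\<dots> \<le> ennreal ((1 + 18 * A0 * h) ^ n * ((1 + 18 * A0 * h) * (1 + (norm x)\<^sup>2)))"
    using c step_law_moment(2)[OF \<delta> h Suc.prems] by (intro ennreal_leI mult_left_mono) auto
  finally show ?case by (simp add: mult_ac)
qed

text \<open>The remaining steps are replaced by their limit transform, with an error weighted by one
  plus the squared norm of the state after the first step. The one-step moment bound turns this into
  the weight of \<open>x\<close> at the cost of a factor \<open>1 + 18 * A0 * h\<close>, and the
  first step adds one local error.\<close>

lemma iterated_laplace:
  assumes u: "u \<in> K"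
    and M: "\<And>s. 0 \<le> s \<Longrightarrow> s \<le> T \<Longrightarrow> norm (flow s u) \<le> M"
    and da: "\<And>s. 0 \<le> s \<Longrightarrow> s + h \<le> T \<Longrightarrow> \<bar>exponent (s + h) u - exponent s u - h * F (flow s u)\<bar> \<le> h * \<omega>"
    and dv: "\<And>s. 0 \<le> s \<Longrightarrow> s + h \<le> T \<Longrightarrow> norm (flow (s + h) u - flow s u - h *\<^sub>R R (flow s u)) \<le> h * \<omega>"
    and x: "x \<in> K" and n: "real n * h \<le> T"
  shows "\<bar>(\<integral>y. exp (- (pr y \<bullet> u)) \<partial>iterated \<delta> h n x) - exp (- (exponent (real n * h) u + x \<bullet> flow (real n * h) u))\<bar>
    \<le> real n * (h * step_error \<delta> h M \<omega>) * (1 + 18 * A0 * h) ^ n * (1 + (norm x)\<^sup>2)"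
  using x n
proof (induction n arbitrary: x)
  case 0
  have "(\<integral>y. exp (- (pr y \<bullet> u)) \<partial>return borel x) = exp (- (pr x \<bullet> u))"
    by (rule integral_return) auto
  then show ?case using 0 u by (simp add: flow_0 pr_ident)
next
  case (Suc n)
  let ?q = "step_law \<delta> h x"
  note q = step_law_props[OF \<delta> h Suc.prems(1)]
  interpret prob_space ?q by (rule q)
  have [measurable_cong]: "sets ?q = sets borel" by (rule q)
  define e where "e = h * step_error \<delta> h M \<omega>"
  define C where "C = 1 + 18 * A0 * h"
  have C: "1 \<le> C" using A0_ge(1) h by (simp add: C_def)
  define s where "s = real n * h"
  have s: "0 \<le> s" "s + h \<le> T" "s \<le> T" "real (Suc n) * h = s + h"
    using h Suc.prems by (auto simp: s_def distrib_right add.commute)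
  have v: "flow s u \<in> K" "norm (flow s u) \<le> M" "flow (s + h) u \<in> K"
    using s h u by (auto intro: flow_in M)
  have a: "0 \<le> exponent s u" "0 \<le> exponent (s + h) u" using s h u by (auto intro: exponent_nonneg)
  have step: "\<bar>exp (- exponent s u) * (\<integral>y. exp (- (y \<bullet> flow s u)) \<partial>step_law \<delta> h z) - exp (- (exponent (s + h) u + z \<bullet> flow (s + h) u))\<bar>
      \<le> e * (1 + (norm z)\<^sup>2)" if "z \<in> K" for z
    unfolding e_def by (rule one_step[OF \<delta> h that v a da[OF s(1,2)] dv[OF s(1,2)]])
  have e0: "0 \<le> e" using step[OF cone_zero] by simp
  let ?f = "\<lambda>z. (\<integral>y. exp (- (pr y \<bullet> u)) \<partial>iterated \<delta> h n z)"
  let ?g = "\<lambda>z. exp (- exponent s u) * exp (- (pr z \<bullet> flow s u))"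
  have ig: "integrable ?q ?g" by (intro integrable_mult_right integrable_exp_pr q v)
  have "(\<integral>y. exp (- (pr y \<bullet> u)) \<partial>iterated \<delta> h (Suc n) x) = (\<integral>z. ?f z \<partial>?q)"
    unfolding iterated.simps step_kernel_eq[OF Suc.prems(1)] by (rule integral_exp_bind[OF q(1,2) iterated_measurable u])
  also have "(\<integral>z. ?f z \<partial>?q) = (\<integral>z. ?f z - ?g z \<partial>?q) + (\<integral>z. ?g z \<partial>?q)"
    using ig integral_exp_bind(2)[OF q(1,2) iterated_measurable u] by simp
  finally have 1: "(\<integral>y. exp (- (pr y \<bullet> u)) \<partial>iterated \<delta> h (Suc n) x) = \<dots>" .
  have 2: "\<bar>\<integral>z. ?f z - ?g z \<partial>?q\<bar> \<le> (\<integral>z. real n * e * C ^ n * (1 + (norm z)\<^sup>2) \<partial>?q)"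
  proof (rule integral_mono_AE_abs[OF q(1)])
    show "AE z in ?q. \<bar>?f z - ?g z\<bar> \<le> real n * e * C ^ n * (1 + (norm z)\<^sup>2)"
      using q(3)
    proof eventually_elim
      case (elim z)
      have "?g z = exp (- (exponent s u + z \<bullet> flow s u))" using elim by (simp add: pr_ident flip: exp_add)
      then show ?case using Suc.IH[OF elim] s(3) by (simp add: s_def[symmetric] e_def C_def)
    qed
  qed (use ig integral_exp_bind(2)[OF q(1,2) iterated_measurable u] step_law_moment(1)[OF \<delta> h Suc.prems(1)] in auto)
  have "(\<integral>z. real n * e * C ^ n * (1 + (norm z)\<^sup>2) \<partial>?q) = real n * e * C ^ n * (1 + (\<integral>z. (norm z)\<^sup>2 \<partial>?q))"
    using step_law_moment(1)[OF \<delta> h Suc.prems(1)] by (simp add: prob_space)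
  also have "\<dots> \<le> real n * e * C ^ n * (C * (1 + (norm x)\<^sup>2))"
    using e0 C step_law_moment(2)[OF \<delta> h Suc.prems(1)] by (intro mult_left_mono) (auto simp: C_def)
  finally have 3: "(\<integral>z. real n * e * C ^ n * (1 + (norm z)\<^sup>2) \<partial>?q) \<le> real n * e * C ^ Suc n * (1 + (norm x)\<^sup>2)"
    by (simp add: mult_ac)
  have 4: "(\<integral>z. ?g z \<partial>?q) = exp (- exponent s u) * (\<integral>y. exp (- (y \<bullet> flow s u)) \<partial>?q)"
    using integral_pr[OF q(2,3) measurable_exp_inner[of "flow s u"]] by simp
  have 5: "e * (1 + (norm x)\<^sup>2) \<le> e * C ^ Suc n * (1 + (norm x)\<^sup>2)"
    using e0 one_le_power[OF C, of "Suc n"] by (intro mult_right_mono) (auto simp: mult_le_cancel_left1)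
  have "\<bar>(\<integral>y. exp (- (pr y \<bullet> u)) \<partial>iterated \<delta> h (Suc n) x) - exp (- (exponent (s + h) u + x \<bullet> flow (s + h) u))\<bar>
      \<le> real n * e * C ^ Suc n * (1 + (norm x)\<^sup>2) + e * C ^ Suc n * (1 + (norm x)\<^sup>2)"
    using 2 3 5 step[OF Suc.prems(1)] unfolding 1 4 by linarith
  also have "\<dots> = real (Suc n) * e * C ^ Suc n * (1 + (norm x)\<^sup>2)" by (simp only: of_nat_Suc distrib_right mult_1_left)
  finally show ?case unfolding e_def C_def s(4) .
qed

end

text \<open>The origin is excluded from the space, so small balls decrease to the empty set; for
  \<open>\<mu>\<close> continuity in norm is needed.\<close>

lemma small_mass_tendsto: "(\<lambda>n. mass {\<xi> \<in> space S. norm \<xi> \<le> 1 / real (Suc n)}) \<longlonglongrightarrow> 0"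
proof -
  interpret m2: finite_measure m2 by (rule finite_m2)
  let ?A = "\<lambda>n. {\<xi> \<in> space S. norm \<xi> \<le> 1 / real (Suc n)}"
  have A: "range ?A \<subseteq> sets S"
    using small_set by blast
  have dec: "decseq ?A"
  proof (rule antimonoI)
    fix k n :: nat assume "k \<le> n"
    then have "1 / real (Suc n) \<le> 1 / real (Suc k)" by (intro divide_left_mono) auto
    then show "?A n \<subseteq> ?A k" by auto
  qed
  have em: "(\<Inter>n. ?A n) = {}"
  proof (rule ccontr)
    assume "(\<Inter>n. ?A n) \<noteq> {}"
    then obtain \<xi> where \<xi>: "\<xi> \<in> space S" "\<And>n. norm \<xi> \<le> 1 / real (Suc n)" by auto
    obtain n where "inverse (real (Suc n)) < norm \<xi>" using reals_Archimedean[OF in_S(3)[OF \<xi>(1)]] by auto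
    then show False using \<xi>(2)[of n] by (simp add: inverse_eq_divide)
  qed
  have "(\<lambda>n. measure m2 (?A n)) \<longlonglongrightarrow> measure m2 (\<Inter>n. ?A n)"
    using A dec by (intro m2.finite_Lim_measure_decseq) auto
  moreover have "(\<lambda>n. norm (\<mu> (?A n))) \<longlonglongrightarrow> 0" by (rule vm_decseq_tendsto_0[OF A dec em])
  ultimately show ?thesis unfolding mass_def em using tendsto_add[of _ 0 _ _ 0] by auto
qed

theorem transition_law_exists:
  assumes x: "x \<in> K" and t: "0 \<le> t"
  shows "\<exists>q. prob_space q \<and> sets q = sets borel \<and> (AE y in q. y \<in> K) \<and>
    (\<forall>u\<in>K. (\<integral>y. exp (- (y \<bullet> u)) \<partial>q) = exp (- (exponent t u + x \<bullet> flow t u)))"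
proof -
  define \<delta> where "\<delta> n = 1 / real (Suc n)" for n
  have \<delta>: "0 < \<delta> n" "\<delta> n \<le> 1" for n by (auto simp: \<delta>_def)
  \<comment> \<open>So many steps that \<open>h n * (D (\<delta> n))\<^sup>2\<close> is at most
    \<open>\<delta> n / 2\<close>; the successor keeps the number positive when \<open>t\<close> is
    0.\<close>
  define N where "N n = Suc (nat \<lceil>2 * real (Suc n) * (D (\<delta> n))\<^sup>2 * t\<rceil>)" for n
  define h where "h n = t / real (N n)" for n
  have D1: "1 \<le> (D (\<delta> n))\<^sup>2" for n by (rule one_le_power[OF D_ge(1)[OF \<delta>]])
  have Nh: "real (N n) * h n = t" for n by (simp add: h_def N_def)
  have h0: "0 \<le> h n" for n using t by (simp add: h_def)
  have hD: "h n * (D (\<delta> n))\<^sup>2 \<le> \<delta> n / 2" for n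
  proof -
    have "2 * real (Suc n) * (D (\<delta> n))\<^sup>2 * t \<le> real (N n)"
      unfolding N_def using real_nat_ceiling_ge[of "2 * real (Suc n) * (D (\<delta> n))\<^sup>2 * t"] by linarith
    then have "2 * real (Suc n) * ((D (\<delta> n))\<^sup>2 * h n) \<le> 1"
      by (simp add: h_def N_def field_simps)
    then show ?thesis by (simp add: \<delta>_def field_simps)
  qed
  have h: "h n * (D (\<delta> n))\<^sup>2 \<le> 1 / 2" for n using hD[of n] \<delta>[of n] by linarith
  have h\<delta>: "h n \<le> \<delta> n / 2" for n
    using hD[of n] mult_left_mono[OF D1 h0, of n n] by simp
  have \<delta>0: "\<delta> \<longlonglongrightarrow> 0" unfolding \<delta>_def by (rule LIMSEQ_Suc[OF lim_const_over_n])
  have h_small: "eventually (\<lambda>n. h n < d) sequentially" if "0 < d" for d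
    using order_tendstoD(2)[OF \<delta>0 that]
  proof eventually_elim
    case (elim n)
    then show ?case using h\<delta>[of n] \<delta>[of n] by linarith
  qed
  \<comment> \<open>Limit of the compounded moment growth over time \<open>t\<close>, the same for
    all truncation levels.\<close>
  define C where "C = exp (18 * A0 * t)"
  have pow: "(1 + 18 * A0 * h n) ^ N n \<le> C" for n
  proof -
    have "(1 + 18 * A0 * h n) ^ N n \<le> exp (18 * A0 * h n) ^ N n"
      using h0[of n] A0_ge(1) by (intro power_mono exp_ge_add_one_self) (auto intro!: add_nonneg_nonneg)
    also have "\<dots> = exp (18 * A0 * (real (N n) * h n))" by (simp flip: exp_of_nat_mult add: mult_ac)
    finally show ?thesis unfolding Nh C_def .
  qed
  have C0: "0 \<le> C" by (simp add: C_def)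
  note it = iterated_prob[OF \<delta> h0 h] iterated_cone[OF \<delta> h0 h x]
  show ?thesis
  proof (rule laplace_limit[where p = "\<lambda>n. iterated (\<delta> n) (h n) (N n) x" and C = "C * (1 + (norm x)\<^sup>2)"])
    fix n
    have "(\<integral>\<^sup>+y. ennreal ((norm y)\<^sup>2) \<partial>iterated (\<delta> n) (h n) (N n) x) \<le> (\<integral>\<^sup>+y. ennreal (1 + (norm y)\<^sup>2) \<partial>iterated (\<delta> n) (h n) (N n) x)"
      by (intro nn_integral_mono ennreal_leI) simp
    also have "\<dots> \<le> ennreal ((1 + 18 * A0 * h n) ^ N n * (1 + (norm x)\<^sup>2))" by (rule iterated_moment[OF \<delta> h0 h x])
    also have "\<dots> \<le> ennreal (C * (1 + (norm x)\<^sup>2))" by (intro ennreal_leI mult_right_mono pow) simp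
    finally show "(\<integral>\<^sup>+y. ennreal ((norm y)\<^sup>2) \<partial>iterated (\<delta> n) (h n) (N n) x) \<le> ennreal (C * (1 + (norm x)\<^sup>2))" .
  next
    fix u assume u: "u \<in> K"
    \<comment> \<open>The a priori bound of \<open>solves_bound\<close>, valid along the whole flow
      up to time \<open>t\<close>.\<close>
    define M where "M = (1 + (norm u)\<^sup>2) * exp (4 * A0 * t)"
    have M: "norm (flow s u) \<le> M" if "0 \<le> s" "s \<le> t" for s
      unfolding M_def using solves_bound[OF flow_solves[OF u]] that by simp
    have M0: "0 \<le> M" using M[of 0] t norm_ge_zero[of "flow 0 u"] by linarith
    \<comment> \<open>The 4 is the factor of \<open>\<omega>\<close> in \<open>step_error\<close>;
      it also dominates the factors of the other two errors.\<close>
    define G where "G = 4 * t * C * (1 + (norm x)\<^sup>2)"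
    define g where "g n = (1 + 2 * M) * \<delta> n + (1 + M) * M * mass {\<xi> \<in> space S. norm \<xi> \<le> \<delta> n}" for n
    have "(\<lambda>n. (1 + 2 * M) * \<delta> n + (1 + M) * M * mass {\<xi> \<in> space S. norm \<xi> \<le> \<delta> n}) \<longlonglongrightarrow> (1 + 2 * M) * 0 + (1 + M) * M * 0"
      using small_mass_tendsto by (intro tendsto_intros \<delta>0) (simp add: \<delta>_def)
    then have g: "g \<longlonglongrightarrow> 0" by (simp add: g_def[abs_def])
    let ?E = "\<lambda>n. (\<integral>y. exp (- (y \<bullet> u)) \<partial>iterated (\<delta> n) (h n) (N n) x)"
    have "(\<lambda>n. ?E n - exp (- (exponent t u + x \<bullet> flow t u))) \<longlonglongrightarrow> 0"
    proof (rule tendsto_zero_approx[OF _ g])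
      show "0 \<le> G" using t C0 by (simp add: G_def)
      fix \<omega> :: real assume \<omega>: "0 < \<omega>"
      obtain d1 where d1: "d1 > 0" "\<forall>s h. 0 \<le> s \<longrightarrow> 0 \<le> h \<longrightarrow> h < d1 \<longrightarrow> s + h \<le> t \<longrightarrow> norm (flow (s + h) u - flow s u - h *\<^sub>R R (flow s u)) \<le> h * \<omega>"
        using uniform_linearization[OF flow_deriv[OF u] continuous_on_R_flow[OF u] \<omega>, of t] by blast
      obtain d2 where d2: "d2 > 0" "\<forall>s h. 0 \<le> s \<longrightarrow> 0 \<le> h \<longrightarrow> h < d2 \<longrightarrow> s + h \<le> t \<longrightarrow> norm (exponent (s + h) u - exponent s u - h *\<^sub>R F (flow s u)) \<le> h * \<omega>"
        using uniform_linearization[OF exponent_deriv[OF u, unfolded has_real_derivative_iff_has_vector_derivative] continuous_on_F_flow[OF u] \<omega>, of t] by blast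
      show "eventually (\<lambda>n. \<bar>?E n - exp (- (exponent t u + x \<bullet> flow t u))\<bar> \<le> G * (g n + \<omega>)) sequentially"
        using h_small[OF d1(1)] h_small[OF d2(1)]
      proof eventually_elim
        case (elim n)
        let ?\<eta> = "mass {\<xi> \<in> space S. norm \<xi> \<le> \<delta> n}"
        have "?E n = (\<integral>y. exp (- (pr y \<bullet> u)) \<partial>iterated (\<delta> n) (h n) (N n) x)"
          by (rule integral_pr[OF it(2,3) measurable_exp_inner, symmetric])
        have "\<bar>?E n - exp (- (exponent t u + x \<bullet> flow t u))\<bar>
            \<le> real (N n) * (h n * step_error (\<delta> n) (h n) M \<omega>) * (1 + 18 * A0 * h n) ^ N n * (1 + (norm x)\<^sup>2)"
        proof -
          have "\<bar>(\<integral>y. exp (- (pr y \<bullet> u)) \<partial>iterated (\<delta> n) (h n) (N n) x) - exp (- (exponent (real (N n) * h n) u + x \<bullet> flow (real (N n) * h n) u))\<bar>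
              \<le> real (N n) * (h n * step_error (\<delta> n) (h n) M \<omega>) * (1 + 18 * A0 * h n) ^ N n * (1 + (norm x)\<^sup>2)"
          proof (rule iterated_laplace[OF \<delta> h0 h u _ _ _ x, where T = t])
            show "real (N n) * h n \<le> t" by (simp add: Nh)
          qed (use M d1(2) d2(2) h0 elim in auto)
          then show ?thesis unfolding Nh \<open>?E n = _\<close> .
        qed
        also have "\<dots> = t * step_error (\<delta> n) (h n) M \<omega> * (1 + 18 * A0 * h n) ^ N n * (1 + (norm x)\<^sup>2)"
          by (simp flip: Nh[of n])
        also have "\<dots> \<le> t * (4 * (g n + \<omega>)) * C * (1 + (norm x)\<^sup>2)"
        proof (rule mult_right_mono[OF mult_mono[OF mult_left_mono[OF _ t] pow]])
          have "(1 + 2 * M) * (h n * (D (\<delta> n))\<^sup>2) \<le> (1 + 2 * M) * (2 * \<delta> n)"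
            using M0 hD[of n] \<delta>[of n] by (intro mult_left_mono) auto
          moreover have "0 \<le> (1 + M) * M * ?\<eta>" using M0 mass_nonneg by (intro mult_nonneg_nonneg) auto
          ultimately show "step_error (\<delta> n) (h n) M \<omega> \<le> 4 * (g n + \<omega>)"
            unfolding step_error_def[OF \<delta> h0 h] g_def by (simp add: algebra_simps)
          show "0 \<le> t * (4 * (g n + \<omega>))"
            unfolding g_def using t M0 \<delta>[of n] mass_nonneg \<omega> by (intro mult_nonneg_nonneg add_nonneg_nonneg) auto
          show "0 \<le> (1 + 18 * A0 * h n) ^ N n" using A0_ge(1) h0[of n] by (intro zero_le_power add_nonneg_nonneg mult_nonneg_nonneg) auto
        qed simp
        also have "\<dots> = G * (g n + \<omega>)" by (simp add: G_def)
        finally show ?case .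
      qed
    qed
    then show "?E \<longlonglongrightarrow> exp (- (exponent t u + x \<bullet> flow t u))" by (simp add: LIM_zero_iff)
  qed (use it C0 in \<open>auto intro: mult_nonneg_nonneg\<close>)
qed

text \<open>The projection \<open>pr\<close> extends the kernels from \<open>K\<close> to the whole Polish space.\<close>

definition transition :: "real \<Rightarrow> 'a \<Rightarrow> 'a measure" where
  "transition t x = (SOME q. prob_space q \<and> sets q = sets borel \<and> (AE y in q. y \<in> K) \<and>
    (\<forall>u\<in>K. (\<integral>y. exp (- (y \<bullet> u)) \<partial>q) = exp (- (exponent t u + pr x \<bullet> flow t u))))"

lemma transition:
  assumes t: "0 \<le> t"
  shows "prob_space (transition t x)" "sets (transition t x) = sets borel" "AE y in transition t x. y \<in> K"
    and transition_laplace: "u \<in> K \<Longrightarrow> (\<integral>y. exp (- (y \<bullet> u)) \<partial>transition t x) = exp (- (exponent t u + pr x \<bullet> flow t u))"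
  using someI_ex[OF transition_law_exists[OF pr_in t, of x], folded transition_def] by blast+

lemma transition_laplace_pr:
  assumes "0 \<le> t" "u \<in> K"
  shows "(\<integral>y. exp (- (pr y \<bullet> u)) \<partial>transition t x) = exp (- (exponent t u + pr x \<bullet> flow t u))"
  using integral_pr[OF transition(2,3)[OF assms(1)] measurable_exp_inner[of u]] transition_laplace[OF assms] by simp

text \<open>The law is chosen separately for every \<open>x\<close>, but its Laplace transform is
  explicit and measurable in \<open>x\<close>.\<close>

lemma transition_measurable:
  assumes t: "0 \<le> t"
  shows "transition t \<in> borel \<rightarrow>\<^sub>M prob_algebra borel"
proof (rule laplace_kernel_measurable)
  fix v assume "v \<in> K"
  then show "(\<lambda>x. \<integral>y. exp (- (y \<bullet> v)) \<partial>transition t x) \<in> borel_measurable borel"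
    by (simp add: transition_laplace[OF t])
qed (rule transition[OF t])+

lemma transition_0: "transition 0 x = return borel (pr x)"
proof (rule laplace_unique)
  show "AE y in return borel (pr x). y \<in> K" by (subst AE_return) (auto intro: pr_in)
  fix v assume v: "v \<in> K"
  have "(\<integral>y. exp (- (y \<bullet> v)) \<partial>return borel (pr x)) = exp (- (pr x \<bullet> v))"
    by (rule integral_return) auto
  then show "(\<integral>y. exp (- (y \<bullet> v)) \<partial>transition 0 x) = (\<integral>y. exp (- (y \<bullet> v)) \<partial>return borel (pr x))"
    using v by (simp add: transition_laplace flow_0)
qed (rule transition[OF order_refl] prob_space_return sets_return | simp)+

text \<open>On Laplace transforms Chapman-Kolmogorov is the semigroup property of
  \<open>flow\<close> together with the cocycle property of \<open>exponent\<close>.\<close>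

lemma transition_add:
  assumes s: "0 \<le> s" and t: "0 \<le> t"
  shows "transition (s + t) x = transition s x \<bind> transition t"
proof (rule laplace_unique)
  have st: "0 \<le> s + t" using s t by simp
  show "prob_space (transition (s + t) x)" "sets (transition (s + t) x) = sets borel" "AE y in transition (s + t) x. y \<in> K"
    by (rule transition[OF st])+
  have a: "transition s x \<in> space (prob_algebra borel)" using transition[OF s] by (simp add: space_prob_algebra)
  show 1: "prob_space (transition s x \<bind> transition t)" "sets (transition s x \<bind> transition t) = sets borel"
    by (rule prob_space_bind'[OF a transition_measurable[OF t]] sets_bind'[OF a transition_measurable[OF t]])+
  show 2: "AE y in transition s x \<bind> transition t. y \<in> K"
    by (rule AE_bind_cone[OF transition(2,3)[OF s] transition_measurable[OF t] transition(3)[OF t]])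
  fix v assume v: "v \<in> K"
  have f: "flow t v \<in> K" by (rule flow_in[OF v t])
  have "(\<integral>y. exp (- (y \<bullet> v)) \<partial>(transition s x \<bind> transition t)) = (\<integral>y. exp (- (pr y \<bullet> v)) \<partial>(transition s x \<bind> transition t))"
    by (rule integral_pr[OF 1(2) 2 measurable_exp_inner, symmetric])
  also have "\<dots> = (\<integral>z. (\<integral>y. exp (- (pr y \<bullet> v)) \<partial>transition t z) \<partial>transition s x)"
    by (rule integral_exp_bind[OF transition(1,2)[OF s] transition_measurable[OF t] v])
  also have "\<dots> = (\<integral>z. exp (- exponent t v) * exp (- (pr z \<bullet> flow t v)) \<partial>transition s x)"
    by (simp add: transition_laplace_pr[OF t v] flip: exp_add)
  also have "\<dots> = exp (- exponent t v) * exp (- (exponent s (flow t v) + pr x \<bullet> flow s (flow t v)))"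
    by (simp only: integral_mult_right_zero transition_laplace_pr[OF s f])
  also have "\<dots> = exp (- (exponent (t + s) v + pr x \<bullet> flow (t + s) v))"
    unfolding exponent_add[OF v t s] flow_add[OF v t s] by (simp flip: exp_add)
  finally show "(\<integral>y. exp (- (y \<bullet> v)) \<partial>transition (s + t) x) = (\<integral>y. exp (- (y \<bullet> v)) \<partial>(transition s x \<bind> transition t))"
    by (simp add: transition_laplace[OF st v] add.commute)
qed

sublocale process: kernel_semigroup transition K pr
  by unfold_locales
     (auto simp: transition_0 pr_ident intro: transition_measurable transition_add pr_in measurable_pr cone_borel,
      simp add: transition_def pr_idem)

theorem process_laplace:
  assumes t: "0 \<le> t" and u: "u \<in> K" and x: "x \<in> K"
  shows "(\<integral>\<omega>. exp (- (process.coord t \<omega> \<bullet> u)) \<partial>process.path_measure x) = exp (- exponent t u - x \<bullet> flow t u)"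
proof -
  have m: "process.coord t \<in> process.path_measure x \<rightarrow>\<^sub>M borel"
    using process.coord_borel[OF t] by (simp add: measurable_cong_sets[OF process.sets_path refl])
  have p: "pr \<in> transition t x \<rightarrow>\<^sub>M borel" by (simp add: measurable_cong_sets[OF transition(2)[OF t] refl])
  have "(\<integral>\<omega>. exp (- (process.coord t \<omega> \<bullet> u)) \<partial>process.path_measure x)
      = (\<integral>y. exp (- (y \<bullet> u)) \<partial>distr (process.path_measure x) borel (process.coord t))"
    by (rule integral_distr[symmetric, OF m]) measurable
  also have "\<dots> = (\<integral>y. exp (- (pr y \<bullet> u)) \<partial>transition t x)"
    unfolding process.distr_coord[OF t] by (rule integral_distr[OF p]) measurable
  also have "\<dots> = exp (- exponent t u - x \<bullet> flow t u)"
    using x by (simp add: transition_laplace_pr[OF t u] pr_ident)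
  finally show ?thesis .
qed

end

section \<open>Positive Hilbert-Schmidt operators\<close>

lemma countable_dense_imp_subbasis:
  fixes D :: "'a::metric_space set"
  assumes D: "countable D" "closure D = UNIV"
  shows "\<exists>\<B>::'a set set. countable \<B> \<and> open = generate_topology \<B>"
proof (intro exI conjI)
  let ?B = "(\<lambda>(d, n). ball d (1 / real (Suc n))) ` (D \<times> (UNIV :: nat set))"
  show "countable ?B" using D by auto
  show "open = generate_topology ?B"
  proof (rule topological_basis_imp_subbasis, rule topological_basisI)
    fix U and x :: 'a assume U: "open U" "x \<in> U"
    then obtain e where e: "0 < e" "ball x e \<subseteq> U" by (meson open_contains_ball)
    obtain n where n: "inverse (real (Suc n)) < e / 2" using reals_Archimedean[of "e / 2"] e by auto
    have "x \<in> closure D" using D by simp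
    then obtain d where d: "d \<in> D" "dist d x < 1 / real (Suc n)"
      unfolding closure_approachable by (metis of_nat_0_less_iff zero_less_Suc zero_less_divide_1_iff)
    have "ball d (1 / real (Suc n)) \<subseteq> U"
    proof
      fix y assume "y \<in> ball d (1 / real (Suc n))"
      then have "dist x y < e" using d n dist_triangle[of x y d] by (simp add: dist_commute inverse_eq_divide)
      then show "y \<in> U" using e by auto
    qed
    then show "\<exists>B'\<in>?B. x \<in> B' \<and> B' \<subseteq> U" using d by (intro bexI[of _ "ball d (1 / real (Suc n))"]) auto
  qed auto
qed

text \<open>Rational combinations are countable as images of lists; their closure is a subspace
  because the rationals are dense in the reals.\<close>

lemma countable_dense_of_span:
  fixes V :: "'a::real_normed_vector set"
  assumes V: "countable V" "closure (span V) = UNIV"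
  shows "\<exists>D::'a set. countable D \<and> closure D = UNIV"
proof (intro exI conjI)
  let ?D = "(\<lambda>l. \<Sum>(r, v)\<leftarrow>l. of_rat r *\<^sub>R v) ` lists ((UNIV :: rat set) \<times> V)"
  show "countable ?D" using V by (intro countable_image countable_lists countable_SIGMA) auto
  have add: "x + y \<in> ?D" if xy: "x \<in> ?D" "y \<in> ?D" for x y
  proof -
    obtain k l where "k \<in> lists (UNIV \<times> V)" "l \<in> lists (UNIV \<times> V)"
      "x = (\<Sum>(r, v)\<leftarrow>k. of_rat r *\<^sub>R v)" "y = (\<Sum>(r, v)\<leftarrow>l. of_rat r *\<^sub>R v)"
      using xy by blast
    then show ?thesis by (intro image_eqI[of _ _ "k @ l"]) auto
  qed
  have scale: "of_rat q *\<^sub>R x \<in> ?D" if x: "x \<in> ?D" for q :: rat and x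
  proof -
    obtain l where l: "l \<in> lists (UNIV \<times> V)" "x = (\<Sum>(r, v)\<leftarrow>l. of_rat r *\<^sub>R v)" using x by blast
    have "of_rat q *\<^sub>R (\<Sum>(r, v)\<leftarrow>l. of_rat r *\<^sub>R v) = (\<Sum>(r, v)\<leftarrow>map (\<lambda>(r, v). (q * r, v)) l. of_rat r *\<^sub>R v)"
      by (induction l) (auto simp: scaleR_add_right of_rat_mult)
    then show ?thesis using l by (intro image_eqI[of _ _ "map (\<lambda>(r, v). (q * r, v)) l"]) auto
  qed
  have zero: "0 \<in> ?D" by (rule image_eqI[of _ _ "[]"]) auto
  have VD: "V \<subseteq> ?D"
  proof
    fix v assume "v \<in> V"
    then show "v \<in> ?D" by (intro image_eqI[of _ _ "[(1, v)]"]) auto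
  qed
  have "subspace (closure ?D)"
    unfolding subspace_def
  proof (intro conjI ballI allI)
    show "0 \<in> closure ?D" by (rule subsetD[OF closure_subset zero])
  next
    fix x y assume "x \<in> closure ?D" "y \<in> closure ?D"
    then obtain a b where "\<And>n. a n \<in> ?D" "\<And>n. b n \<in> ?D" "a \<longlonglongrightarrow> x" "b \<longlonglongrightarrow> y"
      unfolding closure_sequential by blast
    then have "\<forall>n. a n + b n \<in> ?D" "(\<lambda>n. a n + b n) \<longlonglongrightarrow> x + y"
      using add by (blast, intro tendsto_add)
    then show "x + y \<in> closure ?D"
      unfolding closure_sequential by (intro exI[of _ "\<lambda>n. a n + b n"] conjI)
  next
    fix c :: real and x assume "x \<in> closure ?D"
    then obtain a where a: "\<And>n. a n \<in> ?D" "a \<longlonglongrightarrow> x"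
      unfolding closure_sequential by blast
    have "c \<in> closure \<rat>" using Rats_closure_real by simp
    then obtain q where q: "\<And>n. q n \<in> \<rat>" "q \<longlonglongrightarrow> c" unfolding closure_sequential by blast
    have "q n *\<^sub>R a n \<in> ?D" for n using q(1)[of n] scale[OF a(1)[of n]] by (metis Rats_cases)
    moreover have "(\<lambda>n. q n *\<^sub>R a n) \<longlonglongrightarrow> c *\<^sub>R x" by (intro tendsto_scaleR q a)
    ultimately show "c *\<^sub>R x \<in> closure ?D"
      unfolding closure_sequential by (intro exI[of _ "\<lambda>n. q n *\<^sub>R a n"] conjI allI)
  qed
  then have "span V \<subseteq> closure ?D" by (intro span_minimal order_trans[OF VD closure_subset])
  then have "closure (span V) \<subseteq> closure ?D" by (rule closure_minimal) simp
  then show "closure ?D = UNIV" unfolding V(2) by (rule top.extremum_uniqueI)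
qed

lemma orthonormal_basis_parseval_inner:
  fixes x y :: "'h::real_inner"
  assumes "orthonormal_basis E"
  shows "((\<lambda>e. (x \<bullet> e) * (y \<bullet> e)) has_sum (x \<bullet> y)) E"
proof -
  have n: "((\<lambda>e. (z \<bullet> e)\<^sup>2) has_sum (norm z)\<^sup>2) E" for z :: 'h by (rule orthonormal_basis_parseval[OF assms])
  have "((\<lambda>e. (1/2) * (((x + y) \<bullet> e)\<^sup>2 + (- ((x \<bullet> e)\<^sup>2) + - ((y \<bullet> e)\<^sup>2))))
      has_sum (1/2) * ((norm (x + y))\<^sup>2 + (- ((norm x)\<^sup>2) + - ((norm y)\<^sup>2)))) E"
    by (intro has_sum_cmult_right has_sum_add has_sum_uminusI n)
  moreover have "(1/2) * ((norm (x + y))\<^sup>2 + (- ((norm x)\<^sup>2) + - ((norm y)\<^sup>2))) = x \<bullet> y"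
    by (simp add: power2_norm_eq_inner inner_add_left inner_add_right inner_commute)
  moreover have "(1/2) * (((x + y) \<bullet> e)\<^sup>2 + (- ((x \<bullet> e)\<^sup>2) + - ((y \<bullet> e)\<^sup>2))) = (x \<bullet> e) * (y \<bullet> e)" for e
    by (simp add: inner_add_left power2_sum)
  ultimately show ?thesis by simp
qed

text \<open>The matrix form of the inner product as an unconditional sum over pairs, which permits
  any finite truncation, in particular square ones.\<close>

lemma sahs_matrix_has_sum:
  fixes A B :: "'h::{real_inner,banach} sahs"
  assumes E: "orthonormal_basis E"
  shows "((\<lambda>(e, f). (sahs_apply A e \<bullet> f) * (sahs_apply B e \<bullet> f)) has_sum (A \<bullet> B)) (E \<times> E)"
proof -
  have n: "((\<lambda>(e, f). (sahs_apply C e \<bullet> f)\<^sup>2) has_sum (norm C)\<^sup>2) (E \<times> E)" for C :: "'h sahs"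
  proof -
    have inner: "((\<lambda>f. case (e, f) of (e, f) \<Rightarrow> (sahs_apply C e \<bullet> f)\<^sup>2) has_sum (norm (sahs_apply C e))\<^sup>2) E" for e
      using orthonormal_basis_parseval[OF E] by simp
    have outer: "((\<lambda>e. (norm (sahs_apply C e))\<^sup>2) has_sum (norm C)\<^sup>2) E"
      by (rule self_adjoint_has_sum_swap[OF sahs_self_adjoint orthonormal_basis_some_onb E sahs_has_sum_norm])
    show ?thesis
      by (rule has_sum_SigmaI[OF inner outer])
         (rule summable_on_SigmaI[OF inner], use outer in \<open>auto simp: summable_on_def\<close>)
  qed
  have "((\<lambda>p. (1/2) * ((case p of (e, f) \<Rightarrow> (sahs_apply (A + B) e \<bullet> f)\<^sup>2)
        + (- (case p of (e, f) \<Rightarrow> (sahs_apply A e \<bullet> f)\<^sup>2) + - (case p of (e, f) \<Rightarrow> (sahs_apply B e \<bullet> f)\<^sup>2))))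
      has_sum (1/2) * ((norm (A + B))\<^sup>2 + (- ((norm A)\<^sup>2) + - ((norm B)\<^sup>2)))) (E \<times> E)"
    by (intro has_sum_cmult_right has_sum_add has_sum_uminusI n)
  moreover have "(1/2) * ((norm (A + B))\<^sup>2 + (- ((norm A)\<^sup>2) + - ((norm B)\<^sup>2))) = A \<bullet> B"
    by (simp add: power2_norm_eq_inner inner_add_left inner_add_right inner_commute)
  moreover have "(1/2) * ((case p of (e, f) \<Rightarrow> (sahs_apply (A + B) e \<bullet> f)\<^sup>2)
        + (- (case p of (e, f) \<Rightarrow> (sahs_apply A e \<bullet> f)\<^sup>2) + - (case p of (e, f) \<Rightarrow> (sahs_apply B e \<bullet> f)\<^sup>2)))
      = (case p of (e, f) \<Rightarrow> (sahs_apply A e \<bullet> f) * (sahs_apply B e \<bullet> f))" for p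
    by (cases p) (simp add: plus_sahs.rep_eq blinfun.add_left inner_add_left power2_sum)
  ultimately show ?thesis by simp
qed

text \<open>Induction on the index set: one row of \<open>b\<close> is split off by taking its Schur complement.\<close>

lemma psd_frobenius_nonneg:
  fixes a b :: "'i \<Rightarrow> 'i \<Rightarrow> real"
  assumes F: "finite F" and sym: "\<And>i j. a i j = a j i" "\<And>i j. b i j = b j i"
    and a: "\<And>c. 0 \<le> (\<Sum>i\<in>F. \<Sum>j\<in>F. c i * c j * a i j)"
    and b: "\<And>c. 0 \<le> (\<Sum>i\<in>F. \<Sum>j\<in>F. c i * c j * b i j)"
  shows "0 \<le> (\<Sum>i\<in>F. \<Sum>j\<in>F. a i j * b i j)"
  using F a b sym(2)
proof (induction F arbitrary: b rule: finite_induct)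
  case (insert e F)
  note sb = insert.prems(3)
  have split: "(\<Sum>i\<in>insert e F. \<Sum>j\<in>insert e F. g i j) = (\<Sum>i\<in>F. \<Sum>j\<in>F. g i j) + 2 * (\<Sum>i\<in>F. g i e) + g e e"
    if "\<And>i j. g i j = g j i" for g :: "'i \<Rightarrow> 'i \<Rightarrow> real"
    using insert.hyps that by (simp add: sum.distrib)
  have quad: "(\<Sum>i\<in>insert e F. \<Sum>j\<in>insert e F. (if i = e then t else d i) * (if j = e then t else d j) * q i j)
      = (\<Sum>i\<in>F. \<Sum>j\<in>F. d i * d j * q i j) + 2 * (t * (\<Sum>i\<in>F. d i * q i e)) + t\<^sup>2 * q e e"
    if "\<And>i j. q i j = q j i" for q :: "'i \<Rightarrow> 'i \<Rightarrow> real" and d t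
  proof -
    let ?c = "\<lambda>i. if i = e then t else d i"
    have c: "?c i = d i" if "i \<in> F" for i using that insert.hyps by auto
    have "(\<Sum>i\<in>insert e F. \<Sum>j\<in>insert e F. ?c i * ?c j * q i j)
        = (\<Sum>i\<in>F. \<Sum>j\<in>F. ?c i * ?c j * q i j) + 2 * (\<Sum>i\<in>F. ?c i * ?c e * q i e) + ?c e * ?c e * q e e"
      by (rule split) (use that in \<open>simp add: mult_ac\<close>)
    also have "(\<Sum>i\<in>F. \<Sum>j\<in>F. ?c i * ?c j * q i j) = (\<Sum>i\<in>F. \<Sum>j\<in>F. d i * d j * q i j)"
      by (intro sum.cong refl) (simp only: c)
    also have "(\<Sum>i\<in>F. ?c i * ?c e * q i e) = (\<Sum>i\<in>F. t * (d i * q i e))"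
      by (intro sum.cong refl) (simp only: c, simp)
    also have "\<dots> = t * (\<Sum>i\<in>F. d i * q i e)" by (simp add: sum_distrib_left)
    finally show ?thesis by (simp add: power2_eq_square)
  qed
  define L where "L d = (\<Sum>i\<in>F. d i * b i e)" for d
  have qb: "0 \<le> (\<Sum>i\<in>F. \<Sum>j\<in>F. d i * d j * b i j) + 2 * (t * L d) + t\<^sup>2 * b e e" for d t
    using insert.prems(2)[of "\<lambda>i. if i = e then t else d i"] unfolding quad[of b, OF sb] L_def .
  have qa: "0 \<le> (\<Sum>i\<in>F. \<Sum>j\<in>F. d i * d j * a i j) + 2 * (t * (\<Sum>i\<in>F. d i * a i e)) + t\<^sup>2 * a e e" for d t
    using insert.prems(1)[of "\<lambda>i. if i = e then t else d i"] unfolding quad[of a, OF sym(1)] .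
  have aF: "0 \<le> (\<Sum>i\<in>F. \<Sum>j\<in>F. d i * d j * a i j)" for d using qa[of d 0] by simp
  have bF: "0 \<le> (\<Sum>i\<in>F. \<Sum>j\<in>F. d i * d j * b i j)" for d using qb[of d 0] by simp
  have bee: "0 \<le> b e e" using qb[of "\<lambda>_. 0" 1] by (simp add: L_def)
  have total: "(\<Sum>i\<in>insert e F. \<Sum>j\<in>insert e F. a i j * b i j)
      = (\<Sum>i\<in>F. \<Sum>j\<in>F. a i j * b i j) + 2 * (\<Sum>i\<in>F. a i e * b i e) + a e e * b e e"
    by (rule split) (metis sym(1) sb)
  show ?case
  proof (cases "b e e = 0")
    case True
    have "b k e = 0" if k: "k \<in> F" for k
    proof (rule ccontr)
      assume ne: "b k e \<noteq> 0"
      \<comment> \<open>If a diagonal entry of a positive form vanishes, so does its row: over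
        \<open>d\<close> the form would be affine in \<open>t\<close> with nonzero slope and take
        negative values.\<close>
      define d where "d i = (if i = k then b k e else 0)" for i
      define q where "q = (\<Sum>i\<in>F. \<Sum>j\<in>F. d i * d j * b i j)"
      have "L d = (\<Sum>i\<in>F. if i = k then b k e * b k e else 0)" unfolding L_def d_def by (intro sum.cong) auto
      then have "L d = (b k e)\<^sup>2" using k insert.hyps by (simp add: power2_eq_square)
      then have Lpos: "0 < L d" using ne by simp
      have "0 \<le> q + 2 * (- (q + 1) / (2 * L d) * L d)" using qb[of d "- (q + 1) / (2 * L d)"] True by (simp add: q_def)
      also have "\<dots> = - 1" using Lpos by (simp add: field_simps)
      finally show False by simp
    qed
    then have "(\<Sum>i\<in>F. a i e * b i e) = 0" by simp
    then show ?thesis unfolding total using True insert.IH[OF aF bF sb] by simp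
  next
    case False
    then have pos: "0 < b e e" using bee by simp
    define p where "p i = b i e / b e e" for i
    have p: "x * b i e = b e e * (x * p i)" for x i using pos by (simp add: p_def)
    \<comment> \<open>Schur complement of \<open>b e e\<close>. The rank-one part that it removes
      contributes \<open>b e e\<close> times the quadratic form of \<open>a\<close> at
      \<open>p\<close> extended by 1.\<close>
    define b' where "b' i j = b i j - b e e * (p i * p j)" for i j
    have "0 \<le> (\<Sum>i\<in>F. \<Sum>j\<in>F. d i * d j * b' i j)" for d
    proof -
      define P where "P = (\<Sum>i\<in>F. d i * p i)"
      have "L d = b e e * P" unfolding L_def P_def p[of "d _"] by (simp add: sum_distrib_left)
      then have *: "0 \<le> (\<Sum>i\<in>F. \<Sum>j\<in>F. d i * d j * b i j) - b e e * P\<^sup>2"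
        using qb[of d "- P"] by (simp add: power2_eq_square algebra_simps)
      have "b e e * P\<^sup>2 = (\<Sum>i\<in>F. \<Sum>j\<in>F. b e e * ((d i * p i) * (d j * p j)))"
        unfolding P_def power2_eq_square sum_product by (simp add: sum_distrib_left)
      then have "(\<Sum>i\<in>F. \<Sum>j\<in>F. d i * d j * b' i j) = (\<Sum>i\<in>F. \<Sum>j\<in>F. d i * d j * b i j) - b e e * P\<^sup>2"
        by (simp add: b'_def right_diff_distrib sum_subtractf mult_ac)
      then show ?thesis using * by simp
    qed
    then have IH: "0 \<le> (\<Sum>i\<in>F. \<Sum>j\<in>F. a i j * b' i j)"
      by (intro insert.IH aF) (simp_all add: b'_def sb mult.commute)
    have "(\<Sum>i\<in>F. \<Sum>j\<in>F. a i j * b i j) = (\<Sum>i\<in>F. \<Sum>j\<in>F. a i j * b' i j) + b e e * (\<Sum>i\<in>F. \<Sum>j\<in>F. p i * p j * a i j)"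
      by (simp add: b'_def right_diff_distrib sum_subtractf sum_distrib_left mult_ac)
    moreover have "(\<Sum>i\<in>F. a i e * b i e) = b e e * (\<Sum>i\<in>F. p i * a i e)"
      unfolding p[of "a _ e"] by (simp add: sum_distrib_left mult.commute)
    ultimately have "(\<Sum>i\<in>insert e F. \<Sum>j\<in>insert e F. a i j * b i j) = (\<Sum>i\<in>F. \<Sum>j\<in>F. a i j * b' i j)
        + b e e * ((\<Sum>i\<in>F. \<Sum>j\<in>F. p i * p j * a i j) + 2 * (1 * (\<Sum>i\<in>F. p i * a i e)) + 1\<^sup>2 * a e e)"
      unfolding total by (simp add: algebra_simps)
    then show ?thesis using IH mult_nonneg_nonneg[OF bee qa[of p 1]] by simp
  qed
qed simp

section \<open>Rank-one operators and self-duality of the positive cone\<close>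

definition rank_one :: "'h::{real_inner,banach} \<Rightarrow> 'h sahs" where
  "rank_one v = Abs_sahs (Blinfun (\<lambda>x. (v \<bullet> x) *\<^sub>R v))"

lemma rank_one_apply: "sahs_apply (rank_one v) x = (v \<bullet> x) *\<^sub>R v"
proof -
  have bl: "bounded_linear (\<lambda>x. (v \<bullet> x) *\<^sub>R v)"
    by (intro bounded_linear_scaleR_left bounded_linear_compose[OF bounded_linear_scaleR_left bounded_linear_inner_right])
  have ap: "blinfun_apply (Blinfun (\<lambda>x. (v \<bullet> x) *\<^sub>R v)) y = (v \<bullet> y) *\<^sub>R v" for y
    by (simp add: bounded_linear_Blinfun_apply[OF bl])
  have "(\<lambda>e. (norm v)\<^sup>2 * (v \<bullet> e)\<^sup>2) summable_on some_onb"
    using orthonormal_basis_parseval[OF orthonormal_basis_some_onb, of v]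
    by (intro summable_on_cmult_right) (auto simp: summable_on_def)
  then have "hilbert_schmidt (Blinfun (\<lambda>x. (v \<bullet> x) *\<^sub>R v))"
    unfolding hilbert_schmidt_def ap by (simp add: power_mult_distrib mult.commute)
  moreover have "self_adjoint (Blinfun (\<lambda>x. (v \<bullet> x) *\<^sub>R v))"
    unfolding self_adjoint_def ap by (simp add: inner_commute)
  ultimately show ?thesis unfolding rank_one_def by (simp add: Abs_sahs_inverse ap)
qed

text \<open>Pairing with rank-one operators reads off the quadratic form, which yields both
  separability and one half of self-duality.\<close>

lemma rank_one_inner: "A \<bullet> rank_one v = sahs_apply A v \<bullet> v"
proof -
  have "((\<lambda>e. sahs_apply A e \<bullet> sahs_apply (rank_one v) e) has_sum (A \<bullet> rank_one v)) some_onb"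
    by (rule sahs_inner_basis_independent[OF orthonormal_basis_some_onb])
  moreover have "sahs_apply A e \<bullet> sahs_apply (rank_one v) e = (sahs_apply A v \<bullet> e) * (v \<bullet> e)" for e
    using sahs_self_adjoint[of A] by (simp add: rank_one_apply self_adjoint_def inner_commute)
  ultimately show ?thesis
    using has_sum_unique[OF _ orthonormal_basis_parseval_inner[OF orthonormal_basis_some_onb, of "sahs_apply A v" v]] by simp
qed

lemma sahs_eq_0_quadratic:
  assumes "\<And>v. sahs_apply A v \<bullet> v = 0"
  shows "A = 0"
proof -
  have "sahs_apply A x = 0" for x
  proof -
    have sym: "sahs_apply A y \<bullet> x = sahs_apply A x \<bullet> y" for y
      using sahs_self_adjoint[of A] by (simp add: self_adjoint_def inner_commute)
    have "2 * (sahs_apply A x \<bullet> y) = 0" for y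
    proof -
      have "sahs_apply A x \<bullet> x + sahs_apply A y \<bullet> x + (sahs_apply A x \<bullet> y + sahs_apply A y \<bullet> y) = 0"
        using assms[of "x + y"] by (simp only: blinfun.add_right inner_add_left inner_add_right)
      then show ?thesis using assms[of x] assms[of y] sym[of y] by linarith
    qed
    from this[of "sahs_apply A x"] show ?thesis by simp
  qed
  then have "op_of A = 0" by (intro blinfun_eqI) simp
  then show ?thesis by (simp add: zero_sahs.rep_eq flip: op_of_inject)
qed

text \<open>Rank-one operators over a countable dense set have dense span: the quadratic form of an
  operator orthogonal to all of them vanishes on that set, hence everywhere by continuity, and
  polarization makes the operator zero.\<close>

instance sahs :: ("{real_inner,banach,second_countable_topology}") second_countable_topology
proof
  obtain Q :: "'a set" where Q: "countable Q" "\<And>X. open X \<Longrightarrow> X \<noteq> {} \<Longrightarrow> \<exists>d\<in>Q. d \<in> X"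
    using countable_dense_exists by auto
  let ?V = "rank_one ` Q"
  have "closure (span ?V) = UNIV"
  proof (rule ccontr)
    assume "closure (span ?V) \<noteq> UNIV"
    then obtain A where A: "A \<noteq> 0" "\<And>W. W \<in> closure (span ?V) \<Longrightarrow> A \<bullet> W = 0"
      using closed_subspace_orthogonal_vector[of "closure (span ?V)"]
      by (auto simp: closed_subspace subspace_span subspace_closure)
    have q: "sahs_apply A q \<bullet> q = 0" if "q \<in> Q" for q
    proof -
      have "rank_one q \<in> closure (span ?V)" using that by (meson closure_subset span_base subsetD imageI)
      then have "A \<bullet> rank_one q = 0" by (rule A(2))
      then show ?thesis unfolding rank_one_inner .
    qed
    have "sahs_apply A v \<bullet> v = 0" for v
    proof (rule ccontr)
      assume "sahs_apply A v \<bullet> v \<noteq> 0"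
      moreover have "open {v. sahs_apply A v \<bullet> v \<noteq> 0}" by (intro open_Collect_neq continuous_intros)
      ultimately show False using Q(2)[of "{v. sahs_apply A v \<bullet> v \<noteq> 0}"] q by auto
    qed
    then show False using A(1) sahs_eq_0_quadratic by blast
  qed
  then show "\<exists>\<B>::'a sahs set set. countable \<B> \<and> open = generate_topology \<B>"
    using countable_dense_of_span[of ?V] Q(1) countable_dense_imp_subbasis by blast
qed

instance sahs :: ("{real_inner,banach,second_countable_topology}") polish_space ..

lemma rank_one_in_pos_cone: "rank_one v \<in> pos_cone"
  by (simp add: pos_cone_def rank_one_apply inner_commute)

text \<open>If the inner product were negative, so would be the sum over some finite square block of
  matrix entries, against the finite-dimensional case.\<close>

lemma pos_cone_inner_nonneg:
  fixes A B :: "'h::{real_inner,banach} sahs"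
  assumes A: "A \<in> pos_cone" and B: "B \<in> pos_cone"
  shows "0 \<le> A \<bullet> B"
proof (rule ccontr)
  define s where "s = (\<lambda>(e, f). (sahs_apply A e \<bullet> f) * (sahs_apply B e \<bullet> f))"
  assume "\<not> 0 \<le> A \<bullet> B"
  then have "A \<bullet> B < 0" by simp
  moreover have "(s has_sum (A \<bullet> B)) (some_onb \<times> some_onb)"
    unfolding s_def by (rule sahs_matrix_has_sum[OF orthonormal_basis_some_onb])
  ultimately have "eventually (\<lambda>G. sum s G < 0) (finite_subsets_at_top (some_onb \<times> some_onb))"
    unfolding has_sum_def by (intro order_tendstoD(2)) auto
  then obtain G where G: "finite G" "G \<subseteq> some_onb \<times> some_onb"
    "\<forall>H. finite H \<and> G \<subseteq> H \<and> H \<subseteq> some_onb \<times> some_onb \<longrightarrow> sum s H < 0"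
    unfolding eventually_finite_subsets_at_top by (elim exE conjE) (rule that)
  \<comment> \<open>Both coordinates are collected, so that the square \<open>F \<times> F\<close>
    contains the given finite set of pairs.\<close>
  define F where "F = fst ` G \<union> snd ` G"
  have F: "finite F" "F \<subseteq> some_onb"
  proof -
    show "finite F" using G(1) by (simp add: F_def)
    have "fst p \<in> some_onb \<and> snd p \<in> some_onb" if "p \<in> G" for p
      using subsetD[OF G(2) that] by (simp only: mem_Times_iff)
    then show "F \<subseteq> some_onb" unfolding F_def by (simp only: Un_subset_iff image_subset_iff) blast
  qed
  have GF: "G \<subseteq> F \<times> F"
  proof
    fix p assume "p \<in> G"
    then show "p \<in> F \<times> F" unfolding F_def mem_Times_iff by blast
  qed
  have sym: "sahs_apply C e \<bullet> f = sahs_apply C f \<bullet> e" for C :: "'h sahs" and e f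
    using sahs_self_adjoint[of C] by (simp add: self_adjoint_def inner_commute)
  have psd: "0 \<le> (\<Sum>e\<in>F. \<Sum>f\<in>F. c e * c f * (sahs_apply C e \<bullet> f))" if "C \<in> pos_cone" for C :: "'h sahs" and c
  proof -
    have "(\<Sum>e\<in>F. \<Sum>f\<in>F. c e * c f * (sahs_apply C e \<bullet> f)) = sahs_apply C (\<Sum>e\<in>F. c e *\<^sub>R e) \<bullet> (\<Sum>e\<in>F. c e *\<^sub>R e)"
      by (simp add: blinfun.sum_right blinfun.scaleR_right inner_sum_left inner_sum_right sum_distrib_left mult_ac)
        (intro sum.cong refl arg_cong2[where f = "(*)"] sym)
    then show ?thesis using that by (simp add: pos_cone_def)
  qed
  have "0 \<le> (\<Sum>e\<in>F. \<Sum>f\<in>F. (sahs_apply A e \<bullet> f) * (sahs_apply B e \<bullet> f))"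
    by (rule psd_frobenius_nonneg[OF F(1) sym sym psd[OF A] psd[OF B]])
  also have "\<dots> = sum s (F \<times> F)" by (simp add: s_def sum.cartesian_product)
  also have "\<dots> < 0" by (rule G(3)[rule_format]) (use F GF Sigma_mono[OF F(2) F(2)] in simp)
  finally show False by simp
qed

lemma self_dual_pos_cone: "self_dual_cone (pos_cone :: 'h::{real_inner,banach} sahs set)"
proof
  fix A :: "'h sahs"
  show "A \<in> pos_cone \<longleftrightarrow> (\<forall>B\<in>pos_cone. 0 \<le> A \<bullet> B)"
  proof
    assume dual: "\<forall>B\<in>pos_cone. 0 \<le> A \<bullet> B"
    then have "0 \<le> A \<bullet> rank_one v" for v using rank_one_in_pos_cone by blast
    then show "A \<in> pos_cone" by (simp add: pos_cone_def rank_one_inner)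
  qed (intro ballI pos_cone_inner_nonneg)
qed

lemma trunc_eq_cutoff: "trunc = cutoff"
  by (simp add: fun_eq_iff trunc_def cutoff_def)

lemma admissible_affine_parameters:
  fixes b :: "'h::{real_inner,banach,second_countable_topology} sahs"
  assumes adm: "admissible b B m \<mu>"
  shows "affine_parameters pos_cone \<mu> b B m"
proof -
  interpret self_dual_cone "pos_cone :: 'h sahs set" by (rule self_dual_pos_cone)
  interpret cone_vector_measure pos_cone pos_cone_minus_0 \<mu>
    by unfold_locales (use adm in \<open>auto simp: admissible_def pos_vector_measure_def\<close>)
  \<comment> \<open>On the cone the signed integrals of the definition become integrals against
    \<open>scal\<close>.\<close>
  note [simp] = signed_integral_cone
  show ?thesis
    by unfold_locales (use adm in \<open>auto simp: admissible_def trunc_eq_cutoff\<close>)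
qed

theorem theorem1p1:
  fixes b :: "'h::{real_inner,banach,second_countable_topology} sahs"
    and B :: "'h sahs \<Rightarrow>\<^sub>L 'h sahs"
    and m :: "'h sahs measure"
    and \<mu> :: "'h sahs set \<Rightarrow> 'h sahs"
  assumes infinite_dim: "\<nexists>S::'h set. finite S \<and> span S = UNIV"
    and admissible: "admissible b B m \<mu>"
  shows "\<exists>(\<Omega> :: (real \<Rightarrow> 'h sahs) measure) P X \<phi> \<psi>.
    markov_process (restrict_space borel pos_cone) \<Omega> P X \<and>
    (\<forall>u\<in>pos_cone.
       riccati_solution b B m \<mu> u (\<lambda>t. \<phi> t u) (\<lambda>t. \<psi> t u) \<and>
       (\<forall>f g. riccati_solution b B m \<mu> u f g \<longrightarrow> (\<forall>t\<ge>0. f t = \<phi> t u \<and> g t = \<psi> t u))) \<and>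
    (\<forall>t\<ge>0. \<forall>u\<in>pos_cone. \<forall>x\<in>pos_cone.
       (\<integral>\<omega>. exp (- (X t \<omega> \<bullet> u)) \<partial>P x) = exp (- \<phi> t u - x \<bullet> \<psi> t u))"
proof -
  interpret affine_parameters pos_cone \<mu> b B m by (rule admissible_affine_parameters[OF admissible])
  have riccati: "riccati_F b m = F" "riccati_R B \<mu> = R"
    by (simp_all add: fun_eq_iff riccati_F_def riccati_R_def F_def R_def compensated_def wint_def trunc_eq_cutoff)
  have solution: "riccati_solution b B m \<mu> u (\<lambda>t. exponent t u) (\<lambda>t. flow t u)" if u: "u \<in> pos_cone" for u
    unfolding riccati_solution_def riccati
    using u exponent_nonneg flow_in flow_0 exponent_deriv flow_deriv continuous_on_F_flow continuous_on_R_flow by simp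
  have unique: "f t = exponent t u \<and> g t = flow t u"
    if u: "u \<in> pos_cone" and fg: "riccati_solution b B m \<mu> u f g" and t: "0 \<le> t" for u f g t
  proof -
    \<comment> \<open>The equation for \<psi> does not involve \<phi> and is settled first; \<phi>
      is then the integral of a known function.\<close>
    have g: "g s = flow s u" if "0 \<le> s" for s
      by (rule flow_unique[OF u _ _ _ that]) (use fg in \<open>auto simp: riccati_solution_def riccati\<close>)
    have "f t = exponent t u"
      by (rule exponent_unique[OF u _ _ t]) (use fg g in \<open>auto simp: riccati_solution_def riccati\<close>)
    with g[OF t] show ?thesis by simp
  qed
  show ?thesis
    by (intro exI[of _ process.path_space] exI[of _ process.path_measure] exI[of _ process.coord] exI[of _ exponent] exI[of _ flow])
       (intro conjI ballI allI impI process.markov_process_path solution process_laplace; use unique in blast)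
qed

end
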